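(* Let $k,m,n\ge1$ be integers, $\lambda>0$, and let $\kappa(x,y):=x^{2k-1}y^{2m-1}$ and $\mathcal{V}(y):=\frac1{2n}y^{2n}$ for $x,y\in\mathbb{R}$. Let $\beta:=\max\{8k-6,8(m+n)-10\}$ and $p\ge\max\{32k-24,32(m+n)-40\}$. Let $\{W^i\}_{i=1}^N$ be i.i.d. $\mathbb{R}$-valued Brownian motions and $\{\xi^i\}_{i=1}^N$ i.i.d. initial values with $\xi^i\in L^p(\Omega,\mathscr{F}_0,\mathbb{P};\mathbb{R})$. Consider the mean-field equations $$dX_t^i=-\lambda^{-1}\nabla\mathcal{V}(X_t^i)dt-\int_{\mathbb{R}}\big(\nabla_y\kappa(X_t^i,y)+\kappa(X_t^i,y)\nabla\mathcal{V}(y)\big)\mathscr{L}_{X_t^i}(dy)\,dt+\sqrt{2\lambda^{-1}}\,dW_t^i,\qquad X_0^i=\xi^i,$$ and the interacting particle system $$dX_t^{i,N}=-\lambda^{-1}\nabla\mathcal{V}(X_t^{i,N})dt-\frac1N\sum_{j=1}^N\nabla_y\kappa(X_t^{i,N},X_t^{j,N})dt-\frac1N\sum_{j=1}^N\kappa(X_t^{i,N},X_t^{j,N})\nabla\mathcal{V}(X_t^{j,N})dt+\sqrt{2\lambda^{-1}}\,dW_t^i,\quad X_0^{i,N}=\xi^i,$$ on $[0,T]$, $i=1,\dots,N$. Then the mean-field equation has a unique strong and weak solution. Moreover, with implicit constants independent of $N$, $$\sup_{i\in\{1,\dots,N\}}\mathbb{E}\Big[\sup_{t\in[0,T]}|X_t^{i,N}-X_t^i|^2\Big]\lesssim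 N^{-\frac{q-\beta}{q-2}\cdot\frac{p'-2}{p'}}$$ for any $2<p'<\frac{2p}{\beta}$ and $\beta<q<p$, and $$\sup_{i\in\{1,\dots,N\}}\sup_{t\in[0,T]}\mathbb{E}|X_t^{i,N}-X_t^i|^2\lesssim N^{-\frac{p-\beta}{p}}.$$
   Context: Fix $T>0$ and a complete filtered probability space $(\Omega,\mathscr{F},\{\mathscr{F}_t\},\mathbb{P})$. $\nabla\mathcal{V}$ denotes the derivative $\mathcal{V}'$ and $\nabla_y\kappa$ the partial derivative of $\kappa$ in its second variable. $\mathscr{L}_X$ is the law of $X$. Solutions are continuous adapted real-valued processes satisfying the integrated equations a.s. (strong: on any given probability space with given Brownian motion and initial value; weak: on some stochastic basis); uniqueness is pathwise uniqueness for strong solutions and uniqueness in law for weak solutions. The particle system has a unique strong solution. *)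

theory Defs
  imports "HOL-Probability.Probability"
begin

text \<open>
  Only the values of the filtration on \<open>{0..T}\<close> are used below. Filtrations are indexed by
  \<^typ>\<open>real\<close> in order to use the library locale; a filtration on \<open>{0..T}\<close> extends to
  one indexed by \<^typ>\<open>real\<close> by freezing it outside the interval. Right-continuity is not required.
\<close>

definition complete_stochastic_basis :: "'a measure \<Rightarrow> (real \<Rightarrow> 'a measure) \<Rightarrow> bool" where
  "complete_stochastic_basis M F \<longleftrightarrow>
     prob_space M \<and> complete_measure M \<and> filtration (space M) F \<and>
     (\<forall>t. subalgebra M (F t)) \<and> null_sets M \<subseteq> sets (F 0)"

text \<open>Brownian motion on \<open>[0,T]\<close> relative to \<open>F\<close>, started at \<open>0\<close>.\<close>

definition brownian_motion ::
    "'a measure \<Rightarrow> (real \<Rightarrow> 'a measure) \<Rightarrow> real \<Rightarrow> (real \<Rightarrow> 'a \<Rightarrow> real) \<Rightarrow> bool" where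
  "brownian_motion M F T W \<longleftrightarrow>
     (\<forall>t\<in>{0..T}. W t \<in> borel_measurable (F t)) \<and>
     (AE \<omega> in M. W 0 \<omega> = 0) \<and>
     (AE \<omega> in M. continuous_on {0..T} (\<lambda>t. W t \<omega>)) \<and>
     (\<forall>s t. 0 \<le> s \<and> s < t \<and> t \<le> T \<longrightarrow>
        distributed M lborel (\<lambda>\<omega>. W t \<omega> - W s \<omega>) (normal_density 0 (sqrt (t - s))) \<and>
        prob_space.indep_set M (sets (F s))
          (sets (vimage_algebra (space M) (\<lambda>\<omega>. W t \<omega> - W s \<omega>) borel)))"

definition continuous_adapted ::
    "'a measure \<Rightarrow> (real \<Rightarrow> 'a measure) \<Rightarrow> real \<Rightarrow> (real \<Rightarrow> 'a \<Rightarrow> real) \<Rightarrow> bool" where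
  "continuous_adapted M F T X \<longleftrightarrow>
     (\<forall>t\<in>{0..T}. X t \<in> borel_measurable (F t)) \<and>
     (\<forall>\<omega>\<in>space M. continuous_on {0..T} (\<lambda>t. X t \<omega>))"

definition Lp_initial_value ::
    "real \<Rightarrow> 'a measure \<Rightarrow> (real \<Rightarrow> 'a measure) \<Rightarrow> ('a \<Rightarrow> real) \<Rightarrow> bool" where
  "Lp_initial_value p M F \<xi> \<longleftrightarrow>
     \<xi> \<in> borel_measurable (F 0) \<and> integrable M (\<lambda>\<omega>. \<bar>\<xi> \<omega>\<bar> powr p)"

text \<open>The path on \<open>[0,T]\<close>, as an element of the product space \<open>\<real>\<^bsup>[0,T]\<^esup>\<close>.\<close>

definition path_on :: "real \<Rightarrow> (real \<Rightarrow> 'a \<Rightarrow> real) \<Rightarrow> 'a \<Rightarrow> real \<Rightarrow> real" where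
  "path_on T X \<omega> = (\<lambda>t\<in>{0..T}. X t \<omega>)"

definition path_space :: "real \<Rightarrow> (real \<Rightarrow> real) measure" where
  "path_space T = PiM {0..T} (\<lambda>_. borel)"

definition kernel :: "nat \<Rightarrow> nat \<Rightarrow> real \<Rightarrow> real \<Rightarrow> real" where
  "kernel k m x y = x ^ (2 * k - 1) * y ^ (2 * m - 1)"

definition potential :: "nat \<Rightarrow> real \<Rightarrow> real" where
  "potential n y = 1 / (2 * real n) * y ^ (2 * n)"

definition grad_potential :: "nat \<Rightarrow> real \<Rightarrow> real" where
  "grad_potential n = deriv (potential n)"

definition grad2_kernel :: "nat \<Rightarrow> nat \<Rightarrow> real \<Rightarrow> real \<Rightarrow> real" where
  "grad2_kernel k m x = deriv (kernel k m x)"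

definition interaction :: "nat \<Rightarrow> nat \<Rightarrow> nat \<Rightarrow> real \<Rightarrow> real \<Rightarrow> real" where
  "interaction k m n x y = grad2_kernel k m x y + kernel k m x y * grad_potential n y"

definition mean_field_drift ::
    "nat \<Rightarrow> nat \<Rightarrow> nat \<Rightarrow> real \<Rightarrow> real measure \<Rightarrow> real \<Rightarrow> real" where
  "mean_field_drift k m n lam \<nu> x =
     - (1 / lam) * grad_potential n x - (\<integral>y. interaction k m n x y \<partial>\<nu>)"

text \<open>
  The two integrability conditions say that the integrals in the equation exist; without them
  the library would silently read a divergent integral as \<open>0\<close>. The noise is additive, so
  the stochastic integral is \<open>sqrt (2 / \<lambda>) * W t\<close>. As \<open>W 0 = 0\<close> almost surely, the
  equation at \<open>t = 0\<close> is the initial condition.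
\<close>

definition mean_field_solution ::
    "nat \<Rightarrow> nat \<Rightarrow> nat \<Rightarrow> real \<Rightarrow> real \<Rightarrow> 'a measure \<Rightarrow> (real \<Rightarrow> 'a measure) \<Rightarrow>
     (real \<Rightarrow> 'a \<Rightarrow> real) \<Rightarrow> ('a \<Rightarrow> real) \<Rightarrow> (real \<Rightarrow> 'a \<Rightarrow> real) \<Rightarrow> bool" where
  "mean_field_solution k m n lam T M F W \<xi> X \<longleftrightarrow>
     continuous_adapted M F T X \<and>
     (AE \<omega> in M.
        (\<forall>t\<in>{0..T}. integrable (distr M borel (X t)) (interaction k m n (X t \<omega>))) \<and>
        set_integrable lborel {0..T}
          (\<lambda>s. mean_field_drift k m n lam (distr M borel (X s)) (X s \<omega>)) \<and>
        (\<forall>t\<in>{0..T}. X t \<omega> = \<xi> \<omega>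
           + (LBINT s:{0..t}. mean_field_drift k m n lam (distr M borel (X s)) (X s \<omega>))
           + sqrt (2 / lam) * W t \<omega>))"

definition weak_mean_field_solution ::
    "nat \<Rightarrow> nat \<Rightarrow> nat \<Rightarrow> real \<Rightarrow> real \<Rightarrow> real measure \<Rightarrow> 'a measure \<Rightarrow> (real \<Rightarrow> 'a measure) \<Rightarrow>
     (real \<Rightarrow> 'a \<Rightarrow> real) \<Rightarrow> (real \<Rightarrow> 'a \<Rightarrow> real) \<Rightarrow> bool" where
  "weak_mean_field_solution k m n lam T \<mu> M F W X \<longleftrightarrow>
     complete_stochastic_basis M F \<and> brownian_motion M F T W \<and>
     mean_field_solution k m n lam T M F W (X 0) X \<and> distr M borel (X 0) = \<mu>"

definition particle_drift ::
    "nat \<Rightarrow> nat \<Rightarrow> nat \<Rightarrow> real \<Rightarrow> nat \<Rightarrow> (nat \<Rightarrow> real) \<Rightarrow> nat \<Rightarrow> real" where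
  "particle_drift k m n lam N x i =
     - (1 / lam) * grad_potential n (x i)
     - 1 / real N * (\<Sum>j=1..N. grad2_kernel k m (x i) (x j))
     - 1 / real N * (\<Sum>j=1..N. kernel k m (x i) (x j) * grad_potential n (x j))"

text \<open>No integrability condition here: the drift is continuous along continuous paths.\<close>

definition particle_solution ::
    "nat \<Rightarrow> nat \<Rightarrow> nat \<Rightarrow> real \<Rightarrow> real \<Rightarrow> nat \<Rightarrow> 'a measure \<Rightarrow> (real \<Rightarrow> 'a measure) \<Rightarrow>
     (nat \<Rightarrow> real \<Rightarrow> 'a \<Rightarrow> real) \<Rightarrow> (nat \<Rightarrow> 'a \<Rightarrow> real) \<Rightarrow>
     (nat \<Rightarrow> real \<Rightarrow> 'a \<Rightarrow> real) \<Rightarrow> bool" where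
  "particle_solution k m n lam T N M F W \<xi> Y \<longleftrightarrow>
     (\<forall>i\<in>{1..N}.
        continuous_adapted M F T (Y i) \<and>
        (AE \<omega> in M. \<forall>t\<in>{0..T}. Y i t \<omega> = \<xi> i \<omega>
           + (LBINT s:{0..t}. particle_drift k m n lam N (\<lambda>j. Y j s \<omega>) i)
           + sqrt (2 / lam) * W i t \<omega>))"

text \<open>
  The data of the \<open>N\<close> equations: independent Brownian motions with respect to \<open>F\<close> and
  independent initial values with common law \<open>\<mu>\<close>. The Brownian motions have the same law
  by definition.
\<close>

definition iid_data ::
    "real \<Rightarrow> real \<Rightarrow> real measure \<Rightarrow> nat \<Rightarrow> 'a measure \<Rightarrow> (real \<Rightarrow> 'a measure) \<Rightarrow>
     (nat \<Rightarrow> real \<Rightarrow> 'a \<Rightarrow> real) \<Rightarrow> (nat \<Rightarrow> 'a \<Rightarrow> real) \<Rightarrow> bool" where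
  "iid_data T p \<mu> N M F W \<xi> \<longleftrightarrow>
     (\<forall>i\<in>{1..N}. brownian_motion M F T (W i)) \<and>
     prob_space.indep_vars M (\<lambda>_. path_space T) (\<lambda>i. path_on T (W i)) {1..N} \<and>
     (\<forall>i\<in>{1..N}. Lp_initial_value p M F (\<xi> i) \<and> distr M borel (\<xi> i) = \<mu>) \<and>
     prob_space.indep_vars M (\<lambda>_. borel) \<xi> {1..N}"

end

theory Submission
  imports Defs
begin

text \<open>
The interaction factorises: the bracket under the integral equals \<open>g x * h y\<close> with
\<open>g x = x^(2k-1)\<close> and \<open>h y = (2m-1) * y^(2m-2) + y^(2(m+n-1)) \<ge> 0\<close>. So the law of the
solution enters the drift only through one non-negative number per time, the rate
\<open>m t = E (h (X t))\<close>. Given a continuous rate, the equation is an ordinary integral equation for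
each path, \<open>X t = Z t - (LBINT s:{0..t}. f (X s) + m s * g (X s))\<close>, forced by
\<open>Z = \<xi> + \<sigma> * W\<close>, with \<open>f\<close> and \<open>g\<close> odd increasing powers. Monotonicity yields two estimates that do
not depend on the rate and contain no exponential: \<open>X\<close> is at most twice the supremum of \<open>Z\<close>, and two
solutions with the same \<open>Z\<close> and rates \<open>m\<close>, \<open>m'\<close> differ by at most the time integral of
\<open>\<bar>m - m'\<bar> * \<bar>g X'\<bar>\<close> (\<open>forced_solution_bound\<close>, \<open>forced_solution_compare\<close>). The superlinear growth
of the coefficients is thereby absorbed into moments of the driving path.

Well-posedness. A mean-field solution is a fixed point of the map sending a rate \<open>m\<close> to the
expectation of \<open>h\<close> along the flow with rate \<open>m\<close>, an expectation under the law \<open>P\<close> of the driving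
path. The second estimate makes this a Volterra-Lipschitz map, so there is exactly one fixed point
(\<open>mean_rate_exists\<close>, \<open>mean_rate_unique\<close>), and every solution is the same measurable functional of its
driving path (\<open>mean_field_solution_unique\<close>). This gives strong existence and pathwise uniqueness.
Uniqueness in law follows because \<open>P\<close> depends only on the initial law (\<open>path_law_unique\<close>). For weak
existence a Brownian motion is built by interpolating independent Gaussians along the dyadic grid.
Since the path space is the bare product space, in which continuity is not a measurable property,
a path is always read through its values at dyadic times: \<open>regularize\<close> returns the limit of these
values when a weighted sum of increments is finite, and a constant otherwise, so that its values are
continuous paths, bounded by an explicit random radius with as many moments as \<open>\<xi>\<close>.

Propagation of chaos. A particle solves the same forced equation with the random rate
\<open>(\<Sum>l=1..N. h (Y l s)) / N\<close>. Comparing it with the mean-field solution driven by the same path and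
applying Gronwall bounds the difference by the time integral of the fluctuation
\<open>(\<Sum>l=1..N. h (X l s)) / N - m s\<close>, times an exponential in an empirical mean \<open>K\<close> of path weights
(\<open>coupling_pathwise\<close>). The exponential is harmless where \<open>K\<close> exceeds its expectation by at most 1; on
the complement the a priori bound is used, and the squared deviation of \<open>K\<close> is at least 1 there. Both
contributions are thus dominated by weighted second moments of centred empirical means, which are of
order \<open>1/N\<close> because the driving paths are independent (\<open>weighted_mean_square\<close>,
\<open>particle_mean_square\<close>). Independence of the paths \<open>\<xi> i + \<sigma> * W i\<close> needs an argument: the data say
that the Brownian motions are independent of each other, and that each one separately is independent of
the initial sigma-algebra. Levy's characterisation, in the form of \<open>levy_pair\<close>, closes the gap.
The bound \<open>C/N\<close> on the expected squared supremum implies both stated rates, whose exponents are at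
most 1.
\<close>

section \<open>Integral inequalities of Gronwall and Volterra type\<close>

lemma set_integrable_Icc_subset:
  fixes g :: "real \<Rightarrow> 'b::{banach, second_countable_topology}"
  assumes "set_integrable lborel {0..T} g" "A \<subseteq> {0..T}" "A \<in> sets lborel"
  shows "set_integrable lborel A g"
  by (rule set_integrable_subset[OF assms(1)]) (use assms in auto)

lemma set_integral_nonneg_on:
  fixes a :: "'a \<Rightarrow> real"
  assumes "\<And>s. s \<in> A \<Longrightarrow> 0 \<le> a s"
  shows "0 \<le> (LINT s:A|M. a s)"
  unfolding set_lebesgue_integral_def
  by (rule Bochner_Integration.integral_nonneg) (auto simp: indicator_def assms)

lemma set_integral_split_Icc:
  fixes g :: "real \<Rightarrow> real"
  assumes "set_integrable lborel {0..T} g" "0 \<le> s" "s \<le> t" "t \<le> T"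
  shows "(LBINT r:{0..t}. g r) = (LBINT r:{0..s}. g r) + (LBINT r:{s<..t}. g r)"
proof -
  have "{0..t} = {0..s} \<union> {s<..t}" using assms by auto
  then show ?thesis
    using assms by (auto intro!: set_integral_Un set_integrable_Icc_subset[OF assms(1)])
qed

lemma set_integral_singleton_0: "(LBINT s:{0::real}. g s) = (0::real)"
proof -
  have "(LBINT s. indicator {0} s *\<^sub>R g s) = (LBINT s::real. indicator {0} s *\<^sub>R g 0)"
    by (rule Bochner_Integration.integral_cong) (auto simp: indicator_def)
  then show ?thesis by (simp add: set_lebesgue_integral_def)
qed

lemma continuous_bounded_above:
  fixes u :: "real \<Rightarrow> real"
  assumes "continuous_on {a..b} u"
  shows "\<exists>B. \<forall>s\<in>{a..b}. u s \<le> B"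
proof -
  obtain B where "\<forall>y\<in>u ` {a..b}. norm y \<le> B"
    using compact_imp_bounded[OF compact_continuous_image[OF assms compact_Icc]] unfolding bounded_iff by blast
  then show ?thesis by (intro exI[of _ B]) (auto dest: abs_le_D1)
qed

text \<open>
  Look back to the last time at which \<open>D \<le> K\<close>. After it the rate of increase is at most
  \<open>a\<close>. This replaces every use of a differential inequality below; \<open>D\<close> is only
  an integral, so a chain rule for \<open>\<bar>D\<bar>\<close> is out of reach.
\<close>

lemma barrier_upper:
  fixes D g a :: "real \<Rightarrow> real"
  assumes g: "set_integrable lborel {0..T} g" and a: "set_integrable lborel {0..T} a"
    and a0: "\<And>s. s \<in> {0..T} \<Longrightarrow> 0 \<le> a s"
    and D: "\<And>t. t \<in> {0..T} \<Longrightarrow> D t = x + (LBINT s:{0..t}. g s)"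
    and cont: "continuous_on {0..T} D" and x: "x \<le> K"
    and rate: "\<And>s. s \<in> {0..T} \<Longrightarrow> K < D s \<Longrightarrow> g s \<le> a s"
    and t: "t \<in> {0..T}"
  shows "D t \<le> K + (LBINT s:{0..t}. a s)"
proof -
  \<comment> \<open>the set is closed and contains 0, so its supremum is the last time below the barrier\<close>
  define A where "A = {s\<in>{0..t}. D s \<le> K}"
  have D0: "D 0 = x"
    using D[of 0] t by (simp add: set_integral_singleton_0)
  have A0: "0 \<in> A" using D0 x t by (auto simp: A_def)
  have contt: "continuous_on {0..t} D"
    by (rule continuous_on_subset[OF cont]) (use t in auto)
  have "closed A"
    unfolding A_def by (intro continuous_on_closed_Collect_le contt continuous_intros closed_atLeastAtMost)
  moreover have bA: "bdd_above A" by (auto simp: A_def)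
  ultimately have SA: "Sup A \<in> A" using A0 closed_contains_Sup by blast
  define s where "s = Sup A"
  have s: "0 \<le> s" "s \<le> t" "D s \<le> K" using SA by (auto simp: A_def s_def)
  have above: "K < D r" if "r \<in> {s<..t}" for r
  proof (rule ccontr)
    assume "\<not> K < D r"
    then have "r \<in> A" using that s by (auto simp: A_def)
    then have "r \<le> s" using bA by (simp add: s_def cSup_upper)
    then show False using that by auto
  qed
  have "D t = D s + (LBINT r:{s<..t}. g r)"
    using D[of t] D[of s] set_integral_split_Icc[OF g, of s t] t s by simp
  also have "(LBINT r:{s<..t}. g r) \<le> (LBINT r:{s<..t}. a r)"
    by (rule set_integral_mono) (use t s above in \<open>auto intro!: set_integrable_Icc_subset[OF g] set_integrable_Icc_subset[OF a] rate\<close>)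
  also have "\<dots> \<le> (LBINT r:{0..t}. a r)"
    using set_integral_split_Icc[OF a, of s t] t s set_integral_nonneg_on[of "{0..s}" a lborel] a0 by auto
  finally show ?thesis using s by simp
qed

lemma integral_power_bound:
  fixes L t :: real assumes "0 \<le> t"
  shows "(LBINT s:{0..t}. B * (L * s) ^ j / fact j) * L = B * (L * t) ^ Suc j / fact (Suc j)"
proof -
  have "(LBINT s:{0..t}. B * (L * s) ^ j / fact j) = (B * L ^ j / fact j) * (LBINT s:{0..t}. s ^ j)"
    by (simp add: power_mult_distrib mult.assoc flip: set_integral_mult_right)
  also have "(LBINT s:{0..t}. s ^ j) = t ^ Suc j / Suc j"
    using integral_power[OF assms, of j] by (simp add: set_lebesgue_integral_def mult.commute)
  finally show ?thesis
    by (simp add: power_mult_distrib ac_simps del: set_integral_mult_right)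
qed

lemma tendsto_power_div_fact: "(\<lambda>j. B * (c::real) ^ j / fact j) \<longlonglongrightarrow> 0"
  using tendsto_mult_left[OF summable_LIMSEQ_zero[OF summable_exp[of c]], of B] by (simp add: field_simps)

text \<open>
  Iterating a Volterra inequality gains the factorial that makes the iterates summable on the whole
  interval, whatever the size of \<open>L * T\<close>.
\<close>

lemma volterra_iterate_bound:
  fixes u :: "nat \<Rightarrow> real \<Rightarrow> real"
  assumes meas: "\<And>j. set_integrable lborel {0..T} (u j)" and L: "0 \<le> L"
    and step: "\<And>j t. t \<in> {0..T} \<Longrightarrow> u (Suc j) t \<le> L * (LBINT s:{0..t}. u j s)"
    and base: "\<And>t. t \<in> {0..T} \<Longrightarrow> u 0 t \<le> B"
    and t: "t \<in> {0..T}"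
  shows "u j t \<le> B * (L * t) ^ j / fact j"
  using t
proof (induction j arbitrary: t)
  case 0 then show ?case using base by simp
next
  case (Suc j)
  have "(LBINT s:{0..t}. u j s) \<le> (LBINT s:{0..t}. B * (L * s) ^ j / fact j)"
    using Suc by (intro set_integral_mono set_integrable_Icc_subset[OF meas] borel_integrable_atLeastAtMost' continuous_intros) auto
  then have "L * (LBINT s:{0..t}. u j s) \<le> (LBINT s:{0..t}. B * (L * s) ^ j / fact j) * L"
    using L unfolding mult.commute[of _ L] by (rule mult_left_mono)
  then show ?case
    using step[OF Suc.prems, of j] integral_power_bound[of t B L j] Suc.prems by simp
qed

text \<open>
  Iterating the inequality produces the partial sums of the exponential series; an upper bound
  \<open>B\<close> for \<open>u\<close>, of any size, makes the remainder vanish.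
\<close>

lemma gronwall:
  fixes u :: "real \<Rightarrow> real"
  assumes u: "set_integrable lborel {0..T} u" and L: "0 \<le> L"
    and B: "\<And>t. t \<in> {0..T} \<Longrightarrow> u t \<le> B"
    and ineq: "\<And>t. t \<in> {0..T} \<Longrightarrow> u t \<le> c + L * (LBINT s:{0..t}. u s)"
    and t: "t \<in> {0..T}"
  shows "u t \<le> c * exp (L * t)"
proof -
  have part: "u t \<le> (\<Sum>i<j. c * (L * t) ^ i / fact i) + B * (L * t) ^ j / fact j"
    if "t \<in> {0..T}" for j t
    using that
  proof (induction j arbitrary: t)
    case 0 then show ?case using B by simp
  next
    case (Suc j)
    have int: "set_integrable lborel {0..t} (\<lambda>s. C * (L * s) ^ i / fact i)" for i C
      by (intro borel_integrable_atLeastAtMost' continuous_intros) auto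
    have "(LBINT s:{0..t}. u s) \<le> (LBINT s:{0..t}. (\<Sum>i<j. c * (L * s) ^ i / fact i) + B * (L * s) ^ j / fact j)"
      using Suc by (intro set_integral_mono set_integrable_Icc_subset[OF u] borel_integrable_atLeastAtMost' continuous_intros) auto
    also have "\<dots> = (LBINT s:{0..t}. (\<Sum>i<j. c * (L * s) ^ i / fact i)) + (LBINT s:{0..t}. B * (L * s) ^ j / fact j)"
      by (intro set_integral_add borel_integrable_atLeastAtMost' continuous_intros) auto
    also have "(LBINT s:{0..t}. (\<Sum>i<j. c * (L * s) ^ i / fact i)) = (\<Sum>i<j. LBINT s:{0..t}. c * (L * s) ^ i / fact i)"
      using int unfolding set_lebesgue_integral_def set_integrable_def
      by (subst Bochner_Integration.integral_sum[symmetric]) (auto simp: sum_distrib_left)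
    finally have "L * (LBINT s:{0..t}. u s) \<le> L * ((\<Sum>i<j. LBINT s:{0..t}. c * (L * s) ^ i / fact i) + (LBINT s:{0..t}. B * (L * s) ^ j / fact j))"
      using L by (rule mult_left_mono)
    also have "\<dots> = (\<Sum>i<j. (LBINT s:{0..t}. c * (L * s) ^ i / fact i) * L) + (LBINT s:{0..t}. B * (L * s) ^ j / fact j) * L"
      by (simp only: ring_distribs sum_distrib_left sum_distrib_right mult.commute)
    also have "\<dots> = (\<Sum>i<j. c * (L * t) ^ Suc i / fact (Suc i)) + B * (L * t) ^ Suc j / fact (Suc j)"
      using integral_power_bound[of t _ L] Suc.prems by (simp only: atLeastAtMost_iff)
    finally have "u t \<le> c + ((\<Sum>i<j. c * (L * t) ^ Suc i / fact (Suc i)) + B * (L * t) ^ Suc j / fact (Suc j))"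
      using ineq[OF Suc.prems] by linarith
    then show ?case
      by (simp only: sum.lessThan_Suc_shift power_0 fact_0 add.assoc mult_1_right div_by_1)
  qed
  have "(\<lambda>j. (\<Sum>i<j. c * (L * t) ^ i / fact i) + B * (L * t) ^ j / fact j) \<longlonglongrightarrow> c * exp (L * t) + 0"
  proof (intro tendsto_add tendsto_power_div_fact)
    have "(\<lambda>i. c * ((L * t) ^ i /\<^sub>R fact i)) sums (c * exp (L * t))"
      by (intro sums_mult exp_converges)
    then show "(\<lambda>j. \<Sum>i<j. c * (L * t) ^ i / fact i) \<longlonglongrightarrow> c * exp (L * t)"
      by (simp add: sums_def field_simps)
  qed
  then show ?thesis
    using part[OF t] by (intro LIMSEQ_le_const[where X="\<lambda>j. (\<Sum>i<j. c * (L * t) ^ i / fact i) + B * (L * t) ^ j / fact j"]) auto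
qed

text \<open>
  Picard iteration. The conclusion records that the iterates converge pointwise, because this is how the
  solution of a forced equation is seen to depend measurably on its data.
\<close>

lemma volterra_fixpoint:
  fixes \<Phi> :: "(real \<Rightarrow> real) \<Rightarrow> real \<Rightarrow> real"
  assumes cont: "\<And>u. u \<in> S \<Longrightarrow> continuous_on {0..T} u"
    and maps: "\<And>u. u \<in> S \<Longrightarrow> \<Phi> u \<in> S"
    and closed: "\<And>U u. (\<And>j. U j \<in> S) \<Longrightarrow> uniform_limit {0..T} U u sequentially \<Longrightarrow> u \<in> S"
    and L: "0 \<le> L"
    and lip: "\<And>u v t. u \<in> S \<Longrightarrow> v \<in> S \<Longrightarrow> t \<in> {0..T} \<Longrightarrow>
       \<bar>\<Phi> u t - \<Phi> v t\<bar> \<le> L * (LBINT s:{0..t}. \<bar>u s - v s\<bar>)"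
    and u0: "u0 \<in> S"
  shows "\<exists>u\<in>S. (\<forall>t\<in>{0..T}. \<Phi> u t = u t) \<and> (\<forall>t\<in>{0..T}. (\<lambda>j. (\<Phi> ^^ j) u0 t) \<longlonglongrightarrow> u t)"
proof -
  define U where "U j = (\<Phi> ^^ j) u0" for j
  have US: "U j \<in> S" for j by (induction j) (auto simp: U_def u0 maps)
  have USuc: "U (Suc j) = \<Phi> (U j)" for j by (simp add: U_def)
  note contU = cont[OF US]
  define d where "d j t = \<bar>U (Suc j) t - U j t\<bar>" for j t
  have contd: "continuous_on {0..T} (d j)" for j
    unfolding d_def by (intro continuous_intros contU)
  obtain B where B: "\<And>t. t \<in> {0..T} \<Longrightarrow> d 0 t \<le> B"
    using compact_imp_bounded[OF compact_continuous_image[OF contd[of 0] compact_Icc]]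
    by (force simp: bounded_iff abs_le_iff)
  have dle: "d j t \<le> B * (L * t) ^ j / fact j" if "t \<in> {0..T}" for j t
  proof (rule volterra_iterate_bound[where T=T and u=d, OF _ L _ B that])
    show "set_integrable lborel {0..T} (d j)" for j
      by (intro borel_integrable_atLeastAtMost' contd)
    show "d (Suc j) t \<le> L * (LBINT s:{0..t}. d j s)" if "t \<in> {0..T}" for j t
      unfolding d_def using lip[OF US US that, of "Suc j" j] by (simp add: USuc)
  qed
  define v where "v t = U 0 t + (\<Sum>j. U (Suc j) t - U j t)" for t
  have "uniform_limit {0..T} (\<lambda>n t. \<Sum>j<n. U (Suc j) t - U j t) (\<lambda>t. \<Sum>j. U (Suc j) t - U j t) sequentially"
  proof (rule Weierstrass_m_test)
    show "norm (U (Suc j) t - U j t) \<le> \<bar>B\<bar> * (\<bar>L * T\<bar> ^ j / fact j)" if "t \<in> {0..T}" for j t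
    proof -
      have "B * (L * t) ^ j / fact j \<le> \<bar>B\<bar> * (\<bar>L * T\<bar> ^ j / fact j)"
        unfolding times_divide_eq_right
        using that L by (intro divide_right_mono mult_mono power_mono) (auto simp: abs_mult intro!: mult_mono)
      then show ?thesis using dle[OF that, of j] by (simp add: d_def)
    qed
    show "summable (\<lambda>j. \<bar>B\<bar> * (\<bar>L * T\<bar> ^ j / fact j))"
      using summable_exp[of "\<bar>L * T\<bar>"] by (intro summable_mult) (simp add: field_simps)
  qed
  from uniform_limit_add[OF uniform_limit_const[where c="U 0"] this]
  have ul: "uniform_limit {0..T} U v sequentially"
    by (simp add: sum_lessThan_telescope[of "\<lambda>j. U j _"] v_def[abs_def])
  have vS: "v \<in> S" by (rule closed[OF US ul])
  have lim: "(\<lambda>j. U j t) \<longlonglongrightarrow> v t" if "t \<in> {0..T}" for t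
    by (rule tendsto_uniform_limitI[OF ul that])
  have fixp: "\<Phi> v t = v t" if t: "t \<in> {0..T}" for t
  proof -
    have "(\<lambda>j. \<Phi> (U j) t - \<Phi> v t) \<longlonglongrightarrow> 0"
    proof (rule LIMSEQ_I)
      fix e :: real assume e: "0 < e"
      \<comment> \<open>small enough that \<open>L * T * e'\<close> stays below \<open>e\<close>, also when \<open>L = 0\<close>\<close>
      define e' where "e' = e / (1 + L * (1 + \<bar>T\<bar>))"
      have pos: "1 + L * (1 + \<bar>T\<bar>) > 0" using L by (simp add: add_pos_nonneg)
      have e': "0 < e'" using e pos by (simp add: e'_def)
      obtain n where n: "\<And>j s. j \<ge> n \<Longrightarrow> s \<in> {0..T} \<Longrightarrow> dist (U j s) (v s) < e'"
        using uniform_limitD[OF ul e'] unfolding eventually_sequentially by blast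
      have "norm (\<Phi> (U j) t - \<Phi> v t) < e" if j: "j \<ge> n" for j
      proof -
        have "\<bar>\<Phi> (U j) t - \<Phi> v t\<bar> \<le> L * (LBINT s:{0..t}. \<bar>U j s - v s\<bar>)"
          by (rule lip[OF US vS t])
        also have "(LBINT s:{0..t}. \<bar>U j s - v s\<bar>) \<le> (LBINT s:{0..t}. e')"
          using n[OF j] t
          by (intro set_integral_mono borel_integrable_atLeastAtMost' continuous_intros
              continuous_on_subset[OF contU] continuous_on_subset[OF cont[OF vS]])
            (auto simp: dist_real_def less_imp_le)
        also have "(LBINT s:{0..t}. e') = t * e'"
          using t by (simp add: set_lebesgue_integral_def)
        finally have "\<bar>\<Phi> (U j) t - \<Phi> v t\<bar> \<le> L * (t * e')"
          using L by (simp add: mult_left_mono)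
        also have "\<dots> \<le> L * (1 + \<bar>T\<bar>) * e'"
          using L t e' by (auto simp: mult.assoc intro!: mult_left_mono mult_right_mono)
        also have "\<dots> < (1 + L * (1 + \<bar>T\<bar>)) * e'" using e' by (simp add: algebra_simps)
        also have "\<dots> = e" using pos by (simp add: e'_def)
        finally show ?thesis by simp
      qed
      then show "\<exists>no. \<forall>n\<ge>no. norm (\<Phi> (U n) t - \<Phi> v t - 0) < e" by auto
    qed
    then have "(\<lambda>j. U (Suc j) t) \<longlonglongrightarrow> \<Phi> v t"
      unfolding USuc by (rule LIM_zero_cancel)
    then show ?thesis
      by (rule LIMSEQ_unique[OF _ LIMSEQ_Suc[OF lim[OF t]]])
  qed
  show ?thesis using vS fixp lim unfolding U_def by blast
qed

text \<open>
  When \<open>X - z > r\<close>, the path \<open>X\<close> is positive and the drift pushes it down. So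
  \<open>X - z\<close> cannot cross the barrier \<open>r\<close>, and likewise from below.
\<close>

lemma forced_solution_bound:
  fixes f g c X z :: "real \<Rightarrow> real"
  assumes f: "mono f" "f 0 = 0" and g: "mono g" "g 0 = 0"
    and c: "\<And>s. s \<in> {0..T} \<Longrightarrow> 0 \<le> c s"
    and int: "set_integrable lborel {0..T} (\<lambda>s. f (X s) + c s * g (X s))"
    and X: "continuous_on {0..T} X" and z: "continuous_on {0..T} z"
    and eq: "\<And>t. t \<in> {0..T} \<Longrightarrow> X t = z t - (LBINT s:{0..t}. f (X s) + c s * g (X s))"
    and r: "\<And>t. t \<in> {0..T} \<Longrightarrow> \<bar>z t\<bar> \<le> r"
    and t: "t \<in> {0..T}"
  shows "\<bar>X t\<bar> \<le> 2 * r"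
proof -
  have r0: "0 \<le> r" using r[OF t] by linarith
  have zero: "set_integrable lborel {0..T} (\<lambda>_. 0 :: real)" by (simp add: set_integrable_def)
  have pos: "0 \<le> f (X s) + c s * g (X s)" if "s \<in> {0..T}" "0 \<le> X s" for s
    using monoD[OF f(1) that(2)] monoD[OF g(1) that(2)] f g c[OF that(1)] by simp
  have neg: "f (X s) + c s * g (X s) \<le> 0" if "s \<in> {0..T}" "X s \<le> 0" for s
    using monoD[OF f(1) that(2)] monoD[OF g(1) that(2)] f g c[OF that(1)]
    by (simp add: add_nonpos_nonpos mult_nonneg_nonpos)
  have "X t - z t \<le> r + (LBINT s:{0..t}. 0)"
  proof (rule barrier_upper[where T=T and x=0 and g="\<lambda>s. - (f (X s) + c s * g (X s))" and D="\<lambda>t. X t - z t"])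
    show "set_integrable lborel {0..T} (\<lambda>s. - (f (X s) + c s * g (X s)))"
      using int unfolding set_integrable_def scaleR_minus_right by (rule Bochner_Integration.integrable_minus)
    show "X t - z t = 0 + (LBINT s:{0..t}. - (f (X s) + c s * g (X s)))" if "t \<in> {0..T}" for t
      using eq[OF that] unfolding set_lebesgue_integral_def scaleR_minus_right Bochner_Integration.integral_minus by simp
    show "- (f (X s) + c s * g (X s)) \<le> 0" if "s \<in> {0..T}" "r < X s - z s" for s
      using pos[OF that(1)] r[OF that(1)] that(2) by linarith
  qed (use r0 t in \<open>auto intro!: continuous_intros X z simp: set_integrable_def\<close>)
  moreover have "z t - X t \<le> r + (LBINT s:{0..t}. 0)"
  proof (rule barrier_upper[where T=T and x=0 and g="\<lambda>s. (f (X s) + c s * g (X s))" and D="\<lambda>t. z t - X t"])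
    show "z t - X t = 0 + (LBINT s:{0..t}. (f (X s) + c s * g (X s)))" if "t \<in> {0..T}" for t
      using eq[OF that] by simp
    show "(f (X s) + c s * g (X s)) \<le> 0" if "s \<in> {0..T}" "r < z s - X s" for s
      using neg[OF that(1)] r[OF that(1)] that(2) by linarith
  qed (use r0 t zero in \<open>auto intro!: continuous_intros X z int\<close>)
  ultimately show ?thesis using r[OF t] by (auto simp: set_lebesgue_integral_def)
qed

text \<open>
  While \<open>X > X'\<close>, monotonicity of \<open>f\<close> and \<open>g\<close> makes the terms that
  compare \<open>X\<close> with \<open>X'\<close> at equal rates non-positive, and only the difference of
  the rates is left. The bound is therefore free of Lipschitz constants of \<open>f\<close> and
  \<open>g\<close> and of exponential factors.
\<close>

lemma forced_solution_compare:
  fixes f g c X z :: "real \<Rightarrow> real"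
  assumes f: "mono f" and g: "mono g"
    and c: "\<And>s. s \<in> {0..T} \<Longrightarrow> 0 \<le> c s"
    and int: "set_integrable lborel {0..T} (\<lambda>s. f (X s) + c s * g (X s))"
    and int': "set_integrable lborel {0..T} (\<lambda>s. f (X' s) + c' s * g (X' s))"
    and X: "continuous_on {0..T} X" and X': "continuous_on {0..T} X'"
    and eq: "\<And>t. t \<in> {0..T} \<Longrightarrow> X t = z t - (LBINT s:{0..t}. f (X s) + c s * g (X s))"
    and eq': "\<And>t. t \<in> {0..T} \<Longrightarrow> X' t = z t - (LBINT s:{0..t}. f (X' s) + c' s * g (X' s))"
    and a: "set_integrable lborel {0..T} a"
    and ca: "\<And>s. s \<in> {0..T} \<Longrightarrow> \<bar>c s - c' s\<bar> * \<bar>g (X' s)\<bar> \<le> a s"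
    and t: "t \<in> {0..T}"
  shows "\<bar>X t - X' t\<bar> \<le> (LBINT s:{0..t}. a s)"
proof -
  have a0: "0 \<le> a s" if "s \<in> {0..T}" for s
    using ca[OF that] by (smt (verit) mult_nonneg_nonneg)
  have ab: "(c' s - c s) * g (X' s) \<le> a s" "(c s - c' s) * g (X' s) \<le> a s" if "s \<in> {0..T}" for s
    using ca[OF that] by (auto simp: abs_mult[symmetric] algebra_simps)
  have "X t - X' t \<le> 0 + (LBINT s:{0..t}. a s)"
  proof (rule barrier_upper[where T=T and x=0 and g="\<lambda>s. (f (X' s) + c' s * g (X' s)) - (f (X s) + c s * g (X s))" and D="\<lambda>t. X t - X' t", OF _ a a0])
    show "set_integrable lborel {0..T} (\<lambda>s. (f (X' s) + c' s * g (X' s)) - (f (X s) + c s * g (X s)))"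
      by (rule set_integral_diff(1)[OF int' int])
    show "X t - X' t = 0 + (LBINT s:{0..t}. (f (X' s) + c' s * g (X' s)) - (f (X s) + c s * g (X s)))" if "t \<in> {0..T}" for t
      using that by (subst set_integral_diff(2)) (auto simp: eq[OF that] eq'[OF that] intro!: set_integrable_Icc_subset[OF int] set_integrable_Icc_subset[OF int'])
    show "(f (X' s) + c' s * g (X' s)) - (f (X s) + c s * g (X s)) \<le> a s" if "s \<in> {0..T}" "0 < X s - X' s" for s
      using monoD[OF f, of "X' s" "X s"] mult_left_mono[OF monoD[OF g, of "X' s" "X s"] c[OF that(1)]] ab[OF that(1)] that(2)
      by (simp add: algebra_simps)
  qed (use t in \<open>auto intro!: continuous_intros X X'\<close>)
  moreover have "X' t - X t \<le> 0 + (LBINT s:{0..t}. a s)"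
  proof (rule barrier_upper[where T=T and x=0 and g="\<lambda>s. (f (X s) + c s * g (X s)) - (f (X' s) + c' s * g (X' s))" and D="\<lambda>t. X' t - X t", OF _ a a0])
    show "set_integrable lborel {0..T} (\<lambda>s. (f (X s) + c s * g (X s)) - (f (X' s) + c' s * g (X' s)))"
      by (rule set_integral_diff(1)[OF int int'])
    show "X' t - X t = 0 + (LBINT s:{0..t}. (f (X s) + c s * g (X s)) - (f (X' s) + c' s * g (X' s)))" if "t \<in> {0..T}" for t
      using that by (subst set_integral_diff(2)) (auto simp: eq[OF that] eq'[OF that] intro!: set_integrable_Icc_subset[OF int] set_integrable_Icc_subset[OF int'])
    show "(f (X s) + c s * g (X s)) - (f (X' s) + c' s * g (X' s)) \<le> a s" if "s \<in> {0..T}" "0 < X' s - X s" for s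
      using monoD[OF f, of "X s" "X' s"] mult_left_mono[OF monoD[OF g, of "X s" "X' s"] c[OF that(1)]] ab[OF that(1)] that(2)
      by (simp add: algebra_simps)
  qed (use t in \<open>auto intro!: continuous_intros X X'\<close>)
  ultimately show ?thesis by simp
qed

section \<open>Solving forced equations with monotone drift\<close>

definition trunc :: "real \<Rightarrow> real \<Rightarrow> real" where
  "trunc r x = max (- r) (min r x)"

definition truncated_picard ::
    "(real \<Rightarrow> real) \<Rightarrow> (real \<Rightarrow> real) \<Rightarrow> (real \<Rightarrow> real) \<Rightarrow> (real \<Rightarrow> real) \<Rightarrow> real \<Rightarrow> (real \<Rightarrow> real) \<Rightarrow> real \<Rightarrow> real" where
  "truncated_picard f g c z r u t =
     z t - (LBINT s:{0..t}. f (trunc r (u s)) + c s * g (trunc r (u s)))"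

text \<open>
  The solution of the forced equation, defined as an iterated limit of Picard iterates with truncated
  coefficients. An explicit limit is needed instead of a choice: it is a measurable function of the
  forcing path and depends on the past only.
\<close>

definition flow ::
    "(real \<Rightarrow> real) \<Rightarrow> (real \<Rightarrow> real) \<Rightarrow> (real \<Rightarrow> real) \<Rightarrow> (real \<Rightarrow> real) \<Rightarrow> real \<Rightarrow> real" where
  "flow f g c z t = lim (\<lambda>r. lim (\<lambda>j. (truncated_picard f g c z (real r) ^^ j) z t))"

locale monotone_drift =
  fixes f g :: "real \<Rightarrow> real"
  assumes mono_f: "mono f" and mono_g: "mono g" and f0: "f 0 = 0" and g0: "g 0 = 0"
    and cont_f: "continuous_on UNIV f" and cont_g: "continuous_on UNIV g"
    and lip_f: "\<And>r. \<exists>L. \<forall>x\<in>{-r..r}. \<forall>y\<in>{-r..r}. \<bar>f x - f y\<bar> \<le> L * \<bar>x - y\<bar>"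
    and lip_g: "\<And>r. \<exists>L. \<forall>x\<in>{-r..r}. \<forall>y\<in>{-r..r}. \<bar>g x - g y\<bar> \<le> L * \<bar>x - y\<bar>"
begin

lemma continuous_drift:
  assumes "continuous_on A c" "continuous_on A u"
  shows "continuous_on A (\<lambda>s. f (u s) + c s * g (u s))"
  by (intro continuous_intros assms continuous_on_compose2[OF cont_f] continuous_on_compose2[OF cont_g]) auto

lemma continuous_trunc: "continuous_on A u \<Longrightarrow> continuous_on A (\<lambda>s. trunc r (u s))"
  unfolding trunc_def by (intro continuous_intros)

lemma continuous_indefinite_integral:
  fixes h :: "real \<Rightarrow> real"
  assumes "set_integrable lborel {0..T} h"
  shows "continuous_on {0..T} (\<lambda>t. LBINT s:{0..t}. h s)"
proof -
  have "continuous_on {0..T} (\<lambda>t. integral {0..t} h)"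
    by (rule indefinite_integral_continuous_1) (rule set_borel_integral_eq_integral(1)[OF assms])
  then show ?thesis
    by (rule continuous_on_eq)
      (auto intro!: set_borel_integral_eq_integral(2)[symmetric] set_integrable_Icc_subset[OF assms])
qed

lemma continuous_truncated_picard:
  assumes "continuous_on {0..T} z" "continuous_on {0..T} c" "continuous_on {0..T} u"
  shows "continuous_on {0..T} (truncated_picard f g c z r u)"
  unfolding truncated_picard_def
  by (intro continuous_intros assms continuous_indefinite_integral borel_integrable_atLeastAtMost'
      continuous_drift continuous_trunc)

text \<open>
  Truncation at level \<open>r\<close> makes the locally Lipschitz coefficients globally Lipschitz.
\<close>

lemma truncated_solution:
  assumes z: "continuous_on {0..T} z" and c: "continuous_on {0..T} c"
    and c0: "\<And>s. s \<in> {0..T} \<Longrightarrow> 0 \<le> c s" and r: "0 \<le> r"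
  shows "\<exists>u. continuous_on {0..T} u \<and> (\<forall>t\<in>{0..T}. truncated_picard f g c z r u t = u t) \<and>
     (\<forall>t\<in>{0..T}. (\<lambda>j. (truncated_picard f g c z r ^^ j) z t) \<longlonglongrightarrow> u t)"
proof -
  obtain L1 where L1: "\<And>x y. x \<in> {-r..r} \<Longrightarrow> y \<in> {-r..r} \<Longrightarrow> \<bar>f x - f y\<bar> \<le> L1 * \<bar>x - y\<bar>"
    using lip_f by blast
  obtain L2 where L2: "\<And>x y. x \<in> {-r..r} \<Longrightarrow> y \<in> {-r..r} \<Longrightarrow> \<bar>g x - g y\<bar> \<le> L2 * \<bar>x - y\<bar>"
    using lip_g by blast
  obtain B where B: "\<And>s. s \<in> {0..T} \<Longrightarrow> c s \<le> B"
    using continuous_bounded_above[OF c] by blast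
  define L where "L = \<bar>L1\<bar> + \<bar>B\<bar> * \<bar>L2\<bar>"
  have tr: "trunc r x \<in> {-r..r}" "\<bar>trunc r x - trunc r y\<bar> \<le> \<bar>x - y\<bar>" for x y
    using r by (auto simp: trunc_def max_def min_def)
  have lip: "\<bar>(f (trunc r x) + c s * g (trunc r x)) - (f (trunc r y) + c s * g (trunc r y))\<bar> \<le> L * \<bar>x - y\<bar>"
    if s: "s \<in> {0..T}" for s x y
  proof -
    have "\<bar>f (trunc r x) - f (trunc r y)\<bar> \<le> L1 * \<bar>trunc r x - trunc r y\<bar>"
      by (rule L1[OF tr(1) tr(1)])
    also have "\<dots> \<le> \<bar>L1\<bar> * \<bar>x - y\<bar>" by (rule mult_mono) (use tr(2) in auto)
    finally have 1: "\<bar>f (trunc r x) - f (trunc r y)\<bar> \<le> \<bar>L1\<bar> * \<bar>x - y\<bar>" .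
    have "\<bar>g (trunc r x) - g (trunc r y)\<bar> \<le> L2 * \<bar>trunc r x - trunc r y\<bar>"
      by (rule L2[OF tr(1) tr(1)])
    also have "\<dots> \<le> \<bar>L2\<bar> * \<bar>x - y\<bar>" by (rule mult_mono) (use tr(2) in auto)
    finally have "\<bar>c s\<bar> * \<bar>g (trunc r x) - g (trunc r y)\<bar> \<le> \<bar>B\<bar> * (\<bar>L2\<bar> * \<bar>x - y\<bar>)"
      using B[OF s] c0[OF s] by (intro mult_mono) auto
    then have 2: "\<bar>c s * g (trunc r x) - c s * g (trunc r y)\<bar> \<le> \<bar>B\<bar> * \<bar>L2\<bar> * \<bar>x - y\<bar>"
      by (simp add: abs_mult[symmetric] algebra_simps)
    show ?thesis using 1 2 unfolding L_def distrib_right abs_le_iff by linarith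
  qed
  define S where "S = {u. continuous_on {0..T} (u :: real \<Rightarrow> real)}"
  have "\<exists>u\<in>S. (\<forall>t\<in>{0..T}. truncated_picard f g c z r u t = u t) \<and>
     (\<forall>t\<in>{0..T}. (\<lambda>j. (truncated_picard f g c z r ^^ j) z t) \<longlonglongrightarrow> u t)"
  proof (rule volterra_fixpoint[where L=L])
    show "u \<in> S" if "\<And>j. U j \<in> S" "uniform_limit {0..T} U u sequentially" for U u
      using uniform_limit_theorem[OF _ that(2)] that(1) by (auto simp: S_def)
    show "\<bar>truncated_picard f g c z r u t - truncated_picard f g c z r v t\<bar> \<le> L * (LBINT s:{0..t}. \<bar>u s - v s\<bar>)"
      if "u \<in> S" "v \<in> S" and t: "t \<in> {0..T}" for u v t
    proof -
      let ?F = "\<lambda>u s. f (trunc r (u s)) + c s * g (trunc r (u s))"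
      have cu: "continuous_on {0..t} u" and cv: "continuous_on {0..t} v" and cc: "continuous_on {0..t} c"
        using that continuous_on_subset[OF _ , of "{0..T}" _ "{0..t}"] c by (auto simp: S_def)
      have Fu: "continuous_on {0..t} (?F u)" and Fv: "continuous_on {0..t} (?F v)"
        by (intro continuous_drift continuous_trunc cu cv cc)+
      note iu = borel_integrable_atLeastAtMost'[OF Fu] and iv = borel_integrable_atLeastAtMost'[OF Fv]
      have i1: "set_integrable lborel {0..t} (\<lambda>s. \<bar>?F u s - ?F v s\<bar>)"
        by (rule borel_integrable_atLeastAtMost'[OF continuous_on_rabs[OF continuous_on_diff[OF Fu Fv]]])
      have i2: "set_integrable lborel {0..t} (\<lambda>s. L * \<bar>u s - v s\<bar>)"
        by (rule borel_integrable_atLeastAtMost'[OF continuous_on_mult_left[OF continuous_on_rabs[OF continuous_on_diff[OF cu cv]]]])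
      have "truncated_picard f g c z r u t - truncated_picard f g c z r v t = - (LBINT s:{0..t}. ?F u s - ?F v s)"
        unfolding truncated_picard_def using set_integral_diff(2)[OF iu iv] by simp
      then have "\<bar>truncated_picard f g c z r u t - truncated_picard f g c z r v t\<bar> \<le> (LBINT s:{0..t}. \<bar>?F u s - ?F v s\<bar>)"
        using set_integral_norm_bound[OF set_integral_diff(1)[OF iu iv]] by simp
      moreover have "(LBINT s:{0..t}. \<bar>?F u s - ?F v s\<bar>) \<le> (LBINT s:{0..t}. L * \<bar>u s - v s\<bar>)"
        by (rule set_integral_mono[OF i1 i2]) (rule lip, use t in auto)
      ultimately show ?thesis by simp
    qed
  qed (use z in \<open>auto simp: S_def L_def intro!: continuous_truncated_picard c\<close>)
  then show ?thesis by (auto simp: S_def)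
qed

text \<open>
  The a priori bound holds uniformly in the truncation level, so every level beyond twice the radius of
  \<open>z\<close> has the same solution, which never feels the truncation.
\<close>

lemma flow_solves:
  assumes z: "continuous_on {0..T} z" and c: "continuous_on {0..T} c"
    and c0: "\<And>s. s \<in> {0..T} \<Longrightarrow> 0 \<le> c s"
  shows "continuous_on {0..T} (flow f g c z)"
    and "\<And>t. t \<in> {0..T} \<Longrightarrow> flow f g c z t = z t - (LBINT s:{0..t}. f (flow f g c z s) + c s * g (flow f g c z s))"
proof -
  obtain \<rho> where \<rho>: "\<And>s. s \<in> {0..T} \<Longrightarrow> \<bar>z s\<bar> \<le> \<rho>"
    using continuous_bounded_above[OF continuous_on_rabs[OF z]] by blast
  \<comment> \<open>beyond this truncation level the a priori bound makes the truncation inactive\<close>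
  obtain N :: nat where N: "2 * \<bar>\<rho>\<bar> \<le> real N" using real_arch_simple by blast
  have "\<exists>u. continuous_on {0..T} u \<and> (\<forall>t\<in>{0..T}. truncated_picard f g c z (real r) u t = u t) \<and>
     (\<forall>t\<in>{0..T}. (\<lambda>j. (truncated_picard f g c z (real r) ^^ j) z t) \<longlonglongrightarrow> u t)" for r :: nat
    by (rule truncated_solution[OF z c c0]) auto
  then obtain u where ucont: "\<And>r. continuous_on {0..T} (u r)"
    and ueq: "\<And>r t. t \<in> {0..T} \<Longrightarrow> truncated_picard f g c z (real r) (u r) t = u r t"
    and ulim: "\<And>r t. t \<in> {0..T} \<Longrightarrow> (\<lambda>j. (truncated_picard f g c z (real r) ^^ j) z t) \<longlonglongrightarrow> u r t"
    by metis
  have tr0: "trunc (real r) 0 = 0" and trm: "mono (trunc (real r))" for r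
    by (auto simp: trunc_def mono_def max_def min_def)
  have ub: "\<bar>u r t\<bar> \<le> 2 * \<rho>" if t: "t \<in> {0..T}" for r t
  proof (rule forced_solution_bound[where f="\<lambda>x. f (trunc r x)" and g="\<lambda>x. g (trunc r x)" and c=c and T=T and z=z and X="u r"])
    show "mono (\<lambda>x. f (trunc r x))" "mono (\<lambda>x. g (trunc r x))"
      using mono_f mono_g trm unfolding mono_def by blast+
    show "u r t = z t - (LBINT s:{0..t}. f (trunc (real r) (u r s)) + c s * g (trunc (real r) (u r s)))" if "t \<in> {0..T}" for t
      using ueq[OF that, of r] by (simp add: truncated_picard_def)
  qed (use t in \<open>auto simp: tr0 f0 g0 intro!: \<rho> z ucont c0 borel_integrable_atLeastAtMost' continuous_drift continuous_trunc c\<close>)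
  have ueq': "u r t = z t - (LBINT s:{0..t}. f (u r s) + c s * g (u r s))" if "r \<ge> N" "t \<in> {0..T}" for r t
  proof -
    have "trunc (real r) (u r s) = u r s" if "s \<in> {0..t}" for s
    proof -
      have "\<bar>u r s\<bar> \<le> real r" using ub[of s r] that \<open>t \<in> {0..T}\<close> N \<open>r \<ge> N\<close> by (auto simp del: of_nat_le_iff simp flip: of_nat_le_iff[where 'a=real])
      then show ?thesis by (auto simp: trunc_def)
    qed
    then have "(LBINT s:{0..t}. f (trunc r (u r s)) + c s * g (trunc r (u r s))) = (LBINT s:{0..t}. f (u r s) + c s * g (u r s))"
      by (intro set_lebesgue_integral_cong) auto
    then show ?thesis using ueq[OF that(2), of r] by (simp add: truncated_picard_def)
  qed
  have same: "u r t = u N t" if "r \<ge> N" "t \<in> {0..T}" for r t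
  proof -
    have "\<bar>u r t - u N t\<bar> \<le> (LBINT s:{0..t}. 0)"
      by (rule forced_solution_compare[OF mono_f mono_g c0 _ _ ucont ucont ueq' ueq', where a="\<lambda>_. 0"])
        (use that in \<open>auto intro!: borel_integrable_atLeastAtMost' continuous_drift ucont c\<close>)
    then show ?thesis by (simp add: set_lebesgue_integral_def)
  qed
  have flow: "flow f g c z t = u N t" if t: "t \<in> {0..T}" for t
  proof -
    have "flow f g c z t = lim (\<lambda>r. u r t)"
      unfolding flow_def using limI[OF ulim[OF t]] by simp
    also have "\<dots> = u N t"
      by (rule limI, rule tendsto_eventually, rule eventually_sequentiallyI[of N], rule same[OF _ t])
    finally show ?thesis .
  qed
  show "continuous_on {0..T} (flow f g c z)"
    using continuous_on_eq[OF ucont[of N]] flow by simp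
  fix t assume t: "t \<in> {0..T}"
  have "(LBINT s:{0..t}. f (flow f g c z s) + c s * g (flow f g c z s)) = (LBINT s:{0..t}. f (u N s) + c s * g (u N s))"
    by (intro set_lebesgue_integral_cong) (use t flow in auto)
  then show "flow f g c z t = z t - (LBINT s:{0..t}. f (flow f g c z s) + c s * g (flow f g c z s))"
    using flow[OF t] ueq'[OF _ t, of N] by simp
qed

lemma flow_bound:
  assumes z: "continuous_on {0..T} z" and c: "continuous_on {0..T} c"
    and c0: "\<And>s. s \<in> {0..T} \<Longrightarrow> 0 \<le> c s"
    and r: "\<And>t. t \<in> {0..T} \<Longrightarrow> \<bar>z t\<bar> \<le> r" and t: "t \<in> {0..T}"
  shows "\<bar>flow f g c z t\<bar> \<le> 2 * r"
proof (rule forced_solution_bound[where f=f and g=g and c=c and z=z and X="flow f g c z", OF mono_f f0 mono_g g0 c0])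
  show "set_integrable lborel {0..T} (\<lambda>s. f (flow f g c z s) + c s * g (flow f g c z s))"
    by (intro borel_integrable_atLeastAtMost' continuous_drift c flow_solves(1)[OF z c c0])
qed (use t in \<open>auto intro: r flow_solves(1)[OF z c c0] z flow_solves(2)[OF z c c0]\<close>)

lemma flow_unique:
  assumes z: "continuous_on {0..T} z" and c: "continuous_on {0..T} c"
    and c0: "\<And>s. s \<in> {0..T} \<Longrightarrow> 0 \<le> c s"
    and X: "continuous_on {0..T} X"
    and eq: "\<And>t. t \<in> {0..T} \<Longrightarrow> X t = z t - (LBINT s:{0..t}. f (X s) + c s * g (X s))"
    and t: "t \<in> {0..T}"
  shows "X t = flow f g c z t"
proof -
  have "\<bar>X t - flow f g c z t\<bar> \<le> (LBINT s:{0..t}. 0)"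
    by (rule forced_solution_compare[OF mono_f mono_g c0 _ _ X flow_solves(1)[OF z c c0] eq flow_solves(2)[OF z c c0] _ _ t])
      (auto intro!: borel_integrable_atLeastAtMost' continuous_drift X c flow_solves(1)[OF z c c0])
  then show ?thesis by (simp add: set_lebesgue_integral_def)
qed

lemma flow_compare:
  assumes z: "continuous_on {0..T} z" and c: "continuous_on {0..T} c"
    and c0: "\<And>s. s \<in> {0..T} \<Longrightarrow> 0 \<le> c s" and c': "continuous_on {0..T} c'"
    and c0': "\<And>s. s \<in> {0..T} \<Longrightarrow> 0 \<le> c' s"
    and A: "\<And>s. s \<in> {0..T} \<Longrightarrow> \<bar>g (flow f g c' z s)\<bar> \<le> A"
    and t: "t \<in> {0..T}"
  shows "\<bar>flow f g c z t - flow f g c' z t\<bar> \<le> A * (LBINT s:{0..t}. \<bar>c s - c' s\<bar>)"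
proof -
  have "\<bar>flow f g c z t - flow f g c' z t\<bar> \<le> (LBINT s:{0..t}. A * \<bar>c s - c' s\<bar>)"
    by (rule forced_solution_compare[OF mono_f mono_g c0 _ _ flow_solves(1)[OF z c c0] flow_solves(1)[OF z c' c0'] flow_solves(2)[OF z c c0] flow_solves(2)[OF z c' c0'] _ _ t])
      (auto intro!: borel_integrable_atLeastAtMost' continuous_drift c c' flow_solves(1)[OF z c c0] flow_solves(1)[OF z c' c0'] continuous_on_mult_left continuous_on_rabs continuous_on_diff mult_right_mono A simp: mult.commute[of "\<bar>c _ - c' _\<bar>"])
  then show ?thesis by simp
qed

lemma flow_cong:
  assumes z: "continuous_on {0..T} z" and c: "continuous_on {0..T} c"
    and c0: "\<And>s. s \<in> {0..T} \<Longrightarrow> 0 \<le> c s"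
    and zz: "\<And>s. s \<in> {0..T} \<Longrightarrow> z s = z' s" and cc: "\<And>s. s \<in> {0..T} \<Longrightarrow> c s = c' s"
    and t: "t \<in> {0..T}"
  shows "flow f g c z t = flow f g c' z' t"
proof (rule flow_unique[OF _ _ _ flow_solves(1)[OF z c c0] _ t])
  show "continuous_on {0..T} z'" "continuous_on {0..T} c'" using z c zz cc continuous_on_eq by blast+
  show "0 \<le> c' s" if "s \<in> {0..T}" for s using c0[OF that] cc[OF that] by simp
  fix t assume t: "t \<in> {0..T}"
  have "(LBINT s:{0..t}. f (flow f g c z s) + c s * g (flow f g c z s)) = (LBINT s:{0..t}. f (flow f g c z s) + c' s * g (flow f g c z s))"
    by (intro set_lebesgue_integral_cong) (use t cc in auto)
  then show "flow f g c z t = z' t - (LBINT s:{0..t}. f (flow f g c z s) + c' s * g (flow f g c z s))"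
    using flow_solves(2)[OF z c c0 t] zz[OF t] by simp
qed

end

section \<open>Dyadic chaining of paths\<close>

definition grid_index :: "real \<Rightarrow> nat \<Rightarrow> real \<Rightarrow> nat" where
  "grid_index T l t = nat \<lfloor>2 ^ l * t / T\<rfloor>"

text \<open>
  A family \<open>b l i\<close> stands for the values of a path at the points
  \<open>T * i / 2 ^ l\<close>. The energy is a sum of powers of increments, as in the Kolmogorov
  continuity criterion. The weight is chosen so that a finite energy forces increments at level
  \<open>l\<close> to decay like \<open>(7/8)^l\<close>, while the expected energy of Brownian increments
  is still finite for \<open>q \<ge> 2\<close>.
\<close>

definition chain_energy :: "nat \<Rightarrow> (nat \<Rightarrow> nat \<Rightarrow> real) \<Rightarrow> ennreal" where
  "chain_energy q b = (\<Sum>l. \<Sum>i<2 ^ l. ennreal ((8 / 7) ^ (2 * q * l) * (b l (Suc i) - b l i) ^ (2 * q)))"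

text \<open>
  The default value \<open>0\<close> makes the result continuous for families of infinite energy as well.
\<close>

definition chain_limit :: "nat \<Rightarrow> real \<Rightarrow> (nat \<Rightarrow> nat \<Rightarrow> real) \<Rightarrow> real \<Rightarrow> real" where
  "chain_limit q T b t = (if chain_energy q b < \<infinity> then lim (\<lambda>l. b l (grid_index T l t)) else 0)"

text \<open>
  Telescoping over the levels: level \<open>l\<close> contributes at most \<open>(7/8)^l\<close> times
  the root of the energy, and these factors sum to 8.
\<close>

definition chain_radius :: "nat \<Rightarrow> (nat \<Rightarrow> nat \<Rightarrow> real) \<Rightarrow> real" where
  "chain_radius q b = \<bar>b 0 0\<bar> + 8 * root (2 * q) (enn2real (chain_energy q b))"

lemma chain_increment_bound:
  assumes fin: "chain_energy q b < \<infinity>" and q: "0 < q" and i: "i < 2 ^ l"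
  shows "\<bar>b l (Suc i) - b l i\<bar> \<le> root (2 * q) (enn2real (chain_energy q b)) * (7 / 8) ^ l"
proof -
  let ?D = "\<bar>b l (Suc i) - b l i\<bar>" and ?E = "enn2real (chain_energy q b)"
  have "ennreal ((8 / 7) ^ (2 * q * l) * (b l (Suc i) - b l i) ^ (2 * q))
      \<le> (\<Sum>i<2 ^ l. ennreal ((8 / 7) ^ (2 * q * l) * (b l (Suc i) - b l i) ^ (2 * q)))"
    using i by (intro member_le_sum) auto
  also have "\<dots> \<le> chain_energy q b"
    unfolding chain_energy_def
    using sum_le_suminf[of "\<lambda>l. \<Sum>i<2 ^ l. ennreal ((8 / 7) ^ (2 * q * l) * (b l (Suc i) - b l i) ^ (2 * q))" "{l}"]
    by simp
  finally have "(8 / 7) ^ (2 * q * l) * (b l (Suc i) - b l i) ^ (2 * q) \<le> ?E"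
    using enn2real_mono[OF _ fin[unfolded infinity_ennreal_def]] by fastforce
  then have "((8 / 7) ^ l * ?D) ^ (2 * q) \<le> ?E"
    by (simp add: power_mult_distrib power_mult[symmetric] mult.commute[of l] power_even_abs)
  then have "root (2 * q) (((8 / 7) ^ l * ?D) ^ (2 * q)) \<le> root (2 * q) ?E"
    using q by simp
  then have "(8 / 7) ^ l * ?D \<le> root (2 * q) ?E"
    using q by (subst (asm) real_root_power_cancel) auto
  then have "(7 / 8) ^ l * ((8 / 7) ^ l * ?D) \<le> (7 / 8) ^ l * root (2 * q) ?E"
    by (intro mult_left_mono) auto
  moreover have "(7 / 8 :: real) ^ l * (8 / 7) ^ l = 1"
    by (simp add: power_mult_distrib[symmetric])
  ultimately have "?D \<le> (7 / 8) ^ l * root (2 * q) ?E" by (simp only: mult.assoc[symmetric] mult_1_left)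
  then show ?thesis by (simp only: mult.commute)
qed

lemma grid_index_le: "T > 0 \<Longrightarrow> t \<in> {0..T} \<Longrightarrow> grid_index T l t \<le> 2 ^ l"
proof -
  assume *: "T > 0" "t \<in> {0..T}"
  have "2 ^ l * t / T \<le> 2 ^ l" using * by (simp add: field_simps)
  then have "\<lfloor>2 ^ l * t / T\<rfloor> \<le> 2 ^ l"
    by (metis floor_mono floor_numeral_power)
  then show ?thesis by (simp add: grid_index_def)
qed

lemma grid_index_Suc:
  assumes "T > 0" "t \<in> {0..T}"
  shows "grid_index T (Suc l) t = 2 * grid_index T l t \<or> grid_index T (Suc l) t = Suc (2 * grid_index T l t)"
proof -
  define x where "x = 2 ^ l * t / T"
  have x: "0 \<le> x" using assms by (simp add: x_def)
  have "2 ^ Suc l * t / T = 2 * x" by (simp add: x_def)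
  moreover have "\<lfloor>2 * x\<rfloor> = 2 * \<lfloor>x\<rfloor> \<or> \<lfloor>2 * x\<rfloor> = 2 * \<lfloor>x\<rfloor> + 1" by linarith
  moreover obtain k where "\<lfloor>x\<rfloor> = int k" using x by (metis zero_le_floor zero_le_imp_eq_int)
  ultimately show ?thesis by (auto simp: grid_index_def x_def[symmetric])
qed

lemma grid_index_close:
  assumes "T > 0" "0 \<le> s" "s \<le> t" "t - s \<le> T / 2 ^ l"
  shows "grid_index T l t = grid_index T l s \<or> grid_index T l t = Suc (grid_index T l s)"
proof -
  define x y where "x = 2 ^ l * s / T" and "y = 2 ^ l * t / T"
  have "2 ^ l * (t - s) / T \<le> 1" using assms by (simp add: field_simps)
  then have xy: "0 \<le> x" "x \<le> y" "y \<le> x + 1"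
    using assms by (auto simp: x_def y_def field_simps)
  then have "\<lfloor>y\<rfloor> = \<lfloor>x\<rfloor> \<or> \<lfloor>y\<rfloor> = \<lfloor>x\<rfloor> + 1" by linarith
  moreover obtain k where "\<lfloor>x\<rfloor> = int k" using xy by (metis zero_le_floor zero_le_imp_eq_int)
  ultimately show ?thesis by (auto simp: grid_index_def x_def[symmetric] y_def[symmetric])
qed

lemma grid_point_close:
  assumes "T > 0" "t \<in> {0..T}"
  shows "T * real (grid_index T l t) / 2 ^ l \<in> {0..t}" "t - T * real (grid_index T l t) / 2 ^ l \<le> T / 2 ^ l"
proof -
  define x where "x = 2 ^ l * t / T"
  have x: "0 \<le> x" using assms by (simp add: x_def)
  have t: "t = T * x / 2 ^ l" using assms by (simp add: x_def)
  have "real (grid_index T l t) = of_int \<lfloor>x\<rfloor>" using x by (simp add: grid_index_def x_def[symmetric])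
  then have g: "real (grid_index T l t) \<le> x" "x - real (grid_index T l t) \<le> 1" by linarith+
  have "T * real (grid_index T l t) / 2 ^ l \<le> T * x / 2 ^ l"
    using assms(1) g by (intro divide_right_mono mult_left_mono) auto
  then show "T * real (grid_index T l t) / 2 ^ l \<in> {0..t}" using t assms(1) by simp
  have "T * (x - real (grid_index T l t)) / 2 ^ l \<le> T * 1 / 2 ^ l"
    using assms(1) g by (intro divide_right_mono mult_left_mono) auto
  then show "t - T * real (grid_index T l t) / 2 ^ l \<le> T / 2 ^ l"
    using t by (simp add: right_diff_distrib diff_divide_distrib)
qed

lemma grid_index_tendsto:
  assumes "0 < T" "t \<in> {0..T}"
  shows "(\<lambda>l. T * real (grid_index T l t) / 2 ^ l) \<longlonglongrightarrow> t"
proof (rule tendsto_sandwich)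
  show "\<forall>\<^sub>F l in sequentially. t - T * (1 / 2) ^ l \<le> T * real (grid_index T l t) / 2 ^ l"
    using grid_point_close(2)[OF assms] by (intro always_eventually) (auto simp: power_one_over algebra_simps)
  show "\<forall>\<^sub>F l in sequentially. T * real (grid_index T l t) / 2 ^ l \<le> t"
    using grid_point_close(1)[OF assms] by (intro always_eventually) auto
  have "(\<lambda>l. t - T * (1 / 2) ^ l) \<longlonglongrightarrow> t - T * 0"
    by (intro tendsto_intros LIMSEQ_realpow_zero) auto
  then show "(\<lambda>l. t - T * (1 / 2) ^ l) \<longlonglongrightarrow> t" by simp
qed auto

locale dyadic_chain =
  fixes q :: nat and T :: real and b :: "nat \<Rightarrow> nat \<Rightarrow> real"
  assumes T: "T > 0" and q: "q > 0"
    and consistent: "\<And>l i. i \<le> 2 ^ l \<Longrightarrow> b (Suc l) (2 * i) = b l i"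
    and finite_energy: "chain_energy q b < \<infinity>"
begin

definition "amp = root (2 * q) (enn2real (chain_energy q b))"

lemma amp_nonneg: "0 \<le> amp" by (simp add: amp_def real_root_ge_zero)

lemma incr: "i < 2 ^ l \<Longrightarrow> \<bar>b l (Suc i) - b l i\<bar> \<le> amp * (7 / 8) ^ l"
  unfolding amp_def by (rule chain_increment_bound[OF finite_energy q])

lemma level_step:
  assumes "t \<in> {0..T}"
  shows "\<bar>b (Suc l) (grid_index T (Suc l) t) - b l (grid_index T l t)\<bar> \<le> amp * (7 / 8) ^ Suc l"
  using grid_index_Suc[OF T assms, of l]
proof
  assume "grid_index T (Suc l) t = 2 * grid_index T l t"
  then show ?thesis using consistent[OF grid_index_le[OF T assms]] amp_nonneg by simp
next
  assume *: "grid_index T (Suc l) t = Suc (2 * grid_index T l t)"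
  have "2 * grid_index T l t < 2 ^ Suc l"
    using grid_index_le[OF T assms, of "Suc l"] * by simp
  from incr[OF this] show ?thesis using consistent[OF grid_index_le[OF T assms]] * by simp
qed

lemma limit:
  assumes t: "t \<in> {0..T}"
  shows "(\<lambda>l. b l (grid_index T l t)) \<longlonglongrightarrow> chain_limit q T b t"
    and "\<bar>chain_limit q T b t - b l (grid_index T l t)\<bar> \<le> 7 * amp * (7 / 8) ^ l"
proof -
  define B where "B l = b l (grid_index T l t)" for l
  define d where "d l = B (Suc l) - B l" for l
  have d: "norm (d l) \<le> amp * (7 / 8) ^ Suc l" for l
    using level_step[OF t, of l] by (simp add: d_def B_def)
  have sum8: "(\<lambda>j. amp * (7 / 8) ^ Suc (j + l)) sums (7 * amp * (7 / 8) ^ l)" for l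
  proof -
    have "(\<lambda>j. (7 / 8 * amp * (7 / 8) ^ l) * (7 / 8) ^ j) sums ((7 / 8 * amp * (7 / 8) ^ l) * (1 / (1 - 7 / 8)))"
      by (intro sums_mult geometric_sums) simp
    then show ?thesis by (simp add: power_add mult_ac)
  qed
  have sd: "summable d"
    by (rule summable_comparison_test'[OF sums_summable[OF sum8[of 0]], of 0]) (use d in auto)
  have Bl: "B (l + j) - B l = (\<Sum>i<j. d (i + l))" for l j
    by (induction j) (auto simp: d_def add.commute)
  have lim: "B \<longlonglongrightarrow> B 0 + suminf d"
    using tendsto_add[OF tendsto_const summable_LIMSEQ[OF sd], of "B 0"] Bl[of 0]
    by (simp add: d_def sum_lessThan_telescope)
  then have L: "chain_limit q T b t = B 0 + suminf d"
    using finite_energy limI[OF lim] by (simp add: chain_limit_def B_def[abs_def])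
  show "(\<lambda>l. b l (grid_index T l t)) \<longlonglongrightarrow> chain_limit q T b t"
    using lim L by (simp add: B_def[abs_def])
  have "(\<lambda>j. \<bar>B (l + j) - B l\<bar>) \<longlonglongrightarrow> \<bar>chain_limit q T b t - B l\<bar>"
    unfolding L using LIMSEQ_ignore_initial_segment[OF lim, of l]
    by (intro tendsto_intros) (simp add: add.commute)
  moreover have "\<bar>B (l + j) - B l\<bar> \<le> 7 * amp * (7 / 8) ^ l" for j
  proof -
    have "\<bar>\<Sum>i<j. d (i + l)\<bar> \<le> (\<Sum>i<j. amp * (7 / 8) ^ Suc (i + l))"
      using d by (intro order_trans[OF sum_abs] sum_mono) auto
    also have "\<dots> \<le> 7 * amp * (7 / 8) ^ l"
      using sum_le_suminf[OF sums_summable[OF sum8[of l]], of "{..<j}"] amp_nonneg sums_unique[OF sum8[of l]] by auto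
    finally show ?thesis by (simp add: Bl)
  qed
  ultimately show "\<bar>chain_limit q T b t - b l (grid_index T l t)\<bar> \<le> 7 * amp * (7 / 8) ^ l"
    unfolding B_def[symmetric] by (intro LIMSEQ_le_const2) auto
qed

lemma modulus:
  assumes "s \<in> {0..T}" "t \<in> {0..T}" "s \<le> t" "t - s \<le> T / 2 ^ l"
  shows "\<bar>chain_limit q T b t - chain_limit q T b s\<bar> \<le> 15 * amp * (7 / 8) ^ l"
proof -
  have "\<bar>b l (grid_index T l t) - b l (grid_index T l s)\<bar> \<le> amp * (7 / 8) ^ l"
    using grid_index_close[OF T, of s t l] assms incr[of "grid_index T l s" l] grid_index_le[OF T assms(2), of l] amp_nonneg
    by auto
  then show ?thesis using limit(2)[OF assms(1), of l] limit(2)[OF assms(2), of l] by linarith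
qed

lemma continuous: "continuous_on {0..T} (chain_limit q T b)"
  unfolding continuous_on_iff
proof (intro ballI allI impI)
  fix t e :: real assume t: "t \<in> {0..T}" and e: "0 < e"
  have "(\<lambda>l. 15 * amp * (7 / 8) ^ l) \<longlonglongrightarrow> 15 * amp * 0"
    by (intro tendsto_mult tendsto_const LIMSEQ_realpow_zero) auto
  then have "eventually (\<lambda>l. 15 * amp * (7 / 8) ^ l < e) sequentially"
    using e by (intro order_tendstoD) auto
  then obtain l where l: "15 * amp * (7 / 8) ^ l < e" by (auto simp: eventually_sequentially)
  show "\<exists>d>0. \<forall>s\<in>{0..T}. dist s t < d \<longrightarrow> dist (chain_limit q T b s) (chain_limit q T b t) < e"
  proof (intro exI[of _ "T / 2 ^ l"] conjI ballI impI)
    show "0 < T / 2 ^ l" using T by simp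
    fix s assume s: "s \<in> {0..T}" and st: "dist s t < T / 2 ^ l"
    show "dist (chain_limit q T b s) (chain_limit q T b t) < e"
    proof (cases "s \<le> t")
      case True
      then show ?thesis using modulus[OF s t, of l] l st by (auto simp: dist_real_def)
    next
      case False
      then show ?thesis using modulus[OF t s, of l] l st by (auto simp: dist_real_def)
    qed
  qed
qed

lemma bound:
  assumes t: "t \<in> {0..T}"
  shows "\<bar>chain_limit q T b t\<bar> \<le> chain_radius q b"
proof -
  have "\<bar>b 0 (grid_index T 0 t) - b 0 0\<bar> \<le> amp"
    using grid_index_le[OF T t, of 0] incr[of 0 0] amp_nonneg by (auto simp: le_Suc_eq)
  then show ?thesis using limit(2)[OF t, of 0] by (simp add: chain_radius_def amp_def[symmetric])
qed

end

definition sample_path :: "real \<Rightarrow> (real \<Rightarrow> real) \<Rightarrow> nat \<Rightarrow> nat \<Rightarrow> real" where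
  "sample_path T w l i = w (T * real i / 2 ^ l)"

text \<open>
  Continuous paths do not form a measurable subset of the product space, so a path is rebuilt from its
  dyadic values. The result is continuous for every \<open>w\<close> and agrees with \<open>w\<close> for
  almost every driving path.
\<close>

definition regularize :: "nat \<Rightarrow> real \<Rightarrow> (real \<Rightarrow> real) \<Rightarrow> real \<Rightarrow> real" where
  "regularize q T w = chain_limit q T (sample_path T w)"

definition path_radius :: "nat \<Rightarrow> real \<Rightarrow> (real \<Rightarrow> real) \<Rightarrow> real" where
  "path_radius q T w = chain_radius q (sample_path T w)"

lemma path_radius_nonneg: "0 \<le> path_radius q T w"
  by (simp add: path_radius_def chain_radius_def real_root_ge_zero)

lemma regularize_continuous_bound:
  assumes "T > 0" "q > 0"
  shows "continuous_on {0..T} (regularize q T w)"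
    and "t \<in> {0..T} \<Longrightarrow> \<bar>regularize q T w t\<bar> \<le> path_radius q T w"
proof -
  have "continuous_on {0..T} (regularize q T w) \<and> (t \<in> {0..T} \<longrightarrow> \<bar>regularize q T w t\<bar> \<le> path_radius q T w)"
  proof (cases "chain_energy q (sample_path T w) < \<infinity>")
    case True
    then interpret dyadic_chain q T "sample_path T w"
      by unfold_locales (use assms in \<open>auto simp: sample_path_def\<close>)
    show ?thesis unfolding regularize_def path_radius_def using continuous bound by blast
  next
    case False
    then have "regularize q T w = (\<lambda>t. 0)" by (auto simp: regularize_def chain_limit_def)
    then show ?thesis using path_radius_nonneg[of q T w] by simp
  qed
  then show "continuous_on {0..T} (regularize q T w)"
    "t \<in> {0..T} \<Longrightarrow> \<bar>regularize q T w t\<bar> \<le> path_radius q T w" by auto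
qed

lemma regularize_eq:
  assumes "T > 0" and w: "continuous_on {0..T} w" and fin: "chain_energy q (sample_path T w) < \<infinity>"
    and t: "t \<in> {0..T}"
  shows "regularize q T w t = w t"
proof -
  have pt: "T * real (grid_index T l t) / 2 ^ l \<in> {0..T}" for l
    using grid_point_close(1)[OF assms(1) t, of l] t by auto
  have "(\<lambda>l. T * real (grid_index T l t) / 2 ^ l) \<longlonglongrightarrow> t"
    by (rule grid_index_tendsto[OF assms(1) t])
  then have "(\<lambda>l. w (T * real (grid_index T l t) / 2 ^ l)) \<longlonglongrightarrow> w t"
    using w t pt by (auto simp: continuous_on_sequentially comp_def)
  then show ?thesis
    using fin limI by (auto simp: regularize_def chain_limit_def sample_path_def)
qed

lemma measurable_chain_energy:
  assumes b: "\<And>l i. i \<le> 2 ^ l \<Longrightarrow> (\<lambda>\<omega>. b \<omega> l i) \<in> borel_measurable M"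
  shows "(\<lambda>\<omega>. chain_energy q (b \<omega>)) \<in> borel_measurable M"
  unfolding chain_energy_def
  by (intro borel_measurable_suminf_order borel_measurable_sum measurable_compose[OF _ measurable_ennreal]
      borel_measurable_times borel_measurable_power borel_measurable_diff b) auto

lemma measurable_chain_limit:
  assumes b: "\<And>l i. i \<le> 2 ^ l \<Longrightarrow> (\<lambda>\<omega>. b \<omega> l i) \<in> borel_measurable M"
    and "T > 0" "t \<in> {0..T}"
  shows "(\<lambda>\<omega>. chain_limit q T (b \<omega>) t) \<in> borel_measurable M"
proof -
  note [measurable] = measurable_chain_energy[of b M q, OF b]
  have [measurable]: "(\<lambda>\<omega>. b \<omega> l (grid_index T l t)) \<in> borel_measurable M" for l
    by (rule b[OF grid_index_le[OF assms(2,3)]])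
  show ?thesis unfolding chain_limit_def by measurable
qed

lemma measurable_chain_radius:
  assumes b: "\<And>l i. i \<le> 2 ^ l \<Longrightarrow> (\<lambda>\<omega>. b \<omega> l i) \<in> borel_measurable M"
  shows "(\<lambda>\<omega>. chain_radius q (b \<omega>)) \<in> borel_measurable M"
proof -
  note [measurable] = measurable_chain_energy[of b M q, OF b]
  have [measurable]: "(\<lambda>\<omega>. b \<omega> 0 0) \<in> borel_measurable M" by (rule b) simp
  have [measurable]: "root (2 * q) \<in> borel_measurable borel"
    by (intro borel_measurable_continuous_onI continuous_on_real_root continuous_on_id)
  show ?thesis unfolding chain_radius_def by measurable
qed

lemma measurable_path_component:
  assumes "t \<in> {0..T}" shows "(\<lambda>w. w t) \<in> borel_measurable (path_space T)"
  unfolding path_space_def using assms by measurable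

lemma sample_path_point: "0 < T \<Longrightarrow> i \<le> 2 ^ l \<Longrightarrow> T * real i / 2 ^ l \<in> {0..T}"
proof -
  assume *: "0 < T" "i \<le> 2 ^ l"
  then have "real i \<le> 2 ^ l" by (metis of_nat_le_iff of_nat_numeral of_nat_power)
  then show ?thesis using * by (auto simp: field_simps)
qed

lemma measurable_regularize:
  assumes "T > 0" "t \<in> {0..T}"
  shows "(\<lambda>w. regularize q T w t) \<in> borel_measurable (path_space T)"
  unfolding regularize_def
  by (rule measurable_chain_limit[OF _ assms])
    (unfold sample_path_def, rule measurable_path_component[OF sample_path_point[OF assms(1)]])

lemma measurable_path_radius:
  assumes "T > 0"
  shows "path_radius q T \<in> borel_measurable (path_space T)"
  unfolding path_radius_def[abs_def]
  by (rule measurable_chain_radius)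
    (unfold sample_path_def, rule measurable_path_component[OF sample_path_point[OF assms(1)]])

section \<open>Joint laws and characteristic functions\<close>

lemma (in prob_space) integrable_bounded_complex:
  fixes C :: "'a \<Rightarrow> complex"
  assumes "C \<in> borel_measurable M" "\<And>\<omega>. norm (C \<omega>) \<le> B"
  shows "integrable M C"
  by (rule integrable_const_bound[where B=B]) (use assms in auto)

text \<open>
  Normalised, \<open>C\<close> is a probability density, and the hypothesis says that \<open>X\<close>
  has the same characteristic function under the two reweighted measures. Levy uniqueness then identifies
  the reweighted laws.
\<close>

lemma weighted_char_unique:
  fixes X :: "'a \<Rightarrow> real" and X' :: "'b \<Rightarrow> real"
  assumes "prob_space M" "prob_space M'"
    and X: "X \<in> borel_measurable M" and X': "X' \<in> borel_measurable M'"
    and C: "C \<in> borel_measurable M" and C': "C' \<in> borel_measurable M'"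
    and bd: "\<And>\<omega>. 0 \<le> C \<omega> \<and> C \<omega> \<le> (K::real)" and bd': "\<And>\<omega>. 0 \<le> C' \<omega> \<and> C' \<omega> \<le> K"
    and char: "\<And>v. (\<integral>\<omega>. complex_of_real (C \<omega>) * iexp (v * X \<omega>) \<partial>M) = (\<integral>\<omega>. complex_of_real (C' \<omega>) * iexp (v * X' \<omega>) \<partial>M')"
    and B: "B \<in> sets borel"
  shows "(\<integral>\<omega>. C \<omega> * indicator B (X \<omega>) \<partial>M) = (\<integral>\<omega>. C' \<omega> * indicator B (X' \<omega>) \<partial>M')"
proof -
  interpret M: prob_space M by fact
  interpret M': prob_space M' by fact
  note [measurable] = X X' C C' B
  have iC: "integrable M C" by (rule M.integrable_const_bound[where B=K]) (use bd C in auto)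
  have iC': "integrable M' C'" by (rule M'.integrable_const_bound[where B=K]) (use bd' C' in auto)
  define c where "c = (\<integral>\<omega>. C \<omega> \<partial>M)"
  have c': "c = (\<integral>\<omega>. C' \<omega> \<partial>M')"
    using char[of 0] by (simp add: c_def)
  show ?thesis
  proof (cases "c = 0")
    case True
    have "AE \<omega> in M. C \<omega> = 0" using integral_nonneg_eq_0_iff_AE[OF iC] True bd by (simp add: c_def)
    then have "(\<integral>\<omega>. C \<omega> * indicator B (X \<omega>) \<partial>M) = (\<integral>\<omega>. 0 \<partial>M)"
      by (intro integral_cong_AE) auto
    moreover have "AE \<omega> in M'. C' \<omega> = 0" using integral_nonneg_eq_0_iff_AE[OF iC'] True bd' by (simp add: c')
    then have "(\<integral>\<omega>. C' \<omega> * indicator B (X' \<omega>) \<partial>M') = (\<integral>\<omega>. 0 \<partial>M')"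
      by (intro integral_cong_AE) auto
    ultimately show ?thesis by simp
  next
    case False
    have "0 \<le> c" unfolding c_def by (rule Bochner_Integration.integral_nonneg) (use bd in auto)
    with False have c: "0 < c" by simp
    have main: "real_distribution (distr (density N (\<lambda>\<omega>. ennreal (D \<omega> / c))) borel Y) \<and>
        char (distr (density N (\<lambda>\<omega>. ennreal (D \<omega> / c))) borel Y) = (\<lambda>v. (\<integral>\<omega>. complex_of_real (D \<omega>) * iexp (v * Y \<omega>) \<partial>N) / c) \<and>
        measure (distr (density N (\<lambda>\<omega>. ennreal (D \<omega> / c))) borel Y) B = (\<integral>\<omega>. D \<omega> * indicator B (Y \<omega>) \<partial>N) / c"
      if "prob_space N" and Y[measurable]: "Y \<in> borel_measurable N" and D[measurable]: "D \<in> borel_measurable N"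
        and iD: "integrable N D" and bD: "\<And>\<omega>. 0 \<le> D \<omega>" and cD: "c = (\<integral>\<omega>. D \<omega> \<partial>N)"
      for N :: "'c measure" and D Y
    proof -
      interpret N: prob_space N by fact
      let ?N = "density N (\<lambda>\<omega>. ennreal (D \<omega> / c))"
      have pos: "AE \<omega> in N. 0 \<le> D \<omega> / c" using bD c by simp
      have "emeasure ?N (space ?N) = (\<integral>\<^sup>+\<omega>. ennreal (D \<omega> / c) \<partial>N)"
        by (simp add: emeasure_density nn_integral_set_ennreal cong: nn_integral_cong)
      also have "\<dots> = ennreal (\<integral>\<omega>. D \<omega> / c \<partial>N)"
        using iD pos by (intro nn_integral_eq_integral) auto
      also have "\<dots> = 1" using c cD by simp
      finally have "prob_space ?N" by (rule prob_spaceI)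
      then interpret D: prob_space ?N .
      have rd: "real_distribution (distr ?N borel Y)"
        by (rule D.real_distribution_distr) simp
      have "char (distr ?N borel Y) v = (\<integral>\<omega>. complex_of_real (D \<omega>) * iexp (v * Y \<omega>) \<partial>N) / c" for v
      proof -
        have "char (distr ?N borel Y) v = (\<integral>\<omega>. iexp (v * Y \<omega>) \<partial>?N)"
          unfolding char_def by (rule integral_distr) auto
        also have "\<dots> = (\<integral>\<omega>. (D \<omega> / c) *\<^sub>R iexp (v * Y \<omega>) \<partial>N)"
          by (rule integral_density) (use pos in auto)
        also have "\<dots> = (\<integral>\<omega>. complex_of_real (D \<omega>) * iexp (v * Y \<omega>) / c \<partial>N)"
          by (simp add: scaleR_conv_of_real)
        finally show ?thesis by simp
      qed
      moreover have "measure (distr ?N borel Y) B = (\<integral>\<omega>. D \<omega> * indicator B (Y \<omega>) \<partial>N) / c"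
      proof -
        interpret DY: prob_space "distr ?N borel Y" by (rule D.prob_space_distr) simp
        have "measure (distr ?N borel Y) B = (\<integral>y. indicator B y \<partial>distr ?N borel Y)" by simp
        also have "\<dots> = (\<integral>\<omega>. indicator B (Y \<omega>) \<partial>?N)" by (rule integral_distr) auto
        also have "\<dots> = (\<integral>\<omega>. (D \<omega> / c) *\<^sub>R indicator B (Y \<omega>) \<partial>N)"
          by (rule integral_density) (use pos in auto)
        also have "\<dots> = (\<integral>\<omega>. D \<omega> * indicator B (Y \<omega>) / c \<partial>N)" by simp
        finally show ?thesis by simp
      qed
      ultimately show ?thesis using rd by auto
    qed
    have m1: "real_distribution (distr (density M (\<lambda>\<omega>. ennreal (C \<omega> / c))) borel X) \<and>
        char (distr (density M (\<lambda>\<omega>. ennreal (C \<omega> / c))) borel X) = (\<lambda>v. (\<integral>\<omega>. complex_of_real (C \<omega>) * iexp (v * X \<omega>) \<partial>M) / c) \<and>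
        measure (distr (density M (\<lambda>\<omega>. ennreal (C \<omega> / c))) borel X) B = (\<integral>\<omega>. C \<omega> * indicator B (X \<omega>) \<partial>M) / c"
      by (rule main) (use assms iC c_def in auto)
    have m2: "real_distribution (distr (density M' (\<lambda>\<omega>. ennreal (C' \<omega> / c))) borel X') \<and>
        char (distr (density M' (\<lambda>\<omega>. ennreal (C' \<omega> / c))) borel X') = (\<lambda>v. (\<integral>\<omega>. complex_of_real (C' \<omega>) * iexp (v * X' \<omega>) \<partial>M') / c) \<and>
        measure (distr (density M' (\<lambda>\<omega>. ennreal (C' \<omega> / c))) borel X') B = (\<integral>\<omega>. C' \<omega> * indicator B (X' \<omega>) \<partial>M') / c"
      by (rule main) (use assms iC' c' in auto)
    have "distr (density M (\<lambda>\<omega>. ennreal (C \<omega> / c))) borel X = distr (density M' (\<lambda>\<omega>. ennreal (C' \<omega> / c))) borel X'"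
      by (rule Levy_uniqueness) (use m1 m2 char in auto)
    then have "(\<integral>\<omega>. C \<omega> * indicator B (X \<omega>) \<partial>M) / c = (\<integral>\<omega>. C' \<omega> * indicator B (X' \<omega>) \<partial>M') / c"
      using m1 m2 by metis
    then show ?thesis using c by simp
  qed
qed

text \<open>
  The weight \<open>1 + Re C\<close> is non-negative, and its transform is obtained from that of
  \<open>C\<close> by conjugation, since \<open>2 * Re C = C + cnj C\<close>.
\<close>

lemma Re_weighted_char_unique:
  fixes X :: "'a \<Rightarrow> real" and X' :: "'b \<Rightarrow> real" and C :: "'a \<Rightarrow> complex" and C' :: "'b \<Rightarrow> complex"
  assumes "prob_space M" "prob_space M'"
    and X: "X \<in> borel_measurable M" and X': "X' \<in> borel_measurable M'"
    and C: "C \<in> borel_measurable M" and C': "C' \<in> borel_measurable M'"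
    and bd: "\<And>\<omega>. norm (C \<omega>) \<le> 1" and bd': "\<And>\<omega>. norm (C' \<omega>) \<le> 1"
    and char: "\<And>v. (\<integral>\<omega>. C \<omega> * iexp (v * X \<omega>) \<partial>M) = (\<integral>\<omega>. C' \<omega> * iexp (v * X' \<omega>) \<partial>M')"
    and char1: "\<And>v. (\<integral>\<omega>. iexp (v * X \<omega>) \<partial>M) = (\<integral>\<omega>. iexp (v * X' \<omega>) \<partial>M')"
    and B: "B \<in> sets borel"
  shows "(\<integral>\<omega>. Re (C \<omega>) * indicator B (X \<omega>) \<partial>M) = (\<integral>\<omega>. Re (C' \<omega>) * indicator B (X' \<omega>) \<partial>M')"
proof -
  interpret M: prob_space M by fact
  interpret M': prob_space M' by fact
  note [measurable] = X X' C C' B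
  have ind: "(\<integral>\<omega>. 1 * (indicator B (X \<omega>) :: real) \<partial>M) = (\<integral>\<omega>. 1 * indicator B (X' \<omega>) \<partial>M')"
    by (rule weighted_char_unique[where K=1 and C="\<lambda>_. 1" and C'="\<lambda>_. 1"]) (use assms in auto)
  have expand: "(\<integral>\<omega>. complex_of_real (1 + Re (D \<omega>)) * iexp (v * Y \<omega>) \<partial>N) =
       (\<integral>\<omega>. iexp (v * Y \<omega>) \<partial>N) + (\<integral>\<omega>. D \<omega> * iexp (v * Y \<omega>) \<partial>N) / 2 + cnj (\<integral>\<omega>. D \<omega> * iexp ((-v) * Y \<omega>) \<partial>N) / 2"
    if "prob_space N" and [measurable]: "Y \<in> borel_measurable N" "D \<in> borel_measurable N" and "\<And>\<omega>. norm (D \<omega>) \<le> 1"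
    for N :: "'c measure" and D Y v
  proof -
    interpret N: prob_space N by fact
    have i1: "integrable N (\<lambda>\<omega>. iexp (v * Y \<omega>))"
      by (rule N.integrable_bounded_complex[where B=1]) auto
    have i2: "integrable N (\<lambda>\<omega>. D \<omega> * iexp (v * Y \<omega>))" for v
      by (rule N.integrable_bounded_complex[where B=1]) (use that(4) in \<open>auto simp: norm_mult\<close>)
    have "complex_of_real (1 + Re z) * w = w + z * w / 2 + cnj (z * cnj w) / 2" for z w
      by (simp add: complex_eq_iff field_simps)
    then have "complex_of_real (1 + Re (D \<omega>)) * iexp (v * Y \<omega>) = iexp (v * Y \<omega>) + D \<omega> * iexp (v * Y \<omega>) / 2 + cnj (D \<omega> * iexp ((-v) * Y \<omega>)) / 2" for \<omega>
      by (metis cis_cnj cis_conv_exp mult_minus_left)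
    then have "(\<integral>\<omega>. complex_of_real (1 + Re (D \<omega>)) * iexp (v * Y \<omega>) \<partial>N) = (\<integral>\<omega>. iexp (v * Y \<omega>) + D \<omega> * iexp (v * Y \<omega>) / 2 + cnj (D \<omega> * iexp ((-v) * Y \<omega>)) / 2 \<partial>N)"
      by simp
    also have "\<dots> = (\<integral>\<omega>. iexp (v * Y \<omega>) \<partial>N) + (\<integral>\<omega>. D \<omega> * iexp (v * Y \<omega>) / 2 \<partial>N) + (\<integral>\<omega>. cnj (D \<omega> * iexp ((-v) * Y \<omega>)) / 2 \<partial>N)"
      using i1 i2[of v] integrable_cnj[OF i2[of "-v"]]
      by (subst Bochner_Integration.integral_add Bochner_Integration.integrable_add; force)+
    finally show ?thesis by (simp del: complex_cnj_mult of_real_mult)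
  qed
  have "(\<integral>\<omega>. (1 + Re (C \<omega>)) * indicator B (X \<omega>) \<partial>M) = (\<integral>\<omega>. (1 + Re (C' \<omega>)) * indicator B (X' \<omega>) \<partial>M')"
  proof (rule weighted_char_unique[where K=2])
    fix v show "(\<integral>\<omega>. complex_of_real (1 + Re (C \<omega>)) * iexp (v * X \<omega>) \<partial>M) = (\<integral>\<omega>. complex_of_real (1 + Re (C' \<omega>)) * iexp (v * X' \<omega>) \<partial>M')"
      by (simp only: expand[OF assms(1) X C bd] expand[OF assms(2) X' C' bd'] char char1)
  next
    fix \<omega> show "0 \<le> 1 + Re (C \<omega>) \<and> 1 + Re (C \<omega>) \<le> 2"
      using abs_Re_le_cmod[of "C \<omega>"] bd[of \<omega>] by linarith
  next
    fix \<omega> show "0 \<le> 1 + Re (C' \<omega>) \<and> 1 + Re (C' \<omega>) \<le> 2"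
      using abs_Re_le_cmod[of "C' \<omega>"] bd'[of \<omega>] by linarith
  qed (use assms in auto)
  moreover have "(\<integral>\<omega>. (1 + Re (D \<omega>)) * indicator B (Y \<omega>) \<partial>N) = (\<integral>\<omega>. 1 * indicator B (Y \<omega>) \<partial>N) + (\<integral>\<omega>. Re (D \<omega>) * indicator B (Y \<omega>) \<partial>N)"
    if "prob_space N" and [measurable]: "Y \<in> borel_measurable N" "D \<in> borel_measurable N" and D: "\<And>\<omega>. norm (D \<omega>) \<le> 1"
    for N :: "'c measure" and D :: "'c \<Rightarrow> complex" and Y
  proof -
    interpret N: prob_space N by fact
    have "integrable N (\<lambda>\<omega>. indicator B (Y \<omega>) :: real)"
      by (rule N.integrable_const_bound[where B=1]) (auto simp: indicator_def)
    moreover have "integrable N (\<lambda>\<omega>. Re (D \<omega>) * indicator B (Y \<omega>) :: real)"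
      by (rule N.integrable_const_bound[where B=1]) (use order_trans[OF abs_Re_le_cmod D] in \<open>auto simp: indicator_def\<close>)
    ultimately show ?thesis by (simp add: ring_distribs)
  qed
  note this[OF assms(1) X C bd] this[OF assms(2) X' C' bd']
  ultimately show ?thesis using ind by simp
qed

lemma complex_weighted_char_unique:
  fixes X :: "'a \<Rightarrow> real" and X' :: "'b \<Rightarrow> real" and C :: "'a \<Rightarrow> complex" and C' :: "'b \<Rightarrow> complex"
  assumes "prob_space M" "prob_space M'"
    and X: "X \<in> borel_measurable M" and X': "X' \<in> borel_measurable M'"
    and C: "C \<in> borel_measurable M" and C': "C' \<in> borel_measurable M'"
    and bd: "\<And>\<omega>. norm (C \<omega>) \<le> 1" and bd': "\<And>\<omega>. norm (C' \<omega>) \<le> 1"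
    and char: "\<And>v. (\<integral>\<omega>. C \<omega> * iexp (v * X \<omega>) \<partial>M) = (\<integral>\<omega>. C' \<omega> * iexp (v * X' \<omega>) \<partial>M')"
    and char1: "\<And>v. (\<integral>\<omega>. iexp (v * X \<omega>) \<partial>M) = (\<integral>\<omega>. iexp (v * X' \<omega>) \<partial>M')"
    and B: "B \<in> sets borel"
  shows "(\<integral>\<omega>. C \<omega> * indicator B (X \<omega>) \<partial>M) = (\<integral>\<omega>. C' \<omega> * indicator B (X' \<omega>) \<partial>M')"
proof -
  interpret M: prob_space M by fact
  interpret M': prob_space M' by fact
  note [measurable] = X X' C C' B
  have i: "integrable M (\<lambda>\<omega>. C \<omega> * indicator B (X \<omega>))"
    by (rule M.integrable_bounded_complex[where B=1]) (use bd in \<open>auto simp: indicator_def\<close>)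
  have i': "integrable M' (\<lambda>\<omega>. C' \<omega> * indicator B (X' \<omega>))"
    by (rule M'.integrable_bounded_complex[where B=1]) (use bd' in \<open>auto simp: indicator_def\<close>)
  have ind: "Re (z * indicator B x) = Re z * indicator B x" "Im (z * indicator B x) = Im z * indicator B x" for z x
    by (auto simp: indicator_def)
  have re: "(\<integral>\<omega>. Re (C \<omega>) * indicator B (X \<omega>) \<partial>M) = (\<integral>\<omega>. Re (C' \<omega>) * indicator B (X' \<omega>) \<partial>M')"
    by (rule Re_weighted_char_unique[OF assms])
  have "(\<integral>\<omega>. Re (- \<i> * C \<omega>) * indicator B (X \<omega>) \<partial>M) = (\<integral>\<omega>. Re (- \<i> * C' \<omega>) * indicator B (X' \<omega>) \<partial>M')"
  proof (rule Re_weighted_char_unique[OF assms(1-4) _ _ _ _ _ char1 B])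
    fix v show "(\<integral>\<omega>. - \<i> * C \<omega> * iexp (v * X \<omega>) \<partial>M) = (\<integral>\<omega>. - \<i> * C' \<omega> * iexp (v * X' \<omega>) \<partial>M')"
      using char[of v] by (simp only: mult.assoc integral_mult_right_zero)
  qed (use bd bd' in \<open>auto simp: norm_mult\<close>)
  then have im: "(\<integral>\<omega>. Im (C \<omega>) * indicator B (X \<omega>) \<partial>M) = (\<integral>\<omega>. Im (C' \<omega>) * indicator B (X' \<omega>) \<partial>M')"
    by simp
  show ?thesis
    by (rule complex_eqI) (simp_all only: integral_Re[OF i, symmetric] integral_Re[OF i', symmetric]
        integral_Im[OF i, symmetric] integral_Im[OF i', symmetric] ind re im)
qed

text \<open>
  Levy uniqueness on the line is applied one coordinate at a time: the exponential factor of one more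
  coordinate is exchanged for an indicator, with the product of the factors already treated as complex
  weight.
\<close>

lemma joint_char_unique:
  fixes X :: "'i \<Rightarrow> 'a \<Rightarrow> real" and X' :: "'i \<Rightarrow> 'b \<Rightarrow> real"
  assumes "prob_space M" "prob_space M'" and I: "finite I"
    and X: "\<And>i. i \<in> I \<Longrightarrow> X i \<in> borel_measurable M" and X': "\<And>i. i \<in> I \<Longrightarrow> X' i \<in> borel_measurable M'"
    and char: "\<And>u :: 'i \<Rightarrow> real. (\<integral>\<omega>. iexp (\<Sum>i\<in>I. u i * X i \<omega>) \<partial>M) = (\<integral>\<omega>. iexp (\<Sum>i\<in>I. u i * X' i \<omega>) \<partial>M')"
    and B: "\<And>i. i \<in> I \<Longrightarrow> B i \<in> sets borel"
  shows "measure M {\<omega>\<in>space M. \<forall>i\<in>I. X i \<omega> \<in> B i} = measure M' {\<omega>\<in>space M'. \<forall>i\<in>I. X' i \<omega> \<in> B i}"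
proof -
  interpret M: prob_space M by fact
  interpret M': prob_space M' by fact
  have single: "(\<integral>\<omega>. iexp (v * X j \<omega>) \<partial>M) = (\<integral>\<omega>. iexp (v * X' j \<omega>) \<partial>M')" if "j \<in> I" for j v
    using char[of "\<lambda>i. if i = j then v else 0"] I that
    by (simp add: if_distrib[of "\<lambda>x. x * _"] sum.delta cong: if_cong)
  have step: "(\<integral>\<omega>. (\<Prod>i\<in>J. indicator (B i) (X i \<omega>)) * iexp (\<Sum>i\<in>I - J. u i * X i \<omega>) \<partial>M) =
        (\<integral>\<omega>. (\<Prod>i\<in>J. indicator (B i) (X' i \<omega>)) * iexp (\<Sum>i\<in>I - J. u i * X' i \<omega>) \<partial>M')"
    if "J \<subseteq> I" for J and u :: "'i \<Rightarrow> real"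
    using finite_subset[OF that I] that
  proof (induction J arbitrary: u rule: finite_subset_induct')
    case empty then show ?case using char by simp
  next
    case (insert j J)
    have eq: "(\<Sum>i\<in>I - J. (u(j := v)) i * Y i \<omega>) = (\<Sum>i\<in>I - insert j J. u i * Y i \<omega>) + v * Y j \<omega>"
      for v \<omega> and Y :: "'i \<Rightarrow> 'c \<Rightarrow> real"
    proof -
      have fin: "finite (I - J)" and j: "j \<in> I - J" using I insert by auto
      have "(\<Sum>i\<in>I - J. (u(j := v)) i * Y i \<omega>) = v * Y j \<omega> + (\<Sum>i\<in>I - J - {j}. (u(j := v)) i * Y i \<omega>)"
        using sum.remove[OF fin j, of "\<lambda>i. (u(j := v)) i * Y i \<omega>"] by simp
      also have "(\<Sum>i\<in>I - J - {j}. (u(j := v)) i * Y i \<omega>) = (\<Sum>i\<in>I - insert j J. u i * Y i \<omega>)"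
        by (intro sum.cong) auto
      finally show ?thesis by simp
    qed
    have "(\<integral>\<omega>. ((\<Prod>i\<in>J. indicator (B i) (X i \<omega>)) * iexp (\<Sum>i\<in>I - insert j J. u i * X i \<omega>)) * indicator (B j) (X j \<omega>) \<partial>M) =
        (\<integral>\<omega>. ((\<Prod>i\<in>J. indicator (B i) (X' i \<omega>)) * iexp (\<Sum>i\<in>I - insert j J. u i * X' i \<omega>)) * indicator (B j) (X' j \<omega>) \<partial>M')"
    proof (rule complex_weighted_char_unique[OF assms(1,2)])
      show "(\<integral>\<omega>. (\<Prod>i\<in>J. indicator (B i) (X i \<omega>)) * iexp (\<Sum>i\<in>I - insert j J. u i * X i \<omega>) * iexp (v * X j \<omega>) \<partial>M) =
        (\<integral>\<omega>. (\<Prod>i\<in>J. indicator (B i) (X' i \<omega>)) * iexp (\<Sum>i\<in>I - insert j J. u i * X' i \<omega>) * iexp (v * X' j \<omega>) \<partial>M')" for v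
        using insert.IH[of "u(j := v)"] unfolding eq by (simp add: exp_add distrib_left mult.assoc)
      have ib: "norm (\<Prod>i\<in>J. indicator (B i) (Y i \<omega>) :: complex) \<le> 1" for Y :: "'i \<Rightarrow> 'c \<Rightarrow> real" and \<omega>
        unfolding prod_norm[symmetric] by (rule prod_le_1) (auto simp: indicator_def)
      show "norm ((\<Prod>i\<in>J. indicator (B i) (X i \<omega>)) * iexp (\<Sum>i\<in>I - insert j J. u i * X i \<omega>)) \<le> 1"
         "norm ((\<Prod>i\<in>J. indicator (B i) (X' i \<omega>')) * iexp (\<Sum>i\<in>I - insert j J. u i * X' i \<omega>')) \<le> 1" for \<omega> \<omega>'
        using ib by (simp_all add: norm_mult)
      have m: "(\<lambda>\<omega>. (\<Prod>i\<in>J. indicator (B i) (Y i \<omega>)) * iexp (\<Sum>i\<in>I - insert j J. u i * Y i \<omega>)) \<in> borel_measurable N"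
        if Y: "\<And>i. i \<in> I \<Longrightarrow> Y i \<in> borel_measurable N" for N :: "'c measure" and Y
      proof -
        have "(\<lambda>\<omega>. indicator (B i) (Y i \<omega>) :: complex) \<in> borel_measurable N" if "i \<in> J" for i
          using Y[of i] B[of i] insert that by (intro borel_measurable_indicator') auto
        moreover have "(\<lambda>\<omega>. \<Sum>i\<in>I - insert j J. u i * Y i \<omega>) \<in> borel_measurable N"
          using Y by (intro borel_measurable_sum borel_measurable_times) auto
        ultimately show ?thesis by measurable
      qed
      show "(\<lambda>\<omega>. (\<Prod>i\<in>J. indicator (B i) (X i \<omega>)) * iexp (\<Sum>i\<in>I - insert j J. u i * X i \<omega>)) \<in> borel_measurable M"
        "(\<lambda>\<omega>. (\<Prod>i\<in>J. indicator (B i) (X' i \<omega>)) * iexp (\<Sum>i\<in>I - insert j J. u i * X' i \<omega>)) \<in> borel_measurable M'"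
        by (intro m X X'; assumption)+
    qed (use insert X X' B single in auto)
    then show ?case using insert by (simp add: mult_ac)
  qed
  have ind: "(\<Prod>i\<in>I. indicator (B i) (Y i \<omega>) :: complex) = of_real (indicator {\<omega>\<in>space N. \<forall>i\<in>I. Y i \<omega> \<in> B i} \<omega>)"
    if "\<omega> \<in> space N" for N :: "'c measure" and Y :: "'i \<Rightarrow> 'c \<Rightarrow> real" and \<omega>
    using that I by (auto simp: indicator_def prod.neutral)
  have meas: "(\<integral>\<omega>. (\<Prod>i\<in>I. indicator (B i) (Y i \<omega>) :: complex) \<partial>N) = of_real (measure N {\<omega>\<in>space N. \<forall>i\<in>I. Y i \<omega> \<in> B i})"
    for N :: "'c measure" and Y :: "'i \<Rightarrow> 'c \<Rightarrow> real"
    using Bochner_Integration.integral_cong[OF refl ind[of _ N Y], where M=N] by (simp add: Int_absorb2)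
  show ?thesis
    using step[of I] meas[of M X] meas[of M' X'] by simp
qed

section \<open>Gaussian increments relative to a filtration\<close>

lemma borel_measurable_cnj [measurable]: "f \<in> borel_measurable M \<Longrightarrow> (\<lambda>x. cnj (f x)) \<in> borel_measurable M"
  by (rule measurable_compose[OF _ borel_measurable_continuous_onI[OF continuous_on_cnj[OF continuous_on_id]]])

text \<open>The part of a complete stochastic basis that determines laws.\<close>

locale stochastic_basis = prob_space M for M :: "'a measure" +
  fixes F :: "real \<Rightarrow> 'a measure"
  assumes filt: "filtration (space M) F" and sub: "\<And>t. subalgebra M (F t)"
begin

lemma space_F: "space (F t) = space M" by (rule filtration.space_F[OF filt])

lemma adapted_mono: "s \<le> t \<Longrightarrow> X \<in> measurable (F s) N \<Longrightarrow> X \<in> measurable (F t) N"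
  using filtration.sets_F_mono[OF filt, of s t]
  by (auto simp: measurable_def space_F)

lemma adapted_M: "X \<in> measurable (F s) N \<Longrightarrow> X \<in> measurable M N"
  by (rule measurable_from_subalg[OF sub])

end

text \<open>
  Increments that are independent of the past and Gaussian with variance \<open>v * (t - s)\<close>,
  expressed by testing against bounded functions of the past. This form passes to sums of independent
  processes and is insensitive to adding a variable of the initial sigma-algebra. The characteristic
  function is required at the point 1 only; other points are reached by scaling \<open>Z\<close>.
\<close>

definition char_increments ::
    "'a measure \<Rightarrow> (real \<Rightarrow> 'a measure) \<Rightarrow> real \<Rightarrow> real \<Rightarrow> (real \<Rightarrow> 'a \<Rightarrow> real) \<Rightarrow> bool" where
  "char_increments M F T v Z \<longleftrightarrow>
     (\<forall>t\<in>{0..T}. Z t \<in> borel_measurable (F t)) \<and>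
     (\<forall>s t C. 0 \<le> s \<and> s < t \<and> t \<le> T \<and> C \<in> borel_measurable (F s) \<and> (\<forall>\<omega>. cmod (C \<omega>) \<le> 1) \<longrightarrow>
        (\<integral>\<omega>. C \<omega> * iexp (Z t \<omega> - Z s \<omega>) \<partial>M) = (\<integral>\<omega>. C \<omega> \<partial>M) * complex_of_real (exp (- (v * (t - s) / 2))))"

lemma (in stochastic_basis) char_increments_bounded:
  assumes Z: "char_increments M F T v Z" and st: "0 \<le> s" "s < t" "t \<le> T"
    and C: "C \<in> borel_measurable (F s)" and K: "\<And>\<omega>. cmod (C \<omega>) \<le> K"
  shows "(\<integral>\<omega>. C \<omega> * iexp (Z t \<omega> - Z s \<omega>) \<partial>M) = (\<integral>\<omega>. C \<omega> \<partial>M) * complex_of_real (exp (- (v * (t - s) / 2)))"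
proof -
  define k where "k = \<bar>K\<bar> + 1"
  have k: "k > 0" "\<And>\<omega>. cmod (C \<omega>) \<le> k"
    using K by (auto simp: k_def intro: order_trans[of _ K])
  have "(\<integral>\<omega>. (C \<omega> / k) * iexp (Z t \<omega> - Z s \<omega>) \<partial>M) = (\<integral>\<omega>. C \<omega> / k \<partial>M) * complex_of_real (exp (- (v * (t - s) / 2)))"
  proof -
    have "(\<lambda>\<omega>. C \<omega> / k) \<in> borel_measurable (F s)" using C by measurable
    moreover have "cmod (C \<omega> / k) \<le> 1" for \<omega> using k by (simp add: norm_divide)
    ultimately show ?thesis using Z st unfolding char_increments_def by blast
  qed
  then have "(\<integral>\<omega>. C \<omega> * iexp (Z t \<omega> - Z s \<omega>) \<partial>M) / k = ((\<integral>\<omega>. C \<omega> \<partial>M) * complex_of_real (exp (- (v * (t - s) / 2)))) / k"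
    by (simp only: times_divide_eq_left integral_divide_zero)
  then show ?thesis using k(1) by simp
qed

lemma (in prob_space) normal_char:
  assumes "distributed M lborel D (normal_density 0 \<sigma>)" and \<sigma>: "0 < \<sigma>"
  shows "(\<integral>\<omega>. iexp (u * D \<omega>) \<partial>M) = complex_of_real (exp (- ((u * \<sigma>)\<^sup>2 / 2)))"
proof -
  have d: "distributed M lborel (\<lambda>\<omega>. (D \<omega> - 0) / \<sigma>) std_normal_density"
    using normal_standard_normal_convert[OF \<sigma>, of D 0] assms(1) by blast
  have [measurable]: "D \<in> borel_measurable M" using distributed_measurable[OF assms(1)] by simp
  have "(\<integral>\<omega>. iexp (u * D \<omega>) \<partial>M) = (\<integral>\<omega>. iexp ((u * \<sigma>) * ((D \<omega> - 0) / \<sigma>)) \<partial>M)"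
    using \<sigma> by (simp add: field_simps)
  also have "\<dots> = (\<integral>x. iexp ((u * \<sigma>) * x) \<partial>distr M lborel (\<lambda>\<omega>. (D \<omega> - 0) / \<sigma>))"
    by (rule integral_distr[symmetric]) auto
  also have "distr M lborel (\<lambda>\<omega>. (D \<omega> - 0) / \<sigma>) = std_normal_distribution"
    by (rule distributed_distr_eq_density[OF d])
  also have "(\<integral>x. iexp ((u * \<sigma>) * x) \<partial>std_normal_distribution) = complex_of_real (exp (- ((u * \<sigma>)\<^sup>2 / 2)))"
    using fun_cong[OF char_std_normal_distribution, of "u * \<sigma>"] by (simp add: char_def del: of_real_exp)
  finally show ?thesis .
qed

lemma (in stochastic_basis) brownian_char_increments:
  assumes W: "brownian_motion M F T W" and \<xi>: "\<xi> \<in> borel_measurable (F 0)"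
  shows "char_increments M F T (u\<^sup>2) (\<lambda>t \<omega>. \<xi> \<omega> + u * W t \<omega>)"
  unfolding char_increments_def
proof (intro conjI ballI allI impI)
  fix t :: real assume "t \<in> {0..T}"
  then have "W t \<in> borel_measurable (F t)" "\<xi> \<in> borel_measurable (F t)"
    using W adapted_mono[OF _ \<xi>, of t] unfolding brownian_motion_def by auto
  then show "(\<lambda>\<omega>. \<xi> \<omega> + u * W t \<omega>) \<in> borel_measurable (F t)" by measurable
next
  fix s t :: real and C :: "'a \<Rightarrow> complex"
  assume *: "0 \<le> s \<and> s < t \<and> t \<le> T \<and> C \<in> borel_measurable (F s) \<and> (\<forall>\<omega>. cmod (C \<omega>) \<le> 1)"
  define D where "D \<omega> = W t \<omega> - W s \<omega>" for \<omega>
  have dist: "distributed M lborel D (normal_density 0 (sqrt (t - s)))"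
    and ind: "indep_set (sets (F s)) (sets (vimage_algebra (space M) D borel))"
    using W * unfolding brownian_motion_def D_def[abs_def] by blast+
  have [measurable]: "D \<in> borel_measurable M" using distributed_measurable[OF dist] by simp
  have [measurable]: "C \<in> borel_measurable M" using adapted_M * by blast
  let ?SC = "sigma_sets (space M) {C -` A \<inter> space M |A. A \<in> sets borel}"
  let ?E = "\<lambda>\<omega>. iexp (u * D \<omega>)" and ?V = "vimage_algebra (space M) D borel"
  let ?SE = "sigma_sets (space M) {?E -` A \<inter> space M |A. A \<in> sets borel}"
  have 1: "?SC \<subseteq> sets (F s)"
    using measurable_sets[of C "F s" borel] *
    by (intro sets.sigma_sets_subset[of _ "F s", simplified space_F]) (auto simp: space_F)
  have "D \<in> measurable ?V borel" by (rule measurable_vimage_algebra1) simp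
  then have E: "?E \<in> borel_measurable ?V" by measurable
  have 2: "?SE \<subseteq> sets ?V"
    using measurable_sets[OF E] by (intro sets.sigma_sets_subset[of _ ?V, simplified]) auto
  have "indep_set ?SC ?SE"
    using ind 1 2 unfolding indep_sets2_eq by blast
  then have iv: "indep_var borel C borel ?E"
    unfolding indep_var_eq by simp
  have "(\<integral>\<omega>. C \<omega> * iexp (u * D \<omega>) \<partial>M) = (\<integral>\<omega>. C \<omega> \<partial>M) * (\<integral>\<omega>. iexp (u * D \<omega>) \<partial>M)"
    by (rule indep_var_lebesgue_integral[OF iv]) (use * in \<open>auto intro!: integrable_bounded_complex[where B=1]\<close>)
  also have "(\<integral>\<omega>. iexp (u * D \<omega>) \<partial>M) = complex_of_real (exp (- (u\<^sup>2 * (t - s) / 2)))"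
    using normal_char[OF dist, of u] * by (simp add: power_mult_distrib del: of_real_exp)
  finally show "(\<integral>\<omega>. C \<omega> * iexp ((\<xi> \<omega> + u * W t \<omega>) - (\<xi> \<omega> + u * W s \<omega>)) \<partial>M) = (\<integral>\<omega>. C \<omega> \<partial>M) * complex_of_real (exp (- (u\<^sup>2 * (t - s) / 2)))"
    by (simp add: D_def right_diff_distrib)
qed

section \<open>Exponential martingales and Levy characterisation\<close>

lemma (in prob_space) norm_integral_le_sqrt:
  fixes X :: "'a \<Rightarrow> complex"
  assumes [measurable]: "X \<in> borel_measurable M" and K: "\<And>\<omega>. cmod (X \<omega>) \<le> K"
  shows "cmod (\<integral>\<omega>. X \<omega> \<partial>M) \<le> sqrt (\<integral>\<omega>. (cmod (X \<omega>))\<^sup>2 \<partial>M)"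
proof (rule real_le_rsqrt)
  have i: "integrable M (\<lambda>\<omega>. cmod (X \<omega>))" by (rule integrable_const_bound[where B=K]) (use K in auto)
  have i2: "integrable M (\<lambda>\<omega>. (cmod (X \<omega>))\<^sup>2)"
    by (rule integrable_const_bound[where B="K\<^sup>2"]) (use power_mono[OF K norm_ge_zero, of _ 2] in auto)
  have "(\<integral>\<omega>. cmod (X \<omega>) \<partial>M)\<^sup>2 \<le> (\<integral>\<omega>. (cmod (X \<omega>))\<^sup>2 \<partial>M)"
    using variance_eq[OF i i2] variance_positive[of "\<lambda>\<omega>. cmod (X \<omega>)"] by linarith
  moreover have "(cmod (\<integral>\<omega>. X \<omega> \<partial>M))\<^sup>2 \<le> (\<integral>\<omega>. cmod (X \<omega>) \<partial>M)\<^sup>2"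
    by (intro power_mono integral_norm_bound) auto
  ultimately show "(cmod (\<integral>\<omega>. X \<omega> \<partial>M))\<^sup>2 \<le> (\<integral>\<omega>. (cmod (X \<omega>))\<^sup>2 \<partial>M)" by linarith
qed

text \<open>
  The complex exponential martingale of a process with Gaussian increments, along a path
  \<open>p\<close>: the elapsed time \<open>d = r - s\<close> is a separate argument, so that at grid
  points it is literally \<open>real k * h\<close>.
\<close>

definition exp_martingale :: "real \<Rightarrow> real \<Rightarrow> (real \<Rightarrow> real) \<Rightarrow> real \<Rightarrow> real \<Rightarrow> complex" where
  "exp_martingale v s p r d = iexp (p r - p s) * complex_of_real (exp (v * d / 2))"

lemma norm_exp_martingale: "cmod (exp_martingale v s p r d) = exp (v * d / 2)"
  unfolding exp_martingale_def norm_mult by (simp del: of_real_exp add: norm_exp_i_times)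

context stochastic_basis begin

text \<open>
  Along the grid of mesh \<open>h\<close> the increments of the exponential martingale are orthogonal to
  the past, hence to each other, and have second moments of order \<open>h\<close>.
\<close>

lemma exp_martingale_props:
  fixes h :: real
  assumes Z: "char_increments M F T v Z" and v: "0 \<le> v" and st: "0 \<le> s" "0 < h" "s + real n * h \<le> T"
  defines "x \<equiv> \<lambda>k \<omega>. exp_martingale v s (\<lambda>r. Z r \<omega>) (s + real k * h) (real k * h)"
  defines "dx \<equiv> \<lambda>k \<omega>. x (Suc k) \<omega> - x k \<omega>"
  shows "k \<le> n \<Longrightarrow> x k \<in> borel_measurable (F (s + real k * h))"
    and "k \<le> n \<Longrightarrow> cmod (x k \<omega>) \<le> exp (v * (real n * h) / 2)"
    and "k < n \<Longrightarrow> C \<in> borel_measurable (F (s + real k * h)) \<Longrightarrow> (\<And>\<omega>. cmod (C \<omega>) \<le> K) \<Longrightarrow>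
       (\<integral>\<omega>. C \<omega> * dx k \<omega> \<partial>M) = 0"
    and "k < n \<Longrightarrow> l < n \<Longrightarrow> k \<noteq> l \<Longrightarrow> (\<integral>\<omega>. dx k \<omega> * cnj (dx l \<omega>) \<partial>M) = 0"
    and "k < n \<Longrightarrow> cmod (\<integral>\<omega>. dx k \<omega> * cnj (dx k \<omega>) \<partial>M) \<le> exp (v * (real n * h)) * (v * h)"
proof -
  have time: "s + real k * h \<in> {0..T}" if "k \<le> n" for k
  proof -
    have "real k * h \<le> real n * h" "0 \<le> real k * h" using that st by (auto intro: mult_right_mono)
    then show ?thesis using st unfolding atLeastAtMost_iff by linarith
  qed
  have nx: "cmod (x k \<omega>) = exp (v * (real k * h) / 2)" for k \<omega>
    by (simp add: x_def norm_exp_martingale)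
  have ad: "Z t \<in> borel_measurable (F t)" if "t \<in> {0..T}" for t using Z that by (auto simp: char_increments_def)
  have xm: "x k \<in> borel_measurable (F (s + real l * h))" if "k \<le> l" "l \<le> n" for k l
  proof -
    have "s + real k * h \<le> s + real l * h" using that st by (simp add: mult_right_mono)
    then have [measurable]: "Z (s + real k * h) \<in> borel_measurable (F (s + real l * h))"
      using adapted_mono[OF _ ad[OF time[of k]]] that by auto
    have [measurable]: "Z s \<in> borel_measurable (F (s + real l * h))"
      using adapted_mono[OF _ ad[of s]] time[of 0] st by auto
    show ?thesis unfolding x_def exp_martingale_def by measurable
  qed
  show xm1: "x k \<in> borel_measurable (F (s + real k * h))" if "k \<le> n" for k using xm that by auto
  have xM[measurable]: "x k \<in> borel_measurable M" if "k \<le> n" for k using adapted_M xm1 that by blast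
  show xb: "cmod (x k \<omega>) \<le> exp (v * (real n * h) / 2)" if "k \<le> n" for k \<omega>
    using that v st by (simp add: nx mult_left_mono mult_right_mono divide_right_mono)
  let ?B = "exp (v * (real n * h) / 2)"
  have dm: "dx k \<in> borel_measurable (F (s + real l * h))" if "k < l" "l \<le> n" for k l
    unfolding dx_def using xm[of "Suc k" l] xm[of k l] that by (intro borel_measurable_diff) auto
  have dM: "dx k \<in> borel_measurable M" if "k < n" for k
    using adapted_M[OF dm[of k n]] that by simp
  have db: "cmod (dx k \<omega>) \<le> 2 * ?B" if "k < n" for k \<omega>
    using norm_triangle_ineq4[of "x (Suc k) \<omega>" "x k \<omega>"] xb[of "Suc k" \<omega>] xb[of k \<omega>] that unfolding dx_def by linarith
  have mart: "(\<integral>\<omega>. C \<omega> * dx k \<omega> \<partial>M) = 0"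
    if k: "k < n" and C: "C \<in> borel_measurable (F (s + real k * h))" and K: "\<And>\<omega>. cmod (C \<omega>) \<le> K'" for C K' k
  proof -
    have CM: "C \<in> borel_measurable M" using adapted_M C by blast
    have K0: "0 \<le> K'" using order_trans[OF norm_ge_zero K] .
    have Cx: "cmod (C \<omega> * x k \<omega>) \<le> K' * ?B" for \<omega>
      unfolding norm_mult using K[of \<omega>] xb[of k \<omega>] k K0 by (intro mult_mono) auto
    have Cx': "cmod (C \<omega> * x (Suc k) \<omega>) \<le> K' * ?B" for \<omega>
      unfolding norm_mult using K[of \<omega>] xb[of "Suc k" \<omega>] k K0 by (intro mult_mono) auto
    have i1: "integrable M (\<lambda>\<omega>. C \<omega> * x k \<omega>)"
      by (rule integrable_bounded_complex[OF _ Cx]) (use CM xM[of k] k in auto)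
    have i2: "integrable M (\<lambda>\<omega>. C \<omega> * x (Suc k) \<omega>)"
      by (rule integrable_bounded_complex[OF _ Cx']) (use CM xM[of "Suc k"] k in auto)
    let ?t = "s + real k * h" and ?t' = "s + real (Suc k) * h"
    have e1: "x (Suc k) \<omega> = x k \<omega> * iexp (Z ?t' \<omega> - Z ?t \<omega>) * complex_of_real (exp (v * h / 2))" for \<omega>
    proof -
      have "iexp (Z ?t' \<omega> - Z s \<omega>) = iexp (Z ?t \<omega> - Z s \<omega>) * iexp (Z ?t' \<omega> - Z ?t \<omega>)"
        unfolding exp_add[symmetric] by (rule arg_cong[where f=exp]) (simp add: algebra_simps)
      moreover have "exp (v * (real (Suc k) * h) / 2) = exp (v * (real k * h) / 2) * exp (v * h / 2)"
        unfolding exp_add[symmetric] by (rule arg_cong[where f=exp]) (simp add: algebra_simps add_divide_distrib)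
      ultimately show ?thesis by (simp only: x_def exp_martingale_def of_real_mult mult_ac)
    qed
    have "(\<integral>\<omega>. C \<omega> * x (Suc k) \<omega> \<partial>M) = (\<integral>\<omega>. ((C \<omega> * x k \<omega>) * iexp (Z ?t' \<omega> - Z ?t \<omega>)) * complex_of_real (exp (v * h / 2)) \<partial>M)"
      unfolding e1 by (simp only: mult.assoc)
    also have "\<dots> = (\<integral>\<omega>. (C \<omega> * x k \<omega>) * iexp (Z ?t' \<omega> - Z ?t \<omega>) \<partial>M) * complex_of_real (exp (v * h / 2))"
      by (rule integral_mult_left_zero)
    also have "(\<integral>\<omega>. (C \<omega> * x k \<omega>) * iexp (Z ?t' \<omega> - Z ?t \<omega>) \<partial>M) =
      (\<integral>\<omega>. C \<omega> * x k \<omega> \<partial>M) * complex_of_real (exp (- (v * (?t' - ?t) / 2)))"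
      using time[of k] time[of "Suc k"] k st
      by (intro char_increments_bounded[OF Z _ _ _ _ Cx] borel_measurable_times C xm1) (auto simp: algebra_simps)
    also have "?t' - ?t = h" by (simp add: algebra_simps)
    also have "(\<integral>\<omega>. C \<omega> * x k \<omega> \<partial>M) * complex_of_real (exp (- (v * h / 2))) * complex_of_real (exp (v * h / 2)) = (\<integral>\<omega>. C \<omega> * x k \<omega> \<partial>M)"
      by (simp only: mult.assoc of_real_mult[symmetric] exp_add[symmetric]) simp
    finally have "(\<integral>\<omega>. C \<omega> * x (Suc k) \<omega> \<partial>M) = (\<integral>\<omega>. C \<omega> * x k \<omega> \<partial>M)" .
    then show ?thesis unfolding dx_def using i1 i2 by (simp add: right_diff_distrib)
  qed
  then show "k < n \<Longrightarrow> C \<in> borel_measurable (F (s + real k * h)) \<Longrightarrow> (\<And>\<omega>. cmod (C \<omega>) \<le> K) \<Longrightarrow>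
       (\<integral>\<omega>. C \<omega> * dx k \<omega> \<partial>M) = 0" by blast
  have o1: "(\<integral>\<omega>. cnj (dx l \<omega>) * dx k \<omega> \<partial>M) = 0" if "l < k" "k < n" for k l
  proof (rule mart)
    show "cmod (cnj (dx l \<omega>)) \<le> 2 * ?B" for \<omega> using that db[of l] by simp
  qed (use that dm[of l k] in auto)
  show "(\<integral>\<omega>. dx k \<omega> * cnj (dx l \<omega>) \<partial>M) = 0" if kl: "k < n" "l < n" "k \<noteq> l" for k l
  proof (cases "l < k")
    case True then show ?thesis using o1[of l k] kl by (simp add: mult.commute)
  next
    case False
    then have "(\<integral>\<omega>. cnj (dx k \<omega>) * dx l \<omega> \<partial>M) = 0" using o1[of k l] kl by simp
    then show ?thesis using Bochner_Integration.integral_cnj[of M "\<lambda>\<omega>. cnj (dx k \<omega>) * dx l \<omega>"] by simp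
  qed
  assume k: "k < n"
  have z1: "(\<integral>\<omega>. cnj (x k \<omega>) * dx k \<omega> \<partial>M) = 0"
  proof (rule mart)
    show "cmod (cnj (x k \<omega>)) \<le> ?B" for \<omega> using k xb[of k] by simp
  qed (use k xm1[of k] in auto)
  then have z2: "(\<integral>\<omega>. x k \<omega> * cnj (dx k \<omega>) \<partial>M) = 0"
    using Bochner_Integration.integral_cnj[of M "\<lambda>\<omega>. cnj (x k \<omega>) * dx k \<omega>"] by simp
  have sq: "x j \<omega> * cnj (x j \<omega>) = complex_of_real (exp (v * (real j * h)))" for j \<omega>
  proof -
    have "x j \<omega> * cnj (x j \<omega>) = complex_of_real ((cmod (x j \<omega>))\<^sup>2)" by (simp only: complex_norm_square)
    also have "(cmod (x j \<omega>))\<^sup>2 = exp (v * (real j * h))"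
      unfolding nx power2_eq_square exp_add[symmetric] by simp
    finally show ?thesis .
  qed
  have e: "dx k \<omega> * cnj (dx k \<omega>) = complex_of_real (exp (v * (real (Suc k) * h)) - exp (v * (real k * h))) - cnj (x k \<omega>) * dx k \<omega> - x k \<omega> * cnj (dx k \<omega>)" for \<omega>
    unfolding of_real_diff sq[of _ \<omega>, symmetric] dx_def by (simp add: algebra_simps)
  have bb: "cmod (cnj (x k \<omega>) * dx k \<omega>) \<le> ?B * (2 * ?B)" "cmod (x k \<omega> * cnj (dx k \<omega>)) \<le> ?B * (2 * ?B)" for \<omega>
    unfolding norm_mult complex_mod_cnj using k xb[of k \<omega>] db[of k \<omega>] by (auto intro!: mult_mono)
  have i1: "integrable M (\<lambda>\<omega>. cnj (x k \<omega>) * dx k \<omega>)"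
    by (rule integrable_bounded_complex[OF _ bb(1)]) (use k xM[of k] dM[of k] in auto)
  have i2: "integrable M (\<lambda>\<omega>. x k \<omega> * cnj (dx k \<omega>))"
    by (rule integrable_bounded_complex[OF _ bb(2)]) (use k xM[of k] dM[of k] in auto)
  have "(\<integral>\<omega>. dx k \<omega> * cnj (dx k \<omega>) \<partial>M) = complex_of_real (exp (v * (real (Suc k) * h)) - exp (v * (real k * h)))"
    unfolding e using z1 z2 i1 i2 by (simp add: prob_space del: of_real_diff)
  also have "cmod \<dots> = exp (v * (real (Suc k) * h)) - exp (v * (real k * h))"
    using v st unfolding norm_of_real by (simp add: mult_left_mono)
  also have "\<dots> = exp (v * (real (Suc k) * h)) * (1 - exp (- (v * h)))"
    by (simp add: algebra_simps exp_add[symmetric])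
  also have "\<dots> \<le> exp (v * (real n * h)) * (v * h)"
  proof (intro mult_mono)
    have "real (Suc k) * h \<le> real n * h" using k st by (intro mult_right_mono) auto
    then show "exp (v * (real (Suc k) * h)) \<le> exp (v * (real n * h))" using v by (simp add: mult_left_mono)
    show "1 - exp (- (v * h)) \<le> v * h" using exp_ge_add_one_self[of "-(v * h)"] by linarith
    show "0 \<le> 1 - exp (- (v * h))" using v st by simp
  qed simp
  finally show "cmod (\<integral>\<omega>. dx k \<omega> * cnj (dx k \<omega>) \<partial>M) \<le> exp (v * (real n * h)) * (v * h)" .
qed

end

text \<open>
  Orthogonality of the \<open>x k\<close> removes the mixed terms, so \<open>n\<close> terms of size
  \<open>a * b\<close> remain. For martingale increments \<open>a\<close> and \<open>b\<close> are of
  order \<open>1/n\<close>, which makes the sum of products, a discrete bracket, vanish in the limit.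
\<close>

lemma (in prob_space) second_moment_product_sum:
  fixes x y :: "nat \<Rightarrow> 'a \<Rightarrow> complex"
  assumes x: "\<And>k. k < n \<Longrightarrow> x k \<in> borel_measurable M" "\<And>k \<omega>. k < n \<Longrightarrow> cmod (x k \<omega>) \<le> Kx"
    and y: "\<And>k. k < n \<Longrightarrow> y k \<in> borel_measurable M" "\<And>k \<omega>. k < n \<Longrightarrow> cmod (y k \<omega>) \<le> Ky"
    and ind: "\<And>k l. k < n \<Longrightarrow> l < n \<Longrightarrow> (\<integral>\<omega>. (x k \<omega> * cnj (x l \<omega>)) * (y k \<omega> * cnj (y l \<omega>)) \<partial>M) =
       (\<integral>\<omega>. x k \<omega> * cnj (x l \<omega>) \<partial>M) * (\<integral>\<omega>. y k \<omega> * cnj (y l \<omega>) \<partial>M)"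
    and orth: "\<And>k l. k < n \<Longrightarrow> l < n \<Longrightarrow> k \<noteq> l \<Longrightarrow> (\<integral>\<omega>. x k \<omega> * cnj (x l \<omega>) \<partial>M) = 0"
    and a: "\<And>k. k < n \<Longrightarrow> cmod (\<integral>\<omega>. x k \<omega> * cnj (x k \<omega>) \<partial>M) \<le> a"
    and b: "\<And>k. k < n \<Longrightarrow> cmod (\<integral>\<omega>. y k \<omega> * cnj (y k \<omega>) \<partial>M) \<le> b"
  shows "(\<integral>\<omega>. (cmod (\<Sum>k<n. x k \<omega> * y k \<omega>))\<^sup>2 \<partial>M) \<le> real n * (a * b)"
proof -
  let ?S = "\<lambda>\<omega>. \<Sum>k<n. x k \<omega> * y k \<omega>"
  have int: "integrable M (\<lambda>\<omega>. (x k \<omega> * cnj (x l \<omega>)) * (y k \<omega> * cnj (y l \<omega>)))" if "k < n" "l < n" for k l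
  proof (rule integrable_bounded_complex)
    show "(\<lambda>\<omega>. (x k \<omega> * cnj (x l \<omega>)) * (y k \<omega> * cnj (y l \<omega>))) \<in> borel_measurable M"
      using x(1)[OF that(1)] x(1)[OF that(2)] y(1)[OF that(1)] y(1)[OF that(2)] by measurable
    show "cmod ((x k \<omega> * cnj (x l \<omega>)) * (y k \<omega> * cnj (y l \<omega>))) \<le> (Kx * Kx) * (Ky * Ky)" for \<omega>
      using x(2)[OF that(1), of \<omega>] x(2)[OF that(2), of \<omega>] y(2)[OF that(1), of \<omega>] y(2)[OF that(2), of \<omega>]
        order_trans[OF norm_ge_zero x(2)[OF that(1), of \<omega>]] order_trans[OF norm_ge_zero y(2)[OF that(1), of \<omega>]]
      unfolding norm_mult complex_mod_cnj by (intro mult_mono) auto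
  qed
  have sq: "complex_of_real ((cmod (?S \<omega>))\<^sup>2) = (\<Sum>k<n. \<Sum>l<n. (x k \<omega> * cnj (x l \<omega>)) * (y k \<omega> * cnj (y l \<omega>)))" for \<omega>
    unfolding complex_norm_square cnj_sum sum_product by (simp add: mult_ac)
  have "complex_of_real (\<integral>\<omega>. (cmod (?S \<omega>))\<^sup>2 \<partial>M) = (\<integral>\<omega>. (\<Sum>k<n. \<Sum>l<n. (x k \<omega> * cnj (x l \<omega>)) * (y k \<omega> * cnj (y l \<omega>))) \<partial>M)"
    unfolding sq[symmetric] by (rule integral_complex_of_real[symmetric])
  also have "\<dots> = (\<Sum>k<n. \<Sum>l<n. (\<integral>\<omega>. (x k \<omega> * cnj (x l \<omega>)) * (y k \<omega> * cnj (y l \<omega>)) \<partial>M))"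
    by (subst Bochner_Integration.integral_sum, use int in \<open>auto intro!: sum.cong Bochner_Integration.integral_sum\<close>)
  also have "\<dots> = (\<Sum>k<n. \<Sum>l<n. if l = k then (\<integral>\<omega>. x k \<omega> * cnj (x k \<omega>) \<partial>M) * (\<integral>\<omega>. y k \<omega> * cnj (y k \<omega>) \<partial>M) else 0)"
    by (intro sum.cong) (auto simp: ind orth)
  also have "\<dots> = (\<Sum>k<n. (\<integral>\<omega>. x k \<omega> * cnj (x k \<omega>) \<partial>M) * (\<integral>\<omega>. y k \<omega> * cnj (y k \<omega>) \<partial>M))"
    by (intro sum.cong) auto
  finally have eq: "complex_of_real (\<integral>\<omega>. (cmod (?S \<omega>))\<^sup>2 \<partial>M) = (\<Sum>k<n. (\<integral>\<omega>. x k \<omega> * cnj (x k \<omega>) \<partial>M) * (\<integral>\<omega>. y k \<omega> * cnj (y k \<omega>) \<partial>M))" .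
  have "cmod (\<Sum>k<n. (\<integral>\<omega>. x k \<omega> * cnj (x k \<omega>) \<partial>M) * (\<integral>\<omega>. y k \<omega> * cnj (y k \<omega>) \<partial>M)) \<le> (\<Sum>k<n. a * b)"
    unfolding norm_mult[symmetric]
    using a b by (intro order_trans[OF norm_sum] sum_mono) (auto simp: norm_mult intro!: mult_mono intro: order_trans[OF norm_ge_zero])
  also have "\<dots> = real n * (a * b)" by simp
  finally have "cmod (complex_of_real (\<integral>\<omega>. (cmod (?S \<omega>))\<^sup>2 \<partial>M)) \<le> real n * (a * b)" unfolding eq .
  then show ?thesis unfolding norm_of_real by linarith
qed

lemma measurable_path_on:
  assumes "\<And>t. t \<in> {0..T} \<Longrightarrow> Z t \<in> borel_measurable M"
  shows "path_on T Z \<in> measurable M (path_space T)"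
  unfolding path_on_def[abs_def] path_space_def
  by (rule measurable_restrict) (use assms in auto)

lemma measurable_exp_martingale:
  assumes "s \<in> {0..T}" "r \<in> {0..T}"
  shows "(\<lambda>p. exp_martingale v s p r d) \<in> borel_measurable (path_space T)"
proof -
  note [measurable] = measurable_path_component[OF assms(1)] measurable_path_component[OF assms(2)]
  show ?thesis unfolding exp_martingale_def by measurable
qed

context stochastic_basis begin

text \<open>
  The delicate point is independence of the joint increment from the common past \<open>F s\<close>: the
  processes are independent of each other and each increment is independent of \<open>F s\<close>, but
  joint independence does not follow formally. It holds because the product of the two exponential
  martingales is again a martingale. The product rule leaves only the sum of the products of increments,
  whose mean square tends to \<open>0\<close> with the mesh since independent martingales have vanishing
  bracket.
\<close>

lemma levy_pair:
  assumes A: "char_increments M F T v A" and B: "char_increments M F T v' B"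
    and v: "0 \<le> v" "0 \<le> v'"
    and ind: "indep_var (path_space T) (path_on T A) (path_space T) (path_on T B)"
  shows "char_increments M F T (v + v') (\<lambda>t \<omega>. A t \<omega> + B t \<omega>)"
  unfolding char_increments_def
proof (intro conjI ballI allI impI)
  fix t :: real assume "t \<in> {0..T}"
  then have "A t \<in> borel_measurable (F t)" "B t \<in> borel_measurable (F t)"
    using A B by (auto simp: char_increments_def)
  then show "(\<lambda>\<omega>. A t \<omega> + B t \<omega>) \<in> borel_measurable (F t)" by measurable
next
  fix s t :: real and C :: "'a \<Rightarrow> complex"
  assume "0 \<le> s \<and> s < t \<and> t \<le> T \<and> C \<in> borel_measurable (F s) \<and> (\<forall>\<omega>. cmod (C \<omega>) \<le> 1)"
  then have st: "0 \<le> s" "s < t" "t \<le> T" and C: "C \<in> borel_measurable (F s)" and C1: "\<And>\<omega>. cmod (C \<omega>) \<le> 1" by auto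
  have CM: "C \<in> borel_measurable M" using adapted_M C by blast
  define E where "E = (\<integral>\<omega>. C \<omega> * iexp ((A t \<omega> + B t \<omega>) - (A s \<omega> + B s \<omega>)) \<partial>M)"
  define e where "e = complex_of_real (exp ((v + v') * (t - s) / 2))"
  define K where "K = exp (v * (t - s)) * (v * (t - s)) * (exp (v' * (t - s)) * (v' * (t - s)))"
  have bound: "cmod (E * e - (\<integral>\<omega>. C \<omega> \<partial>M)) \<le> sqrt (K / real n)" if n: "n > 0" for n :: nat
  proof -
    define h where "h = (t - s) / real n"
    have h: "0 < h" "s + real n * h = t" "real n * h = t - s" using n st by (auto simp: h_def)
    have hT: "s + real n * h \<le> T" using h st by simp
    define x where "x k \<omega> = exp_martingale v s (\<lambda>r. A r \<omega>) (s + real k * h) (real k * h)" for k \<omega>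
    define y where "y k \<omega> = exp_martingale v' s (\<lambda>r. B r \<omega>) (s + real k * h) (real k * h)" for k \<omega>
    define dx where "dx k \<omega> = x (Suc k) \<omega> - x k \<omega>" for k \<omega>
    define dy where "dy k \<omega> = y (Suc k) \<omega> - y k \<omega>" for k \<omega>
    note xp = exp_martingale_props[OF A v(1) st(1) h(1) hT, folded x_def, folded dx_def]
    note yp = exp_martingale_props[OF B v(2) st(1) h(1) hT, folded y_def, folded dy_def]
    let ?Bx = "exp (v * (t - s) / 2)" and ?By = "exp (v' * (t - s) / 2)"
    have xm: "x k \<in> borel_measurable (F (s + real k * h))" "x k \<in> borel_measurable M" "cmod (x k \<omega>) \<le> ?Bx" if "k \<le> n" for k \<omega>
      using xp(1)[OF that] adapted_M[OF xp(1)[OF that]] xp(2)[OF that] h by auto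
    have ym: "y k \<in> borel_measurable (F (s + real k * h))" "y k \<in> borel_measurable M" "cmod (y k \<omega>) \<le> ?By" if "k \<le> n" for k \<omega>
      using yp(1)[OF that] adapted_M[OF yp(1)[OF that]] yp(2)[OF that] h by auto
    have dxm: "dx k \<in> borel_measurable M" "cmod (dx k \<omega>) \<le> 2 * ?Bx" if "k < n" for k \<omega>
      using xm(2,3)[of k] xm(2,3)[of "Suc k"] norm_triangle_ineq4[of "x (Suc k) \<omega>" "x k \<omega>"] that unfolding dx_def by (auto, smt (verit))
    have dym: "dy k \<in> borel_measurable M" "cmod (dy k \<omega>) \<le> 2 * ?By" if "k < n" for k \<omega>
      using ym(2,3)[of k] ym(2,3)[of "Suc k"] norm_triangle_ineq4[of "y (Suc k) \<omega>" "y k \<omega>"] that unfolding dy_def by (auto, smt (verit))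
    have time: "s + real k * h \<in> {0..T}" "s \<in> {0..T}" "s \<le> s + real k * h" if "k \<le> n" for k
    proof -
      have "real k * h \<le> real n * h" by (rule mult_right_mono) (use that h in auto)
      moreover have "0 \<le> real k * h" using h by simp
      ultimately show "s + real k * h \<in> {0..T}" "s \<in> {0..T}" "s \<le> s + real k * h" using st h unfolding atLeastAtMost_iff by linarith+
    qed
    have dxp: "dx k \<omega> = (\<lambda>p. exp_martingale v s p (s + real (Suc k) * h) (real (Suc k) * h) - exp_martingale v s p (s + real k * h) (real k * h)) (path_on T A \<omega>)" if "k < n" for k \<omega>
      using time[of k] time[of "Suc k"] that unfolding dx_def x_def exp_martingale_def path_on_def by simp
    have dyp: "dy k \<omega> = (\<lambda>p. exp_martingale v' s p (s + real (Suc k) * h) (real (Suc k) * h) - exp_martingale v' s p (s + real k * h) (real k * h)) (path_on T B \<omega>)" if "k < n" for k \<omega>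
      using time[of k] time[of "Suc k"] that unfolding dy_def y_def exp_martingale_def path_on_def by simp
    have indep: "(\<integral>\<omega>. (dx k \<omega> * cnj (dx l \<omega>)) * (dy k \<omega> * cnj (dy l \<omega>)) \<partial>M) =
       (\<integral>\<omega>. dx k \<omega> * cnj (dx l \<omega>) \<partial>M) * (\<integral>\<omega>. dy k \<omega> * cnj (dy l \<omega>) \<partial>M)" if kl: "k < n" "l < n" for k l
    proof -
      define G where "G v k p = exp_martingale v s p (s + real (Suc k) * h) (real (Suc k) * h) - exp_martingale v s p (s + real k * h) (real k * h)" for v k p
      have Gm: "G v k \<in> borel_measurable (path_space T)" if "k < n" for v k
        unfolding G_def[abs_def] using time[of k] time[of "Suc k"] that by (intro borel_measurable_diff measurable_exp_martingale) auto
      have Gm2: "(\<lambda>p. G v k p * cnj (G v l p)) \<in> borel_measurable (path_space T)" for v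
        using Gm[OF kl(1), of v] Gm[OF kl(2), of v] by measurable
      have "indep_var borel ((\<lambda>p. G v k p * cnj (G v l p)) \<circ> path_on T A) borel ((\<lambda>p. G v' k p * cnj (G v' l p)) \<circ> path_on T B)"
        by (rule indep_var_compose[OF ind Gm2 Gm2])
      then have iv: "indep_var borel (\<lambda>\<omega>. dx k \<omega> * cnj (dx l \<omega>)) borel (\<lambda>\<omega>. dy k \<omega> * cnj (dy l \<omega>))"
        using dxp[OF kl(1)] dxp[OF kl(2)] dyp[OF kl(1)] dyp[OF kl(2)] by (simp add: comp_def G_def)
      show ?thesis
      proof (rule indep_var_lebesgue_integral[OF iv])
        show "integrable M (\<lambda>\<omega>. dx k \<omega> * cnj (dx l \<omega>))"
        proof (rule integrable_bounded_complex)
          show "(\<lambda>\<omega>. dx k \<omega> * cnj (dx l \<omega>)) \<in> borel_measurable M" using dxm(1)[OF kl(1)] dxm(1)[OF kl(2)] by measurable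
          show "cmod (dx k \<omega> * cnj (dx l \<omega>)) \<le> 2 * ?Bx * (2 * ?Bx)" for \<omega>
            unfolding norm_mult complex_mod_cnj by (intro mult_mono dxm(2) kl) auto
        qed
        show "integrable M (\<lambda>\<omega>. dy k \<omega> * cnj (dy l \<omega>))"
        proof (rule integrable_bounded_complex)
          show "(\<lambda>\<omega>. dy k \<omega> * cnj (dy l \<omega>)) \<in> borel_measurable M" using dym(1)[OF kl(1)] dym(1)[OF kl(2)] by measurable
          show "cmod (dy k \<omega> * cnj (dy l \<omega>)) \<le> 2 * ?By * (2 * ?By)" for \<omega>
            unfolding norm_mult complex_mod_cnj by (intro mult_mono dym(2) kl) auto
        qed
      qed
    qed
    let ?S = "\<lambda>\<omega>. \<Sum>k<n. dx k \<omega> * dy k \<omega>"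
    have "(\<integral>\<omega>. (cmod (?S \<omega>))\<^sup>2 \<partial>M) \<le> real n * ((exp (v * (real n * h)) * (v * h)) * (exp (v' * (real n * h)) * (v' * h)))"
      by (rule second_moment_product_sum[OF dxm dym indep xp(4) xp(5) yp(5)])
    also have "\<dots> = K / real n"
      using n unfolding h(3) K_def by (simp add: h_def field_simps)
    finally have S2: "(\<integral>\<omega>. (cmod (?S \<omega>))\<^sup>2 \<partial>M) \<le> K / real n" .
    have Sm: "?S \<in> borel_measurable M" using dxm(1) dym(1) by (intro borel_measurable_sum borel_measurable_times) auto
    have Sb: "cmod (?S \<omega>) \<le> real n * (2 * ?Bx * (2 * ?By))" for \<omega>
    proof -
      have "cmod (?S \<omega>) \<le> (\<Sum>k<n. cmod (dx k \<omega>) * cmod (dy k \<omega>))"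
        unfolding norm_mult[symmetric] by (rule norm_sum)
      also have "\<dots> \<le> (\<Sum>k<n. (2 * ?Bx) * (2 * ?By))"
        by (intro sum_mono mult_mono dxm(2) dym(2)) auto
      finally have "cmod (?S \<omega>) \<le> (\<Sum>k<n. (2 * ?Bx) * (2 * ?By))" .
      then show ?thesis by simp
    qed
    have CxyM: "integrable M (\<lambda>\<omega>. C \<omega> * a \<omega> * b \<omega>)"
      if "a \<in> borel_measurable M" "b \<in> borel_measurable M" "\<And>\<omega>. cmod (a \<omega>) \<le> 2 * ?Bx" "\<And>\<omega>. cmod (b \<omega>) \<le> 2 * ?By" for a b
    proof (rule integrable_bounded_complex)
      show "(\<lambda>\<omega>. C \<omega> * a \<omega> * b \<omega>) \<in> borel_measurable M" using CM that by measurable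
      show "cmod (C \<omega> * a \<omega> * b \<omega>) \<le> 1 * (2 * ?Bx) * (2 * ?By)" for \<omega>
        unfolding norm_mult using C1[of \<omega>] that(3)[of \<omega>] that(4)[of \<omega>] by (intro mult_mono) auto
    qed
    have xb2: "cmod (x k \<omega>) \<le> 2 * ?Bx" "cmod (y k \<omega>) \<le> 2 * ?By" if "k \<le> n" for k \<omega>
      using xm(3)[OF that, of \<omega>] ym(3)[OF that, of \<omega>] by (smt (verit) exp_gt_zero)+
    have step: "(\<integral>\<omega>. C \<omega> * x (Suc k) \<omega> * y (Suc k) \<omega> \<partial>M) - (\<integral>\<omega>. C \<omega> * x k \<omega> * y k \<omega> \<partial>M) = (\<integral>\<omega>. C \<omega> * dx k \<omega> * dy k \<omega> \<partial>M)" if k: "k < n" for k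
    proof -
      have Ck: "C \<in> borel_measurable (F (s + real k * h))" using adapted_mono[OF time(3) C] k by auto
      have "(\<integral>\<omega>. C \<omega> * y k \<omega> * dx k \<omega> \<partial>M) = 0"
      proof (rule xp(3)[OF k])
        show "(\<lambda>\<omega>. C \<omega> * y k \<omega>) \<in> borel_measurable (F (s + real k * h))" using Ck ym(1)[OF less_imp_le[OF k]] by measurable
        show "cmod (C \<omega> * y k \<omega>) \<le> 1 * ?By" for \<omega> unfolding norm_mult using C1[of \<omega>] ym(3)[of k \<omega>] k by (intro mult_mono) auto
      qed
      moreover have "(\<integral>\<omega>. C \<omega> * x k \<omega> * dy k \<omega> \<partial>M) = 0"
      proof (rule yp(3)[OF k])
        show "(\<lambda>\<omega>. C \<omega> * x k \<omega>) \<in> borel_measurable (F (s + real k * h))" using Ck xm(1)[OF less_imp_le[OF k]] by measurable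
        show "cmod (C \<omega> * x k \<omega>) \<le> 1 * ?Bx" for \<omega> unfolding norm_mult using C1[of \<omega>] xm(3)[of k \<omega>] k by (intro mult_mono) auto
      qed
      moreover have "C \<omega> * x (Suc k) \<omega> * y (Suc k) \<omega> = C \<omega> * x k \<omega> * y k \<omega> + C \<omega> * dx k \<omega> * y k \<omega> + C \<omega> * x k \<omega> * dy k \<omega> + C \<omega> * dx k \<omega> * dy k \<omega>" for \<omega>
        by (simp add: dx_def dy_def algebra_simps)
      moreover have "integrable M (\<lambda>\<omega>. C \<omega> * x k \<omega> * y k \<omega>)" "integrable M (\<lambda>\<omega>. C \<omega> * dx k \<omega> * y k \<omega>)"
         "integrable M (\<lambda>\<omega>. C \<omega> * x k \<omega> * dy k \<omega>)" "integrable M (\<lambda>\<omega>. C \<omega> * dx k \<omega> * dy k \<omega>)"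
        by (rule CxyM; use k xm(2) ym(2) dxm dym xb2 in auto)+
      ultimately show ?thesis by (simp add: mult_ac)
    qed
    have "(\<integral>\<omega>. C \<omega> * x n \<omega> * y n \<omega> \<partial>M) - (\<integral>\<omega>. C \<omega> * x 0 \<omega> * y 0 \<omega> \<partial>M) = (\<Sum>k<n. (\<integral>\<omega>. C \<omega> * dx k \<omega> * dy k \<omega> \<partial>M))"
      using sum_lessThan_telescope[of "\<lambda>k. \<integral>\<omega>. C \<omega> * x k \<omega> * y k \<omega> \<partial>M" n] step by simp
    also have "\<dots> = (\<integral>\<omega>. (\<Sum>k<n. C \<omega> * dx k \<omega> * dy k \<omega>) \<partial>M)"
      by (rule Bochner_Integration.integral_sum[symmetric]) (rule CxyM, use dxm dym in auto)
    also have "\<dots> = (\<integral>\<omega>. C \<omega> * ?S \<omega> \<partial>M)" by (simp add: sum_distrib_left mult.assoc)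
    finally have "cmod ((\<integral>\<omega>. C \<omega> * x n \<omega> * y n \<omega> \<partial>M) - (\<integral>\<omega>. C \<omega> * x 0 \<omega> * y 0 \<omega> \<partial>M)) = cmod (\<integral>\<omega>. C \<omega> * ?S \<omega> \<partial>M)" by simp
    also have "\<dots> \<le> sqrt (\<integral>\<omega>. (cmod (C \<omega> * ?S \<omega>))\<^sup>2 \<partial>M)"
    proof (rule norm_integral_le_sqrt)
      show "(\<lambda>\<omega>. C \<omega> * ?S \<omega>) \<in> borel_measurable M" using CM Sm by measurable
      show "cmod (C \<omega> * ?S \<omega>) \<le> 1 * (real n * (2 * ?Bx * (2 * ?By)))" for \<omega>
        unfolding norm_mult[of "C \<omega>"] using C1[of \<omega>] Sb[of \<omega>] by (intro mult_mono) auto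
    qed
    also have "\<dots> \<le> sqrt (\<integral>\<omega>. (cmod (?S \<omega>))\<^sup>2 \<partial>M)"
    proof (intro real_sqrt_le_mono integral_mono_AE')
      show "integrable M (\<lambda>\<omega>. (cmod (?S \<omega>))\<^sup>2)"
        by (rule integrable_const_bound[where B="(real n * (2 * ?Bx * (2 * ?By)))\<^sup>2"])
          (use Sm power_mono[OF Sb norm_ge_zero, of _ 2] in auto)
      show "AE \<omega> in M. (cmod (C \<omega> * ?S \<omega>))\<^sup>2 \<le> (cmod (?S \<omega>))\<^sup>2"
        using C1 by (intro AE_I2 power_mono) (auto simp: norm_mult mult_left_le_one_le)
    qed auto
    also have "\<dots> \<le> sqrt (K / real n)" using S2 by simp
    finally have fin: "cmod ((\<integral>\<omega>. C \<omega> * x n \<omega> * y n \<omega> \<partial>M) - (\<integral>\<omega>. C \<omega> * x 0 \<omega> * y 0 \<omega> \<partial>M)) \<le> sqrt (K / real n)" .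
    have "C \<omega> * x n \<omega> * y n \<omega> = (C \<omega> * iexp ((A t \<omega> + B t \<omega>) - (A s \<omega> + B s \<omega>))) * e" for \<omega>
    proof -
      have "iexp ((A t \<omega> + B t \<omega>) - (A s \<omega> + B s \<omega>)) = iexp (A t \<omega> - A s \<omega>) * iexp (B t \<omega> - B s \<omega>)"
        unfolding exp_add[symmetric] by (rule arg_cong[where f=exp]) (simp add: algebra_simps)
      moreover have "exp ((v + v') * (t - s) / 2) = exp (v * (t - s) / 2) * exp (v' * (t - s) / 2)"
        unfolding exp_add[symmetric] by (rule arg_cong[where f=exp]) (simp add: field_simps)
      ultimately show ?thesis
        unfolding x_def y_def exp_martingale_def e_def h(2) unfolding h(3) by (simp only: of_real_mult mult_ac)
    qed
    then have "(\<integral>\<omega>. C \<omega> * x n \<omega> * y n \<omega> \<partial>M) = E * e"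
      unfolding E_def by (simp only: integral_mult_left_zero)
    moreover have "(\<integral>\<omega>. C \<omega> * x 0 \<omega> * y 0 \<omega> \<partial>M) = (\<integral>\<omega>. C \<omega> \<partial>M)"
      by (simp add: x_def y_def exp_martingale_def)
    ultimately show ?thesis using fin by simp
  qed
  have "(\<lambda>n. sqrt (K / real n)) \<longlonglongrightarrow> sqrt 0"
    by (intro tendsto_real_sqrt lim_const_over_n)
  then have "cmod (E * e - (\<integral>\<omega>. C \<omega> \<partial>M)) \<le> sqrt 0"
    by (rule LIMSEQ_le_const) (use bound in \<open>auto intro!: exI[of _ 1]\<close>)
  then have "E * e = (\<integral>\<omega>. C \<omega> \<partial>M)" by simp
  then have "E * (e * complex_of_real (exp (- ((v + v') * (t - s) / 2)))) = (\<integral>\<omega>. C \<omega> \<partial>M) * complex_of_real (exp (- ((v + v') * (t - s) / 2)))"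
    by (simp only: mult.assoc[symmetric])
  moreover have "e * complex_of_real (exp (- ((v + v') * (t - s) / 2))) = 1"
    unfolding e_def of_real_mult[symmetric] exp_add[symmetric] by simp
  ultimately show "(\<integral>\<omega>. C \<omega> * iexp ((A t \<omega> + B t \<omega>) - (A s \<omega> + B s \<omega>)) \<partial>M) = (\<integral>\<omega>. C \<omega> \<partial>M) * complex_of_real (exp (- ((v + v') * (t - s) / 2)))"
    unfolding E_def[symmetric] by simp
qed

end

text \<open>
  The processes \<open>Z j\<close> have jointly Gaussian increments, with covariance
  \<open>v * (t - s)\<close> times the identity matrix, jointly independent of the past. By the
  Cramer-Wold device this is a condition on linear combinations.
\<close>

definition linear_increments ::
    "'a measure \<Rightarrow> (real \<Rightarrow> 'a measure) \<Rightarrow> real \<Rightarrow> real \<Rightarrow> nat set \<Rightarrow> (nat \<Rightarrow> real \<Rightarrow> 'a \<Rightarrow> real) \<Rightarrow> bool" where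
  "linear_increments M F T v I Z \<longleftrightarrow>
     (\<forall>j\<in>I. \<forall>t\<in>{0..T}. Z j t \<in> borel_measurable (F t)) \<and>
     (\<forall>u. char_increments M F T (v * (\<Sum>j\<in>I. (u j)\<^sup>2)) (\<lambda>t \<omega>. \<Sum>j\<in>I. u j * Z j t \<omega>))"

context stochastic_basis begin

lemma char_increments_add_initial:
  assumes Z: "char_increments M F T v Z" and \<xi>: "\<xi> \<in> borel_measurable (F 0)"
  shows "char_increments M F T v (\<lambda>t \<omega>. \<xi> \<omega> + Z t \<omega>)"
  unfolding char_increments_def
proof (intro conjI ballI allI impI)
  fix t :: real assume "t \<in> {0..T}"
  then have "Z t \<in> borel_measurable (F t)" "\<xi> \<in> borel_measurable (F t)"
    using Z adapted_mono[OF _ \<xi>, of t] unfolding char_increments_def by auto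
  then show "(\<lambda>\<omega>. \<xi> \<omega> + Z t \<omega>) \<in> borel_measurable (F t)" by measurable
next
  fix s t :: real and C :: "'a \<Rightarrow> complex"
  assume *: "0 \<le> s \<and> s < t \<and> t \<le> T \<and> C \<in> borel_measurable (F s) \<and> (\<forall>\<omega>. cmod (C \<omega>) \<le> 1)"
  have "\<And>\<omega>. (\<xi> \<omega> + Z t \<omega>) - (\<xi> \<omega> + Z s \<omega>) = Z t \<omega> - Z s \<omega>" by simp
  then show "(\<integral>\<omega>. C \<omega> * iexp ((\<xi> \<omega> + Z t \<omega>) - (\<xi> \<omega> + Z s \<omega>)) \<partial>M) = (\<integral>\<omega>. C \<omega> \<partial>M) * complex_of_real (exp (- (v * (t - s) / 2)))"
    using Z * unfolding char_increments_def by presburger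
qed

text \<open>
  The processes are added one by one. Each step is Levy's characterisation for a sum of two independent
  processes.
\<close>

lemma brownian_linear_increments:
  assumes W: "\<And>j. j \<in> I \<Longrightarrow> brownian_motion M F T (W j)" and I: "finite I"
    and ind: "indep_vars (\<lambda>_. path_space T) (\<lambda>j. path_on T (W j)) I"
    and \<xi>: "\<And>j. j \<in> I \<Longrightarrow> \<xi> j \<in> borel_measurable (F 0)"
  shows "linear_increments M F T (\<sigma>\<^sup>2) I (\<lambda>j t \<omega>. \<xi> j \<omega> + \<sigma> * W j t \<omega>)"
  unfolding linear_increments_def
proof (intro conjI ballI allI)
  fix j and t :: real assume jt: "j \<in> I" "t \<in> {0..T}"
  then have "W j t \<in> borel_measurable (F t)" "\<xi> j \<in> borel_measurable (F t)"
    using W[OF jt(1)] adapted_mono[OF _ \<xi>[OF jt(1)], of t] unfolding brownian_motion_def by auto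
  then show "(\<lambda>\<omega>. \<xi> j \<omega> + \<sigma> * W j t \<omega>) \<in> borel_measurable (F t)" by measurable
next
  fix u :: "nat \<Rightarrow> real"
  have "char_increments M F T (\<Sum>j\<in>J. (u j * \<sigma>)\<^sup>2) (\<lambda>t \<omega>. \<Sum>j\<in>J. (u j * \<sigma>) * W j t \<omega>)" if "J \<subseteq> I" for J
    using finite_subset[OF that I] that
  proof (induction J rule: finite_induct)
    case empty
    then show ?case by (auto simp: char_increments_def)
  next
    case (insert j J)
    have J: "j \<in> I" "J \<subseteq> I" using insert by auto
    have "char_increments M F T ((\<Sum>j\<in>J. (u j * \<sigma>)\<^sup>2) + (u j * \<sigma>)\<^sup>2) (\<lambda>t \<omega>. (\<Sum>j\<in>J. (u j * \<sigma>) * W j t \<omega>) + (u j * \<sigma>) * W j t \<omega>)"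
    proof (rule levy_pair)
      show "char_increments M F T (\<Sum>j\<in>J. (u j * \<sigma>)\<^sup>2) (\<lambda>t \<omega>. \<Sum>j\<in>J. (u j * \<sigma>) * W j t \<omega>)"
        by (rule insert.IH[OF J(2)])
      show "char_increments M F T ((u j * \<sigma>)\<^sup>2) (\<lambda>t \<omega>. (u j * \<sigma>) * W j t \<omega>)"
        using brownian_char_increments[OF W[OF J(1)], of "\<lambda>_. 0" "u j * \<sigma>"] by simp
      show "0 \<le> (\<Sum>j\<in>J. (u j * \<sigma>)\<^sup>2)" "0 \<le> (u j * \<sigma>)\<^sup>2" by (auto intro: sum_nonneg)
      let ?f = "\<lambda>p. \<lambda>t\<in>{0..T}. \<Sum>i\<in>J. (u i * \<sigma>) * p i t" and ?g = "\<lambda>p. \<lambda>t\<in>{0..T}. (u j * \<sigma>) * p j t"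
      have comp: "(\<lambda>p. p i t) \<in> borel_measurable (PiM K (\<lambda>_. path_space T))" if "i \<in> K" "t \<in> {0..T}" for i t and K :: "nat set"
        by (rule measurable_compose[OF measurable_component_singleton[OF that(1)] measurable_path_component[OF that(2)]])
      have f: "?f \<in> measurable (PiM J (\<lambda>_. path_space T)) (path_space T)"
        unfolding path_space_def[of T] by (rule measurable_restrict) (use comp[unfolded path_space_def] in measurable)
      have g: "?g \<in> measurable (PiM {j} (\<lambda>_. path_space T)) (path_space T)"
        unfolding path_space_def[of T] by (rule measurable_restrict) (use comp[unfolded path_space_def] in measurable)
      have "indep_var (path_space T) (?f \<circ> (\<lambda>\<omega>. restrict (\<lambda>i. path_on T (W i) \<omega>) J)) (path_space T) (?g \<circ> (\<lambda>\<omega>. restrict (\<lambda>i. path_on T (W i) \<omega>) {j}))"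
        by (rule indep_var_compose[OF indep_var_restrict[OF ind] f g]) (use insert J in auto)
      moreover have "?f \<circ> (\<lambda>\<omega>. restrict (\<lambda>i. path_on T (W i) \<omega>) J) = path_on T (\<lambda>t \<omega>. \<Sum>j\<in>J. (u j * \<sigma>) * W j t \<omega>)"
        by (auto simp: fun_eq_iff path_on_def intro!: sum.cong)
      moreover have "?g \<circ> (\<lambda>\<omega>. restrict (\<lambda>i. path_on T (W i) \<omega>) {j}) = path_on T (\<lambda>t \<omega>. (u j * \<sigma>) * W j t \<omega>)"
        by (auto simp: fun_eq_iff path_on_def)
      ultimately show "indep_var (path_space T) (path_on T (\<lambda>t \<omega>. \<Sum>j\<in>J. (u j * \<sigma>) * W j t \<omega>)) (path_space T) (path_on T (\<lambda>t \<omega>. (u j * \<sigma>) * W j t \<omega>))"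
        by simp
    qed
    then show ?case using insert by (simp add: add.commute)
  qed
  from this[of I] have "char_increments M F T (\<Sum>j\<in>I. (u j * \<sigma>)\<^sup>2) (\<lambda>t \<omega>. (\<Sum>j\<in>I. u j * \<xi> j \<omega>) + (\<Sum>j\<in>I. (u j * \<sigma>) * W j t \<omega>))"
    using \<xi> by (intro char_increments_add_initial borel_measurable_sum borel_measurable_times) auto
  then show "char_increments M F T (\<sigma>\<^sup>2 * (\<Sum>j\<in>I. (u j)\<^sup>2)) (\<lambda>t \<omega>. \<Sum>j\<in>I. u j * (\<xi> j \<omega> + \<sigma> * W j t \<omega>))"
    by (simp add: sum_distrib_left power_mult_distrib mult_ac distrib_left sum.distrib)
qed

end

section \<open>Law and independence of driving paths\<close>

definition last_time :: "real list \<Rightarrow> real" where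
  "last_time ts = (case ts of [] \<Rightarrow> 0 | s # _ \<Rightarrow> s)"

text \<open>
  The variance contributed by the increments in \<open>\<Sum>t. a t * Z t\<close> for a decreasing list
  of times: the last increment is split off and its coefficient is moved to the preceding time.
\<close>

primrec gauss_form :: "real list \<Rightarrow> (real \<Rightarrow> real) \<Rightarrow> real" where
  "gauss_form [] a = 0"
| "gauss_form (t # ts) a = (a t)\<^sup>2 * (t - last_time ts) + gauss_form ts (a(last_time ts := a (last_time ts) + a t))"

text \<open>
  Conditioning on the past of the last but one time removes the latest increment. Induction removes all
  of them, and only the initial values stay coupled.
\<close>

lemma (in stochastic_basis) char_reduce_initial:
  assumes Z: "linear_increments M F T v I Z" and I: "finite I"
  shows "sorted_wrt (>) ts \<Longrightarrow> set ts \<subseteq> {0<..T} \<Longrightarrow>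
     (\<integral>\<omega>. iexp (\<Sum>j\<in>I. \<Sum>t\<in>insert 0 (set ts). a j t * Z j t \<omega>) \<partial>M) =
     (\<integral>\<omega>. iexp (\<Sum>j\<in>I. (\<Sum>t\<in>insert 0 (set ts). a j t) * Z j 0 \<omega>) \<partial>M) * complex_of_real (exp (- (v / 2) * (\<Sum>j\<in>I. gauss_form ts (a j))))"
proof (induction ts arbitrary: a)
  case Nil then show ?case by simp
next
  case (Cons t ts)
  define s where "s = last_time ts"
  define S where "S = insert 0 (set ts)"
  have s: "s \<in> S" "\<And>r. r \<in> S \<Longrightarrow> r \<le> s" "0 \<le> s" "s < t" "t \<le> T" "t \<notin> S" "finite S"
    using Cons.prems by (cases ts; force simp: s_def S_def last_time_def)+
  define a' where "a' j = (a j)(s := a j s + a j t)" for j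
  have sum_a: "(\<Sum>r\<in>insert t S. a j r * y r) = (\<Sum>r\<in>S. a' j r * y r) + a j t * (y t - y s)" for j and y :: "real \<Rightarrow> real"
  proof -
    have "(\<Sum>r\<in>S. a' j r * y r) = (\<Sum>r\<in>S. a j r * y r + (if r = s then a j t * y s else 0))"
      by (intro sum.cong) (auto simp: a'_def algebra_simps)
    also have "\<dots> = (\<Sum>r\<in>S. a j r * y r) + a j t * y s"
      using s by (simp add: sum.distrib)
    finally show ?thesis using s by (simp add: algebra_simps)
  qed
  have tot: "(\<Sum>r\<in>insert t S. a j r) = (\<Sum>r\<in>S. a' j r)" for j
    using sum_a[of j "\<lambda>_. 1"] by simp
  have meas: "Z j r \<in> borel_measurable (F s)" if "j \<in> I" "r \<in> S" for j r
  proof -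
    have "r \<in> {0..T}" using that Cons.prems s by (auto simp: S_def)
    then show ?thesis using Z that s(2)[OF that(2)] adapted_mono[of r s "Z j r" borel] unfolding linear_increments_def by blast
  qed
  have Cm: "(\<lambda>\<omega>. iexp (\<Sum>j\<in>I. \<Sum>r\<in>S. a' j r * Z j r \<omega>)) \<in> borel_measurable (F s)"
  proof -
    have "(\<lambda>\<omega>. \<Sum>j\<in>I. \<Sum>r\<in>S. a' j r * Z j r \<omega>) \<in> borel_measurable (F s)"
      using meas by (intro borel_measurable_sum borel_measurable_times) auto
    then show ?thesis by measurable
  qed
  have split: "iexp (\<Sum>j\<in>I. \<Sum>r\<in>insert t S. a j r * Z j r \<omega>) =
     iexp (\<Sum>j\<in>I. \<Sum>r\<in>S. a' j r * Z j r \<omega>) * iexp ((\<Sum>j\<in>I. a j t * Z j t \<omega>) - (\<Sum>j\<in>I. a j t * Z j s \<omega>))" for \<omega>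
    unfolding sum_a exp_add[symmetric]
    by (rule arg_cong[where f=exp]) (simp add: sum.distrib sum_subtractf algebra_simps)
  have ch: "char_increments M F T (v * (\<Sum>j\<in>I. (a j t)\<^sup>2)) (\<lambda>r \<omega>. \<Sum>j\<in>I. a j t * Z j r \<omega>)"
    using Z unfolding linear_increments_def by (elim conjE allE[where x="\<lambda>j. a j t"])
  have "(\<integral>\<omega>. iexp (\<Sum>j\<in>I. \<Sum>r\<in>insert t S. a j r * Z j r \<omega>) \<partial>M) =
     (\<integral>\<omega>. iexp (\<Sum>j\<in>I. \<Sum>r\<in>S. a' j r * Z j r \<omega>) \<partial>M) * complex_of_real (exp (- (v * (\<Sum>j\<in>I. (a j t)\<^sup>2) * (t - s) / 2)))"
    unfolding split by (rule char_increments_bounded[OF ch s(3,4,5) Cm, where K=1]) simp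
  also have "(\<integral>\<omega>. iexp (\<Sum>j\<in>I. \<Sum>r\<in>S. a' j r * Z j r \<omega>) \<partial>M) =
    (\<integral>\<omega>. iexp (\<Sum>j\<in>I. (\<Sum>r\<in>insert t S. a j r) * Z j 0 \<omega>) \<partial>M) * complex_of_real (exp (- (v / 2) * (\<Sum>j\<in>I. gauss_form ts (a' j))))"
    unfolding tot unfolding S_def by (rule Cons.IH) (use Cons.prems in auto)
  also have "\<dots> * complex_of_real (exp (- (v * (\<Sum>j\<in>I. (a j t)\<^sup>2) * (t - s) / 2))) =
    (\<integral>\<omega>. iexp (\<Sum>j\<in>I. (\<Sum>r\<in>insert t S. a j r) * Z j 0 \<omega>) \<partial>M) * complex_of_real (exp (- (v / 2) * (\<Sum>j\<in>I. gauss_form (t # ts) (a j))))"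
  proof -
    have "- (v / 2) * (\<Sum>j\<in>I. gauss_form (t # ts) (a j)) = - (v / 2) * (\<Sum>j\<in>I. gauss_form ts (a' j)) + - (v * (\<Sum>j\<in>I. (a j t)\<^sup>2) * (t - s) / 2)"
    proof -
      have "gauss_form (t # ts) (a j) = (a j t)\<^sup>2 * (t - s) + gauss_form ts (a' j)" for j
        by (simp add: a'_def s_def)
      then have "(\<Sum>j\<in>I. gauss_form (t # ts) (a j)) = (\<Sum>j\<in>I. (a j t)\<^sup>2) * (t - s) + (\<Sum>j\<in>I. gauss_form ts (a' j))"
        by (simp only: sum.distrib sum_distrib_right)
      then have e: "(\<Sum>j\<in>I. gauss_form (t # ts) (a j)) = (\<Sum>j\<in>I. (a j t)\<^sup>2) * (t - s) + (\<Sum>j\<in>I. gauss_form ts (a' j))" .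
      show ?thesis unfolding e by (simp add: field_simps)
    qed
    then show ?thesis by (simp only: exp_add of_real_mult mult.assoc)
  qed
  finally show ?case by (simp add: S_def insert_commute)
qed

lemma (in stochastic_basis) char_finite_times:
  assumes Z: "linear_increments M F T v I Z" and I: "finite I" and S: "finite S" "S \<subseteq> {0..T}" "0 \<in> S"
  shows "(\<integral>\<omega>. iexp (\<Sum>j\<in>I. \<Sum>t\<in>S. a j t * Z j t \<omega>) \<partial>M) =
     (\<integral>\<omega>. iexp (\<Sum>j\<in>I. (\<Sum>t\<in>S. a j t) * Z j 0 \<omega>) \<partial>M) *
     complex_of_real (exp (- (v / 2) * (\<Sum>j\<in>I. gauss_form (rev (sorted_list_of_set (S - {0}))) (a j))))"
proof -
  let ?ts = "rev (sorted_list_of_set (S - {0}))"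
  have "sorted_wrt (>) ?ts" by (simp add: sorted_wrt_rev strict_sorted_list_of_set)
  moreover have "set ?ts = S - {0}" using S by simp
  moreover have "set ?ts \<subseteq> {0<..T}" using S by auto
  ultimately show ?thesis
    using char_reduce_initial[OF Z I, of ?ts a] S by (simp add: insert_absorb)
qed

text \<open>
  Finite-dimensional laws generate the law on path space, and their characteristic functions depend on
  the law of \<open>Z 0\<close> only.
\<close>

lemma path_law_unique:
  assumes "stochastic_basis M F" "stochastic_basis M' F'"
    and Z: "linear_increments M F T v {0} (\<lambda>_. Z)" and Z': "linear_increments M' F' T v {0} (\<lambda>_. Z')"
    and init: "distr M borel (Z 0) = distr M' borel (Z' 0)" and T: "0 < T"
  shows "distr M (path_space T) (path_on T Z) = distr M' (path_space T) (path_on T Z')"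
proof -
  interpret M: stochastic_basis M F by fact
  interpret M': stochastic_basis M' F' by fact
  have Zm: "Z t \<in> borel_measurable M" if "t \<in> {0..T}" for t
    using Z that M.adapted_M unfolding linear_increments_def by blast
  have Zm': "Z' t \<in> borel_measurable M'" if "t \<in> {0..T}" for t
    using Z' that M'.adapted_M unfolding linear_increments_def by blast
  have Z0: "Z 0 \<in> borel_measurable M" "Z' 0 \<in> borel_measurable M'" using T by (auto intro!: Zm Zm')
  have P: "path_on T Z \<in> measurable M (path_space T)" by (rule measurable_path_on) (rule Zm)
  have P': "path_on T Z' \<in> measurable M' (path_space T)" by (rule measurable_path_on) (rule Zm')
  have char0: "(\<integral>\<omega>. iexp (u * Z 0 \<omega>) \<partial>M) = (\<integral>\<omega>. iexp (u * Z' 0 \<omega>) \<partial>M')" for u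
  proof -
    have "(\<integral>\<omega>. iexp (u * Z 0 \<omega>) \<partial>M) = (\<integral>x. iexp (u * x) \<partial>distr M borel (Z 0))"
      by (rule integral_distr[symmetric]) (use Z0 in auto)
    also have "\<dots> = (\<integral>\<omega>. iexp (u * Z' 0 \<omega>) \<partial>M')"
      unfolding init by (rule integral_distr) (use Z0 in auto)
    finally show ?thesis .
  qed
  have fdd: "measure M {\<omega>\<in>space M. \<forall>t\<in>J. Z t \<omega> \<in> B t} = measure M' {\<omega>\<in>space M'. \<forall>t\<in>J. Z' t \<omega> \<in> B t}"
    if J: "finite J" "J \<subseteq> {0..T}" and B: "\<And>t. t \<in> J \<Longrightarrow> B t \<in> sets borel" for J B
  proof (rule joint_char_unique[OF M.prob_space_axioms M'.prob_space_axioms J(1) _ _ _ B])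
    show "Z t \<in> borel_measurable M" "Z' t \<in> borel_measurable M'" if "t \<in> J" for t
      using that J Zm Zm' by auto
    fix u :: "real \<Rightarrow> real"
    define a where "a t = (if t \<in> J then u t else 0)" for t
    have ins: "(\<Sum>t\<in>J. u t * y t) = (\<Sum>t\<in>insert 0 J. a t * y t)" for y :: "real \<Rightarrow> real"
    proof -
      have "(\<Sum>t\<in>insert 0 J. a t * y t) = (\<Sum>t\<in>J. a t * y t)"
        using J by (intro sum.mono_neutral_right) (auto simp: a_def)
      also have "\<dots> = (\<Sum>t\<in>J. u t * y t)" by (intro sum.cong) (auto simp: a_def)
      finally show ?thesis by simp
    qed
    have S: "finite (insert 0 J)" "insert 0 J \<subseteq> {0..T}" "0 \<in> insert 0 J" using J T by auto
    show "(\<integral>\<omega>. iexp (\<Sum>t\<in>J. u t * Z t \<omega>) \<partial>M) = (\<integral>\<omega>. iexp (\<Sum>t\<in>J. u t * Z' t \<omega>) \<partial>M')"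
      unfolding ins
      using M.char_finite_times[OF Z _ S, of "\<lambda>_. a"] M'.char_finite_times[OF Z' _ S, of "\<lambda>_. a"] char0
      by (simp del: of_real_sum of_real_mult)
  qed
  show ?thesis
  proof (rule measure_eqI_PiM_infinite[where I="{0..T}" and M="\<lambda>_. borel"])
    fix B and J assume J: "finite J" "J \<subseteq> {0..T}" and B: "\<And>i. i \<in> J \<Longrightarrow> B i \<in> sets (borel :: real measure)"
    let ?A = "prod_emb {0..T} (\<lambda>_. borel :: real measure) J (Pi\<^sub>E J B)"
    have A: "?A \<in> sets (path_space T)" unfolding path_space_def using J B by (intro sets_PiM_I) auto
    have pre: "path_on T Y -` ?A \<inter> space N = {\<omega>\<in>space N. \<forall>t\<in>J. Y t \<omega> \<in> B t}" for N :: "'c measure" and Y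
      using J by (auto simp: prod_emb_def path_on_def PiE_iff space_PiM subset_iff)
    show "emeasure (distr M (path_space T) (path_on T Z)) ?A = emeasure (distr M' (path_space T) (path_on T Z')) ?A"
      unfolding emeasure_distr[OF P A] emeasure_distr[OF P' A] pre M.emeasure_eq_measure M'.emeasure_eq_measure
      using fdd[OF J B] by simp
  qed (auto simp: path_space_def intro!: prob_space.finite_measure M.prob_space_distr P[unfolded path_space_def])
qed

text \<open>
  The joint characteristic function is the one of the initial values, which factorises by independence,
  times a Gaussian factor that is already a product over \<open>j\<close>. Comparison with independent
  copies on a product space turns this into independence of the paths.
\<close>

lemma (in stochastic_basis) path_independence:
  assumes Z: "linear_increments M F T v I Z" and I: "finite I" "I \<noteq> {}" and T: "0 < T"
    and init: "indep_vars (\<lambda>_. borel) (\<lambda>j. Z j 0) I"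
  shows "indep_vars (\<lambda>_. path_space T) (\<lambda>j. path_on T (Z j)) I"
proof -
  have Zm: "Z j t \<in> borel_measurable M" if "j \<in> I" "t \<in> {0..T}" for j t
    using Z that adapted_M unfolding linear_increments_def by blast
  have P: "path_on T (Z j) \<in> measurable M (path_space T)" if "j \<in> I" for j
    by (rule measurable_path_on) (rule Zm[OF that])
  have single: "linear_increments M F T v {j} Z" if j: "j \<in> I" for j
    unfolding linear_increments_def
  proof (intro conjI allI)
    show "\<forall>j\<in>{j}. \<forall>t\<in>{0..T}. Z j t \<in> borel_measurable (F t)" using Z j by (auto simp: linear_increments_def)
    fix u :: "nat \<Rightarrow> real"
    define u' where "u' i = (if i = j then u j else 0)" for i
    have "char_increments M F T (v * (\<Sum>j\<in>I. (u' j)\<^sup>2)) (\<lambda>t \<omega>. \<Sum>j\<in>I. u' j * Z j t \<omega>)"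
      using Z unfolding linear_increments_def by blast
    moreover have "(\<Sum>j\<in>I. (u' j)\<^sup>2) = (u j)\<^sup>2" "\<And>t \<omega>. (\<Sum>j\<in>I. u' j * Z j t \<omega>) = u j * Z j t \<omega>"
      using I j by (auto simp: u'_def if_distrib[of "\<lambda>x. x\<^sup>2"] if_distrib[of "\<lambda>x. x * _"] cong: if_cong)
    ultimately show "char_increments M F T (v * (\<Sum>j\<in>{j}. (u j)\<^sup>2)) (\<lambda>t \<omega>. \<Sum>j\<in>{j}. u j * Z j t \<omega>)" by simp
  qed
  have factor: "(\<integral>\<omega>. iexp (\<Sum>j\<in>I. \<Sum>t\<in>S. a j t * Z j t \<omega>) \<partial>M) = (\<Prod>j\<in>I. \<integral>\<omega>. iexp (\<Sum>t\<in>S. a j t * Z j t \<omega>) \<partial>M)"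
    if S: "finite S" "S \<subseteq> {0..T}" "0 \<in> S" for S and a :: "nat \<Rightarrow> real \<Rightarrow> real"
  proof -
    let ?q = "\<lambda>j. gauss_form (rev (sorted_list_of_set (S - {0}))) (a j)" and ?b = "\<lambda>j. \<Sum>t\<in>S. a j t"
    have "(\<integral>\<omega>. iexp (\<Sum>j\<in>I. ?b j * Z j 0 \<omega>) \<partial>M) = (\<integral>\<omega>. (\<Prod>j\<in>I. iexp (?b j * Z j 0 \<omega>)) \<partial>M)"
      by (simp add: exp_sum[OF I(1), symmetric] sum_distrib_left)
    also have "\<dots> = (\<Prod>j\<in>I. \<integral>\<omega>. iexp (?b j * Z j 0 \<omega>) \<partial>M)"
    proof (rule indep_vars_lebesgue_integral[OF I(1)])
      have "indep_vars (\<lambda>_. borel) (\<lambda>j \<omega>. (\<lambda>x. iexp (?b j * x)) (Z j 0 \<omega>)) I"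
        by (rule indep_vars_compose2[OF init]) auto
      then show "indep_vars (\<lambda>_. borel) (\<lambda>j \<omega>. iexp (?b j * Z j 0 \<omega>)) I" by simp
      show "integrable M (\<lambda>\<omega>. iexp (?b j * Z j 0 \<omega>))" if "j \<in> I" for j
      proof (rule integrable_bounded_complex[where B=1])
        have [measurable]: "Z j 0 \<in> borel_measurable M" using Zm[OF that, of 0] T by simp
        show "(\<lambda>\<omega>. iexp (?b j * Z j 0 \<omega>)) \<in> borel_measurable M" by measurable
      qed simp
    qed
    finally have "(\<integral>\<omega>. iexp (\<Sum>j\<in>I. \<Sum>t\<in>S. a j t * Z j t \<omega>) \<partial>M) =
       (\<Prod>j\<in>I. \<integral>\<omega>. iexp (?b j * Z j 0 \<omega>) \<partial>M) * complex_of_real (exp (- (v / 2) * (\<Sum>j\<in>I. ?q j)))"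
      using char_finite_times[OF Z I(1) S, of a] by simp
    also have "complex_of_real (exp (- (v / 2) * (\<Sum>j\<in>I. ?q j))) = (\<Prod>j\<in>I. complex_of_real (exp (- (v / 2) * ?q j)))"
      unfolding sum_distrib_left exp_sum[OF I(1)] by (rule of_real_prod)
    also have "(\<Prod>j\<in>I. \<integral>\<omega>. iexp (?b j * Z j 0 \<omega>) \<partial>M) * \<dots> = (\<Prod>j\<in>I. (\<integral>\<omega>. iexp (?b j * Z j 0 \<omega>) \<partial>M) * complex_of_real (exp (- (v / 2) * ?q j)))"
      by (rule prod.distrib[symmetric])
    also have "\<dots> = (\<Prod>j\<in>I. \<integral>\<omega>. iexp (\<Sum>t\<in>S. a j t * Z j t \<omega>) \<partial>M)"
    proof (rule prod.cong[OF refl])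
      fix j assume "j \<in> I"
      from char_finite_times[OF single[OF this] _ S, of a]
      show "(\<integral>\<omega>. iexp (?b j * Z j 0 \<omega>) \<partial>M) * complex_of_real (exp (- (v / 2) * ?q j)) = (\<integral>\<omega>. iexp (\<Sum>t\<in>S. a j t * Z j t \<omega>) \<partial>M)"
        by simp
    qed
    finally show ?thesis .
  qed
  interpret PM: finite_product_prob_space "\<lambda>_. M" I
    by unfold_locales (rule I(1))
  show ?thesis
  proof (rule indep_vars_finite[OF I(2,1), where E="\<lambda>_. prod_algebra {0..T} (\<lambda>_. borel :: real measure)", THEN iffD2])
    show "sets (path_space T) = sigma_sets (space (path_space T)) (prod_algebra {0..T} (\<lambda>_. borel))"
      unfolding path_space_def sets_PiM space_PiM ..
    show "space (path_space T) \<in> prod_algebra {0..T} (\<lambda>_. borel)"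
      unfolding path_space_def space_PiM by (rule space_in_prod_algebra)
    show "prod_algebra {0..T} (\<lambda>_. borel) \<subseteq> Pow (space (path_space T))"
      unfolding path_space_def space_PiM by (rule prod_algebra_sets_into_space)
    show "Int_stable (prod_algebra {0..T} (\<lambda>_. borel :: real measure))" by (rule Int_stable_prod_algebra)
    show "random_variable (path_space T) (path_on T (Z j))" if "j \<in> I" for j by (rule P[OF that])
    show "\<forall>A\<in>I \<rightarrow> prod_algebra {0..T} (\<lambda>_. borel). prob (\<Inter>j\<in>I. path_on T (Z j) -` A j \<inter> space M) = (\<Prod>j\<in>I. prob (path_on T (Z j) -` A j \<inter> space M))"
    proof
      fix A assume A: "A \<in> I \<rightarrow> prod_algebra {0..T} (\<lambda>_. borel :: real measure)"
      have "\<exists>J E. A j = prod_emb {0..T} (\<lambda>_. borel) J (Pi\<^sub>E J E) \<and> finite J \<and> J \<subseteq> {0..T} \<and> (\<forall>i\<in>J. E i \<in> sets borel)" if "j \<in> I" for j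
      proof -
        have "A j \<in> prod_algebra {0..T} (\<lambda>_. borel :: real measure)" using A that by auto
        then show ?thesis by (rule prod_algebraE) blast
      qed
      then obtain J E where JE: "\<And>j. j \<in> I \<Longrightarrow> A j = prod_emb {0..T} (\<lambda>_. borel) (J j) (Pi\<^sub>E (J j) (E j))"
        "\<And>j. j \<in> I \<Longrightarrow> finite (J j)" "\<And>j. j \<in> I \<Longrightarrow> J j \<subseteq> {0..T}" "\<And>j i. j \<in> I \<Longrightarrow> i \<in> J j \<Longrightarrow> E j i \<in> sets borel"
        by metis
      have pre: "path_on T (Z j) -` A j \<inter> space M = {\<omega>\<in>space M. \<forall>t\<in>J j. Z j t \<omega> \<in> E j t}" if "j \<in> I" for j
        unfolding JE(1)[OF that] using JE(3)[OF that] by (auto simp: prod_emb_def path_on_def PiE_iff space_PiM subset_iff)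
      have preM: "{\<omega>\<in>space M. \<forall>t\<in>J j. Z j t \<omega> \<in> E j t} \<in> events" if j: "j \<in> I" for j
      proof -
        have "A j \<in> sets (path_space T)" unfolding JE(1)[OF j] path_space_def using JE(2-4)[OF j] by (intro sets_PiM_I) auto
        then show ?thesis using measurable_sets[OF P[OF j]] pre[OF j] by metis
      qed
      \<comment> \<open>pairs of a process and a time, as coordinates of one finite-dimensional vector\<close>
      define L where "L = Sigma I J"
      have L: "finite L" unfolding L_def using I JE by auto
      have "prob {\<omega>\<in>space M. \<forall>i\<in>L. Z (fst i) (snd i) \<omega> \<in> E (fst i) (snd i)} =
         measure (PiM I (\<lambda>_. M)) {p\<in>space (PiM I (\<lambda>_. M)). \<forall>i\<in>L. Z (fst i) (snd i) (p (fst i)) \<in> E (fst i) (snd i)}"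
      proof (rule joint_char_unique[OF prob_space_axioms PM.prob_space_axioms L])
        have Lp: "fst i \<in> I" "snd i \<in> {0..T}" if "i \<in> L" for i
          using that subsetD[OF JE(3)[of "fst i"], of "snd i"] by (auto simp: L_def)
        show "Z (fst i) (snd i) \<in> borel_measurable M" if "i \<in> L" for i
          by (rule Zm[OF Lp[OF that]])
        show "(\<lambda>p. Z (fst i) (snd i) (p (fst i))) \<in> borel_measurable (PiM I (\<lambda>_. M))" if "i \<in> L" for i
          by (rule measurable_compose[OF measurable_component_singleton[OF Lp(1)[OF that]] Zm[OF Lp[OF that]]])
        show "E (fst i) (snd i) \<in> sets borel" if "i \<in> L" for i using that JE(4) by (auto simp: L_def)
        fix u :: "nat \<times> real \<Rightarrow> real"
        define S where "S = insert 0 (\<Union>j\<in>I. J j)"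
        have "(\<Union>j\<in>I. J j) \<subseteq> {0..T}" using JE(3) by (rule UN_least)
        then have S: "finite S" "S \<subseteq> {0..T}" "0 \<in> S" using I JE(2) T by (auto simp: S_def simp del: UN_subset_iff)
        define a where "a j t = (if t \<in> J j then u (j, t) else 0)" for j t
        have Lsum: "(\<Sum>i\<in>L. u i * y (fst i) (snd i)) = (\<Sum>j\<in>I. \<Sum>t\<in>S. a j t * y j t)" for y :: "nat \<Rightarrow> real \<Rightarrow> real"
        proof -
          have "(\<Sum>i\<in>L. u i * y (fst i) (snd i)) = (\<Sum>j\<in>I. \<Sum>t\<in>J j. u (j, t) * y j t)"
            unfolding L_def using I JE by (subst sum.Sigma) (auto simp: split_beta)
          also have "\<dots> = (\<Sum>j\<in>I. \<Sum>t\<in>S. a j t * y j t)"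
          proof (rule sum.cong[OF refl])
            fix j assume "j \<in> I"
            then show "(\<Sum>t\<in>J j. u (j, t) * y j t) = (\<Sum>t\<in>S. a j t * y j t)"
              using S by (intro sum.mono_neutral_cong_left) (auto simp: a_def S_def)
          qed
          finally show ?thesis .
        qed
        have "(\<integral>p. iexp (\<Sum>i\<in>L. u i * Z (fst i) (snd i) (p (fst i))) \<partial>PiM I (\<lambda>_. M)) =
           (\<integral>p. (\<Prod>j\<in>I. iexp (\<Sum>t\<in>S. a j t * Z j t (p j))) \<partial>PiM I (\<lambda>_. M))"
          unfolding Lsum[of "\<lambda>j t. Z j t (_ j)"] exp_sum[OF I(1), symmetric] of_real_sum sum_distrib_left ..
        also have "\<dots> = (\<Prod>j\<in>I. \<integral>\<omega>. iexp (\<Sum>t\<in>S. a j t * Z j t \<omega>) \<partial>M)"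
        proof (rule PM.product_integral_prod[OF I(1)])
          show "integrable M (\<lambda>\<omega>. iexp (\<Sum>t\<in>S. a j t * Z j t \<omega>))" if "j \<in> I" for j
          proof (rule integrable_bounded_complex[where B=1])
            have [measurable]: "(\<lambda>\<omega>. \<Sum>t\<in>S. a j t * Z j t \<omega>) \<in> borel_measurable M"
              using Zm[OF that] S by (intro borel_measurable_sum borel_measurable_times) auto
            show "(\<lambda>\<omega>. iexp (\<Sum>t\<in>S. a j t * Z j t \<omega>)) \<in> borel_measurable M" by measurable
          qed simp
        qed
        also have "\<dots> = (\<integral>\<omega>. iexp (\<Sum>i\<in>L. u i * Z (fst i) (snd i) \<omega>) \<partial>M)"
          unfolding Lsum[of "\<lambda>j t. Z j t _"] by (rule factor[OF S, symmetric])
        finally show "(\<integral>\<omega>. iexp (\<Sum>i\<in>L. u i * Z (fst i) (snd i) \<omega>) \<partial>M) = (\<integral>p. iexp (\<Sum>i\<in>L. u i * Z (fst i) (snd i) (p (fst i))) \<partial>PiM I (\<lambda>_. M))" ..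
      qed
      also have "{p\<in>space (PiM I (\<lambda>_. M)). \<forall>i\<in>L. Z (fst i) (snd i) (p (fst i)) \<in> E (fst i) (snd i)} = (\<Pi>\<^sub>E j\<in>I. {\<omega>\<in>space M. \<forall>t\<in>J j. Z j t \<omega> \<in> E j t})"
        by (auto simp: space_PiM L_def PiE_iff extensional_def)
      also have "measure (PiM I (\<lambda>_. M)) \<dots> = (\<Prod>j\<in>I. prob {\<omega>\<in>space M. \<forall>t\<in>J j. Z j t \<omega> \<in> E j t})"
        by (rule PM.prob_times) (rule preM)
      also have "{\<omega>\<in>space M. \<forall>i\<in>L. Z (fst i) (snd i) \<omega> \<in> E (fst i) (snd i)} = (\<Inter>j\<in>I. path_on T (Z j) -` A j \<inter> space M)"
        using I(2) pre by (auto simp: L_def)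
      finally show "prob (\<Inter>j\<in>I. path_on T (Z j) -` A j \<inter> space M) = (\<Prod>j\<in>I. prob (path_on T (Z j) -` A j \<inter> space M))"
        using pre by simp
    qed
  qed
qed

section \<open>Moments of the path weight\<close>

lemma chain_energy_cong:
  assumes "\<And>l i. i \<le> 2 ^ l \<Longrightarrow> b l i = b' l i"
  shows "chain_energy q b = chain_energy q b'"
  unfolding chain_energy_def by (intro suminf_cong sum.cong) (auto simp: assms Suc_leI)

lemma chain_energy_affine:
  "chain_energy q (\<lambda>l i. x + \<sigma> * b l i) = ennreal (\<sigma> ^ (2 * q)) * chain_energy q b"
proof -
  have "(8 / 7) ^ (2 * q * l) * ((x + \<sigma> * b l (Suc i)) - (x + \<sigma> * b l i)) ^ (2 * q) =
     \<sigma> ^ (2 * q) * ((8 / 7) ^ (2 * q * l) * (b l (Suc i) - b l i) ^ (2 * q))" for l i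
    by (simp add: right_diff_distrib[symmetric] power_mult_distrib)
  then have "ennreal ((8 / 7) ^ (2 * q * l) * ((x + \<sigma> * b l (Suc i)) - (x + \<sigma> * b l i)) ^ (2 * q)) =
     ennreal (\<sigma> ^ (2 * q)) * ennreal ((8 / 7) ^ (2 * q * l) * (b l (Suc i) - b l i) ^ (2 * q))" for l i
    by (simp only:) (rule ennreal_mult, auto)
  then show ?thesis
    unfolding chain_energy_def by (simp only: sum_distrib_left[symmetric] ennreal_suminf_cmult)
qed

text \<open>
  The even Gaussian moment of order \<open>2 * q\<close>, summed over the levels of the grid. The ratio
  of consecutive levels is \<open>2 * (64/49)^q * (1/2)^q = 2 * (32/49)^q\<close>.
\<close>

definition gauss_energy :: "nat \<Rightarrow> real \<Rightarrow> real" where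
  "gauss_energy q T = fact (2 * q) / (2 ^ q * fact q) * T ^ q / (1 - 2 * (32 / 49) ^ q)"

text \<open>
  This fails for \<open>q = 1\<close>: second moments of the increments do not give continuity.
\<close>

lemma energy_ratio:
  assumes "2 \<le> q" shows "2 * (32 / 49) ^ q < (1 :: real)"
proof -
  have "(32 / 49) ^ q \<le> (32 / 49 :: real) ^ 2" using assms by (intro power_decreasing) auto
  then show ?thesis by (simp add: power2_eq_square)
qed

lemma (in prob_space) gaussian_chain_energy:
  assumes D: "\<And>l i. i < 2 ^ l \<Longrightarrow> distributed M lborel (\<lambda>\<omega>. b \<omega> l (Suc i) - b \<omega> l i) (normal_density 0 (sqrt (T / 2 ^ l)))"
    and q: "2 \<le> q" and T: "0 < T"
  shows "(\<integral>\<^sup>+\<omega>. chain_energy q (b \<omega>) \<partial>M) \<le> ennreal (gauss_energy q T)"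
proof -
  let ?m = "fact (2 * q) / (2 ^ q * fact q) :: real"
  let ?c = "\<lambda>l. (8 / 7) ^ (2 * q * l) :: real"
  let ?r = "2 * (32 / 49) ^ q :: real"
  have Dm: "(\<lambda>\<omega>. b \<omega> l (Suc i) - b \<omega> l i) \<in> borel_measurable M" if "i < 2 ^ l" for l i
    using distributed_measurable[OF D[OF that]] by simp
  have mom: "(\<integral>\<^sup>+\<omega>. ennreal (?c l * (b \<omega> l (Suc i) - b \<omega> l i) ^ (2 * q)) \<partial>M) = ennreal (?c l * (?m * (T / 2 ^ l) ^ q))"
    if i: "i < 2 ^ l" for l i
  proof -
    have s: "0 < sqrt (T / 2 ^ l)" using T by simp
    have "has_bochner_integral lborel (\<lambda>x. normal_density 0 (sqrt (T / 2 ^ l)) x * (x - 0) ^ (2 * q)) (fact (2 * q) / ((2 / (sqrt (T / 2 ^ l))\<^sup>2)^q * fact q))"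
      by (rule normal_moment_even[OF s])
    also have "(fact (2 * q) / ((2 / (sqrt (T / 2 ^ l))\<^sup>2)^q * fact q)) = ?m * (T / 2 ^ l) ^ q"
      using T by (simp add: power_divide field_simps)
    finally have hb: "has_bochner_integral lborel (\<lambda>x. normal_density 0 (sqrt (T / 2 ^ l)) x * x ^ (2 * q)) (?m * (T / 2 ^ l) ^ q)" by simp
    then have int: "integrable lborel (\<lambda>x. normal_density 0 (sqrt (T / 2 ^ l)) x * x ^ (2 * q))"
      and val: "(LBINT x. normal_density 0 (sqrt (T / 2 ^ l)) x * x ^ (2 * q)) = ?m * (T / 2 ^ l) ^ q"
      by (auto simp: has_bochner_integral_iff)
    have i1: "integrable M (\<lambda>\<omega>. (b \<omega> l (Suc i) - b \<omega> l i) ^ (2 * q))"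
      using distributed_integrable[OF D[OF i], of "\<lambda>x. x ^ (2 * q)"] int by (auto simp: normal_density_nonneg)
    have i2: "(\<integral>\<omega>. (b \<omega> l (Suc i) - b \<omega> l i) ^ (2 * q) \<partial>M) = ?m * (T / 2 ^ l) ^ q"
      using distributed_integral[OF D[OF i], of "\<lambda>x. x ^ (2 * q)"] val by (auto simp: normal_density_nonneg)
    have "(\<integral>\<^sup>+\<omega>. ennreal (?c l * (b \<omega> l (Suc i) - b \<omega> l i) ^ (2 * q)) \<partial>M) = ennreal (\<integral>\<omega>. ?c l * (b \<omega> l (Suc i) - b \<omega> l i) ^ (2 * q) \<partial>M)"
      by (rule nn_integral_eq_integral) (use i1 in auto)
    then show ?thesis using i2 by simp
  qed
  have level_sum: "2 ^ l * (?c l * (?m * (T / 2 ^ l) ^ q)) = ?m * T ^ q * ?r ^ l" for l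
  proof -
    have "(8 / 7 :: real) ^ (2 * q * l) = (64 / 49) ^ (q * l)"
      by (simp add: power_mult power2_eq_square)
    moreover have "(T / 2 ^ l) ^ q = T ^ q * (1 / 2) ^ (q * l)"
      by (simp add: power_divide power_mult[symmetric] mult.commute)
    moreover have "(64 / 49 :: real) ^ (q * l) * (1 / 2) ^ (q * l) = (32 / 49) ^ (q * l)"
      by (simp add: power_mult_distrib[symmetric])
    moreover have "?r ^ l = 2 ^ l * (32 / 49) ^ (q * l)"
      by (simp add: power_mult_distrib power_mult)
    ultimately show ?thesis by (simp add: mult_ac)
  qed
  have r: "0 \<le> ?r" "?r < 1" using energy_ratio[OF q] by auto
  have sums: "(\<lambda>l. ?m * T ^ q * ?r ^ l) sums (?m * T ^ q * (1 / (1 - ?r)))"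
    by (intro sums_mult geometric_sums) (use r in auto)
  have "(\<integral>\<^sup>+\<omega>. chain_energy q (b \<omega>) \<partial>M) = (\<Sum>l. \<Sum>i<2 ^ l. \<integral>\<^sup>+\<omega>. ennreal (?c l * (b \<omega> l (Suc i) - b \<omega> l i) ^ (2 * q)) \<partial>M)"
    unfolding chain_energy_def
    by (subst nn_integral_suminf; (subst nn_integral_sum)?)
      (auto intro!: borel_measurable_sum measurable_compose[OF _ measurable_ennreal] borel_measurable_times borel_measurable_power Dm)
  also have "\<dots> = (\<Sum>l. \<Sum>i<(2::nat) ^ l. ennreal (?c l * (?m * (T / 2 ^ l) ^ q)))"
    by (intro suminf_cong sum.cong) (auto simp: mom)
  also have "\<dots> = (\<Sum>l. ennreal (?m * T ^ q * ?r ^ l))"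
  proof (rule suminf_cong)
    fix l
    have "(\<Sum>i<(2::nat) ^ l. ennreal (?c l * (?m * (T / 2 ^ l) ^ q))) = ennreal (2 ^ l * (?c l * (?m * (T / 2 ^ l) ^ q)))"
      using T by (subst sum_ennreal) auto
    then show "(\<Sum>i<(2::nat) ^ l. ennreal (?c l * (?m * (T / 2 ^ l) ^ q))) = ennreal (?m * T ^ q * ?r ^ l)"
      unfolding level_sum .
  qed
  also have "\<dots> = ennreal (?m * T ^ q * (1 / (1 - ?r)))"
    by (rule suminf_ennreal_eq[OF _ sums]) (use T r in auto)
  finally show ?thesis by (simp add: gauss_energy_def)
qed

lemma path_on_eq: "t \<in> {0..T} \<Longrightarrow> path_on T Z \<omega> t = Z t \<omega>"
  by (simp add: path_on_def)

lemma (in stochastic_basis) brownian_path_regular: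
  fixes \<sigma> :: real
  assumes W: "brownian_motion M F T W" and T: "0 < T" and q: "2 \<le> q" and \<xi>: "\<xi> \<in> borel_measurable (F 0)"
  defines "Z \<equiv> \<lambda>t \<omega>. \<xi> \<omega> + \<sigma> * W t \<omega>"
  shows "(\<integral>\<^sup>+\<omega>. chain_energy q (sample_path T (path_on T Z \<omega>)) \<partial>M) < \<infinity>"
    and "AE \<omega> in M. continuous_on {0..T} (\<lambda>t. Z t \<omega>) \<and> (\<forall>t\<in>{0..T}. regularize q T (path_on T Z \<omega>) t = Z t \<omega>) \<and>
       Z 0 \<omega> = \<xi> \<omega>"
proof -
  have Wm: "W t \<in> borel_measurable M" if "t \<in> {0..T}" for t
    using W that adapted_M unfolding brownian_motion_def by blast
  have \<xi>M: "\<xi> \<in> borel_measurable M" using adapted_M \<xi> by blast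
  have Zm: "Z t \<in> borel_measurable M" if "t \<in> {0..T}" for t
    unfolding Z_def using Wm[OF that] \<xi>M by measurable
  \<comment> \<open>the initial value cancels in the increments\<close>
  have eq: "chain_energy q (sample_path T (path_on T Z \<omega>)) = ennreal (\<sigma> ^ (2 * q)) * chain_energy q (sample_path T (\<lambda>t. W t \<omega>))" for \<omega>
    unfolding chain_energy_affine[where x="\<xi> \<omega>", symmetric]
    by (rule chain_energy_cong) (simp only: sample_path_def path_on_eq[OF sample_path_point[OF T]] Z_def)
  have D: "distributed M lborel (\<lambda>\<omega>. sample_path T (\<lambda>t. W t \<omega>) l (Suc i) - sample_path T (\<lambda>t. W t \<omega>) l i) (normal_density 0 (sqrt (T / 2 ^ l)))"
    if "i < 2 ^ l" for l i
  proof -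
    have pts: "T * real i / 2 ^ l \<in> {0..T}" "T * real (Suc i) / 2 ^ l \<in> {0..T}"
      using sample_path_point[OF T, of i l] sample_path_point[OF T, of "Suc i" l] that by auto
    moreover have "T * real i / 2 ^ l < T * real (Suc i) / 2 ^ l" using T by (simp add: divide_strict_right_mono)
    moreover have "T * real (Suc i) / 2 ^ l - T * real i / 2 ^ l = T / 2 ^ l" by (simp add: field_simps)
    ultimately show ?thesis using W unfolding brownian_motion_def sample_path_def by (metis atLeastAtMost_iff)
  qed
  have m: "(\<lambda>\<omega>. chain_energy q (sample_path T (\<lambda>t. W t \<omega>))) \<in> borel_measurable M"
    by (rule measurable_chain_energy) (unfold sample_path_def, rule Wm[OF sample_path_point[OF T]])
  have "(\<integral>\<^sup>+\<omega>. chain_energy q (sample_path T (path_on T Z \<omega>)) \<partial>M) = ennreal (\<sigma> ^ (2 * q)) * (\<integral>\<^sup>+\<omega>. chain_energy q (sample_path T (\<lambda>t. W t \<omega>)) \<partial>M)"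
    unfolding eq by (rule nn_integral_cmult[OF m])
  also have "\<dots> \<le> ennreal (\<sigma> ^ (2 * q)) * ennreal (gauss_energy q T)"
    by (intro mult_left_mono gaussian_chain_energy D q T) auto
  also have "\<dots> < \<infinity>" by (simp add: ennreal_mult_less_top)
  finally show fin: "(\<integral>\<^sup>+\<omega>. chain_energy q (sample_path T (path_on T Z \<omega>)) \<partial>M) < \<infinity>" .
  have m2: "(\<lambda>\<omega>. chain_energy q (sample_path T (path_on T Z \<omega>))) \<in> borel_measurable M"
    unfolding eq using m by measurable
  have "AE \<omega> in M. chain_energy q (sample_path T (path_on T Z \<omega>)) \<noteq> \<infinity>"
    by (rule nn_integral_PInf_AE[OF m2]) (use fin in auto)
  moreover have "AE \<omega> in M. continuous_on {0..T} (\<lambda>t. W t \<omega>)" "AE \<omega> in M. W 0 \<omega> = 0"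
    using W unfolding brownian_motion_def by auto
  ultimately show "AE \<omega> in M. continuous_on {0..T} (\<lambda>t. Z t \<omega>) \<and> (\<forall>t\<in>{0..T}. regularize q T (path_on T Z \<omega>) t = Z t \<omega>) \<and> Z 0 \<omega> = \<xi> \<omega>"
  proof eventually_elim
    case (elim \<omega>)
    have c: "continuous_on {0..T} (\<lambda>t. Z t \<omega>)" unfolding Z_def by (intro continuous_intros elim)
    then have "continuous_on {0..T} (path_on T Z \<omega>)"
      by (rule continuous_on_eq) (simp add: path_on_eq)
    then have "regularize q T (path_on T Z \<omega>) t = path_on T Z \<omega> t" if "t \<in> {0..T}" for t
      using regularize_eq[OF T _ _ that, of "path_on T Z \<omega>" q] elim by (auto simp: less_top)
    then show ?case using c elim by (auto simp: path_on_eq Z_def)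
  qed
qed

text \<open>
  Linear in the energy, whose root of order \<open>2 * d\<close> occurs in the radius: the power
  \<open>d\<close> costs only the square root of the energy. The constant comes from
  \<open>1 + 2 * x + 16 * y \<le> 19 * max 1 (max x y)\<close>.
\<close>

lemma path_weight_le:
  fixes d :: nat
  assumes d: "2 \<le> d" and fin: "chain_energy d (sample_path T w) < \<infinity>"
  shows "(1 + 2 * path_radius d T w) ^ d \<le> 19 ^ d * (2 + \<bar>w 0\<bar> ^ d + enn2real (chain_energy d (sample_path T w)))"
proof -
  define x where "x = \<bar>w 0\<bar>"
  define E where "E = enn2real (chain_energy d (sample_path T w))"
  define y where "y = root (2 * d) E"
  have E: "0 \<le> E" by (simp add: E_def)
  have x: "0 \<le> x" and y: "0 \<le> y" using E by (auto simp: x_def y_def real_root_ge_zero)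
  have yd: "y ^ d \<le> 1 + E"
  proof -
    have "y ^ (2 * d) = E" unfolding y_def using d E by (intro real_root_pow_pos2) auto
    then have "(y ^ d)\<^sup>2 = E" by (simp add: power_mult[symmetric] mult.commute)
    then have "(y ^ d) * (y ^ d) = E" by (simp add: power2_eq_square)
    moreover have "0 \<le> (y ^ d - 1)\<^sup>2" by simp
    ultimately have "2 * y ^ d \<le> 1 + E"
      by (simp add: power2_eq_square algebra_simps)
    then show ?thesis using zero_le_power[OF y, of d] by linarith
  qed
  define z where "z = max 1 (max x y)"
  have "1 + 2 * path_radius d T w = 1 + 2 * x + 16 * y"
    by (simp add: path_radius_def chain_radius_def sample_path_def x_def y_def E_def)
  also have "\<dots> \<le> 19 * z" by (auto simp: z_def)
  finally have "(1 + 2 * path_radius d T w) ^ d \<le> (19 * z) ^ d"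
    using path_radius_nonneg[of d T w] by (intro power_mono) auto
  also have "\<dots> = 19 ^ d * z ^ d" by (simp add: power_mult_distrib)
  also have "z ^ d \<le> 1 + x ^ d + y ^ d"
    using x y by (auto simp: z_def max_def)
  also have "\<dots> \<le> 2 + x ^ d + E" using yd by simp
  finally show ?thesis by (simp add: x_def E_def)
qed

lemma (in stochastic_basis) path_weight_integrable:
  assumes W: "brownian_motion M F T W" and T: "0 < T" and d: "2 \<le> d" and \<xi>: "\<xi> \<in> borel_measurable (F 0)"
    and mom: "integrable M (\<lambda>\<omega>. \<bar>\<xi> \<omega>\<bar> ^ d)"
  shows "integrable (distr M (path_space T) (path_on T (\<lambda>t \<omega>. \<xi> \<omega> + \<sigma> * W t \<omega>))) (\<lambda>w. (1 + 2 * path_radius d T w) ^ d)"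
proof -
  define Z where "Z t \<omega> = \<xi> \<omega> + \<sigma> * W t \<omega>" for t \<omega>
  have Wm: "W t \<in> borel_measurable M" if "t \<in> {0..T}" for t
    using W that adapted_M unfolding brownian_motion_def by blast
  have \<xi>M: "\<xi> \<in> borel_measurable M" using adapted_M \<xi> by blast
  have Zm: "Z t \<in> borel_measurable M" if "t \<in> {0..T}" for t
    unfolding Z_def using Wm[OF that] \<xi>M by measurable
  have P: "path_on T Z \<in> measurable M (path_space T)" by (rule measurable_path_on) (rule Zm)
  note reg = brownian_path_regular[OF W T d \<xi>, of \<sigma>, folded Z_def]
  have m2: "(\<lambda>\<omega>. chain_energy d (sample_path T (path_on T Z \<omega>))) \<in> borel_measurable M"
    by (rule measurable_chain_energy)
      (unfold sample_path_def, rule measurable_compose[OF P measurable_path_component[OF sample_path_point[OF T]]])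
  have "AE \<omega> in M. chain_energy d (sample_path T (path_on T Z \<omega>)) \<noteq> \<infinity>"
    by (rule nn_integral_PInf_AE[OF m2]) (use reg(1) in auto)
  have intE: "integrable M (\<lambda>\<omega>. enn2real (chain_energy d (sample_path T (path_on T Z \<omega>))))"
  proof (rule integrableI_nonneg)
    have "(\<integral>\<^sup>+\<omega>. ennreal (enn2real (chain_energy d (sample_path T (path_on T Z \<omega>)))) \<partial>M) \<le> (\<integral>\<^sup>+\<omega>. chain_energy d (sample_path T (path_on T Z \<omega>)) \<partial>M)"
      by (intro nn_integral_mono) (simp add: ennreal_enn2real_if)
    then show "(\<integral>\<^sup>+\<omega>. ennreal (enn2real (chain_energy d (sample_path T (path_on T Z \<omega>)))) \<partial>M) < \<infinity>"
      using reg(1) by (rule le_less_trans)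
  qed (use m2 in auto)
  have radm: "path_radius d T \<in> borel_measurable (path_space T)" by (rule measurable_path_radius[OF T])
  have "integrable M (\<lambda>\<omega>. (1 + 2 * path_radius d T (path_on T Z \<omega>)) ^ d)"
  proof (rule Bochner_Integration.integrable_bound)
    show "integrable M (\<lambda>\<omega>. 19 ^ d * (2 + \<bar>\<xi> \<omega>\<bar> ^ d + enn2real (chain_energy d (sample_path T (path_on T Z \<omega>)))))"
      using mom intE by auto
    show "(\<lambda>\<omega>. (1 + 2 * path_radius d T (path_on T Z \<omega>)) ^ d) \<in> borel_measurable M"
      using measurable_compose[OF P radm] by measurable
    show "AE \<omega> in M. norm ((1 + 2 * path_radius d T (path_on T Z \<omega>)) ^ d) \<le> norm (19 ^ d * (2 + \<bar>\<xi> \<omega>\<bar> ^ d + enn2real (chain_energy d (sample_path T (path_on T Z \<omega>)))))"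
      using \<open>AE \<omega> in M. chain_energy d (sample_path T (path_on T Z \<omega>)) \<noteq> \<infinity>\<close> reg(2)
    proof eventually_elim
      case (elim \<omega>)
      have "path_on T Z \<omega> 0 = \<xi> \<omega>" using elim T by (simp add: path_on_eq)
      then show ?case using path_weight_le[OF d, of T "path_on T Z \<omega>"] elim path_radius_nonneg[of d T "path_on T Z \<omega>"]
        by (simp add: less_top)
    qed
  qed
  then show ?thesis unfolding Z_def[abs_def, symmetric]
    using radm by (subst integrable_distr_eq[OF P]) (auto simp: Z_def[abs_def])
qed

section \<open>Construction of Brownian motion\<close>

text \<open>
  The index set is the type of the reals so that the sample space has the type of a path space. Brownian
  motion is built from the coordinates at natural numbers.
\<close>

definition white_noise :: "(real \<Rightarrow> real) measure" where
  "white_noise = PiM UNIV (\<lambda>_. std_normal_distribution)"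

text \<open>
  Brownian motion on the dyadic grid by midpoint displacement: each midpoint is the average of its
  neighbours plus a fresh Gaussian with the conditional standard deviation. The coordinate
  \<open>2 ^ l + i\<close> serves the \<open>i\<close>-th midpoint of level \<open>l\<close>, so all
  coordinates are distinct.
\<close>

primrec levy_grid :: "real \<Rightarrow> (real \<Rightarrow> real) \<Rightarrow> nat \<Rightarrow> nat \<Rightarrow> real" where
  "levy_grid T \<omega> 0 i = sqrt T * \<omega> 0 * real i"
| "levy_grid T \<omega> (Suc l) i = (if even i then levy_grid T \<omega> l (i div 2)
     else (levy_grid T \<omega> l (i div 2) + levy_grid T \<omega> l (Suc (i div 2))) / 2 + sqrt (T / 2 ^ l) / 2 * \<omega> (real (2 ^ l + i div 2)))"

lemma sum_lessThan_double: "(\<Sum>i<2 * n. f i) = (\<Sum>i<n. f (2 * i) + f (Suc (2 * i)))" for f :: "nat \<Rightarrow> real"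
  by (induction n) auto

lemma sum_lessThan_plus: "(\<Sum>i<m + n. f i) = (\<Sum>i<m. f i) + (\<Sum>i<n. f (m + i))" for f :: "nat \<Rightarrow> real"
  by (induction n) auto

text \<open>
  The change of coordinates from white noise to scaled grid increments is orthogonal. This is the
  parallelogram law, level by level.
\<close>

lemma levy_grid_linear:
  assumes "0 \<le> T"
  shows "\<exists>c. (\<forall>\<omega>. (\<Sum>i<2 ^ l. u i * (levy_grid T \<omega> l (Suc i) - levy_grid T \<omega> l i)) = (\<Sum>n<2 ^ l. c n * \<omega> (real n))) \<and>
     (\<Sum>n<2 ^ l. (c n)\<^sup>2) = T / 2 ^ l * (\<Sum>i<2 ^ l. (u i)\<^sup>2)"
proof (induction l arbitrary: u)
  case 0
  show ?case
    by (rule exI[of _ "\<lambda>_. u 0 * sqrt T"]) (use assms in \<open>auto simp: lessThan_Suc power_mult_distrib\<close>)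
next
  case (Suc l)
  let ?k = "sqrt (T / 2 ^ l) / 2"
  obtain c where c: "\<And>\<omega>. (\<Sum>i<2 ^ l. (u (2 * i) + u (Suc (2 * i))) / 2 * (levy_grid T \<omega> l (Suc i) - levy_grid T \<omega> l i)) = (\<Sum>n<2 ^ l. c n * \<omega> (real n))"
    "(\<Sum>n<2 ^ l. (c n)\<^sup>2) = T / 2 ^ l * (\<Sum>i<2 ^ l. ((u (2 * i) + u (Suc (2 * i))) / 2)\<^sup>2)"
    using Suc[of "\<lambda>i. (u (2 * i) + u (Suc (2 * i))) / 2"] by auto
  \<comment> \<open>the old coordinates keep their coefficients, and each new coordinate enters the two halves of an interval with opposite signs\<close>
  define d where "d n = (if n < 2 ^ l then c n else ?k * (u (2 * (n - 2 ^ l)) - u (Suc (2 * (n - 2 ^ l)))))" for n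
  have double: "(2::nat) ^ Suc l = 2 * 2 ^ l" "(2::nat) ^ Suc l = 2 ^ l + 2 ^ l" by auto
  show ?case
  proof (intro exI[of _ d] conjI allI)
    fix \<omega>
    let ?D = "\<lambda>i. levy_grid T \<omega> l (Suc i) - levy_grid T \<omega> l i" and ?z = "\<lambda>i. \<omega> (real (2 ^ l + i))"
    have e1: "levy_grid T \<omega> (Suc l) (Suc (2 * i)) - levy_grid T \<omega> (Suc l) (2 * i) = ?D i / 2 + ?k * ?z i" for i
      by (simp add: field_simps)
    have e2: "levy_grid T \<omega> (Suc l) (Suc (Suc (2 * i))) - levy_grid T \<omega> (Suc l) (Suc (2 * i)) = ?D i / 2 - ?k * ?z i" for i
      by (simp add: field_simps)
    have "(\<Sum>i<2 ^ Suc l. u i * (levy_grid T \<omega> (Suc l) (Suc i) - levy_grid T \<omega> (Suc l) i)) =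
      (\<Sum>i<2 ^ l. u (2 * i) * (?D i / 2 + ?k * ?z i) + u (Suc (2 * i)) * (?D i / 2 - ?k * ?z i))"
      unfolding double(1) sum_lessThan_double e1 e2 ..
    also have "\<dots> = (\<Sum>i<2 ^ l. (u (2 * i) + u (Suc (2 * i))) / 2 * ?D i) + (\<Sum>i<2 ^ l. ?k * (u (2 * i) - u (Suc (2 * i))) * ?z i)"
      unfolding sum.distrib[symmetric] by (intro sum.cong) (auto simp: field_simps)
    also have "\<dots> = (\<Sum>n<2 ^ l. d n * \<omega> (real n)) + (\<Sum>i<2 ^ l. d (2 ^ l + i) * \<omega> (real (2 ^ l + i)))"
      unfolding c(1) by (simp add: d_def)
    also have "\<dots> = (\<Sum>n<2 ^ Suc l. d n * \<omega> (real n))"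
      unfolding double(2) sum_lessThan_plus ..
    finally show "(\<Sum>i<2 ^ Suc l. u i * (levy_grid T \<omega> (Suc l) (Suc i) - levy_grid T \<omega> (Suc l) i)) = (\<Sum>n<2 ^ Suc l. d n * \<omega> (real n))" .
  next
    have k2: "?k\<^sup>2 = T / 2 ^ l / 4" using assms by (simp add: power_divide)
    have "(\<Sum>n<2 ^ Suc l. (d n)\<^sup>2) = (\<Sum>n<2 ^ l. (c n)\<^sup>2) + (\<Sum>i<2 ^ l. (?k * (u (2 * i) - u (Suc (2 * i))))\<^sup>2)"
      unfolding double(2) sum_lessThan_plus by (simp add: d_def)
    also have "\<dots> = (\<Sum>i<2 ^ l. T / 2 ^ l * ((u (2 * i) + u (Suc (2 * i))) / 2)\<^sup>2 + ?k\<^sup>2 * (u (2 * i) - u (Suc (2 * i)))\<^sup>2)"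
      unfolding c(2) sum_distrib_left sum.distrib power_mult_distrib ..
    also have "\<dots> = (\<Sum>i<2 ^ l. T / 2 ^ Suc l * ((u (2 * i))\<^sup>2 + (u (Suc (2 * i)))\<^sup>2))"
      unfolding k2 by (intro sum.cong) (auto simp: power2_eq_square field_simps)
    also have "\<dots> = T / 2 ^ Suc l * (\<Sum>i<2 ^ Suc l. (u i)\<^sup>2)"
      unfolding double(1)[of] sum_lessThan_double sum_distrib_left ..
    finally show "(\<Sum>n<2 ^ Suc l. (d n)\<^sup>2) = T / 2 ^ Suc l * (\<Sum>i<2 ^ Suc l. (u i)\<^sup>2)" .
  qed
qed

lemma sets_std_normal [measurable_cong, simp]: "sets std_normal_distribution = sets borel"
  by simp

lemma measurable_white_noise_component [measurable]: "(\<lambda>\<omega>. \<omega> x) \<in> borel_measurable white_noise"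
  unfolding white_noise_def
  using measurable_component_singleton[of x UNIV "\<lambda>_. std_normal_distribution"] by (simp cong: measurable_cong_sets)

lemma prob_space_white_noise: "prob_space white_noise"
  unfolding white_noise_def by (intro prob_space_PiM prob_space_normal_density) auto

lemma white_noise_char:
  "(\<integral>\<omega>. iexp (\<Sum>n<m. c n * \<omega> (real n)) \<partial>white_noise) = complex_of_real (exp (- (\<Sum>n<m. (c n)\<^sup>2) / 2))"
proof -
  interpret P: product_prob_space "\<lambda>_::real. std_normal_distribution" UNIV
    by (intro product_prob_spaceI prob_space_normal_density) auto
  let ?J = "real ` {..<m}"
  let ?c = "\<lambda>j. c (nat \<lfloor>j\<rfloor>)"
  interpret J: finite_product_prob_space "\<lambda>_::real. std_normal_distribution" ?J by unfold_locales auto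
  have re: "(\<Sum>n<m. c n * \<omega> (real n)) = (\<Sum>j\<in>?J. ?c j * \<omega> j)" for \<omega>
    by (subst sum.reindex) (auto simp: inj_on_def)
  have re2: "(\<Sum>n<m. (c n)\<^sup>2) = (\<Sum>j\<in>?J. (?c j)\<^sup>2)"
    by (subst sum.reindex) (auto simp: inj_on_def)
  have mJ[measurable]: "(\<lambda>p. p j) \<in> borel_measurable (PiM ?J (\<lambda>_. std_normal_distribution))" if "j \<in> ?J" for j
    using measurable_component_singleton[OF that, of "\<lambda>_. std_normal_distribution"] by (simp cong: measurable_cong_sets)
  have "(\<integral>\<omega>. iexp (\<Sum>n<m. c n * \<omega> (real n)) \<partial>white_noise) = (\<integral>\<omega>. iexp (\<Sum>j\<in>?J. ?c j * (restrict \<omega> ?J) j) \<partial>white_noise)"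
    unfolding re by simp
  also have "\<dots> = (\<integral>p. iexp (\<Sum>j\<in>?J. ?c j * p j) \<partial>distr white_noise (PiM ?J (\<lambda>_. std_normal_distribution)) (\<lambda>\<omega>. restrict \<omega> ?J))"
  proof (rule integral_distr[symmetric])
    show "(\<lambda>\<omega>. restrict \<omega> ?J) \<in> measurable white_noise (PiM ?J (\<lambda>_. std_normal_distribution))"
      unfolding white_noise_def by (rule measurable_restrict_subset) auto
    have "(\<lambda>p. \<Sum>j\<in>?J. ?c j * p j) \<in> borel_measurable (PiM ?J (\<lambda>_. std_normal_distribution))"
      using mJ by (intro borel_measurable_sum borel_measurable_times) auto
    then show "(\<lambda>p. iexp (\<Sum>j\<in>?J. ?c j * p j)) \<in> borel_measurable (PiM ?J (\<lambda>_. std_normal_distribution))"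
      by measurable
  qed
  also have "distr white_noise (PiM ?J (\<lambda>_. std_normal_distribution)) (\<lambda>\<omega>. restrict \<omega> ?J) = PiM ?J (\<lambda>_. std_normal_distribution)"
    unfolding white_noise_def by (rule P.distr_PiM_restrict_finite) auto
  also have "(\<integral>p. iexp (\<Sum>j\<in>?J. ?c j * p j) \<partial>PiM ?J (\<lambda>_. std_normal_distribution)) = (\<integral>p. (\<Prod>j\<in>?J. iexp (?c j * p j)) \<partial>PiM ?J (\<lambda>_. std_normal_distribution))"
  proof -
    have "iexp (\<Sum>j\<in>?J. ?c j * p j) = (\<Prod>j\<in>?J. iexp (?c j * p j))" for p
      unfolding of_real_sum sum_distrib_left by (rule exp_sum) simp
    then show ?thesis by simp
  qed
  also have "\<dots> = (\<Prod>j\<in>?J. \<integral>x. iexp (?c j * x) \<partial>std_normal_distribution)"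
  proof (rule P.product_integral_prod)
    have "prob_space std_normal_distribution" by (intro prob_space_normal_density) simp
    then show "integrable std_normal_distribution (\<lambda>x. iexp (?c j * x))" for j
      by (rule prob_space.integrable_bounded_complex[where B=1]) auto
  qed simp
  also have "\<dots> = (\<Prod>j\<in>?J. complex_of_real (exp (- (?c j)\<^sup>2 / 2)))"
    using fun_cong[OF char_std_normal_distribution] unfolding char_def by (intro prod.cong) auto
  also have "\<dots> = complex_of_real (exp (\<Sum>j\<in>?J. - (?c j)\<^sup>2 / 2))"
    by (simp only: exp_sum[of ?J] of_real_prod finite_imageI finite_lessThan)
  also have "(\<Sum>j\<in>?J. - (?c j)\<^sup>2 / 2) = - (\<Sum>n<m. (c n)\<^sup>2) / 2"
    unfolding re2 by (simp add: sum_negf sum_divide_distrib)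
  finally show ?thesis .
qed

lemma levy_grid_char:
  assumes "0 \<le> T"
  shows "(\<integral>\<omega>. iexp (\<Sum>i<2 ^ l. u i * (levy_grid T \<omega> l (Suc i) - levy_grid T \<omega> l i)) \<partial>white_noise) =
     complex_of_real (exp (- (T / 2 ^ l * (\<Sum>i<2 ^ l. (u i)\<^sup>2)) / 2))"
proof -
  obtain c where "\<And>\<omega>. (\<Sum>i<2 ^ l. u i * (levy_grid T \<omega> l (Suc i) - levy_grid T \<omega> l i)) = (\<Sum>n<2 ^ l. c n * \<omega> (real n))"
     "(\<Sum>n<2 ^ l. (c n)\<^sup>2) = T / 2 ^ l * (\<Sum>i<2 ^ l. (u i)\<^sup>2)"
    using levy_grid_linear[OF assms, where l=l and u=u] by auto
  then show ?thesis using white_noise_char[of c "2 ^ l"] by (simp only:)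
qed

lemma measurable_levy_grid [measurable]: "(\<lambda>\<omega>. levy_grid T \<omega> l i) \<in> borel_measurable white_noise"
proof (induction l arbitrary: i)
  case 0 show ?case by simp
next
  case (Suc l)
  note [measurable] = Suc
  show ?case by simp
qed

lemma (in prob_space) char_imp_normal:
  assumes [measurable]: "D \<in> borel_measurable M" and \<sigma>: "0 < \<sigma>"
    and char: "\<And>u. (\<integral>\<omega>. iexp (u * D \<omega>) \<partial>M) = complex_of_real (exp (- ((u * \<sigma>)\<^sup>2 / 2)))"
  shows "distributed M lborel D (normal_density 0 \<sigma>)"
proof -
  have "distr M borel (\<lambda>\<omega>. D \<omega> / \<sigma>) = std_normal_distribution"
  proof (rule Levy_uniqueness)
    show "real_distribution (distr M borel (\<lambda>\<omega>. D \<omega> / \<sigma>))" by (rule real_distribution_distr) simp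
    show "real_distribution std_normal_distribution" by (rule real_dist_normal_dist)
    show "char (distr M borel (\<lambda>\<omega>. D \<omega> / \<sigma>)) = char std_normal_distribution"
    proof
      fix t
      have "char (distr M borel (\<lambda>\<omega>. D \<omega> / \<sigma>)) t = (\<integral>\<omega>. iexp (t * (D \<omega> / \<sigma>)) \<partial>M)"
        unfolding char_def by (rule integral_distr) auto
      also have "\<dots> = (\<integral>\<omega>. iexp ((t / \<sigma>) * D \<omega>) \<partial>M)" by simp
      also have "\<dots> = char std_normal_distribution t"
        unfolding char char_std_normal_distribution using \<sigma> by simp
      finally show "char (distr M borel (\<lambda>\<omega>. D \<omega> / \<sigma>)) t = char std_normal_distribution t" .
    qed
  qed
  then have "distr M lborel (\<lambda>\<omega>. D \<omega> / \<sigma>) = density lborel std_normal_density"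
    by (simp cong: distr_cong)
  then have "distributed M lborel (\<lambda>\<omega>. (D \<omega> - 0) / \<sigma>) std_normal_density"
    unfolding distributed_def by simp
  then show ?thesis using normal_standard_normal_convert[OF \<sigma>, of D 0] by simp
qed

definition wiener :: "real \<Rightarrow> real \<Rightarrow> (real \<Rightarrow> real) \<Rightarrow> real" where
  "wiener T t \<omega> = chain_limit 2 T (levy_grid T \<omega>) t"

lemma levy_grid_0: "levy_grid T \<omega> l 0 = 0"
  by (induction l) auto

lemma wiener_0: "wiener T 0 \<omega> = 0"
proof -
  have "grid_index T l 0 = 0" for l by (simp add: grid_index_def)
  then show ?thesis by (simp add: wiener_def chain_limit_def levy_grid_0)
qed

lemma wiener_continuous: "0 < T \<Longrightarrow> continuous_on {0..T} (\<lambda>t. wiener T t \<omega>)"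
proof (cases "chain_energy 2 (levy_grid T \<omega>) < \<infinity>")
  case True
  assume T: "0 < T"
  interpret dyadic_chain 2 T "levy_grid T \<omega>"
    by unfold_locales (use T True in auto)
  show ?thesis unfolding wiener_def using continuous .
next
  case False
  then show ?thesis by (simp add: wiener_def chain_limit_def)
qed

lemma measurable_wiener: "0 < T \<Longrightarrow> t \<in> {0..T} \<Longrightarrow> wiener T t \<in> borel_measurable white_noise"
  unfolding wiener_def[abs_def] by (rule measurable_chain_limit) auto

lemma wiener_approx:
  assumes T: "0 < T"
  shows "AE \<omega> in white_noise. \<forall>t\<in>{0..T}. (\<lambda>l. levy_grid T \<omega> l (grid_index T l t)) \<longlonglongrightarrow> wiener T t \<omega>"
proof -
  interpret prob_space white_noise by (rule prob_space_white_noise)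
  have D: "distributed white_noise lborel (\<lambda>\<omega>. levy_grid T \<omega> l (Suc i) - levy_grid T \<omega> l i) (normal_density 0 (sqrt (T / 2 ^ l)))"
    if i: "i < 2 ^ l" for l i
  proof (rule char_imp_normal)
    fix u
    have "(\<Sum>k<2 ^ l. (if k = i then u else 0) * y k) = u * y i" "(\<Sum>k<2 ^ l. (if k = i then u else 0)\<^sup>2) = u\<^sup>2" for y :: "nat \<Rightarrow> real"
      using i by (auto simp: if_distrib[of "\<lambda>x. x * _"] if_distrib[of "\<lambda>x. x\<^sup>2"] cong: if_cong)
    note single = this
    have "T / 2 ^ l * u\<^sup>2 = (u * sqrt (T / 2 ^ l))\<^sup>2" using T by (simp add: power_mult_distrib)
    then show "(\<integral>\<omega>. iexp (u * (levy_grid T \<omega> l (Suc i) - levy_grid T \<omega> l i)) \<partial>white_noise) = complex_of_real (exp (- ((u * sqrt (T / 2 ^ l))\<^sup>2 / 2)))"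
      using levy_grid_char[where T=T and l=l and u="\<lambda>k. if k = i then u else 0", unfolded single] T
      by (simp only: less_imp_le minus_divide_left)
  qed (use T in auto)
  have "(\<integral>\<^sup>+\<omega>. chain_energy 2 (levy_grid T \<omega>) \<partial>white_noise) \<le> ennreal (gauss_energy 2 T)"
    by (rule gaussian_chain_energy[where b="\<lambda>\<omega>. levy_grid T \<omega>"]) (use D T in auto)
  then have "AE \<omega> in white_noise. chain_energy 2 (levy_grid T \<omega>) \<noteq> \<infinity>"
    by (intro nn_integral_PInf_AE measurable_chain_energy) (auto simp: top_unique)
  then show ?thesis
  proof eventually_elim
    case (elim \<omega>)
    interpret dyadic_chain 2 T "levy_grid T \<omega>"
      by unfold_locales (use T elim in \<open>auto simp: less_top\<close>)
    show ?case unfolding wiener_def using limit(1) by blast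
  qed
qed

lemma grid_index_mono: "0 < T \<Longrightarrow> s \<le> t \<Longrightarrow> grid_index T l s \<le> grid_index T l t"
  unfolding grid_index_def by (intro nat_mono floor_mono divide_right_mono mult_left_mono) auto

text \<open>
  At each level of the grid the increment over \<open>{s..t}\<close> and the values before
  \<open>s\<close> are combinations of disjoint sets of grid increments, so the identity is exact there;
  it passes to the limit by dominated convergence.
\<close>

lemma wiener_char:
  assumes T: "0 < T" and st: "0 \<le> s" "s \<le> t" "t \<le> T" and J: "finite J" "J \<subseteq> {0..s}"
  shows "(\<integral>\<omega>. iexp ((\<Sum>r\<in>J. u r * wiener T r \<omega>) + v * (wiener T t \<omega> - wiener T s \<omega>)) \<partial>white_noise) =
    (\<integral>\<omega>. iexp (\<Sum>r\<in>J. u r * wiener T r \<omega>) \<partial>white_noise) * complex_of_real (exp (- (v\<^sup>2 * (t - s) / 2)))"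
proof -
  interpret prob_space white_noise by (rule prob_space_white_noise)
  define G where "G l \<omega> = (\<Sum>r\<in>J. u r * levy_grid T \<omega> l (grid_index T l r))" for l \<omega>
  define D where "D l \<omega> = levy_grid T \<omega> l (grid_index T l t) - levy_grid T \<omega> l (grid_index T l s)" for l \<omega>
  have JT: "J \<subseteq> {0..T}" using J st by auto
  have level: "(\<integral>\<omega>. iexp (G l \<omega> + v * D l \<omega>) \<partial>white_noise) = (\<integral>\<omega>. iexp (G l \<omega>) \<partial>white_noise) * complex_of_real (exp (- (v\<^sup>2 * (T * real (grid_index T l t) / 2 ^ l - T * real (grid_index T l s) / 2 ^ l) / 2)))" for l
  proof -
    let ?s = "grid_index T l s" and ?t = "grid_index T l t"
    have sle: "?s \<le> ?t" "?t \<le> 2 ^ l" using grid_index_mono[OF T st(2)] grid_index_le[OF T, of t] st by auto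
    \<comment> \<open>coefficients of the grid increments in \<open>G l\<close> and in \<open>v * D l\<close>; their supports are disjoint because \<open>J\<close> lies before \<open>s\<close>\<close>
    define a where "a i = (\<Sum>r\<in>J. if i < grid_index T l r then u r else 0)" for i
    define d where "d i = (if ?s \<le> i \<and> i < ?t then v else 0)" for i
    let ?y = "\<lambda>\<omega> i. levy_grid T \<omega> l (Suc i) - levy_grid T \<omega> l i"
    have tele: "(\<Sum>i<2 ^ l. (if i < m then w else 0) * ?y \<omega> i) = w * levy_grid T \<omega> l m" if "m \<le> 2 ^ l" for m w \<omega>
    proof -
      have "(\<Sum>i<2 ^ l. (if i < m then w else 0) * ?y \<omega> i) = (\<Sum>i<m. w * ?y \<omega> i)"
        using that by (intro sum.mono_neutral_cong_right) auto
      then show ?thesis by (simp add: sum_distrib_left[symmetric] sum_lessThan_telescope levy_grid_0)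
    qed
    have Ga: "(\<Sum>i<2 ^ l. a i * ?y \<omega> i) = G l \<omega>" for \<omega>
    proof -
      have "(\<Sum>i<2 ^ l. a i * ?y \<omega> i) = (\<Sum>r\<in>J. \<Sum>i<2 ^ l. (if i < grid_index T l r then u r else 0) * ?y \<omega> i)"
        unfolding a_def sum_distrib_right by (rule sum.swap)
      also have "\<dots> = G l \<omega>" unfolding G_def
        by (intro sum.cong refl tele grid_index_le[OF T]) (use JT in auto)
      finally show ?thesis .
    qed
    have Dd: "(\<Sum>i<2 ^ l. d i * ?y \<omega> i) = v * D l \<omega>" for \<omega>
    proof -
      have "d i * ?y \<omega> i = (if i < ?t then v else 0) * ?y \<omega> i - (if i < ?s then v else 0) * ?y \<omega> i" for i
        using sle by (auto simp: d_def)
      then have "(\<Sum>i<2 ^ l. d i * ?y \<omega> i) = v * levy_grid T \<omega> l ?t - v * levy_grid T \<omega> l ?s"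
        using tele[of ?t v \<omega>] tele[of ?s v \<omega>] sle by (simp add: sum_subtractf)
      then show ?thesis by (simp add: D_def right_diff_distrib)
    qed
    have ad: "a i * d i = 0" for i
    proof (cases "?s \<le> i")
      case True
      have "grid_index T l r \<le> i" if "r \<in> J" for r
        using grid_index_mono[OF T, of r s l] J that True by auto
      then have "a i = 0" unfolding a_def by (intro sum.neutral) (auto simp: not_less dest!: leD)
      then show ?thesis by simp
    qed (auto simp: d_def)
    have "(a i + d i)\<^sup>2 = (a i)\<^sup>2 + (d i)\<^sup>2" for i
      using ad[of i] by (simp add: power2_eq_square algebra_simps)
    moreover have "(\<Sum>i<2 ^ l. (d i)\<^sup>2) = v\<^sup>2 * (real ?t - real ?s)"
    proof -
      have "(\<Sum>i<2 ^ l. (d i)\<^sup>2) = (\<Sum>i\<in>{?s..<?t}. v\<^sup>2)"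
        using sle by (intro sum.mono_neutral_cong_right) (auto simp: d_def)
      then show ?thesis using sle by (simp add: of_nat_diff)
    qed
    ultimately have sq: "(\<Sum>i<2 ^ l. (a i + d i)\<^sup>2) = (\<Sum>i<2 ^ l. (a i)\<^sup>2) + v\<^sup>2 * (real ?t - real ?s)"
      by (simp add: sum.distrib)
    have "(\<integral>\<omega>. iexp (G l \<omega> + v * D l \<omega>) \<partial>white_noise) = (\<integral>\<omega>. iexp (\<Sum>i<2 ^ l. (a i + d i) * ?y \<omega> i) \<partial>white_noise)"
      unfolding Ga[symmetric] Dd[symmetric] sum.distrib[symmetric] distrib_right ..
    also have "\<dots> = complex_of_real (exp (- (T / 2 ^ l * (\<Sum>i<2 ^ l. (a i + d i)\<^sup>2)) / 2))"
      by (rule levy_grid_char) (use T in simp)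
    also have "exp (- (T / 2 ^ l * (\<Sum>i<2 ^ l. (a i + d i)\<^sup>2)) / 2) = exp (- (T / 2 ^ l * (\<Sum>i<2 ^ l. (a i)\<^sup>2)) / 2) * exp (- (v\<^sup>2 * (T * real ?t / 2 ^ l - T * real ?s / 2 ^ l) / 2))"
      unfolding sq exp_add[symmetric] by (rule arg_cong[where f=exp]) (simp add: field_simps)
    also have "complex_of_real (exp (- (T / 2 ^ l * (\<Sum>i<2 ^ l. (a i)\<^sup>2)) / 2) * exp (- (v\<^sup>2 * (T * real ?t / 2 ^ l - T * real ?s / 2 ^ l) / 2))) =
       (\<integral>\<omega>. iexp (\<Sum>i<2 ^ l. a i * ?y \<omega> i) \<partial>white_noise) * complex_of_real (exp (- (v\<^sup>2 * (T * real ?t / 2 ^ l - T * real ?s / 2 ^ l) / 2)))"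
      unfolding of_real_mult using levy_grid_char[where T=T and l=l and u=a] T by (simp only: less_imp_le)
    finally show ?thesis unfolding Ga .
  qed
  have ae: "AE \<omega> in white_noise. (\<lambda>l. G l \<omega>) \<longlonglongrightarrow> (\<Sum>r\<in>J. u r * wiener T r \<omega>) \<and> (\<lambda>l. D l \<omega>) \<longlonglongrightarrow> wiener T t \<omega> - wiener T s \<omega>"
    using wiener_approx[OF T]
  proof eventually_elim
    case (elim \<omega>)
    then show ?case unfolding G_def D_def using JT st
      by (intro conjI tendsto_sum tendsto_mult tendsto_const tendsto_diff) auto
  qed
  have Gm[measurable]: "G l \<in> borel_measurable white_noise" "D l \<in> borel_measurable white_noise" for l
    unfolding G_def[abs_def] D_def[abs_def] by measurable
  have [measurable]: "(\<lambda>\<omega>. \<Sum>r\<in>J. u r * wiener T r \<omega>) \<in> borel_measurable white_noise"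
    using JT by (intro borel_measurable_sum borel_measurable_times measurable_wiener[OF T]) auto
  have [measurable]: "wiener T t \<in> borel_measurable white_noise" "wiener T s \<in> borel_measurable white_noise"
    using st by (auto intro!: measurable_wiener[OF T])
  have lim1: "(\<lambda>l. \<integral>\<omega>. iexp (G l \<omega> + v * D l \<omega>) \<partial>white_noise) \<longlonglongrightarrow> (\<integral>\<omega>. iexp ((\<Sum>r\<in>J. u r * wiener T r \<omega>) + v * (wiener T t \<omega> - wiener T s \<omega>)) \<partial>white_noise)"
  proof (rule integral_dominated_convergence[where w="\<lambda>_. 1"])
    show "AE \<omega> in white_noise. (\<lambda>l. iexp (G l \<omega> + v * D l \<omega>)) \<longlonglongrightarrow> iexp ((\<Sum>r\<in>J. u r * wiener T r \<omega>) + v * (wiener T t \<omega> - wiener T s \<omega>))"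
      using ae by eventually_elim (intro tendsto_exp tendsto_mult tendsto_of_real tendsto_const tendsto_add; simp)
    show "(\<lambda>\<omega>. iexp ((\<Sum>r\<in>J. u r * wiener T r \<omega>) + v * (wiener T t \<omega> - wiener T s \<omega>))) \<in> borel_measurable white_noise"
      "(\<lambda>\<omega>. iexp (G l \<omega> + v * D l \<omega>)) \<in> borel_measurable white_noise" for l by measurable
  qed (simp_all del: of_real_add of_real_mult)
  have lim2: "(\<lambda>l. \<integral>\<omega>. iexp (G l \<omega>) \<partial>white_noise) \<longlonglongrightarrow> (\<integral>\<omega>. iexp (\<Sum>r\<in>J. u r * wiener T r \<omega>) \<partial>white_noise)"
  proof (rule integral_dominated_convergence[where w="\<lambda>_. 1"])
    show "AE \<omega> in white_noise. (\<lambda>l. iexp (G l \<omega>)) \<longlonglongrightarrow> iexp (\<Sum>r\<in>J. u r * wiener T r \<omega>)"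
      using ae by eventually_elim (intro tendsto_exp tendsto_mult tendsto_of_real tendsto_const; simp)
    show "(\<lambda>\<omega>. iexp (\<Sum>r\<in>J. u r * wiener T r \<omega>)) \<in> borel_measurable white_noise"
      "(\<lambda>\<omega>. iexp (G l \<omega>)) \<in> borel_measurable white_noise" for l by measurable
  qed simp_all
  have lim3: "(\<lambda>l. complex_of_real (exp (- (v\<^sup>2 * (T * real (grid_index T l t) / 2 ^ l - T * real (grid_index T l s) / 2 ^ l) / 2)))) \<longlonglongrightarrow> complex_of_real (exp (- (v\<^sup>2 * (t - s) / 2)))"
    by (intro tendsto_of_real tendsto_exp tendsto_minus tendsto_divide tendsto_mult tendsto_const tendsto_diff grid_index_tendsto[OF T]) (use st in auto)
  show ?thesis
    by (rule LIMSEQ_unique[OF lim1]) (unfold level, rule tendsto_mult[OF lim2 lim3])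
qed

lemma pair_integral_mult:
  fixes f :: "'a \<Rightarrow> complex" and g :: "'b \<Rightarrow> complex"
  assumes "prob_space M" "prob_space N"
    and f: "f \<in> borel_measurable M" "\<And>x. cmod (f x) \<le> 1" and g: "g \<in> borel_measurable N" "\<And>y. cmod (g y) \<le> 1"
  shows "(\<integral>z. f (fst z) * g (snd z) \<partial>(M \<Otimes>\<^sub>M N)) = (\<integral>x. f x \<partial>M) * (\<integral>y. g y \<partial>N)"
proof -
  interpret M: prob_space M by fact
  interpret N: prob_space N by fact
  interpret pair_prob_space M N ..
  note [measurable] = f(1) g(1)
  have "integrable (M \<Otimes>\<^sub>M N) (\<lambda>z. f (fst z) * g (snd z))"
  proof (rule P.integrable_bounded_complex)
    show "(\<lambda>z. f (fst z) * g (snd z)) \<in> borel_measurable (M \<Otimes>\<^sub>M N)" by measurable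
    show "cmod (f (fst z) * g (snd z)) \<le> 1 * 1" for z
      unfolding norm_mult by (intro mult_mono f(2) g(2)) auto
  qed
  from integral_fst'[OF this] show ?thesis by simp
qed

text \<open>
  The characteristic function of the values and the increment agrees with the one of a pair living on two
  independent copies of the noise.
\<close>

lemma wiener_increment_independent:
  assumes T: "0 < T" and st: "0 \<le> s" "s < t" "t \<le> T" and J: "finite J" "J \<subseteq> {0..s}"
    and B: "\<And>r. r \<in> J \<Longrightarrow> B r \<in> sets borel" and C: "C \<in> sets borel"
  shows "measure white_noise {\<omega>\<in>space white_noise. (\<forall>r\<in>J. wiener T r \<omega> \<in> B r) \<and> wiener T t \<omega> - wiener T s \<omega> \<in> C} =
    measure white_noise {\<omega>\<in>space white_noise. \<forall>r\<in>J. wiener T r \<omega> \<in> B r} *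
    measure white_noise {\<omega>\<in>space white_noise. wiener T t \<omega> - wiener T s \<omega> \<in> C}"
proof -
  interpret N: prob_space white_noise by (rule prob_space_white_noise)
  interpret NN: pair_prob_space white_noise white_noise ..
  define D where "D \<omega> = wiener T t \<omega> - wiener T s \<omega>" for \<omega>
  have JT: "J \<subseteq> {0..T}" using J st by auto
  have Wm: "wiener T r \<in> borel_measurable white_noise" if "r \<in> J" for r
    using that JT by (intro measurable_wiener[OF T]) auto
  have Dm[measurable]: "D \<in> borel_measurable white_noise"
    unfolding D_def[abs_def] using st by (intro borel_measurable_diff measurable_wiener[OF T]) auto
  \<comment> \<open>the index \<open>-1\<close>, which is not a time, stands for the increment\<close>
  define L where "L = insert (-1) J"
  have L: "finite L" "-1 \<notin> J" using J by (auto simp: L_def)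
  define X where "X i \<omega> = (if i < 0 then D \<omega> else wiener T i \<omega>)" for i \<omega>
  define X' where "X' i z = (if i < 0 then D (snd z) else wiener T i (fst z))" for i and z :: "(real \<Rightarrow> real) \<times> (real \<Rightarrow> real)"
  define B' where "B' i = (if i < 0 then C else B i)" for i
  have J0: "\<not> r < 0" if "r \<in> J" for r using that J by auto
  have "measure white_noise {\<omega>\<in>space white_noise. \<forall>i\<in>L. X i \<omega> \<in> B' i} =
      measure (white_noise \<Otimes>\<^sub>M white_noise) {z\<in>space (white_noise \<Otimes>\<^sub>M white_noise). \<forall>i\<in>L. X' i z \<in> B' i}"
  proof (rule joint_char_unique[OF N.prob_space_axioms NN.prob_space_axioms L(1)])
    fix i assume i: "i \<in> L"
    show "X i \<in> borel_measurable white_noise"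
      using i Wm J0 unfolding X_def[abs_def] L_def by (cases "i < 0") auto
    show "X' i \<in> borel_measurable (white_noise \<Otimes>\<^sub>M white_noise)"
      using i measurable_compose[OF measurable_fst Wm] measurable_compose[OF measurable_snd Dm] J0
      unfolding X'_def[abs_def] L_def by (cases "i < 0") auto
    show "B' i \<in> sets borel" using i B C J0 by (auto simp: B'_def L_def)
  next
    fix u :: "real \<Rightarrow> real"
    let ?f = "\<lambda>\<omega>. iexp (\<Sum>r\<in>J. u r * wiener T r \<omega>)" and ?g = "\<lambda>\<omega>. iexp (u (-1) * D \<omega>)"
    have [measurable]: "(\<lambda>\<omega>. \<Sum>r\<in>J. u r * wiener T r \<omega>) \<in> borel_measurable white_noise"
      using Wm by (intro borel_measurable_sum borel_measurable_times) auto
    have sX: "(\<Sum>i\<in>L. u i * X i \<omega>) = (\<Sum>r\<in>J. u r * wiener T r \<omega>) + u (-1) * D \<omega>" for \<omega>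
      using J(1) L(2) J0 by (simp add: L_def X_def)
    have sX': "(\<Sum>i\<in>L. u i * X' i z) = (\<Sum>r\<in>J. u r * wiener T r (fst z)) + u (-1) * D (snd z)" for z
      using J(1) L(2) J0 by (simp add: L_def X'_def)
    have "(\<integral>z. iexp (\<Sum>i\<in>L. u i * X' i z) \<partial>(white_noise \<Otimes>\<^sub>M white_noise)) = (\<integral>z. ?f (fst z) * ?g (snd z) \<partial>(white_noise \<Otimes>\<^sub>M white_noise))"
      unfolding sX' exp_add[symmetric] of_real_add distrib_left ..
    also have "\<dots> = (\<integral>\<omega>. ?f \<omega> \<partial>white_noise) * (\<integral>\<omega>. ?g \<omega> \<partial>white_noise)"
    proof (rule pair_integral_mult[OF N.prob_space_axioms N.prob_space_axioms])
      show "?f \<in> borel_measurable white_noise" "?g \<in> borel_measurable white_noise" by measurable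
    qed simp_all
    also have "(\<integral>\<omega>. ?g \<omega> \<partial>white_noise) = complex_of_real (exp (- ((u (-1))\<^sup>2 * (t - s) / 2)))"
      using wiener_char[OF T st(1) less_imp_le[OF st(2)] st(3), of "{}" _ "u (-1)"] by (simp add: D_def N.prob_space)
    also have "(\<integral>\<omega>. ?f \<omega> \<partial>white_noise) * complex_of_real (exp (- ((u (-1))\<^sup>2 * (t - s) / 2))) = (\<integral>\<omega>. iexp (\<Sum>i\<in>L. u i * X i \<omega>) \<partial>white_noise)"
      unfolding sX D_def by (rule wiener_char[OF T st(1) less_imp_le[OF st(2)] st(3) J, symmetric])
    finally show "(\<integral>\<omega>. iexp (\<Sum>i\<in>L. u i * X i \<omega>) \<partial>white_noise) = (\<integral>z. iexp (\<Sum>i\<in>L. u i * X' i z) \<partial>(white_noise \<Otimes>\<^sub>M white_noise))" ..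
  qed
  also have "{\<omega>\<in>space white_noise. \<forall>i\<in>L. X i \<omega> \<in> B' i} = {\<omega>\<in>space white_noise. (\<forall>r\<in>J. wiener T r \<omega> \<in> B r) \<and> D \<omega> \<in> C}"
    using J0 by (auto simp: L_def X_def B'_def)
  also have "{z\<in>space (white_noise \<Otimes>\<^sub>M white_noise). \<forall>i\<in>L. X' i z \<in> B' i} =
     {\<omega>\<in>space white_noise. \<forall>r\<in>J. wiener T r \<omega> \<in> B r} \<times> {\<omega>\<in>space white_noise. D \<omega> \<in> C}"
    using J0 by (auto simp: L_def X'_def B'_def space_pair_measure)
  also have "measure (white_noise \<Otimes>\<^sub>M white_noise) \<dots> = measure white_noise {\<omega>\<in>space white_noise. \<forall>r\<in>J. wiener T r \<omega> \<in> B r} * measure white_noise {\<omega>\<in>space white_noise. D \<omega> \<in> C}"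
  proof -
    have "{\<omega>\<in>space white_noise. wiener T r \<omega> \<in> B r} \<in> sets white_noise" if "r \<in> J" for r
      using measurable_sets[OF Wm[OF that] B[OF that]] by (simp add: vimage_def Int_def conj_commute)
    then have "{\<omega>\<in>space white_noise. \<forall>r\<in>J. wiener T r \<omega> \<in> B r} \<in> sets white_noise"
      by (intro sets.sets_Collect_finite_All J(1)) auto
    moreover have "{\<omega>\<in>space white_noise. D \<omega> \<in> C} \<in> sets white_noise" using C by measurable
    ultimately show ?thesis
      unfolding measure_def by (subst N.emeasure_pair_measure_Times) (auto simp: enn2real_mult)
  qed
  finally show ?thesis by (simp add: D_def)
qed

section \<open>A complete basis with given initial law\<close>

definition canonical_base :: "real measure \<Rightarrow> (real \<times> (real \<Rightarrow> real)) measure" where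
  "canonical_base \<mu> = \<mu> \<Otimes>\<^sub>M white_noise"

definition past_event :: "real measure \<Rightarrow> real \<Rightarrow> real set \<Rightarrow> real set \<Rightarrow> (real \<Rightarrow> real set) \<Rightarrow> (real \<times> (real \<Rightarrow> real)) set" where
  "past_event \<mu> T A J B = {z\<in>space (canonical_base \<mu>). fst z \<in> A \<and> (\<forall>r\<in>J. wiener T r (snd z) \<in> B r)}"

definition past_events :: "real measure \<Rightarrow> real \<Rightarrow> real \<Rightarrow> (real \<times> (real \<Rightarrow> real)) set set" where
  "past_events \<mu> T t = {past_event \<mu> T A J B | A J B. A \<in> sets borel \<and> finite J \<and> J \<subseteq> {0..min t T} \<and> (\<forall>r\<in>J. B r \<in> sets borel)}"

text \<open>
  Generated by the initial value and the values of the motion up to time \<open>t\<close>, completed by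
  all null sets of the completed measure. The generators except for the null sets form a pi-system, on
  which independence is checked.
\<close>

definition canonical_filtration :: "real measure \<Rightarrow> real \<Rightarrow> real \<Rightarrow> (real \<times> (real \<Rightarrow> real)) measure" where
  "canonical_filtration \<mu> T t = sigma (space (canonical_base \<mu>)) (past_events \<mu> T t \<union> null_sets (completion (canonical_base \<mu>)))"

context
  fixes \<mu> :: "real measure" and T :: real
  assumes \<mu>: "prob_space \<mu>" and \<mu>_sets: "sets \<mu> = sets borel" and T: "0 < T"
begin

interpretation init: prob_space \<mu> by (rule \<mu>)
interpretation noise: prob_space white_noise by (rule prob_space_white_noise)
interpretation base: pair_prob_space \<mu> white_noise ..

private abbreviation "M0 \<equiv> canonical_base \<mu>"
private abbreviation "M \<equiv> completion (canonical_base \<mu>)"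

lemma prob_space_base: "prob_space (canonical_base \<mu>)"
  unfolding canonical_base_def by (rule base.prob_space_axioms)

lemma prob_space_completed: "prob_space (completion (canonical_base \<mu>))"
  by (rule prob_space.prob_space_completion[OF prob_space_base])

lemma past_event_product:
  "past_event \<mu> T A J B = (A \<inter> space \<mu>) \<times> {\<omega>\<in>space white_noise. \<forall>r\<in>J. wiener T r \<omega> \<in> B r}"
  by (auto simp: past_event_def canonical_base_def space_pair_measure)

lemma noise_event:
  assumes "finite J" "J \<subseteq> {0..T}" "\<And>r. r \<in> J \<Longrightarrow> B r \<in> sets borel"
  shows "{\<omega>\<in>space white_noise. \<forall>r\<in>J. wiener T r \<omega> \<in> B r} \<in> sets white_noise"
proof -
  have "{\<omega>\<in>space white_noise. wiener T r \<omega> \<in> B r} \<in> sets white_noise" if "r \<in> J" for r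
    using measurable_sets[OF measurable_wiener[OF T, of r] assms(3)[OF that]] that assms(2) by (auto simp: vimage_def Int_def conj_commute)
  then show ?thesis by (intro sets.sets_Collect_finite_All assms(1)) auto
qed

lemma past_event_sets:
  assumes "A \<in> sets borel" "finite J" "J \<subseteq> {0..T}" "\<And>r. r \<in> J \<Longrightarrow> B r \<in> sets borel"
  shows "past_event \<mu> T A J B \<in> sets (canonical_base \<mu>)"
  unfolding past_event_product canonical_base_def
  using assms noise_event \<mu>_sets by (intro pair_measureI) auto

lemma past_events_subset: "past_events \<mu> T t \<subseteq> sets (canonical_base \<mu>)"
  unfolding past_events_def by (auto intro!: past_event_sets)

lemma sets_canonical_filtration:
  "sets (canonical_filtration \<mu> T t) = sigma_sets (space M) (past_events \<mu> T t \<union> null_sets M)"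
  "space (canonical_filtration \<mu> T t) = space M"
proof -
  have "past_events \<mu> T t \<union> null_sets M \<subseteq> Pow (space M0)"
    using subset_trans[OF past_events_subset[of t] sets.space_closed[of M0]] sets.space_closed[of M] by (auto simp: null_sets_def)
  then show "sets (canonical_filtration \<mu> T t) = sigma_sets (space M) (past_events \<mu> T t \<union> null_sets M)"
    "space (canonical_filtration \<mu> T t) = space M"
    by (simp_all add: canonical_filtration_def)
qed

lemma canonical_basis: "complete_stochastic_basis M (canonical_filtration \<mu> T)"
  unfolding complete_stochastic_basis_def
proof (intro conjI allI)
  show "prob_space M" by (rule prob_space_completed)
  show "complete_measure M" by (rule completion.complete_measure_axioms)
  show "filtration (space M) (canonical_filtration \<mu> T)"
  proof
    show "space (canonical_filtration \<mu> T t) = space M" for t by (rule sets_canonical_filtration)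
    fix s t :: real assume st: "s \<le> t"
    have "J \<subseteq> {0..min t T}" if "J \<subseteq> {0..min s T}" for J using that st by force
    then have "past_events \<mu> T s \<subseteq> past_events \<mu> T t" unfolding past_events_def by blast
    then show "sets (canonical_filtration \<mu> T s) \<subseteq> sets (canonical_filtration \<mu> T t)"
      unfolding sets_canonical_filtration by (intro sigma_sets_mono') auto
  qed
  show "subalgebra M (canonical_filtration \<mu> T t)" for t
    unfolding subalgebra_def sets_canonical_filtration
    using past_events_subset[of t] by (intro conjI refl sets.sigma_sets_subset) (auto simp: null_sets_def)
  show "null_sets M \<subseteq> sets (canonical_filtration \<mu> T 0)"
    unfolding sets_canonical_filtration by (auto intro: sigma_sets.Basic)
qed

lemma initial_adapted: "fst \<in> borel_measurable (canonical_filtration \<mu> T 0)"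
proof (rule measurableI)
  fix A :: "real set" assume "A \<in> sets borel"
  then have "past_event \<mu> T A {} (\<lambda>_. UNIV) \<in> past_events \<mu> T 0" unfolding past_events_def by blast
  moreover have "fst -` A \<inter> space (canonical_filtration \<mu> T 0) = past_event \<mu> T A {} (\<lambda>_. UNIV)"
    by (auto simp: sets_canonical_filtration past_event_def)
  ultimately show "fst -` A \<inter> space (canonical_filtration \<mu> T 0) \<in> sets (canonical_filtration \<mu> T 0)"
    unfolding sets_canonical_filtration(1) by (auto intro: sigma_sets.Basic)
qed simp

lemma initial_law: "distr M borel fst = \<mu>"
proof (rule measure_eqI)
  fix A :: "real set" assume "A \<in> sets (distr M borel fst)"
  then have A: "A \<in> sets borel" by simp
  have m: "fst \<in> measurable M0 borel"
    unfolding canonical_base_def using measurable_fst[of \<mu> white_noise] \<mu>_sets by (simp cong: measurable_cong_sets)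
  have "emeasure (distr M borel fst) A = emeasure M0 (fst -` A \<inter> space M0)"
    using A measurable_sets[OF m A] by (subst emeasure_distr[OF measurable_completion[OF m]]) auto
  also have "fst -` A \<inter> space M0 = (A \<inter> space \<mu>) \<times> space white_noise"
    by (auto simp: canonical_base_def space_pair_measure)
  also have "emeasure M0 \<dots> = emeasure \<mu> (A \<inter> space \<mu>) * emeasure white_noise (space white_noise)"
    unfolding canonical_base_def by (rule noise.emeasure_pair_measure_Times) (use A \<mu>_sets in auto)
  also have "\<dots> = emeasure \<mu> A" using \<mu>_sets sets_eq_imp_space_eq[OF \<mu>_sets] by (simp add: noise.emeasure_space_1)
  finally show "emeasure (distr M borel fst) A = emeasure \<mu> A" .
qed (simp add: \<mu>_sets)

lemma canonical_brownian: "brownian_motion M (canonical_filtration \<mu> T) T (\<lambda>t z. wiener T t (snd z))"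
  unfolding brownian_motion_def
proof (intro conjI ballI allI impI)
  interpret M: prob_space M by (rule prob_space_completed)
  fix t assume t: "t \<in> {0..T}"
  show "(\<lambda>z. wiener T t (snd z)) \<in> borel_measurable (canonical_filtration \<mu> T t)"
  proof (rule measurableI)
    fix A :: "real set" assume A: "A \<in> sets borel"
    have "past_event \<mu> T UNIV {t} (\<lambda>_. A) \<in> past_events \<mu> T t" unfolding past_events_def
      using A t by (intro CollectI exI[of _ UNIV] exI[of _ "{t}"] exI[of _ "\<lambda>_. A"]) auto
    moreover have "(\<lambda>z. wiener T t (snd z)) -` A \<inter> space (canonical_filtration \<mu> T t) = past_event \<mu> T UNIV {t} (\<lambda>_. A)"
      by (auto simp: sets_canonical_filtration past_event_def)
    ultimately show "(\<lambda>z. wiener T t (snd z)) -` A \<inter> space (canonical_filtration \<mu> T t) \<in> sets (canonical_filtration \<mu> T t)"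
      unfolding sets_canonical_filtration(1) by (auto intro: sigma_sets.Basic)
  qed simp
next
  show "AE z in M. wiener T 0 (snd z) = 0" by (simp add: wiener_0)
  show "AE z in M. continuous_on {0..T} (\<lambda>t. wiener T t (snd z))" by (simp add: wiener_continuous[OF T])
next
  interpret M: prob_space M by (rule prob_space_completed)
  fix s t assume "0 \<le> s \<and> s < t \<and> t \<le> T"
  then have st: "0 \<le> s" "s < t" "t \<le> T" by auto
  define D where "D \<omega> = wiener T t \<omega> - wiener T s \<omega>" for \<omega>
  have Dm: "D \<in> borel_measurable white_noise"
    unfolding D_def[abs_def] using st by (intro borel_measurable_diff measurable_wiener[OF T]) auto
  have DM0: "(\<lambda>z. D (snd z)) \<in> borel_measurable M0"
    unfolding canonical_base_def by (rule measurable_compose[OF measurable_snd Dm])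
  have DM: "(\<lambda>z. D (snd z)) \<in> borel_measurable M" by (rule measurable_completion[OF DM0])
  have law: "emeasure M ((\<lambda>z. D (snd z)) -` C \<inter> space M) = emeasure white_noise (D -` C \<inter> space white_noise)" if C: "C \<in> sets borel" for C
  proof -
    have "emeasure M ((\<lambda>z. D (snd z)) -` C \<inter> space M) = emeasure M0 ((\<lambda>z. D (snd z)) -` C \<inter> space M0)"
      using measurable_sets[OF DM0 C] by simp
    also have "(\<lambda>z. D (snd z)) -` C \<inter> space M0 = space \<mu> \<times> (D -` C \<inter> space white_noise)"
      by (auto simp: canonical_base_def space_pair_measure)
    also have "emeasure M0 \<dots> = emeasure \<mu> (space \<mu>) * emeasure white_noise (D -` C \<inter> space white_noise)"
      unfolding canonical_base_def by (rule noise.emeasure_pair_measure_Times) (use measurable_sets[OF Dm C] in auto)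
    finally show ?thesis by (simp add: init.emeasure_space_1)
  qed
  have Ddist: "distributed white_noise lborel D (normal_density 0 (sqrt (t - s)))"
  proof (rule noise.char_imp_normal[OF Dm])
    show "(\<integral>\<omega>. iexp (u * D \<omega>) \<partial>white_noise) = complex_of_real (exp (- ((u * sqrt (t - s))\<^sup>2 / 2)))" for u
      using wiener_char[OF T st(1) less_imp_le[OF st(2)] st(3), of "{}" _ u] st by (simp add: D_def noise.prob_space power_mult_distrib)
  qed (use st in simp)
  have "distr M lborel (\<lambda>z. D (snd z)) = distr white_noise lborel D"
  proof (rule measure_eqI)
    fix C assume "C \<in> sets (distr M lborel (\<lambda>z. D (snd z)))"
    then have C: "C \<in> sets borel" by simp
    show "emeasure (distr M lborel (\<lambda>z. D (snd z))) C = emeasure (distr white_noise lborel D) C"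
      using law[OF C] C DM Dm by (subst (1 2) emeasure_distr) auto
  qed simp
  then show "distributed M lborel (\<lambda>z. wiener T t (snd z) - wiener T s (snd z)) (\<lambda>x. ennreal (normal_density 0 (sqrt (t - s)) x))"
    using Ddist DM unfolding distributed_def D_def by simp
  let ?V = "vimage_algebra (space M) (\<lambda>z. D (snd z)) borel"
  have V: "sets ?V = {(\<lambda>z. D (snd z)) -` C \<inter> space M | C. C \<in> sets borel}"
    by (rule sets_vimage_algebra2) auto
  let ?E = "past_events \<mu> T s \<union> null_sets M"
  have VM: "sets ?V \<subseteq> sets M" unfolding V using measurable_sets[OF DM] by auto
  have EM: "?E \<subseteq> sets M" using past_events_subset[of s] by (auto simp: null_sets_def)
  have ind: "M.prob (a \<inter> b) = M.prob a * M.prob b" if a: "a \<in> ?E" and b: "b \<in> sets ?V" for a b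
  proof (cases "a \<in> null_sets M")
    case True
    then have "a \<inter> b \<in> null_sets M" using VM b by (intro null_set_Int2) auto
    then show ?thesis using True by (auto simp: measure_def null_sets_def)
  next
    case False
    then obtain A J B where a': "a = past_event \<mu> T A J B" and A: "A \<in> sets borel" and J: "finite J" "J \<subseteq> {0..min s T}" and B: "\<And>r. r \<in> J \<Longrightarrow> B r \<in> sets borel"
      using a unfolding past_events_def by blast
    obtain C where b': "b = (\<lambda>z. D (snd z)) -` C \<inter> space M" and C: "C \<in> sets borel" using b V by auto
    have Js: "J \<subseteq> {0..s}" and JT: "J \<subseteq> {0..T}" using J by auto
    let ?G = "{\<omega>\<in>space white_noise. \<forall>r\<in>J. wiener T r \<omega> \<in> B r}" and ?H = "{\<omega>\<in>space white_noise. D \<omega> \<in> C}"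
    have G: "?G \<in> sets white_noise" by (rule noise_event[OF J(1) JT B])
    have H: "?H \<in> sets white_noise" using measurable_sets[OF Dm C] by (simp add: vimage_def Int_def conj_commute)
    have GH: "?G \<inter> ?H = {\<omega>\<in>space white_noise. (\<forall>r\<in>J. wiener T r \<omega> \<in> B r) \<and> wiener T t \<omega> - wiener T s \<omega> \<in> C}"
      by (auto simp: D_def)
    have A\<mu>: "A \<inter> space \<mu> \<in> sets \<mu>" using A \<mu>_sets by auto
    have prodm: "M.prob ((A \<inter> space \<mu>) \<times> K) = measure \<mu> (A \<inter> space \<mu>) * measure white_noise K" if K: "K \<in> sets white_noise" for K
    proof -
      have "(A \<inter> space \<mu>) \<times> K \<in> sets M0" unfolding canonical_base_def using A\<mu> K by (rule pair_measureI)
      then have "M.prob ((A \<inter> space \<mu>) \<times> K) = measure M0 ((A \<inter> space \<mu>) \<times> K)" by simp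
      also have "\<dots> = measure \<mu> (A \<inter> space \<mu>) * measure white_noise K"
        unfolding measure_def canonical_base_def noise.emeasure_pair_measure_Times[OF A\<mu> K] by (rule enn2real_mult)
      finally show ?thesis .
    qed
    have ab: "a \<inter> b = (A \<inter> space \<mu>) \<times> (?G \<inter> ?H)"
      unfolding a' b' past_event_product by (auto simp: canonical_base_def space_pair_measure)
    have "M.prob b = measure white_noise ?H"
      using law[OF C] unfolding b' measure_def by (simp add: vimage_def Int_def conj_commute)
    moreover have "M.prob a = measure \<mu> (A \<inter> space \<mu>) * measure white_noise ?G"
      unfolding a' past_event_product by (rule prodm[OF G])
    moreover have "M.prob (a \<inter> b) = measure \<mu> (A \<inter> space \<mu>) * measure white_noise (?G \<inter> ?H)"
      unfolding ab by (rule prodm) (use G H in auto)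
    moreover have "measure white_noise (?G \<inter> ?H) = measure white_noise ?G * measure white_noise ?H"
      unfolding GH using wiener_increment_independent[OF T st J(1) Js B C] by (simp add: D_def)
    ultimately show ?thesis by simp
  qed
  have iE: "Int_stable ?E"
  proof (rule Int_stableI)
    fix a b assume ab: "a \<in> ?E" "b \<in> ?E"
    show "a \<inter> b \<in> ?E"
    proof (cases "a \<in> null_sets M \<or> b \<in> null_sets M")
      case True
      then show ?thesis using ab EM by (auto intro: null_set_Int1 null_set_Int2)
    next
      case False
      then obtain A J B A' J' B' where a': "a = past_event \<mu> T A J B" "A \<in> sets borel" "finite J" "J \<subseteq> {0..min s T}" "\<And>r. r \<in> J \<Longrightarrow> B r \<in> sets borel"
        and b': "b = past_event \<mu> T A' J' B'" "A' \<in> sets borel" "finite J'" "J' \<subseteq> {0..min s T}" "\<And>r. r \<in> J' \<Longrightarrow> B' r \<in> sets borel"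
        using ab unfolding past_events_def by blast
      define BB where "BB r = (if r \<in> J then B r else UNIV) \<inter> (if r \<in> J' then B' r else UNIV)" for r
      have "a \<inter> b = past_event \<mu> T (A \<inter> A') (J \<union> J') BB"
        unfolding a'(1) b'(1) past_event_def BB_def by (auto split: if_splits)
      moreover have "\<forall>r\<in>J \<union> J'. BB r \<in> sets borel" using a' b' by (auto simp: BB_def)
      ultimately have "a \<inter> b \<in> past_events \<mu> T s"
        unfolding past_events_def using a'(2-4) b'(2-4)
        by (intro CollectI exI[of _ "A \<inter> A'"] exI[of _ "J \<union> J'"] exI[of _ BB]) auto
      then show ?thesis by simp
    qed
  qed
  have "M.indep_set ?E (sets ?V)"
    by (rule M.indep_setI[OF EM VM ind])
  then have "M.indep_set (sigma_sets (space M) ?E) (sigma_sets (space M) (sets ?V))"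
    by (rule M.indep_set_sigma_sets[OF _ iE]) (rule sets.Int_stable)
  moreover have "sigma_sets (space M) (sets ?V) = sets ?V" using sets.sigma_sets_eq[of ?V] by simp
  ultimately show "M.indep_set (sets (canonical_filtration \<mu> T s)) (sets (vimage_algebra (space M) (\<lambda>z. wiener T t (snd z) - wiener T s (snd z)) borel))"
    unfolding sets_canonical_filtration(1) D_def by simp
qed

end

section \<open>Measurability of time integrals and flows\<close>

text \<open>
  Time is clamped to \<open>{0..t}\<close> because \<open>X\<close> is only assumed well behaved there.
  Joint measurability comes from approximation by processes that are constant between grid points.
\<close>

lemma measurable_joint_continuous:
  fixes X :: "real \<Rightarrow> 'a \<Rightarrow> real"
  assumes X: "\<And>s. s \<in> {0..t} \<Longrightarrow> X s \<in> borel_measurable N" and t: "0 \<le> t"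
    and cont: "\<And>\<omega>. \<omega> \<in> space N \<Longrightarrow> continuous_on {0..t} (\<lambda>s. X s \<omega>)"
  shows "(\<lambda>(\<omega>, s). X (max 0 (min t s)) \<omega>) \<in> borel_measurable (N \<Otimes>\<^sub>M borel)"
proof -
  define cl where "cl s = max 0 (min t s)" for s :: real
  have cl: "cl s \<in> {0..t}" for s using t by (auto simp: cl_def)
  define Y where "Y n p = X (cl (real_of_int \<lfloor>real (Suc n) * snd p\<rfloor> / real (Suc n))) (fst p)" for n and p :: "'a \<times> real"
  have "Y n \<in> borel_measurable (N \<Otimes>\<^sub>M borel)" for n
  proof -
    have "(\<lambda>p. (\<lambda>i p. X (cl (real_of_int i / real (Suc n))) (fst p)) (\<lfloor>real (Suc n) * snd p\<rfloor>) p) \<in> borel_measurable (N \<Otimes>\<^sub>M borel)"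
    proof (rule measurable_compose_countable[where f="\<lambda>i p. X (cl (real_of_int i / real (Suc n))) (fst p)" and g="\<lambda>p. \<lfloor>real (Suc n) * snd p\<rfloor>"])
      show "(\<lambda>p. X (cl (real_of_int i / real (Suc n))) (fst p)) \<in> borel_measurable (N \<Otimes>\<^sub>M (borel :: real measure))" for i
        by (rule measurable_compose[OF measurable_fst X[OF cl]])
      show "(\<lambda>p. \<lfloor>real (Suc n) * snd p\<rfloor>) \<in> measurable (N \<Otimes>\<^sub>M borel) (count_space UNIV)"
        by (rule measurable_compose[OF borel_measurable_times[OF borel_measurable_const measurable_snd] measurable_real_floor])
    qed
    then show ?thesis by (simp add: Y_def[abs_def])
  qed
  note Ym = this
  have lim: "(\<lambda>n. Y n p) \<longlonglongrightarrow> X (cl (snd p)) (fst p)" if p: "p \<in> space (N \<Otimes>\<^sub>M (borel :: real measure))" for p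
  proof -
    define x where "x = snd p"
    have "(\<lambda>n. real_of_int \<lfloor>real (Suc n) * x\<rfloor> / real (Suc n)) \<longlonglongrightarrow> x"
    proof (rule tendsto_sandwich)
      have "x - 1 / real (Suc n) \<le> real_of_int \<lfloor>real (Suc n) * x\<rfloor> / real (Suc n)" for n
      proof -
        have "real (Suc n) * x - 1 \<le> real_of_int \<lfloor>real (Suc n) * x\<rfloor>" by linarith
        then have "(real (Suc n) * x - 1) / real (Suc n) \<le> real_of_int \<lfloor>real (Suc n) * x\<rfloor> / real (Suc n)"
          by (rule divide_right_mono) simp
        then show ?thesis by (simp add: diff_divide_distrib del: of_nat_Suc)
      qed
      then show "\<forall>\<^sub>F n in sequentially. x - 1 / real (Suc n) \<le> real_of_int \<lfloor>real (Suc n) * x\<rfloor> / real (Suc n)" by simp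
      have "real_of_int \<lfloor>real (Suc n) * x\<rfloor> / real (Suc n) \<le> (real (Suc n) * x) / real (Suc n)" for n
        by (rule divide_right_mono) auto
      then show "\<forall>\<^sub>F n in sequentially. real_of_int \<lfloor>real (Suc n) * x\<rfloor> / real (Suc n) \<le> x" by (simp del: of_nat_Suc)
      have "(\<lambda>n. x - 1 / real (Suc n)) \<longlonglongrightarrow> x - 0"
        by (intro tendsto_diff tendsto_const LIMSEQ_Suc lim_1_over_n)
      then show "(\<lambda>n. x - 1 / real (Suc n)) \<longlonglongrightarrow> x" by simp
    qed auto
    then have "(\<lambda>n. cl (real_of_int \<lfloor>real (Suc n) * x\<rfloor> / real (Suc n))) \<longlonglongrightarrow> cl x"
      unfolding cl_def by (intro tendsto_max tendsto_min tendsto_const)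
    moreover have "continuous_on {0..t} (\<lambda>s. X s (fst p))" using p by (intro cont) (auto simp: space_pair_measure)
    ultimately show ?thesis
      using cl unfolding Y_def x_def[symmetric] by (auto simp: continuous_on_sequentially comp_def)
  qed
  have "(\<lambda>p. X (cl (snd p)) (fst p)) \<in> borel_measurable (N \<Otimes>\<^sub>M borel)"
    by (rule borel_measurable_LIMSEQ_metric[OF Ym lim])
  then show ?thesis by (simp add: cl_def split_beta')
qed

lemma measurable_integral_continuous:
  fixes X :: "real \<Rightarrow> 'a \<Rightarrow> real"
  assumes X: "\<And>s. s \<in> {0..t} \<Longrightarrow> X s \<in> borel_measurable N" and t: "0 \<le> t"
    and cont: "\<And>\<omega>. \<omega> \<in> space N \<Longrightarrow> continuous_on {0..t} (\<lambda>s. X s \<omega>)"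
  shows "(\<lambda>\<omega>. LBINT s:{0..t}. X s \<omega>) \<in> borel_measurable N"
proof -
  note [measurable] = measurable_joint_continuous[OF assms]
  have "(\<lambda>\<omega>. \<integral>s. indicator {0..t} s *\<^sub>R X (max 0 (min t s)) \<omega> \<partial>lborel) \<in> borel_measurable N"
    by measurable
  moreover have "(LBINT s:{0..t}. X s \<omega>) = (\<integral>s. indicator {0..t} s *\<^sub>R X (max 0 (min t s)) \<omega> \<partial>lborel)" for \<omega>
    unfolding set_lebesgue_integral_def by (rule Bochner_Integration.integral_cong) (auto simp: indicator_def)
  ultimately show ?thesis by simp
qed

lemma expectation_continuous:
  fixes Y :: "real \<Rightarrow> 'a \<Rightarrow> real"
  assumes Y: "\<And>t. t \<in> {0..T} \<Longrightarrow> Y t \<in> borel_measurable N"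
    and cont: "AE \<omega> in N. continuous_on {0..T} (\<lambda>t. Y t \<omega>) \<and> (\<forall>t\<in>{0..T}. \<bar>Y t \<omega>\<bar> \<le> B \<omega>)"
    and B: "integrable N B"
  shows "continuous_on {0..T} (\<lambda>t. \<integral>\<omega>. Y t \<omega> \<partial>N)"
  unfolding continuous_on_sequentially comp_def
proof (intro allI ballI impI)
  fix s :: "nat \<Rightarrow> real" and t assume t: "t \<in> {0..T}" and s: "(\<forall>n. s n \<in> {0..T}) \<and> s \<longlonglongrightarrow> t"
  show "(\<lambda>n. \<integral>\<omega>. Y (s n) \<omega> \<partial>N) \<longlonglongrightarrow> (\<integral>\<omega>. Y t \<omega> \<partial>N)"
  proof (rule integral_dominated_convergence[OF Y[OF t] Y B])
    show "s n \<in> {0..T}" for n using s by blast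
    show "AE \<omega> in N. (\<lambda>n. Y (s n) \<omega>) \<longlonglongrightarrow> Y t \<omega>"
      using cont by eventually_elim (use s t in \<open>auto simp: continuous_on_sequentially comp_def\<close>)
    show "AE \<omega> in N. norm (Y (s n) \<omega>) \<le> B \<omega>" for n
      using cont by eventually_elim (use s in auto)
  qed
qed

text \<open>
  The Picard iterates are measurable by induction, and \<open>flow\<close> is a limit of them. Only
  \<open>z\<close> up to time \<open>t\<close> is used, which yields adaptedness.
\<close>

lemma (in monotone_drift) measurable_flow:
  assumes z: "\<And>\<omega>. \<omega> \<in> space N \<Longrightarrow> continuous_on {0..T} (z \<omega>)"
    and zm: "\<And>s. s \<in> {0..t} \<Longrightarrow> (\<lambda>\<omega>. z \<omega> s) \<in> borel_measurable N"
    and c: "continuous_on {0..T} c" and t: "t \<in> {0..T}"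
  shows "(\<lambda>\<omega>. flow f g c (z \<omega>) t) \<in> borel_measurable N"
proof -
  let ?P = "\<lambda>r j \<omega>. (truncated_picard f g c (z \<omega>) (real r) ^^ j) (z \<omega>)"
  have pc: "continuous_on {0..T} (?P r j \<omega>)" if "\<omega> \<in> space N" for r j \<omega>
    by (induction j) (auto intro: z[OF that] continuous_truncated_picard[OF z[OF that] c])
  have fm: "f \<in> borel_measurable borel" "g \<in> borel_measurable borel"
    by (intro borel_measurable_continuous_onI cont_f cont_g)+
  have pm: "(\<lambda>\<omega>. ?P r j \<omega> s) \<in> borel_measurable N" if "s \<in> {0..t}" for r j s
    using that
  proof (induction j arbitrary: s)
    case 0 then show ?case using zm by simp
  next
    case (Suc j)
    have "(\<lambda>\<omega>. z \<omega> s - (LBINT u:{0..s}. f (trunc r (?P r j \<omega> u)) + c u * g (trunc r (?P r j \<omega> u)))) \<in> borel_measurable N"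
    proof (intro borel_measurable_diff zm Suc.prems measurable_integral_continuous)
      show "0 \<le> s" using Suc.prems by simp
      fix u assume u: "u \<in> {0..s}"
      have "(\<lambda>\<omega>. ?P r j \<omega> u) \<in> borel_measurable N" using u Suc.prems by (intro Suc.IH) auto
      then have "(\<lambda>\<omega>. trunc r (?P r j \<omega> u)) \<in> borel_measurable N" unfolding trunc_def by measurable
      then show "(\<lambda>\<omega>. f (trunc r (?P r j \<omega> u)) + c u * g (trunc r (?P r j \<omega> u))) \<in> borel_measurable N"
        using measurable_compose[OF _ fm(1)] measurable_compose[OF _ fm(2)] by measurable
    next
      fix \<omega> assume \<omega>: "\<omega> \<in> space N"
      have "{0..s} \<subseteq> {0..T}" using Suc.prems t by auto
      then show "continuous_on {0..s} (\<lambda>u. f (trunc r (?P r j \<omega> u)) + c u * g (trunc r (?P r j \<omega> u)))"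
        by (intro continuous_drift continuous_trunc continuous_on_subset[OF pc[OF \<omega>]] continuous_on_subset[OF c])
    qed
    moreover have "?P r (Suc j) \<omega> s = z \<omega> s - (LBINT u:{0..s}. f (trunc r (?P r j \<omega> u)) + c u * g (trunc r (?P r j \<omega> u)))" for \<omega>
      unfolding funpow.simps comp_apply by (rule truncated_picard_def)
    ultimately show ?case by presburger
  qed
  have "(\<lambda>\<omega>. ?P r j \<omega> t) \<in> borel_measurable N" for r j using pm t by auto
  then show ?thesis unfolding flow_def by (intro borel_measurable_lim_metric)
qed

section \<open>The fixed point equation for the rate\<close>

text \<open>
  The drift is \<open>- (f x + (\<integral>y. h y \<partial>\<nu>) * g x)\<close>; the exponents
  \<open>b\<close> and \<open>c\<close> control the growth of \<open>g\<close> and the local Lipschitz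
  constant of \<open>h\<close>.
\<close>

locale mean_field = monotone_drift f g for f g :: "real \<Rightarrow> real" +
  fixes h :: "real \<Rightarrow> real" and T Ch :: real and b c :: nat
  assumes T: "0 < T" and Ch: "0 \<le> Ch" and h_nonneg: "\<And>x. 0 \<le> h x" and cont_h: "continuous_on UNIV h"
    and g_growth: "\<And>x r. \<bar>x\<bar> \<le> r \<Longrightarrow> \<bar>g x\<bar> \<le> (1 + r) ^ b"
    and h_growth: "\<And>x r. \<bar>x\<bar> \<le> r \<Longrightarrow> h x \<le> Ch * (1 + r) ^ (c + 1)"
    and h_lip: "\<And>x y r. \<bar>x\<bar> \<le> r \<Longrightarrow> \<bar>y\<bar> \<le> r \<Longrightarrow> \<bar>h x - h y\<bar> \<le> Ch * (1 + r) ^ c * \<bar>x - y\<bar>"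
begin

text \<open>
  The number of moments that the squared fluctuation of \<open>h\<close>, of degree
  \<open>2 * (c + 1)\<close>, weighted by the squared growth of \<open>g\<close>, of degree
  \<open>2 * b\<close>, requires.
\<close>

definition moment_degree :: nat where "moment_degree = 2 * (b + c + 1)"

text \<open>
  One more than the bound \<open>2 * path_radius\<close> on every solution driven by the path. All growth
  conditions become powers of this weight.
\<close>

definition weight :: "(real \<Rightarrow> real) \<Rightarrow> real" where "weight w = 1 + 2 * path_radius moment_degree T w"

definition solution :: "(real \<Rightarrow> real) \<Rightarrow> (real \<Rightarrow> real) \<Rightarrow> real \<Rightarrow> real" where
  "solution m w t = flow f g m (regularize moment_degree T w) t"

definition rates :: "(real \<Rightarrow> real) set" where
  "rates = {m. continuous_on {0..T} m \<and> (\<forall>t\<in>{0..T}. 0 \<le> m t)}"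

definition driving_law :: "(real \<Rightarrow> real) measure \<Rightarrow> bool" where
  "driving_law P \<longleftrightarrow> prob_space P \<and> sets P = sets (path_space T) \<and> integrable P (\<lambda>w. weight w ^ moment_degree)"

definition is_mean_rate :: "(real \<Rightarrow> real) measure \<Rightarrow> (real \<Rightarrow> real) \<Rightarrow> bool" where
  "is_mean_rate P m \<longleftrightarrow> m \<in> rates \<and> (\<forall>t\<in>{0..T}. m t = (\<integral>w. h (solution m w t) \<partial>P))"

lemma moment_degree_ge_2: "2 \<le> moment_degree" and moment_degree_pos: "0 < moment_degree" by (auto simp: moment_degree_def)

lemma weight_ge_1: "1 \<le> weight w" using path_radius_nonneg[of moment_degree T w] by (simp add: weight_def)

lemma measurable_weight: "weight \<in> borel_measurable (path_space T)"
  unfolding weight_def[abs_def] using measurable_path_radius[OF T, of moment_degree] by measurable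

lemma ratesD: "m \<in> rates \<Longrightarrow> continuous_on {0..T} m" "m \<in> rates \<Longrightarrow> s \<in> {0..T} \<Longrightarrow> 0 \<le> m s"
  by (auto simp: rates_def)

lemma reg_cont: "continuous_on {0..T} (regularize moment_degree T w)"
  by (rule regularize_continuous_bound[OF T moment_degree_pos])

lemma solution_cont: "m \<in> rates \<Longrightarrow> continuous_on {0..T} (solution m w)"
  unfolding solution_def by (rule flow_solves(1)[OF reg_cont ratesD])

lemma solution_bound:
  assumes m: "m \<in> rates" and t: "t \<in> {0..T}"
  shows "\<bar>solution m w t\<bar> \<le> weight w - 1"
  unfolding solution_def weight_def
  using flow_bound[OF reg_cont ratesD(1)[OF m] ratesD(2)[OF m] regularize_continuous_bound(2)[OF T moment_degree_pos] t] by simp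

lemma measurable_solution: "m \<in> rates \<Longrightarrow> t \<in> {0..T} \<Longrightarrow> (\<lambda>w. solution m w t) \<in> borel_measurable (path_space T)"
  unfolding solution_def
  by (rule measurable_flow[OF reg_cont measurable_regularize[OF T] ratesD(1)]) auto

lemma h_measurable: "h \<in> borel_measurable borel"
  by (intro borel_measurable_continuous_onI cont_h)

lemma driving_law_measurable: "driving_law P \<Longrightarrow> X \<in> borel_measurable (path_space T) \<Longrightarrow> X \<in> borel_measurable P"
  unfolding driving_law_def by (simp cong: measurable_cong_sets)

lemma weight_power_integrable:
  assumes P: "driving_law P" and j: "j \<le> moment_degree"
  shows "integrable P (\<lambda>w. weight w ^ j)"
proof (rule Bochner_Integration.integrable_bound)
  show "integrable P (\<lambda>w. weight w ^ moment_degree)" using P by (simp add: driving_law_def)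
  show "(\<lambda>w. weight w ^ j) \<in> borel_measurable P"
    using driving_law_measurable[OF P measurable_weight] by measurable
  have "weight w ^ j \<le> weight w ^ moment_degree" for w by (rule power_increasing[OF j weight_ge_1])
  then show "AE w in P. norm (weight w ^ j) \<le> norm (weight w ^ moment_degree)"
    using weight_ge_1 by (intro AE_I2) (simp add: abs_of_nonneg[OF zero_le_power] order_trans[OF zero_le_one weight_ge_1])
qed

lemma h_solution_bound: "m \<in> rates \<Longrightarrow> t \<in> {0..T} \<Longrightarrow> \<bar>h (solution m w t)\<bar> \<le> Ch * weight w ^ (c + 1)"
  using h_growth[OF solution_bound[of m t w]] h_nonneg[of "solution m w t"] by simp

lemma h_solution_integrable:
  assumes P: "driving_law P" and m: "m \<in> rates" and t: "t \<in> {0..T}"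
  shows "integrable P (\<lambda>w. h (solution m w t))"
proof (rule Bochner_Integration.integrable_bound)
  show "integrable P (\<lambda>w. Ch * weight w ^ (c + 1))"
    by (intro integrable_mult_right weight_power_integrable[OF P]) (simp add: moment_degree_def)
  show "(\<lambda>w. h (solution m w t)) \<in> borel_measurable P"
    by (rule driving_law_measurable[OF P measurable_compose[OF measurable_solution[OF m t] h_measurable]])
  show "AE w in P. norm (h (solution m w t)) \<le> norm (Ch * weight w ^ (c + 1))"
    using h_solution_bound[OF m t] order_trans[OF abs_ge_zero h_solution_bound[OF m t]] by (intro AE_I2) simp
qed

lemma mean_rate_map:
  assumes P: "driving_law P" and m: "m \<in> rates"
  shows "(\<lambda>t. \<integral>w. h (solution m w t) \<partial>P) \<in> rates"
  unfolding rates_def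
proof (intro CollectI conjI ballI)
  show "continuous_on {0..T} (\<lambda>t. \<integral>w. h (solution m w t) \<partial>P)"
  proof (rule expectation_continuous[where B="\<lambda>w. Ch * weight w ^ (c + 1)"])
    show "(\<lambda>w. h (solution m w t)) \<in> borel_measurable P" if "t \<in> {0..T}" for t
      by (rule driving_law_measurable[OF P measurable_compose[OF measurable_solution[OF m that] h_measurable]])
    show "AE w in P. continuous_on {0..T} (\<lambda>t. h (solution m w t)) \<and> (\<forall>t\<in>{0..T}. \<bar>h (solution m w t)\<bar> \<le> Ch * weight w ^ (c + 1))"
      using h_solution_bound[OF m] solution_cont[OF m] by (intro AE_I2 conjI ballI continuous_on_compose2[OF cont_h]) auto
    show "integrable P (\<lambda>w. Ch * weight w ^ (c + 1))"
      by (intro integrable_mult_right weight_power_integrable[OF P]) (simp add: moment_degree_def)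
  qed
  show "0 \<le> (\<integral>w. h (solution m w t) \<partial>P)" for t by (rule Bochner_Integration.integral_nonneg) (rule h_nonneg)
qed

text \<open>
  The comparison estimate bounds the change of the solution by \<open>weight w ^ b\<close> times the
  integrated change of the rate, with no dependence on the path inside the time integral; the local
  Lipschitz bound on \<open>h\<close> adds \<open>weight w ^ c\<close>.
\<close>

lemma mean_rate_lipschitz:
  assumes P: "driving_law P" and m: "m \<in> rates" "m' \<in> rates" and t: "t \<in> {0..T}"
  shows "\<bar>(\<integral>w. h (solution m w t) \<partial>P) - (\<integral>w. h (solution m' w t) \<partial>P)\<bar> \<le> (Ch * (\<integral>w. weight w ^ (b + c) \<partial>P)) * (LBINT s:{0..t}. \<bar>m s - m' s\<bar>)"
proof -
  let ?I = "LBINT s:{0..t}. \<bar>m s - m' s\<bar>"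
  note int = h_solution_integrable[OF P m(1) t] h_solution_integrable[OF P m(2) t]
  have i1: "integrable P (\<lambda>w. \<bar>h (solution m w t) - h (solution m' w t)\<bar>)"
    by (rule integrable_abs[OF Bochner_Integration.integrable_diff[OF int]])
  have "b + c \<le> moment_degree" by (simp add: moment_degree_def)
  then have i2: "integrable P (\<lambda>w. (Ch * ?I) * weight w ^ (b + c))"
    by (rule integrable_mult_right[OF weight_power_integrable[OF P]])
  have le: "\<bar>h (solution m w t) - h (solution m' w t)\<bar> \<le> (Ch * ?I) * weight w ^ (b + c)" for w
  proof -
    have g: "\<bar>g (solution m' w s)\<bar> \<le> weight w ^ b" if "s \<in> {0..T}" for s
      using g_growth[OF solution_bound[OF m(2) that, of w]] by simp
    have "\<bar>solution m w t - solution m' w t\<bar> \<le> weight w ^ b * ?I"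
      unfolding solution_def
      by (rule flow_compare[OF reg_cont ratesD(1)[OF m(1)] ratesD(2)[OF m(1)] ratesD(1)[OF m(2)] ratesD(2)[OF m(2)] g[unfolded solution_def] t])
    moreover have "\<bar>h (solution m w t) - h (solution m' w t)\<bar> \<le> Ch * weight w ^ c * \<bar>solution m w t - solution m' w t\<bar>"
      using h_lip[OF solution_bound[OF m(1) t, of w] solution_bound[OF m(2) t, of w]] by simp
    moreover have "0 \<le> Ch * weight w ^ c" using Ch weight_ge_1[of w] by simp
    ultimately have "\<bar>h (solution m w t) - h (solution m' w t)\<bar> \<le> Ch * weight w ^ c * (weight w ^ b * ?I)"
      by (meson mult_left_mono order_trans)
    also have "\<dots> = (Ch * ?I) * weight w ^ (b + c)" by (simp only: power_add mult_ac)
    finally show ?thesis .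
  qed
  have "(\<integral>w. h (solution m w t) \<partial>P) - (\<integral>w. h (solution m' w t) \<partial>P) = (\<integral>w. h (solution m w t) - h (solution m' w t) \<partial>P)"
    using int by simp
  then have "\<bar>(\<integral>w. h (solution m w t) \<partial>P) - (\<integral>w. h (solution m' w t) \<partial>P)\<bar> \<le> (\<integral>w. \<bar>h (solution m w t) - h (solution m' w t)\<bar> \<partial>P)"
    using integral_abs_bound[of P "\<lambda>w. h (solution m w t) - h (solution m' w t)"] by (simp only:)
  moreover have "(\<integral>w. \<bar>h (solution m w t) - h (solution m' w t)\<bar> \<partial>P) \<le> (\<integral>w. (Ch * ?I) * weight w ^ (b + c) \<partial>P)"
    using i1 i2 AE_I2[OF le] by (rule integral_mono_AE)
  moreover have "(\<integral>w. (Ch * ?I) * weight w ^ (b + c) \<partial>P) = (Ch * (\<integral>w. weight w ^ (b + c) \<partial>P)) * ?I"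
    unfolding integral_mult_right_zero by (simp only: mult_ac)
  ultimately show ?thesis by linarith
qed

lemma mean_rate_exists:
  assumes P: "driving_law P" shows "\<exists>m. is_mean_rate P m"
proof -
  have "\<exists>m\<in>rates. (\<forall>t\<in>{0..T}. (\<lambda>t. \<integral>w. h (solution m w t) \<partial>P) t = m t) \<and>
     (\<forall>t\<in>{0..T}. (\<lambda>j. ((\<lambda>m t. \<integral>w. h (solution m w t) \<partial>P) ^^ j) (\<lambda>_. 0) t) \<longlonglongrightarrow> m t)"
  proof (rule volterra_fixpoint[where \<Phi>="\<lambda>m t. \<integral>w. h (solution m w t) \<partial>P"])
    show "continuous_on {0..T} m" if "m \<in> rates" for m by (rule ratesD(1)[OF that])
    show "(\<lambda>t. \<integral>w. h (solution m w t) \<partial>P) \<in> rates" if "m \<in> rates" for m by (rule mean_rate_map[OF P that])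
    show "u \<in> rates" if U: "\<And>j. U j \<in> rates" and lim: "uniform_limit {0..T} U u sequentially" for U u
    proof -
      have "continuous_on {0..T} u"
        using uniform_limit_theorem[OF _ lim] ratesD(1)[OF U] by auto
      moreover have "0 \<le> u t" if t: "t \<in> {0..T}" for t
        by (rule LIMSEQ_le_const[OF tendsto_uniform_limitI[OF lim t]]) (use ratesD(2)[OF U t] in auto)
      ultimately show ?thesis by (auto simp: rates_def)
    qed
    show "0 \<le> Ch * (\<integral>w. weight w ^ (b + c) \<partial>P)"
      using Ch weight_ge_1 by (intro mult_nonneg_nonneg Bochner_Integration.integral_nonneg) (auto intro: order_trans[OF zero_le_one])
    show "(\<lambda>_. 0) \<in> rates" by (simp add: rates_def)
  qed (rule mean_rate_lipschitz[OF P])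
  then show ?thesis by (auto simp: is_mean_rate_def)
qed

lemma mean_rate_unique:
  assumes P: "driving_law P" and m: "is_mean_rate P m" and m': "is_mean_rate P m'" and t: "t \<in> {0..T}"
  shows "m t = m' t"
proof -
  have mr: "m \<in> rates" "m' \<in> rates" using m m' by (auto simp: is_mean_rate_def)
  let ?L = "Ch * (\<integral>w. weight w ^ (b + c) \<partial>P)" and ?u = "\<lambda>t. \<bar>m t - m' t\<bar>"
  have cont: "continuous_on {0..T} ?u" by (intro continuous_intros ratesD mr)
  obtain B where B: "\<And>s. s \<in> {0..T} \<Longrightarrow> ?u s \<le> B"
    using continuous_bounded_above[OF cont] by blast
  have "?u t \<le> 0 * exp (?L * t)"
  proof (rule gronwall[OF _ _ B _ t])
    show "set_integrable lborel {0..T} ?u" by (rule borel_integrable_atLeastAtMost'[OF cont])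
    show "0 \<le> ?L"
      using Ch weight_ge_1 by (intro mult_nonneg_nonneg Bochner_Integration.integral_nonneg) (auto intro: order_trans[OF zero_le_one])
    show "?u s \<le> 0 + ?L * (LBINT r:{0..s}. ?u r)" if "s \<in> {0..T}" for s
      using mean_rate_lipschitz[OF P mr that] m m' that by (simp add: is_mean_rate_def)
  qed
  then show ?thesis by simp
qed

definition mean_rate :: "(real \<Rightarrow> real) measure \<Rightarrow> real \<Rightarrow> real" where
  "mean_rate P = (SOME m. is_mean_rate P m)"

lemma mean_rate: "driving_law P \<Longrightarrow> is_mean_rate P (mean_rate P)"
  unfolding mean_rate_def by (rule someI_ex[OF mean_rate_exists])

lemma solution_cong:
  assumes "m \<in> rates" "\<And>s. s \<in> {0..T} \<Longrightarrow> m s = m' s" "t \<in> {0..T}"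
  shows "solution m w t = solution m' w t"
  unfolding solution_def by (rule flow_cong[OF reg_cont ratesD[OF assms(1)] _ assms(2) assms(3)]) auto

lemma solution_solves:
  assumes "m \<in> rates" "t \<in> {0..T}"
  shows "solution m w t = regularize moment_degree T w t - (LBINT s:{0..t}. f (solution m w s) + m s * g (solution m w s))"
  unfolding solution_def by (rule flow_solves(2)[OF reg_cont ratesD[OF assms(1)] assms(2)])

end

section \<open>Solutions driven by Brownian motion\<close>

locale driven_mean_field = mean_field f g h T Ch b c + stochastic_basis M F
  for f g h :: "real \<Rightarrow> real" and T Ch :: real and b c :: nat and M :: "'a measure" and F +
  fixes W :: "real \<Rightarrow> 'a \<Rightarrow> real" and \<xi> :: "'a \<Rightarrow> real" and \<sigma> :: real
  assumes W: "brownian_motion M F T W" and \<xi>: "\<xi> \<in> borel_measurable (F 0)"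
    and \<xi>_moment: "integrable M (\<lambda>\<omega>. \<bar>\<xi> \<omega>\<bar> ^ moment_degree)"
begin

definition Z :: "real \<Rightarrow> 'a \<Rightarrow> real" where "Z t \<omega> = \<xi> \<omega> + \<sigma> * W t \<omega>"

definition P :: "(real \<Rightarrow> real) measure" where "P = distr M (path_space T) (path_on T Z)"

lemma Z_adapted: "t \<in> {0..T} \<Longrightarrow> Z t \<in> borel_measurable (F t)"
proof -
  assume t: "t \<in> {0..T}"
  then have "W t \<in> borel_measurable (F t)" "\<xi> \<in> borel_measurable (F t)"
    using W adapted_mono[OF _ \<xi>, of t] by (auto simp: brownian_motion_def)
  then show ?thesis unfolding Z_def by measurable
qed

lemma path_measurable: "path_on T Z \<in> measurable M (path_space T)"
  by (rule measurable_path_on) (rule adapted_M[OF Z_adapted])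

lemma driving_law_P: "driving_law P"
  unfolding driving_law_def
proof (intro conjI)
  show "prob_space P" unfolding P_def by (rule prob_space_distr[OF path_measurable])
  show "sets P = sets (path_space T)" by (simp add: P_def)
  show "integrable P (\<lambda>w. weight w ^ moment_degree)"
    using path_weight_integrable[OF W T moment_degree_ge_2 \<xi> \<xi>_moment, of \<sigma>] unfolding P_def weight_def Z_def[abs_def] by simp
qed

lemma path_regular: "AE \<omega> in M. continuous_on {0..T} (\<lambda>t. Z t \<omega>) \<and> (\<forall>t\<in>{0..T}. regularize moment_degree T (path_on T Z \<omega>) t = Z t \<omega>)"
  using brownian_path_regular(2)[OF W T moment_degree_ge_2 \<xi>, of \<sigma>, folded Z_def[abs_def]]
  by (rule AE_mp) (rule AE_I2, simp add: Z_def)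

lemma weight_P_integrable: "j \<le> moment_degree \<Longrightarrow> integrable M (\<lambda>\<omega>. weight (path_on T Z \<omega>) ^ j)"
  by (rule integrable_distr[OF path_measurable, folded P_def, OF weight_power_integrable[OF driving_law_P]])

lemma forced_bound:
  assumes c0: "\<And>s. s \<in> {0..T} \<Longrightarrow> 0 \<le> k s"
    and int: "set_integrable lborel {0..T} (\<lambda>s. f (x s) + k s * g (x s))" and x: "continuous_on {0..T} x"
    and z: "continuous_on {0..T} (\<lambda>t. Z t \<omega>)" "\<forall>t\<in>{0..T}. regularize moment_degree T (path_on T Z \<omega>) t = Z t \<omega>"
    and eq: "\<And>t. t \<in> {0..T} \<Longrightarrow> x t = Z t \<omega> - (LBINT s:{0..t}. f (x s) + k s * g (x s))"
    and t: "t \<in> {0..T}"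
  shows "\<bar>x t\<bar> \<le> weight (path_on T Z \<omega>) - 1"
proof -
  have "\<bar>Z t \<omega>\<bar> \<le> path_radius moment_degree T (path_on T Z \<omega>)" if "t \<in> {0..T}" for t
    using regularize_continuous_bound(2)[OF T moment_degree_pos that, of "path_on T Z \<omega>"] z(2) that by simp
  from forced_solution_bound[OF mono_f f0 mono_g g0 c0 int x z(1) eq this t] show ?thesis by (simp add: weight_def)
qed

text \<open>
  The a priori bound shows that the rate of a solution is continuous. Pathwise uniqueness for the forced
  equation then makes the solution the flow with its own rate, and taking expectations shows that this
  rate is the fixed point.
\<close>

theorem mean_field_solution_unique:
  assumes Xm: "\<And>t. t \<in> {0..T} \<Longrightarrow> X t \<in> borel_measurable M"
    and Xc: "\<And>\<omega>. \<omega> \<in> space M \<Longrightarrow> continuous_on {0..T} (\<lambda>t. X t \<omega>)"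
    and eq: "AE \<omega> in M. set_integrable lborel {0..T} (\<lambda>s. f (X s \<omega>) + (\<integral>\<omega>'. h (X s \<omega>') \<partial>M) * g (X s \<omega>)) \<and>
       (\<forall>t\<in>{0..T}. X t \<omega> = Z t \<omega> - (LBINT s:{0..t}. f (X s \<omega>) + (\<integral>\<omega>'. h (X s \<omega>') \<partial>M) * g (X s \<omega>)))"
  shows "AE \<omega> in M. \<forall>t\<in>{0..T}. X t \<omega> = solution (mean_rate P) (path_on T Z \<omega>) t"
proof -
  define k where "k s = (\<integral>\<omega>'. h (X s \<omega>') \<partial>M)" for s
  have k0: "0 \<le> k s" for s unfolding k_def by (rule Bochner_Integration.integral_nonneg) (rule h_nonneg)
  have bound: "AE \<omega> in M. \<forall>t\<in>{0..T}. \<bar>X t \<omega>\<bar> \<le> weight (path_on T Z \<omega>) - 1"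
    using eq path_regular AE_space
  proof eventually_elim
    case (elim \<omega>)
    then show ?case unfolding k_def[symmetric]
      by (intro ballI forced_bound[where k=k and x="\<lambda>t. X t \<omega>"] k0 Xc) auto
  qed
  have kr: "k \<in> rates"
    unfolding rates_def
  proof (intro CollectI conjI ballI k0)
    show "continuous_on {0..T} k"
      unfolding k_def[abs_def]
    proof (rule expectation_continuous[where B="\<lambda>\<omega>. Ch * weight (path_on T Z \<omega>) ^ (c + 1)"])
      show "(\<lambda>\<omega>. h (X t \<omega>)) \<in> borel_measurable M" if "t \<in> {0..T}" for t
        by (rule measurable_compose[OF Xm[OF that] h_measurable])
      show "AE \<omega> in M. continuous_on {0..T} (\<lambda>t. h (X t \<omega>)) \<and> (\<forall>t\<in>{0..T}. \<bar>h (X t \<omega>)\<bar> \<le> Ch * weight (path_on T Z \<omega>) ^ (c + 1))"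
        using bound AE_space
      proof eventually_elim
        case (elim \<omega>)
        show ?case
        proof (intro conjI ballI)
          show "continuous_on {0..T} (\<lambda>t. h (X t \<omega>))"
            by (rule continuous_on_compose2[OF cont_h Xc[OF elim(2)]]) auto
          show "\<bar>h (X t \<omega>)\<bar> \<le> Ch * weight (path_on T Z \<omega>) ^ (c + 1)" if "t \<in> {0..T}" for t
            using h_growth[of "X t \<omega>" "weight (path_on T Z \<omega>) - 1"] elim(1) that h_nonneg[of "X t \<omega>"] by simp
        qed
      qed
      show "integrable M (\<lambda>\<omega>. Ch * weight (path_on T Z \<omega>) ^ (c + 1))"
        by (intro integrable_mult_right weight_P_integrable) (simp add: moment_degree_def)
    qed
  qed
  have Xsol: "AE \<omega> in M. \<forall>t\<in>{0..T}. X t \<omega> = solution k (path_on T Z \<omega>) t"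
    using eq path_regular AE_space
  proof eventually_elim
    case (elim \<omega>)
    show ?case
    proof (intro ballI)
      fix t assume t: "t \<in> {0..T}"
      have "X t \<omega> = flow f g k (\<lambda>t. Z t \<omega>) t"
        by (rule flow_unique[OF _ ratesD[OF kr] Xc[OF elim(3)] _ t]) (use elim in \<open>auto simp: k_def\<close>)
      also have "\<dots> = solution k (path_on T Z \<omega>) t"
        unfolding solution_def by (rule flow_cong[OF _ ratesD[OF kr] _ _ t]) (use elim in auto)
      finally show "X t \<omega> = solution k (path_on T Z \<omega>) t" .
    qed
  qed
  have "is_mean_rate P k"
    unfolding is_mean_rate_def
  proof (intro conjI kr ballI)
    fix t assume t: "t \<in> {0..T}"
    note ms = measurable_compose[OF measurable_solution[OF kr t] h_measurable]
    have "k t = (\<integral>\<omega>. h (solution k (path_on T Z \<omega>) t) \<partial>M)"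
      unfolding k_def[of t]
    proof (rule integral_cong_AE)
      show "(\<lambda>\<omega>. h (X t \<omega>)) \<in> borel_measurable M" by (rule measurable_compose[OF Xm[OF t] h_measurable])
      show "(\<lambda>\<omega>. h (solution k (path_on T Z \<omega>) t)) \<in> borel_measurable M" by (rule measurable_compose[OF path_measurable ms])
      show "AE \<omega> in M. h (X t \<omega>) = h (solution k (path_on T Z \<omega>) t)"
        using Xsol by eventually_elim (use t in simp)
    qed
    also have "\<dots> = (\<integral>w. h (solution k w t) \<partial>P)"
      unfolding P_def by (rule integral_distr[OF path_measurable ms, symmetric])
    finally show "k t = (\<integral>w. h (solution k w t) \<partial>P)" .
  qed
  then have same: "k s = mean_rate P s" if "s \<in> {0..T}" for s
    using mean_rate_unique[OF driving_law_P _ mean_rate[OF driving_law_P] that] by blast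
  show ?thesis
    using Xsol by eventually_elim (use solution_cong[OF kr same] in auto)
qed

definition X :: "real \<Rightarrow> 'a \<Rightarrow> real" where
  "X t \<omega> = solution (mean_rate P) (path_on T Z \<omega>) t"

lemma mean_rate_rates: "mean_rate P \<in> rates"
  using mean_rate[OF driving_law_P] by (simp add: is_mean_rate_def)

lemma X_continuous: "continuous_on {0..T} (\<lambda>t. X t \<omega>)"
  unfolding X_def by (rule solution_cont[OF mean_rate_rates])

lemma X_measurable: "t \<in> {0..T} \<Longrightarrow> X t \<in> borel_measurable M"
  unfolding X_def[abs_def] by (rule measurable_compose[OF path_measurable measurable_solution[OF mean_rate_rates]])

lemma X_mean: "t \<in> {0..T} \<Longrightarrow> (\<integral>\<omega>. h (X t \<omega>) \<partial>M) = mean_rate P t"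
proof -
  assume t: "t \<in> {0..T}"
  have "(\<integral>\<omega>. h (X t \<omega>) \<partial>M) = (\<integral>w. h (solution (mean_rate P) w t) \<partial>P)"
    unfolding X_def P_def[symmetric]
    by (subst (2) P_def) (rule integral_distr[OF path_measurable measurable_compose[OF measurable_solution[OF mean_rate_rates t] h_measurable], symmetric])
  then show ?thesis using mean_rate[OF driving_law_P] t by (simp add: is_mean_rate_def)
qed

lemma X_h_integrable: "t \<in> {0..T} \<Longrightarrow> integrable M (\<lambda>\<omega>. h (X t \<omega>))"
  unfolding X_def
  by (rule integrable_distr[OF path_measurable, folded P_def, OF h_solution_integrable[OF driving_law_P mean_rate_rates]])

lemma X_solves:
  "set_integrable lborel {0..T} (\<lambda>s. f (X s \<omega>) + mean_rate P s * g (X s \<omega>))"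
  "AE \<omega> in M. \<forall>t\<in>{0..T}. X t \<omega> = Z t \<omega> - (LBINT s:{0..t}. f (X s \<omega>) + mean_rate P s * g (X s \<omega>))"
proof -
  show "set_integrable lborel {0..T} (\<lambda>s. f (X s \<omega>) + mean_rate P s * g (X s \<omega>))"
    by (intro borel_integrable_atLeastAtMost' continuous_drift ratesD(1)[OF mean_rate_rates] X_continuous)
  show "AE \<omega> in M. \<forall>t\<in>{0..T}. X t \<omega> = Z t \<omega> - (LBINT s:{0..t}. f (X s \<omega>) + mean_rate P s * g (X s \<omega>))"
    using path_regular by eventually_elim (use solution_solves[OF mean_rate_rates] in \<open>auto simp: X_def\<close>)
qed

text \<open>
  The value at \<open>t\<close> is a limit of values at grid points not later than \<open>t\<close>,
  except on the set of infinite energy. That set depends on the whole path but is a null set, so it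
  belongs to the initial sigma-algebra.
\<close>

lemma regularize_adapted:
  assumes null: "null_sets M \<subseteq> sets (F 0)" and t: "t \<in> {0..T}"
  shows "(\<lambda>\<omega>. regularize moment_degree T (path_on T Z \<omega>) t) \<in> borel_measurable (F t)"
proof -
  let ?E = "\<lambda>\<omega>. chain_energy moment_degree (sample_path T (path_on T Z \<omega>))"
  \<comment> \<open>outside this null set the value is a limit of adapted variables\<close>
  let ?N = "{\<omega>\<in>space M. \<not> ?E \<omega> < \<infinity>}"
  have Em: "?E \<in> borel_measurable M"
    by (rule measurable_chain_energy)
      (unfold sample_path_def, rule measurable_compose[OF path_measurable measurable_path_component[OF sample_path_point[OF T]]])
  have "AE \<omega> in M. ?E \<omega> \<noteq> \<infinity>"
    using brownian_path_regular(1)[OF W T moment_degree_ge_2 \<xi>, of \<sigma>]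
    by (intro nn_integral_PInf_AE[OF Em]) (auto simp: Z_def[abs_def])
  then have "?N \<in> null_sets M"
    using Em by (subst AE_iff_null[symmetric]) (auto simp: less_top)
  then have N: "?N \<in> sets (F t)"
    using null filtration.sets_F_mono[OF filt, of 0 t] t by auto
  have pt: "T * real (grid_index T l t) / 2 ^ l \<in> {0..T}" "T * real (grid_index T l t) / 2 ^ l \<le> t" for l
    using grid_point_close(1)[OF T t, of l] t by auto
  have "(\<lambda>\<omega>. sample_path T (path_on T Z \<omega>) l (grid_index T l t)) \<in> borel_measurable (F t)" for l
    using adapted_mono[OF pt(2) Z_adapted[OF pt(1)], of l] pt(1)[of l] by (simp add: sample_path_def path_on_eq)
  then have "(\<lambda>\<omega>. lim (\<lambda>l. sample_path T (path_on T Z \<omega>) l (grid_index T l t))) \<in> borel_measurable (F t)"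
    by (rule borel_measurable_lim_metric)
  then have "(\<lambda>\<omega>. if \<omega> \<in> ?N then 0 else lim (\<lambda>l. sample_path T (path_on T Z \<omega>) l (grid_index T l t))) \<in> borel_measurable (F t)"
    using N by (intro measurable_If_set) (auto simp: space_F Int_absorb2 sets.Int_space_eq2)
  then show ?thesis
    by (rule measurable_cong[THEN iffD1, rotated]) (auto simp: regularize_def chain_limit_def space_F)
qed

lemma X_adapted:
  assumes null: "null_sets M \<subseteq> sets (F 0)" and t: "t \<in> {0..T}"
  shows "X t \<in> borel_measurable (F t)"
  unfolding X_def[abs_def] solution_def
proof (rule measurable_flow[OF reg_cont _ ratesD(1)[OF mean_rate_rates] t])
  fix s assume s: "s \<in> {0..t}"
  show "(\<lambda>\<omega>. regularize moment_degree T (path_on T Z \<omega>) s) \<in> borel_measurable (F t)"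
    using s t by (intro adapted_mono[OF _ regularize_adapted[OF null, of s]]) auto
qed

end

section \<open>Fluctuations and coupling\<close>

text \<open>
  Expand the square. A term with \<open>j \<noteq> l\<close> has a factor \<open>\<psi> (V r)\<close>
  with \<open>r \<noteq> i\<close> that occurs once and is independent of the rest, so it vanishes; at
  most \<open>N\<close> terms remain of the \<open>N ^ 2\<close>. The weight \<open>\<phi> (V i)\<close>
  belongs to the particle under consideration.
\<close>

lemma (in prob_space) weighted_mean_square:
  fixes V :: "nat \<Rightarrow> 'a \<Rightarrow> 'p" and \<phi> \<psi> :: "'p \<Rightarrow> real"
  assumes ind: "indep_vars (\<lambda>_. S) V {1..N}" and law: "\<And>j. j \<in> {1..N} \<Longrightarrow> distr M S (V j) = P"
    and P: "prob_space P" "sets P = sets S"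
    and \<phi>: "\<phi> \<in> borel_measurable S" "\<And>x. 0 \<le> \<phi> x" and \<psi>: "\<psi> \<in> borel_measurable S"
    and int: "integrable P \<phi>" "integrable P (\<lambda>x. (\<psi> x)\<^sup>2)" "integrable P (\<lambda>x. \<phi> x * (\<psi> x)\<^sup>2)"
    and centered: "(\<integral>x. \<psi> x \<partial>P) = 0" and i: "i \<in> {1..N}"
  shows "integrable M (\<lambda>\<omega>. \<phi> (V i \<omega>) * ((\<Sum>j=1..N. \<psi> (V j \<omega>)) / real N)\<^sup>2)"
    and "(\<integral>\<omega>. \<phi> (V i \<omega>) * ((\<Sum>j=1..N. \<psi> (V j \<omega>)) / real N)\<^sup>2 \<partial>M)
       \<le> ((\<integral>x. \<phi> x * (\<psi> x)\<^sup>2 \<partial>P) + (\<integral>x. \<phi> x \<partial>P) * (\<integral>x. (\<psi> x)\<^sup>2 \<partial>P)) / real N"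
proof -
  interpret P: prob_space P by (rule P)
  have N: "0 < real N" using i by simp
  have V: "V j \<in> measurable M S" if "j \<in> {1..N}" for j using ind that by (auto simp: indep_vars_def)
  have Pm: "f \<in> borel_measurable P" if "f \<in> borel_measurable S" for f :: "'p \<Rightarrow> real"
    using that P(2) by (simp cong: measurable_cong_sets)
  have abs_le: "\<bar>y\<bar> \<le> 1 + y\<^sup>2" for y :: real
    using sum_squares_bound[of 1 "\<bar>y\<bar>"] by (simp add: power2_eq_square)
  have int\<psi>: "integrable P \<psi>"
    by (rule Bochner_Integration.integrable_bound[where f="\<lambda>x. 1 + (\<psi> x)\<^sup>2"]) (use int Pm[OF \<psi>] abs_le in auto)
  have int\<phi>\<psi>: "integrable P (\<lambda>x. \<phi> x * \<psi> x)"
  proof (rule Bochner_Integration.integrable_bound[where f="\<lambda>x. \<phi> x + \<phi> x * (\<psi> x)\<^sup>2"])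
    show "(\<lambda>x. \<phi> x * \<psi> x) \<in> borel_measurable P" using Pm[OF \<phi>(1)] Pm[OF \<psi>] by measurable
    have "\<phi> x * \<bar>\<psi> x\<bar> \<le> \<phi> x * (1 + (\<psi> x)\<^sup>2)" for x by (rule mult_left_mono[OF abs_le \<phi>(2)])
    then show "AE x in P. norm (\<phi> x * \<psi> x) \<le> norm (\<phi> x + \<phi> x * (\<psi> x)\<^sup>2)"
      using \<phi>(2) by (intro AE_I2) (simp add: abs_mult distrib_left)
  qed (use int in auto)
  \<comment> \<open>the factor that the index \<open>r\<close> contributes to the product of the weight and the two fluctuations\<close>
  define G where "G j l r x = (if r = i then \<phi> x else 1) * ((if r = j then \<psi> x else 1) * (if r = l then \<psi> x else 1))" for j l r :: nat and x
  have Gm: "G j l r \<in> borel_measurable S" for j l r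
    unfolding G_def[abs_def] using \<phi>(1) \<psi> by measurable
  have Gint: "integrable P (G j l r)" for j l r
    using int int\<psi> int\<phi>\<psi> unfolding G_def[abs_def]
    by (cases "r = i"; cases "r = j"; cases "r = l") (simp_all add: power2_eq_square)
  have Gind: "indep_vars (\<lambda>_. borel) (\<lambda>r \<omega>. G j l r (V r \<omega>)) {1..N}" for j l
    by (rule indep_vars_compose2[OF ind Gm])
  have Gdistr: "integrable M (\<lambda>\<omega>. G j l r (V r \<omega>))" "(\<integral>\<omega>. G j l r (V r \<omega>) \<partial>M) = (\<integral>x. G j l r x \<partial>P)" if "r \<in> {1..N}" for j l r
    using Gint[of j l r] integrable_distr_eq[OF V[OF that] Gm] integral_distr[OF V[OF that] Gm] law[OF that] by auto
  have prod: "\<phi> (V i \<omega>) * (\<psi> (V j \<omega>) * \<psi> (V l \<omega>)) = (\<Prod>r\<in>{1..N}. G j l r (V r \<omega>))" if "j \<in> {1..N}" "l \<in> {1..N}" for j l \<omega>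
    using that i by (simp add: G_def prod.distrib prod.delta' cong: if_cong)
  have Iint: "integrable M (\<lambda>\<omega>. \<phi> (V i \<omega>) * (\<psi> (V j \<omega>) * \<psi> (V l \<omega>)))" if "j \<in> {1..N}" "l \<in> {1..N}" for j l
    unfolding prod[OF that] by (rule indep_vars_integrable[OF _ Gind Gdistr(1)]) auto
  have Ival: "(\<integral>\<omega>. \<phi> (V i \<omega>) * (\<psi> (V j \<omega>) * \<psi> (V l \<omega>)) \<partial>M) = (\<Prod>r\<in>{1..N}. \<integral>x. G j l r x \<partial>P)" if "j \<in> {1..N}" "l \<in> {1..N}" for j l
    unfolding prod[OF that] by (subst indep_vars_lebesgue_integral[OF _ Gind Gdistr(1)]) (auto intro!: prod.cong simp: Gdistr(2))
  let ?A = "\<integral>x. \<phi> x * (\<psi> x)\<^sup>2 \<partial>P" and ?B = "(\<integral>x. \<phi> x \<partial>P) * (\<integral>x. (\<psi> x)\<^sup>2 \<partial>P)"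
  have A0: "0 \<le> ?A" "0 \<le> ?B" using \<phi>(2) by (auto intro!: mult_nonneg_nonneg Bochner_Integration.integral_nonneg)
  have off: "(\<integral>\<omega>. \<phi> (V i \<omega>) * (\<psi> (V j \<omega>) * \<psi> (V l \<omega>)) \<partial>M) = 0" if jl: "j \<in> {1..N}" "l \<in> {1..N}" "j \<noteq> l" for j l
  proof -
    \<comment> \<open>an index different from \<open>i\<close> that carries exactly one factor \<open>\<psi>\<close>\<close>
    define r where "r = (if l = i then j else l)"
    have "G j l r = \<psi>" using jl(3) by (auto simp: G_def r_def fun_eq_iff)
    then have "(\<integral>x. G j l r x \<partial>P) = 0" using centered by simp
    moreover have "r \<in> {1..N}" using jl by (simp add: r_def)
    ultimately show ?thesis unfolding Ival[OF jl(1,2)] by (intro prod_zero) auto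
  qed
  have diag: "(\<integral>\<omega>. \<phi> (V i \<omega>) * (\<psi> (V j \<omega>) * \<psi> (V j \<omega>)) \<partial>M) \<le> ?A + ?B" if j: "j \<in> {1..N}" for j
  proof (cases "j = i")
    case True
    have "(\<Prod>r\<in>{1..N}. \<integral>x. G j j r x \<partial>P) = (\<Prod>r\<in>{1..N}. if r = i then ?A else 1)"
      by (intro prod.cong) (auto simp: G_def True power2_eq_square P.prob_space)
    then show ?thesis unfolding Ival[OF j j] using i A0 by simp
  next
    case False
    have "(\<Prod>r\<in>{1..N}. \<integral>x. G j j r x \<partial>P) = (\<Prod>r\<in>{1..N}. (if r = i then \<integral>x. \<phi> x \<partial>P else 1) * (if r = j then \<integral>x. (\<psi> x)\<^sup>2 \<partial>P else 1))"
      using False by (intro prod.cong) (auto simp: G_def power2_eq_square P.prob_space)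
    then show ?thesis unfolding Ival[OF j j] using i j A0 by (simp add: prod.distrib)
  qed
  have expand: "\<phi> (V i \<omega>) * ((\<Sum>j=1..N. \<psi> (V j \<omega>)) / real N)\<^sup>2 = (\<Sum>j=1..N. \<Sum>l=1..N. \<phi> (V i \<omega>) * (\<psi> (V j \<omega>) * \<psi> (V l \<omega>))) / (real N)\<^sup>2" for \<omega>
  proof -
    have "(\<Sum>j=1..N. \<psi> (V j \<omega>))\<^sup>2 = (\<Sum>j=1..N. \<Sum>l=1..N. \<psi> (V j \<omega>) * \<psi> (V l \<omega>))"
      by (simp only: power2_eq_square sum_product)
    then show ?thesis by (simp only: power_divide times_divide_eq_right sum_distrib_left)
  qed
  show "integrable M (\<lambda>\<omega>. \<phi> (V i \<omega>) * ((\<Sum>j=1..N. \<psi> (V j \<omega>)) / real N)\<^sup>2)"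
    unfolding expand by (intro integrable_divide Bochner_Integration.integrable_sum Iint)
  have double: "(\<Sum>j=1..N. \<Sum>l=1..N. \<integral>\<omega>. \<phi> (V i \<omega>) * (\<psi> (V j \<omega>) * \<psi> (V l \<omega>)) \<partial>M) \<le> real N * (?A + ?B)"
  proof -
    have "(\<Sum>l=1..N. \<integral>\<omega>. \<phi> (V i \<omega>) * (\<psi> (V j \<omega>) * \<psi> (V l \<omega>)) \<partial>M) \<le> ?A + ?B" if j: "j \<in> {1..N}" for j
    proof -
      have "(\<Sum>l=1..N. \<integral>\<omega>. \<phi> (V i \<omega>) * (\<psi> (V j \<omega>) * \<psi> (V l \<omega>)) \<partial>M) = (\<Sum>l\<in>{j}. \<integral>\<omega>. \<phi> (V i \<omega>) * (\<psi> (V j \<omega>) * \<psi> (V l \<omega>)) \<partial>M)"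
        by (rule sum.mono_neutral_right) (use j off in auto)
      then show ?thesis using diag[OF j] by simp
    qed
    then have "(\<Sum>j=1..N. \<Sum>l=1..N. \<integral>\<omega>. \<phi> (V i \<omega>) * (\<psi> (V j \<omega>) * \<psi> (V l \<omega>)) \<partial>M) \<le> (\<Sum>j=1..N. ?A + ?B)"
      by (rule sum_mono)
    then show ?thesis by simp
  qed
  have "(\<integral>\<omega>. \<phi> (V i \<omega>) * ((\<Sum>j=1..N. \<psi> (V j \<omega>)) / real N)\<^sup>2 \<partial>M) = (\<Sum>j=1..N. \<Sum>l=1..N. \<integral>\<omega>. \<phi> (V i \<omega>) * (\<psi> (V j \<omega>) * \<psi> (V l \<omega>)) \<partial>M) / (real N)\<^sup>2"
    unfolding expand integral_divide_zero
    by (subst Bochner_Integration.integral_sum, intro Bochner_Integration.integrable_sum Iint, assumption+)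
      (intro arg_cong2[where f="(/)"] sum.cong Bochner_Integration.integral_sum Iint refl, assumption+)
  also have "\<dots> \<le> (real N * (?A + ?B)) / (real N)\<^sup>2" by (rule divide_right_mono[OF double]) simp
  also have "\<dots> = (?A + ?B) / real N" using N by (simp add: power2_eq_square)
  finally show "(\<integral>\<omega>. \<phi> (V i \<omega>) * ((\<Sum>j=1..N. \<psi> (V j \<omega>)) / real N)\<^sup>2 \<partial>M) \<le> (?A + ?B) / real N" .
qed

lemma square_integral_le:
  fixes e :: "real \<Rightarrow> real"
  assumes e: "continuous_on {0..T} e" and T: "0 < T"
  shows "(LBINT s:{0..T}. e s)\<^sup>2 \<le> T * (LBINT s:{0..T}. (e s)\<^sup>2)"
proof -
  let ?I = "LBINT s:{0..T}. e s"
  note i1 = borel_integrable_atLeastAtMost'[OF e]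
  have i2: "set_integrable lborel {0..T} (\<lambda>s. (e s)\<^sup>2)"
    by (rule borel_integrable_atLeastAtMost') (intro continuous_intros e)
  have const: "(LBINT s:{0..T}. a) = T * a" for a using T by (simp add: set_lebesgue_integral_def)
  have i3: "set_integrable lborel {0..T} (\<lambda>s. a)" for a :: real by (rule borel_integrable_atLeastAtMost') simp
  have "0 \<le> (LBINT s:{0..T}. (e s - ?I / T)\<^sup>2)" by (rule set_integral_nonneg_on) simp
  also have "\<dots> = (LBINT s:{0..T}. ((e s)\<^sup>2 - (2 * ?I / T) * e s) + (?I / T)\<^sup>2)"
    by (intro set_lebesgue_integral_cong) (auto simp: power2_eq_square algebra_simps)
  also have "\<dots> = (LBINT s:{0..T}. (e s)\<^sup>2) - (2 * ?I / T) * ?I + T * (?I / T)\<^sup>2"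
    using i1 i2 i3 const by (simp add: set_integral_add(2) set_integral_diff set_integrable_mult_right)
  also have "\<dots> = (LBINT s:{0..T}. (e s)\<^sup>2) - ?I\<^sup>2 / T"
    using T by (simp add: power2_eq_square field_simps)
  finally show ?thesis using T by (simp add: field_simps)
qed

context mean_field begin

text \<open>
  Each particle differs from its mean-field copy by at most \<open>\<omega> i ^ b * U t\<close> with a
  common \<open>U\<close>, because the difference of the two rates does not depend on the particle.
  Averaging the resulting Lipschitz bounds closes a scalar Gronwall inequality with constant
  \<open>K\<close>.
\<close>

lemma coupling_pathwise:
  fixes x y z :: "nat \<Rightarrow> real \<Rightarrow> real" and \<omega> :: "nat \<Rightarrow> real" and N :: nat
  assumes N: "1 \<le> N" and m: "m \<in> rates"
    and x: "\<And>j. j \<in> {1..N} \<Longrightarrow> continuous_on {0..T} (x j)" and y: "\<And>j. j \<in> {1..N} \<Longrightarrow> continuous_on {0..T} (y j)"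
    and xb: "\<And>j t. j \<in> {1..N} \<Longrightarrow> t \<in> {0..T} \<Longrightarrow> \<bar>x j t\<bar> \<le> \<omega> j - 1"
    and yb: "\<And>j t. j \<in> {1..N} \<Longrightarrow> t \<in> {0..T} \<Longrightarrow> \<bar>y j t\<bar> \<le> \<omega> j - 1"
    and xeq: "\<And>j t. j \<in> {1..N} \<Longrightarrow> t \<in> {0..T} \<Longrightarrow> x j t = z j t - (LBINT s:{0..t}. f (x j s) + m s * g (x j s))"
    and yeq: "\<And>j t. j \<in> {1..N} \<Longrightarrow> t \<in> {0..T} \<Longrightarrow> y j t = z j t - (LBINT s:{0..t}. f (y j s) + (\<Sum>l=1..N. h (y l s)) / real N * g (y j s))"
    and i: "i \<in> {1..N}" and t: "t \<in> {0..T}"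
  defines "K \<equiv> (\<Sum>j=1..N. Ch * \<omega> j ^ (b + c)) / real N"
    and "E \<equiv> LBINT s:{0..T}. \<bar>(\<Sum>j=1..N. h (x j s)) / real N - m s\<bar>"
  shows "\<bar>y i t - x i t\<bar> \<le> \<omega> i ^ b * (E * (1 + T * K * exp (K * T)))"
proof -
  let ?e = "\<lambda>s. \<bar>(\<Sum>j=1..N. h (x j s)) / real N - m s\<bar>"
  let ?S = "\<lambda>s. (\<Sum>j=1..N. Ch * \<omega> j ^ c * \<bar>y j s - x j s\<bar>) / real N"
  have N0: "0 < real N" using N by simp
  have w1: "1 \<le> \<omega> j" if "j \<in> {1..N}" for j
    using xb[OF that t] by linarith
  have cH: "continuous_on {0..T} (\<lambda>s. (\<Sum>j=1..N. h (u j s)) / real N)" if "\<And>j. j \<in> {1..N} \<Longrightarrow> continuous_on {0..T} (u j)" for u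
    using N0 by (intro continuous_intros continuous_on_compose2[OF cont_h that]) auto
  have ce: "continuous_on {0..T} ?e"
    by (intro continuous_on_rabs continuous_on_diff cH x ratesD(1)[OF m])
  have cS: "continuous_on {0..T} ?S" using N0 x y by (intro continuous_intros) auto
  have cSe: "continuous_on {0..T} (\<lambda>s. ?S s + ?e s)" by (rule continuous_on_add[OF cS ce])
  have e0: "0 \<le> ?e s" for s by simp
  have S0: "0 \<le> ?S s" for s
    using N0 Ch w1 by (intro divide_nonneg_pos sum_nonneg mult_nonneg_nonneg) (auto intro: order_trans[OF zero_le_one] zero_le_power)
  have K0: "0 \<le> K"
    unfolding K_def using N0 Ch w1 by (intro divide_nonneg_pos sum_nonneg mult_nonneg_nonneg) (auto intro: order_trans[OF zero_le_one] zero_le_power)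
  have diff: "\<bar>(\<Sum>l=1..N. h (y l s)) / real N - m s\<bar> \<le> ?S s + ?e s" if s: "s \<in> {0..T}" for s
  proof -
    have "\<bar>(\<Sum>l=1..N. h (y l s)) / real N - (\<Sum>l=1..N. h (x l s)) / real N\<bar> = \<bar>\<Sum>l=1..N. h (y l s) - h (x l s)\<bar> / real N"
      by (simp add: sum_subtractf diff_divide_distrib[symmetric])
    moreover have "\<bar>\<Sum>l=1..N. h (y l s) - h (x l s)\<bar> \<le> (\<Sum>l=1..N. Ch * \<omega> l ^ c * \<bar>y l s - x l s\<bar>)"
    proof (rule order_trans[OF sum_abs sum_mono])
      fix l assume l: "l \<in> {1..N}"
      show "\<bar>h (y l s) - h (x l s)\<bar> \<le> Ch * \<omega> l ^ c * \<bar>y l s - x l s\<bar>"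
        using h_lip[OF yb[OF l s] xb[OF l s]] by simp
    qed
    ultimately have "\<bar>(\<Sum>l=1..N. h (y l s)) / real N - (\<Sum>l=1..N. h (x l s)) / real N\<bar> \<le> ?S s"
      using N0 by (simp add: divide_right_mono)
    then show ?thesis by linarith
  qed
  define U where "U t = (LBINT s:{0..t}. ?S s + ?e s)" for t
  have D: "\<bar>y j t - x j t\<bar> \<le> \<omega> j ^ b * U t" if j: "j \<in> {1..N}" and t: "t \<in> {0..T}" for j t
  proof -
    have "\<bar>y j t - x j t\<bar> \<le> (LBINT s:{0..t}. \<omega> j ^ b * (?S s + ?e s))"
    proof (rule forced_solution_compare[where c="\<lambda>s. (\<Sum>l=1..N. h (y l s)) / real N" and c'=m and z="z j" and X="y j" and X'="x j", OF mono_f mono_g])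
      show "0 \<le> (\<Sum>l=1..N. h (y l s)) / real N" for s by (intro divide_nonneg_nonneg sum_nonneg h_nonneg) auto
      show "set_integrable lborel {0..T} (\<lambda>s. f (y j s) + (\<Sum>l=1..N. h (y l s)) / real N * g (y j s))"
        by (intro borel_integrable_atLeastAtMost' continuous_drift cH y j)
      show "set_integrable lborel {0..T} (\<lambda>s. f (x j s) + m s * g (x j s))"
        by (intro borel_integrable_atLeastAtMost' continuous_drift x j ratesD(1)[OF m])
      show "set_integrable lborel {0..T} (\<lambda>s. \<omega> j ^ b * (?S s + ?e s))"
        by (rule borel_integrable_atLeastAtMost'[OF continuous_on_mult_left[OF cSe]])
      show "\<bar>(\<Sum>l=1..N. h (y l s)) / real N - m s\<bar> * \<bar>g (x j s)\<bar> \<le> \<omega> j ^ b * (?S s + ?e s)" if s: "s \<in> {0..T}" for s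
      proof -
        have "\<bar>g (x j s)\<bar> \<le> \<omega> j ^ b" using g_growth[OF xb[OF j s]] by simp
        then have "\<bar>(\<Sum>l=1..N. h (y l s)) / real N - m s\<bar> * \<bar>g (x j s)\<bar> \<le> (?S s + ?e s) * \<omega> j ^ b"
          using diff[OF s] S0[of s] e0[of s] by (intro mult_mono) auto
        then show ?thesis by (simp only: mult.commute)
      qed
    qed (use x y j t yeq[OF j] xeq[OF j] in auto)
    then show ?thesis by (simp add: U_def)
  qed
  have Ule: "U t \<le> E + (LBINT s:{0..t}. ?S s)" if t: "t \<in> {0..T}" for t
  proof -
    have sub: "{0..t} \<subseteq> {0..T}" using t by auto
    note iS = borel_integrable_atLeastAtMost'[OF continuous_on_subset[OF cS sub]]
      and ie = borel_integrable_atLeastAtMost'[OF continuous_on_subset[OF ce sub]]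
    have "E = (LBINT s:{0..t}. ?e s) + (LBINT s:{t<..T}. ?e s)"
      unfolding E_def by (rule set_integral_split_Icc[OF borel_integrable_atLeastAtMost'[OF ce]]) (use t in auto)
    moreover have "0 \<le> (LBINT s:{t<..T}. ?e s)" by (rule set_integral_nonneg_on) (rule e0)
    moreover have "U t = (LBINT s:{0..t}. ?S s) + (LBINT s:{0..t}. ?e s)"
      unfolding U_def by (rule set_integral_add(2)[OF iS ie])
    ultimately show ?thesis by linarith
  qed
  have SU: "?S t \<le> K * U t" if t: "t \<in> {0..T}" for t
  proof -
    have "(\<Sum>j=1..N. Ch * \<omega> j ^ c * \<bar>y j t - x j t\<bar>) \<le> (\<Sum>j=1..N. Ch * \<omega> j ^ c * (\<omega> j ^ b * U t))"
      using D[OF _ t] w1 Ch by (intro sum_mono mult_left_mono mult_nonneg_nonneg) (auto intro: order_trans[OF zero_le_one] zero_le_power)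
    also have "\<dots> = (\<Sum>j=1..N. Ch * \<omega> j ^ (b + c)) * U t"
      unfolding sum_distrib_right by (intro sum.cong refl) (simp add: power_add mult_ac)
    finally show ?thesis unfolding K_def using N0 by (simp add: divide_right_mono)
  qed
  have E0: "0 \<le> E" unfolding E_def by (rule set_integral_nonneg_on) simp
  obtain B where B: "\<And>s. s \<in> {0..T} \<Longrightarrow> ?S s \<le> B"
    using continuous_bounded_above[OF cS] by blast
  have Sg: "?S s \<le> K * E * exp (K * T)" if s: "s \<in> {0..T}" for s
  proof -
    have "?S s \<le> K * E * exp (K * s)"
    proof (rule gronwall[OF borel_integrable_atLeastAtMost'[OF cS] K0 B _ s])
      show "?S r \<le> K * E + K * (LBINT s:{0..r}. ?S s)" if "r \<in> {0..T}" for r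
        using SU[OF that] mult_left_mono[OF Ule[OF that] K0] by (simp add: distrib_left)
    qed
    also have "\<dots> \<le> K * E * exp (K * T)"
      using K0 E0 s by (intro mult_left_mono) (auto intro: mult_left_mono)
    finally show ?thesis .
  qed
  have sub: "{0..t} \<subseteq> {0..T}" using t by auto
  have "(LBINT s:{0..t}. ?S s) \<le> (LBINT s:{0..t}. K * E * exp (K * T))"
    by (rule set_integral_mono[OF borel_integrable_atLeastAtMost'[OF continuous_on_subset[OF cS sub]]
          borel_integrable_atLeastAtMost'[OF continuous_on_const] Sg]) (use sub in blast)
  also have "\<dots> = t * (K * E * exp (K * T))" using t by (simp add: set_lebesgue_integral_def)
  also have "\<dots> \<le> T * (K * E * exp (K * T))" using t K0 E0 by (intro mult_right_mono) auto
  finally have "U t \<le> E * (1 + T * K * exp (K * T))" using Ule[OF t] by (simp add: algebra_simps)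
  then have "\<omega> i ^ b * U t \<le> \<omega> i ^ b * (E * (1 + T * K * exp (K * T)))"
    using w1[OF i] by (intro mult_left_mono) auto
  then show ?thesis using D[OF i t] by linarith
qed

end

text \<open>Tonelli, after making the continuous process jointly measurable.\<close>

lemma (in prob_space) nn_integral_time_integral_le:
  fixes X :: "real \<Rightarrow> 'a \<Rightarrow> real"
  assumes X: "\<And>s. s \<in> {0..T} \<Longrightarrow> X s \<in> borel_measurable M" and T: "0 < T"
    and cont: "\<And>\<omega>. \<omega> \<in> space M \<Longrightarrow> continuous_on {0..T} (\<lambda>s. X s \<omega>)"
    and X0: "\<And>s \<omega>. 0 \<le> X s \<omega>"
    and B: "\<And>s. s \<in> {0..T} \<Longrightarrow> (\<integral>\<^sup>+\<omega>. ennreal (X s \<omega>) \<partial>M) \<le> ennreal B"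
  shows "(\<integral>\<^sup>+\<omega>. ennreal (LBINT s:{0..T}. X s \<omega>) \<partial>M) \<le> ennreal (T * B)"
proof -
  interpret PS: pair_sigma_finite M lborel by unfold_locales
  define H where "H = (\<lambda>(\<omega>, s). ennreal (X (max 0 (min T s)) \<omega>) * indicator {0..T} s)"
  have J: "(\<lambda>(\<omega>, s). X (max 0 (min T s)) \<omega>) \<in> borel_measurable (M \<Otimes>\<^sub>M borel)"
    by (rule measurable_joint_continuous[OF X _ cont]) (use T in auto)
  have "H \<in> borel_measurable (M \<Otimes>\<^sub>M borel)"
    unfolding H_def using J by measurable
  then have Hm: "H \<in> borel_measurable (M \<Otimes>\<^sub>M lborel)" by (simp cong: measurable_cong_sets)
  have eq: "ennreal (LBINT s:{0..T}. X s \<omega>) = (\<integral>\<^sup>+s. H (\<omega>, s) \<partial>lborel)" if \<omega>: "\<omega> \<in> space M" for \<omega>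
  proof -
    have "set_integrable lborel {0..T} (\<lambda>s. X s \<omega>)" by (rule borel_integrable_atLeastAtMost'[OF cont[OF \<omega>]])
    then have "ennreal (LBINT s:{0..T}. X s \<omega>) = (\<integral>\<^sup>+s. ennreal (indicator {0..T} s *\<^sub>R X s \<omega>) \<partial>lborel)"
      unfolding set_lebesgue_integral_def set_integrable_def
      by (intro nn_integral_eq_integral[symmetric]) (use X0 in auto)
    also have "\<dots> = (\<integral>\<^sup>+s. H (\<omega>, s) \<partial>lborel)"
      by (intro nn_integral_cong) (auto simp: H_def indicator_def)
    finally show ?thesis .
  qed
  have "(\<integral>\<^sup>+\<omega>. ennreal (LBINT s:{0..T}. X s \<omega>) \<partial>M) = (\<integral>\<^sup>+\<omega>. \<integral>\<^sup>+s. H (\<omega>, s) \<partial>lborel \<partial>M)"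
    by (intro nn_integral_cong eq)
  also have "\<dots> = (\<integral>\<^sup>+s. \<integral>\<^sup>+\<omega>. H (\<omega>, s) \<partial>M \<partial>lborel)" by (rule PS.Fubini[OF Hm, symmetric])
  also have "\<dots> \<le> (\<integral>\<^sup>+s. ennreal B * indicator {0..T} s \<partial>lborel)"
    by (intro nn_integral_mono) (auto simp: H_def indicator_def intro: B)
  also have "\<dots> = ennreal B * ennreal T" using T by (simp add: nn_integral_cmult)
  also have "\<dots> = ennreal (T * B)" unfolding mult.commute[of T B]
    by (rule ennreal_mult''[symmetric]) (use T in simp)
  finally show ?thesis .
qed

context mean_field begin

lemma weight_moment_ge_1:
  assumes P: "driving_law P" and j: "j \<le> moment_degree"
  shows "1 \<le> (\<integral>w. weight w ^ j \<partial>P)" "(\<integral>w. weight w ^ j \<partial>P) \<le> (\<integral>w. weight w ^ moment_degree \<partial>P)"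
proof -
  interpret P: prob_space P using P by (simp add: driving_law_def)
  have "(\<integral>w. 1 \<partial>P) \<le> (\<integral>w. weight w ^ j \<partial>P)"
    by (intro integral_mono weight_power_integrable[OF P j] one_le_power weight_ge_1) simp
  then show "1 \<le> (\<integral>w. weight w ^ j \<partial>P)" by (simp add: P.prob_space)
  show "(\<integral>w. weight w ^ j \<partial>P) \<le> (\<integral>w. weight w ^ moment_degree \<partial>P)"
    by (intro integral_mono weight_power_integrable[OF P] power_increasing[OF j weight_ge_1] j order_refl)
qed

text \<open>
  The law of large numbers in the form used for both error terms: the powers of the weight add up to at
  most \<open>moment_degree\<close>.
\<close>

lemma weighted_fluctuation:
  fixes V :: "nat \<Rightarrow> 'a \<Rightarrow> real \<Rightarrow> real"
  assumes M: "prob_space M"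
    and ind: "prob_space.indep_vars M (\<lambda>_. path_space T) V {1..N}"
    and law: "\<And>j. j \<in> {1..N} \<Longrightarrow> distr M (path_space T) (V j) = P" and P: "driving_law P"
    and \<psi>: "\<psi> \<in> borel_measurable (path_space T)" and bound: "\<And>w. \<bar>\<psi> w\<bar> \<le> A * weight w ^ r"
    and A: "0 \<le> A" and ar: "2 * a + 2 * r \<le> moment_degree" and centered: "(\<integral>w. \<psi> w \<partial>P) = 0" and i: "i \<in> {1..N}"
  shows "(\<integral>\<^sup>+\<omega>. ennreal (weight (V i \<omega>) ^ (2 * a) * ((\<Sum>j=1..N. \<psi> (V j \<omega>)) / real N)\<^sup>2) \<partial>M)
       \<le> ennreal (2 * A\<^sup>2 * (\<integral>w. weight w ^ moment_degree \<partial>P)\<^sup>2 / real N)"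
proof -
  interpret M: prob_space M by (rule M)
  let ?\<Lambda> = "\<integral>w. weight w ^ moment_degree \<partial>P"
  have \<Lambda>: "1 \<le> ?\<Lambda>" by (rule weight_moment_ge_1(1)[OF P order_refl])
  have pP: "prob_space P" "sets P = sets (path_space T)" using P by (auto simp: driving_law_def)
  note \<psi>P = driving_law_measurable[OF P \<psi>] and wtP = driving_law_measurable[OF P measurable_weight]
  have w0: "0 \<le> weight w ^ j" for w j using weight_ge_1[of w] by simp
  have sq: "weight w ^ j * (\<psi> w)\<^sup>2 \<le> A\<^sup>2 * weight w ^ moment_degree" if j: "j \<le> 2 * a" for w j
  proof -
    have "(\<psi> w)\<^sup>2 \<le> (A * weight w ^ r)\<^sup>2" using bound[of w] by (rule abs_le_square_iff[THEN iffD1, OF order_trans[OF _ abs_ge_self]])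
    then have "weight w ^ j * (\<psi> w)\<^sup>2 \<le> weight w ^ j * (A * weight w ^ r)\<^sup>2" by (rule mult_left_mono[OF _ w0])
    also have "\<dots> = A\<^sup>2 * weight w ^ (j + 2 * r)" by (simp add: power_mult_distrib power_add power_mult[symmetric] mult_ac)
    also have "\<dots> \<le> A\<^sup>2 * weight w ^ moment_degree" using j ar by (intro mult_left_mono power_increasing weight_ge_1) auto
    finally show ?thesis .
  qed
  have sqi: "integrable P (\<lambda>w. weight w ^ j * (\<psi> w)\<^sup>2)" "(\<integral>w. weight w ^ j * (\<psi> w)\<^sup>2 \<partial>P) \<le> A\<^sup>2 * ?\<Lambda>" if j: "j \<le> 2 * a" for j
  proof -
    have i: "integrable P (\<lambda>w. A\<^sup>2 * weight w ^ moment_degree)" by (intro integrable_mult_right weight_power_integrable[OF P] order_refl)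
    show 1: "integrable P (\<lambda>w. weight w ^ j * (\<psi> w)\<^sup>2)"
    proof (rule Bochner_Integration.integrable_bound[OF i])
      show "(\<lambda>w. weight w ^ j * (\<psi> w)\<^sup>2) \<in> borel_measurable P" using \<psi>P wtP by measurable
      show "AE w in P. norm (weight w ^ j * (\<psi> w)\<^sup>2) \<le> norm (A\<^sup>2 * weight w ^ moment_degree)"
        using sq[OF j] w0 by (intro AE_I2) (simp add: abs_mult)
    qed
    have "(\<integral>w. weight w ^ j * (\<psi> w)\<^sup>2 \<partial>P) \<le> (\<integral>w. A\<^sup>2 * weight w ^ moment_degree \<partial>P)"
      by (rule integral_mono[OF 1 i sq[OF j]])
    then show "(\<integral>w. weight w ^ j * (\<psi> w)\<^sup>2 \<partial>P) \<le> A\<^sup>2 * ?\<Lambda>" by simp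
  qed
  have \<phi>i: "integrable P (\<lambda>w. weight w ^ (2 * a))" using ar by (intro weight_power_integrable[OF P]) simp
  note s0 = sqi[of 0, simplified] and sa = sqi[of "2 * a", OF order_refl]
  have \<phi>m: "(\<lambda>w. weight w ^ (2 * a)) \<in> borel_measurable (path_space T)" using measurable_weight by measurable
  note mean = M.weighted_mean_square[OF ind law pP \<phi>m w0 \<psi> \<phi>i s0(1) sa(1) centered i]
  have "(\<integral>w. weight w ^ (2 * a) * (\<psi> w)\<^sup>2 \<partial>P) + (\<integral>w. weight w ^ (2 * a) \<partial>P) * (\<integral>w. (\<psi> w)\<^sup>2 \<partial>P) \<le> A\<^sup>2 * ?\<Lambda> + ?\<Lambda> * (A\<^sup>2 * ?\<Lambda>)"
    using weight_moment_ge_1[OF P, of "2 * a"] ar s0(2) sa(2) \<Lambda> by (intro add_mono mult_mono) auto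
  also have "\<dots> \<le> A\<^sup>2 * ?\<Lambda> * ?\<Lambda> + ?\<Lambda> * (A\<^sup>2 * ?\<Lambda>)"
    using \<Lambda> mult_left_mono[OF \<Lambda>, of "A\<^sup>2 * ?\<Lambda>"] by simp
  also have "\<dots> = 2 * A\<^sup>2 * ?\<Lambda>\<^sup>2" by (simp add: power2_eq_square)
  finally have "((\<integral>w. weight w ^ (2 * a) * (\<psi> w)\<^sup>2 \<partial>P) + (\<integral>w. weight w ^ (2 * a) \<partial>P) * (\<integral>w. (\<psi> w)\<^sup>2 \<partial>P)) / real N \<le> 2 * A\<^sup>2 * ?\<Lambda>\<^sup>2 / real N"
    by (rule divide_right_mono) simp
  then have "ennreal (\<integral>\<omega>. weight (V i \<omega>) ^ (2 * a) * ((\<Sum>j=1..N. \<psi> (V j \<omega>)) / real N)\<^sup>2 \<partial>M) \<le> ennreal (2 * A\<^sup>2 * ?\<Lambda>\<^sup>2 / real N)"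
    by (intro ennreal_leI) (rule order_trans[OF mean(2)])
  also have "ennreal (\<integral>\<omega>. weight (V i \<omega>) ^ (2 * a) * ((\<Sum>j=1..N. \<psi> (V j \<omega>)) / real N)\<^sup>2 \<partial>M)
     = (\<integral>\<^sup>+\<omega>. ennreal (weight (V i \<omega>) ^ (2 * a) * ((\<Sum>j=1..N. \<psi> (V j \<omega>)) / real N)\<^sup>2) \<partial>M)"
    by (rule nn_integral_eq_integral[OF mean(1), symmetric]) (auto intro!: AE_I2 mult_nonneg_nonneg w0)
  finally show ?thesis .
qed

definition rate_growth :: "(real \<Rightarrow> real) measure \<Rightarrow> real" where
  "rate_growth P = Ch * (\<integral>w. weight w ^ (b + c) \<partial>P)"

text \<open>
  The Gronwall factor of the coupling with the random constant \<open>K\<close> replaced by one more than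
  its expectation.
\<close>

definition coupling_factor :: "(real \<Rightarrow> real) measure \<Rightarrow> real" where
  "coupling_factor P = 1 + T * (rate_growth P + 1) * exp ((rate_growth P + 1) * T)"

text \<open>
  The first summand comes from the fluctuation of the rate on the event that \<open>K\<close> is close to
  its expectation, the second one from the complementary event.
\<close>

definition chaos_constant :: "(real \<Rightarrow> real) measure \<Rightarrow> real" where
  "chaos_constant P = ((coupling_factor P)\<^sup>2 * T * (T * (2 * (Ch + Ch * (\<integral>w. weight w ^ (c + 1) \<partial>P))\<^sup>2))
     + 4 * (2 * (Ch + rate_growth P)\<^sup>2)) * (\<integral>w. weight w ^ moment_degree \<partial>P)\<^sup>2"

text \<open>
  The event that the random Gronwall constant \<open>K\<close> exceeds its expectation
  \<open>\<kappa>\<close> by more than 1 is not estimated by its probability. Instead the crude bound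
  \<open>4 * weight ^ 2\<close> is multiplied by \<open>(K - \<kappa>)^2 \<ge> 1\<close>, which is again
  a weighted fluctuation of order \<open>1/N\<close>. The supremum over time costs nothing since the
  pathwise bound is uniform in \<open>t\<close>.
\<close>

theorem particle_mean_square:
  fixes V :: "nat \<Rightarrow> 'a \<Rightarrow> real \<Rightarrow> real"
  assumes M: "prob_space M"
    and ind: "prob_space.indep_vars M (\<lambda>_. path_space T) V {1..N}"
    and law: "\<And>j. j \<in> {1..N} \<Longrightarrow> distr M (path_space T) (V j) = P"
    and P: "driving_law P" and m: "is_mean_rate P m" and i: "i \<in> {1..N}"
    and Y: "AE \<omega> in M. \<forall>j\<in>{1..N}. continuous_on {0..T} (\<lambda>t. Y j t \<omega>) \<and> (\<forall>t\<in>{0..T}. \<bar>Y j t \<omega>\<bar> \<le> weight (V j \<omega>) - 1 \<and>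
      Y j t \<omega> = regularize moment_degree T (V j \<omega>) t - (LBINT s:{0..t}. f (Y j s \<omega>) + (\<Sum>l=1..N. h (Y l s \<omega>)) / real N * g (Y j s \<omega>)))"
  shows "(\<integral>\<^sup>+\<omega>. (SUP t\<in>{0..T}. ennreal (\<bar>Y i t \<omega> - solution m (V i \<omega>) t\<bar>\<^sup>2)) \<partial>M) \<le> ennreal (chaos_constant P / real N)"
proof -
  interpret M: prob_space M by (rule M)
  have mr: "m \<in> rates" and m_eq: "\<And>t. t \<in> {0..T} \<Longrightarrow> m t = (\<integral>w. h (solution m w t) \<partial>P)"
    using m by (auto simp: is_mean_rate_def)
  interpret Pp: prob_space P using P by (simp add: driving_law_def)
  have N: "1 \<le> N" "0 < real N" using i by auto
  have V: "V j \<in> measurable M (path_space T)" if "j \<in> {1..N}" for j using ind that by (auto simp: M.indep_vars_def)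
  let ?\<Lambda> = "\<integral>w. weight w ^ moment_degree \<partial>P" and ?I1 = "\<integral>w. weight w ^ (c + 1) \<partial>P"
  define \<kappa> where "\<kappa> = rate_growth P"
  define A where "A = Ch + Ch * ?I1"
  have I1: "1 \<le> ?I1" by (rule weight_moment_ge_1(1)[OF P]) (simp add: moment_degree_def)
  have A0: "0 \<le> A" using I1 Ch by (simp add: A_def)
  have \<kappa>0: "0 \<le> \<kappa>" using weight_moment_ge_1(1)[OF P, of "b + c"] Ch by (simp add: \<kappa>_def rate_growth_def moment_degree_def)
  have w0: "0 \<le> weight w ^ j" for w j using weight_ge_1[of w] by simp
  define \<psi> where "\<psi> s w = h (solution m w s) - m s" for s w
  have hm: "(\<lambda>w. h (solution m w s)) \<in> borel_measurable (path_space T)" if "s \<in> {0..T}" for s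
    by (rule measurable_compose[OF measurable_solution[OF mr that] h_measurable])
  have \<psi>m: "\<psi> s \<in> borel_measurable (path_space T)" if "s \<in> {0..T}" for s
    unfolding \<psi>_def using hm[OF that] by measurable
  have \<psi>b: "\<bar>\<psi> s w\<bar> \<le> A * weight w ^ (c + 1)" if s: "s \<in> {0..T}" for s w
  proof -
    have "m s \<le> (\<integral>w. Ch * weight w ^ (c + 1) \<partial>P)"
      unfolding m_eq[OF s]
      by (intro integral_mono h_solution_integrable[OF P mr s] integrable_mult_right weight_power_integrable[OF P] order_trans[OF abs_ge_self h_solution_bound[OF mr s]])
        (simp add: moment_degree_def)
    then have "m s \<le> (Ch * ?I1) * 1" by simp
    also have "\<dots> \<le> (Ch * ?I1) * weight w ^ (c + 1)"
      using Ch I1 by (intro mult_left_mono one_le_power weight_ge_1) auto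
    finally show ?thesis
      using h_solution_bound[OF mr s, of w] h_nonneg[of "solution m w s"] ratesD(2)[OF mr s]
      unfolding \<psi>_def A_def distrib_right by linarith
  qed
  have \<psi>0: "(\<integral>w. \<psi> s w \<partial>P) = 0" if s: "s \<in> {0..T}" for s
    unfolding \<psi>_def using h_solution_integrable[OF P mr s] m_eq[OF s] by (simp add: Pp.prob_space)
  define \<eta> where "\<eta> w = Ch * weight w ^ (b + c) - \<kappa>" for w
  have \<eta>m: "\<eta> \<in> borel_measurable (path_space T)" unfolding \<eta>_def[abs_def] using measurable_weight by measurable
  have \<eta>b: "\<bar>\<eta> w\<bar> \<le> (Ch + \<kappa>) * weight w ^ (b + c)" for w
    using mult_left_mono[OF one_le_power[OF weight_ge_1[of w], of "b + c"] \<kappa>0] mult_nonneg_nonneg[OF Ch w0, of w "b + c"] \<kappa>0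
    unfolding \<eta>_def distrib_right by linarith
  have \<eta>0: "(\<integral>w. \<eta> w \<partial>P) = 0"
    unfolding \<eta>_def using weight_power_integrable[OF P, of "b + c"] by (simp add: moment_degree_def Pp.prob_space \<kappa>_def rate_growth_def)
  define e where "e s \<omega> = (\<Sum>j=1..N. h (solution m (V j \<omega>) s)) / real N - m s" for s \<omega>
  have e_\<psi>: "e s \<omega> = (\<Sum>j=1..N. \<psi> s (V j \<omega>)) / real N" for s \<omega>
    using N by (simp add: e_def \<psi>_def sum_subtractf diff_divide_distrib)
  have ec: "continuous_on {0..T} (\<lambda>s. e s \<omega>)" for \<omega>
    unfolding e_def using N
    by (intro continuous_intros ratesD(1)[OF mr] continuous_on_compose2[OF cont_h solution_cont[OF mr]]) auto
  define D where "D s \<omega> = weight (V i \<omega>) ^ (2 * b) * (e s \<omega>)\<^sup>2" for s \<omega>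
  have Dc: "continuous_on {0..T} (\<lambda>s. D s \<omega>)" for \<omega> unfolding D_def by (intro continuous_intros ec)
  have Dm: "D s \<in> borel_measurable M" if s: "s \<in> {0..T}" for s
  proof -
    have [measurable]: "(\<lambda>\<omega>. \<psi> s (V j \<omega>)) \<in> borel_measurable M" if "j \<in> {1..N}" for j
      by (rule measurable_compose[OF V[OF that] \<psi>m[OF s]])
    have [measurable]: "(\<lambda>\<omega>. weight (V i \<omega>)) \<in> borel_measurable M" by (rule measurable_compose[OF V[OF i] measurable_weight])
    show ?thesis unfolding D_def[abs_def] e_\<psi> by measurable
  qed
  define G where "G \<omega> = (LBINT s:{0..T}. D s \<omega>)" for \<omega>
  have Gm: "G \<in> borel_measurable M"
    unfolding G_def[abs_def] by (rule measurable_integral_continuous[OF Dm]) (use T Dc in auto)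
  have G0: "0 \<le> G \<omega>" for \<omega> unfolding G_def by (rule set_integral_nonneg_on) (simp add: D_def w0)
  have GI: "(\<integral>\<^sup>+\<omega>. ennreal (G \<omega>) \<partial>M) \<le> ennreal (T * (2 * A\<^sup>2 * ?\<Lambda>\<^sup>2 / real N))"
    unfolding G_def
  proof (rule M.nn_integral_time_integral_le[OF Dm T Dc])
    show "0 \<le> D s \<omega>" for s \<omega> by (simp add: D_def w0)
    show "(\<integral>\<^sup>+\<omega>. ennreal (D s \<omega>) \<partial>M) \<le> ennreal (2 * A\<^sup>2 * ?\<Lambda>\<^sup>2 / real N)" if s: "s \<in> {0..T}" for s
      unfolding D_def e_\<psi>
      by (rule weighted_fluctuation[OF M ind law P \<psi>m[OF s] \<psi>b[OF s] A0 _ \<psi>0[OF s] i]) (simp_all add: moment_degree_def)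
  qed
  define R where "R \<omega> = weight (V i \<omega>) ^ (2 * 1) * ((\<Sum>j=1..N. \<eta> (V j \<omega>)) / real N)\<^sup>2" for \<omega>
  have R0: "0 \<le> R \<omega>" for \<omega> unfolding R_def by (intro mult_nonneg_nonneg w0) simp
  have Rm: "R \<in> borel_measurable M"
  proof -
    have [measurable]: "(\<lambda>\<omega>. \<eta> (V j \<omega>)) \<in> borel_measurable M" if "j \<in> {1..N}" for j
      by (rule measurable_compose[OF V[OF that] \<eta>m])
    have [measurable]: "(\<lambda>\<omega>. weight (V i \<omega>)) \<in> borel_measurable M" by (rule measurable_compose[OF V[OF i] measurable_weight])
    show ?thesis unfolding R_def[abs_def] by measurable
  qed
  have RI: "(\<integral>\<^sup>+\<omega>. ennreal (R \<omega>) \<partial>M) \<le> ennreal (2 * (Ch + \<kappa>)\<^sup>2 * ?\<Lambda>\<^sup>2 / real N)"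
    unfolding R_def
    by (rule weighted_fluctuation[OF M ind law P \<eta>m \<eta>b _ _ \<eta>0 i]) (use Ch \<kappa>0 in \<open>simp_all add: moment_degree_def\<close>)
  let ?C = "coupling_factor P"
  have path: "AE \<omega> in M. (SUP t\<in>{0..T}. ennreal (\<bar>Y i t \<omega> - solution m (V i \<omega>) t\<bar>\<^sup>2)) \<le> ennreal (?C\<^sup>2 * T) * ennreal (G \<omega>) + ennreal 4 * ennreal (R \<omega>)"
    using Y
  proof eventually_elim
    case (elim \<omega>)
    have "\<bar>Y i t \<omega> - solution m (V i \<omega>) t\<bar>\<^sup>2 \<le> ?C\<^sup>2 * T * G \<omega> + 4 * R \<omega>" if t: "t \<in> {0..T}" for t
    proof -
      define K where "K = (\<Sum>j=1..N. Ch * weight (V j \<omega>) ^ (b + c)) / real N"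
      define E where "E = (LBINT s:{0..T}. \<bar>e s \<omega>\<bar>)"
      have K\<eta>: "K - \<kappa> = (\<Sum>j=1..N. \<eta> (V j \<omega>)) / real N"
        using N by (simp add: K_def \<eta>_def sum_subtractf diff_divide_distrib)
      have K0: "0 \<le> K" unfolding K_def using Ch w0 N by (intro divide_nonneg_nonneg sum_nonneg mult_nonneg_nonneg) auto
      have E0: "0 \<le> E" unfolding E_def by (rule set_integral_nonneg_on) simp
      have cp: "\<bar>Y i t \<omega> - solution m (V i \<omega>) t\<bar> \<le> weight (V i \<omega>) ^ b * (E * (1 + T * K * exp (K * T)))"
        unfolding E_def e_def K_def
        by (rule coupling_pathwise[where x="\<lambda>j. solution m (V j \<omega>)" and y="\<lambda>j t. Y j t \<omega>" and z="\<lambda>j. regularize moment_degree T (V j \<omega>)"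
              and \<omega>="\<lambda>j. weight (V j \<omega>)", OF N(1) mr solution_cont[OF mr] _ solution_bound[OF mr] _ solution_solves[OF mr] _ i t])
          (use elim in blast)+
      show ?thesis
      proof (cases "K \<le> \<kappa> + 1")
        case True
        have "K * exp (K * T) \<le> (\<kappa> + 1) * exp ((\<kappa> + 1) * T)"
          using True K0 T by (intro mult_mono) auto
        then have "1 + T * K * exp (K * T) \<le> ?C"
          using mult_left_mono[of "K * exp (K * T)" "(\<kappa> + 1) * exp ((\<kappa> + 1) * T)" T] T
          by (simp add: coupling_factor_def \<kappa>_def mult.assoc)
        then have "weight (V i \<omega>) ^ b * (E * (1 + T * K * exp (K * T))) \<le> weight (V i \<omega>) ^ b * (E * ?C)"
          by (intro mult_left_mono w0 E0)
        with cp have "\<bar>Y i t \<omega> - solution m (V i \<omega>) t\<bar> \<le> weight (V i \<omega>) ^ b * (E * ?C)" by linarith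
        then have "\<bar>Y i t \<omega> - solution m (V i \<omega>) t\<bar>\<^sup>2 \<le> (weight (V i \<omega>) ^ b * (E * ?C))\<^sup>2" by (rule power_mono) simp
        also have "\<dots> = (?C\<^sup>2 * weight (V i \<omega>) ^ (2 * b)) * E\<^sup>2" by (simp add: power_mult_distrib power_mult[symmetric] mult_ac)
        also have "\<dots> \<le> (?C\<^sup>2 * weight (V i \<omega>) ^ (2 * b)) * (T * (LBINT s:{0..T}. (e s \<omega>)\<^sup>2))"
          using square_integral_le[OF continuous_on_rabs[OF ec] T, of \<omega>] w0
          by (intro mult_left_mono) (auto simp: E_def)
        also have "\<dots> = ?C\<^sup>2 * T * G \<omega>" by (simp add: G_def D_def mult_ac)
        finally show ?thesis using R0[of \<omega>] by linarith
      next
        case False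
        then have K1: "1\<^sup>2 \<le> (K - \<kappa>)\<^sup>2" by (intro power_mono) auto
        have "\<bar>Y i t \<omega> - solution m (V i \<omega>) t\<bar> \<le> 2 * weight (V i \<omega>)"
          using solution_bound[OF mr t, of "V i \<omega>"] elim i t by (fastforce intro: order_trans[OF abs_triangle_ineq4])
        then have "\<bar>Y i t \<omega> - solution m (V i \<omega>) t\<bar>\<^sup>2 \<le> (2 * weight (V i \<omega>))\<^sup>2" by (rule power_mono) simp
        also have "\<dots> = 4 * (weight (V i \<omega>) ^ (2 * 1) * 1)" by (simp add: power_mult_distrib)
        also have "\<dots> \<le> 4 * (weight (V i \<omega>) ^ (2 * 1) * (K - \<kappa>)\<^sup>2)"
          using K1 by (intro mult_left_mono w0) auto
        also have "\<dots> = 4 * R \<omega>" by (simp add: R_def K\<eta>)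
        finally have "\<bar>Y i t \<omega> - solution m (V i \<omega>) t\<bar>\<^sup>2 \<le> 4 * R \<omega>" .
        moreover have "0 \<le> ?C\<^sup>2 * T * G \<omega>" using T G0 by simp
        ultimately show ?thesis by linarith
      qed
    qed
    then have "(SUP t\<in>{0..T}. ennreal (\<bar>Y i t \<omega> - solution m (V i \<omega>) t\<bar>\<^sup>2)) \<le> ennreal (?C\<^sup>2 * T * G \<omega> + 4 * R \<omega>)"
      by (intro SUP_least ennreal_leI)
    also have "\<dots> = ennreal (?C\<^sup>2 * T) * ennreal (G \<omega>) + ennreal 4 * ennreal (R \<omega>)"
      using G0 R0 T by (simp add: ennreal_mult ennreal_plus)
    finally show ?case .
  qed
  have "(\<integral>\<^sup>+\<omega>. (SUP t\<in>{0..T}. ennreal (\<bar>Y i t \<omega> - solution m (V i \<omega>) t\<bar>\<^sup>2)) \<partial>M)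
      \<le> (\<integral>\<^sup>+\<omega>. ennreal (?C\<^sup>2 * T) * ennreal (G \<omega>) + ennreal 4 * ennreal (R \<omega>) \<partial>M)"
    by (rule nn_integral_mono_AE[OF path])
  also have "\<dots> = ennreal (?C\<^sup>2 * T) * (\<integral>\<^sup>+\<omega>. ennreal (G \<omega>) \<partial>M) + ennreal 4 * (\<integral>\<^sup>+\<omega>. ennreal (R \<omega>) \<partial>M)"
    using Gm Rm by (simp only: nn_integral_add nn_integral_cmult measurable_compose[OF _ measurable_ennreal] borel_measurable_times_ennreal borel_measurable_const)
  also have "\<dots> \<le> ennreal (?C\<^sup>2 * T) * ennreal (T * (2 * A\<^sup>2 * ?\<Lambda>\<^sup>2 / real N)) + ennreal 4 * ennreal (2 * (Ch + \<kappa>)\<^sup>2 * ?\<Lambda>\<^sup>2 / real N)"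
    by (intro add_mono mult_left_mono GI RI) auto
  also have "\<dots> = ennreal (?C\<^sup>2 * T * (T * (2 * A\<^sup>2 * ?\<Lambda>\<^sup>2 / real N)) + 4 * (2 * (Ch + \<kappa>)\<^sup>2 * ?\<Lambda>\<^sup>2 / real N))"
  proof -
    have nn: "0 \<le> ?C\<^sup>2 * T" "0 \<le> T * (2 * A\<^sup>2 * ?\<Lambda>\<^sup>2 / real N)" "0 \<le> (4 :: real)" "0 \<le> 2 * (Ch + \<kappa>)\<^sup>2 * ?\<Lambda>\<^sup>2 / real N"
      using T by auto
    then show ?thesis by (simp only: ennreal_plus[symmetric] ennreal_mult[symmetric] mult_nonneg_nonneg)
  qed
  also have "?C\<^sup>2 * T * (T * (2 * A\<^sup>2 * ?\<Lambda>\<^sup>2 / real N)) + 4 * (2 * (Ch + \<kappa>)\<^sup>2 * ?\<Lambda>\<^sup>2 / real N) = chaos_constant P / real N"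
    by (simp add: chaos_constant_def A_def \<kappa>_def add_divide_distrib distrib_right)
  finally show ?thesis .
qed

end

section \<open>Propagation of chaos\<close>

lemma (in prob_space) indep_vars_cong_AE:
  assumes X: "indep_vars S X I" and I: "finite I" "I \<noteq> {}"
    and Y: "\<And>i. i \<in> I \<Longrightarrow> Y i \<in> measurable M (S i)" and eq: "\<And>i. i \<in> I \<Longrightarrow> AE \<omega> in M. X i \<omega> = Y i \<omega>"
  shows "indep_vars S Y I"
proof -
  have Xm: "X i \<in> measurable M (S i)" if "i \<in> I" for i using X that by (auto simp: indep_vars_def)
  have "AE \<omega> in M. \<forall>i\<in>I. X i \<omega> = Y i \<omega>" using eq I(1) by (simp add: AE_finite_all)
  then have ae: "AE \<omega> in M. (\<lambda>i\<in>I. X i \<omega>) = (\<lambda>i\<in>I. Y i \<omega>)" by eventually_elim auto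
  have "distr M (PiM I S) (\<lambda>\<omega>. \<lambda>i\<in>I. Y i \<omega>) = distr M (PiM I S) (\<lambda>\<omega>. \<lambda>i\<in>I. X i \<omega>)"
    by (rule distr_cong_AE[symmetric, OF refl refl ae]) (intro measurable_restrict Xm Y, assumption)+
  also have "\<dots> = PiM I (\<lambda>i. distr M (S i) (X i))"
    using X indep_vars_iff_distr_eq_PiM'[where I=I and X=X and M'=S, OF I(2)] Xm by blast
  also have "\<dots> = PiM I (\<lambda>i. distr M (S i) (Y i))"
    by (intro PiM_cong refl distr_cong_AE eq Xm Y)
  finally show ?thesis using indep_vars_iff_distr_eq_PiM'[where I=I and X=Y and M'=S, OF I(2)] Y by blast
qed

lemma (in prob_space) indep_vars_singleton:
  assumes "Y \<in> measurable M S"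
  shows "indep_vars (\<lambda>_. S) (\<lambda>_. Y) {i}"
  unfolding indep_vars_def2 indep_sets_def
  using measurable_sets[OF assms] assms by (auto simp: subset_singleton_iff)

context driven_mean_field begin

lemma linear_increments_Z: "linear_increments M F T (\<sigma>\<^sup>2) {0} (\<lambda>_. Z)"
proof -
  have "path_on T W \<in> measurable M (path_space T)"
    using W by (intro measurable_path_on adapted_M) (auto simp: brownian_motion_def)
  from brownian_linear_increments[of "{0}" T "\<lambda>_. W" "\<lambda>_. \<xi>" \<sigma>, OF W _ indep_vars_singleton[OF this] \<xi>]
  show ?thesis by (simp add: Z_def[abs_def])
qed

lemma Z_start: "AE \<omega> in M. \<xi> \<omega> = Z 0 \<omega>"
  using W unfolding brownian_motion_def Z_def by auto

lemma distr_Z_start: "distr M borel (Z 0) = distr M borel \<xi>"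
  by (rule distr_cong_AE[symmetric]) (use T in \<open>auto intro!: Z_start adapted_M[OF \<xi>] adapted_M[OF Z_adapted]\<close>)

end

context mean_field begin

text \<open>
  The chaos constant depends on the law of the driving path. This makes it the same for all bases and all
  numbers of particles.
\<close>

theorem driving_law_unique:
  assumes D: "driven_mean_field f g h T Ch b c M F W \<xi>" and D': "driven_mean_field f g h T Ch b c M' F' W' \<xi>'"
    and law: "distr M borel \<xi> = distr M' borel \<xi>'"
  shows "driven_mean_field.P T M W \<xi> \<sigma> = driven_mean_field.P T M' W' \<xi>' \<sigma>"
proof -
  interpret D: driven_mean_field f g h T Ch b c M F W \<xi> \<sigma> by (rule D)
  interpret D': driven_mean_field f g h T Ch b c M' F' W' \<xi>' \<sigma> by (rule D')
  show ?thesis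
    unfolding D.P_def D'.P_def
    by (rule path_law_unique[OF D.stochastic_basis_axioms D'.stochastic_basis_axioms D.linear_increments_Z D'.linear_increments_Z _ T])
      (simp add: D.distr_Z_start D'.distr_Z_start law)
qed

text \<open>
  Both systems are forced by the same path: the particle \<open>Y i\<close> with the empirical rate, the
  process \<open>X\<close> with the mean rate. The paths of different indices are independent with a
  common law, so the fluctuation bounds apply.
\<close>

theorem propagation_of_chaos:
  assumes D: "\<And>j. j \<in> {1..N} \<Longrightarrow> driven_mean_field f g h T Ch b c M F (W j) (\<xi> j)"
    and law: "\<And>j. j \<in> {1..N} \<Longrightarrow> driven_mean_field.P T M (W j) (\<xi> j) \<sigma> = P"
    and indW: "prob_space.indep_vars M (\<lambda>_. path_space T) (\<lambda>j. path_on T (W j)) {1..N}"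
    and ind\<xi>: "prob_space.indep_vars M (\<lambda>_. borel) \<xi> {1..N}" and i: "i \<in> {1..N}"
    and Xm: "\<And>t. t \<in> {0..T} \<Longrightarrow> X t \<in> borel_measurable M"
    and Xc: "\<And>\<omega>. \<omega> \<in> space M \<Longrightarrow> continuous_on {0..T} (\<lambda>t. X t \<omega>)"
    and X: "AE \<omega> in M. set_integrable lborel {0..T} (\<lambda>s. f (X s \<omega>) + (\<integral>\<omega>'. h (X s \<omega>') \<partial>M) * g (X s \<omega>)) \<and>
       (\<forall>t\<in>{0..T}. X t \<omega> = (\<xi> i \<omega> + \<sigma> * W i t \<omega>) - (LBINT s:{0..t}. f (X s \<omega>) + (\<integral>\<omega>'. h (X s \<omega>') \<partial>M) * g (X s \<omega>)))"
    and Yc: "\<And>j \<omega>. j \<in> {1..N} \<Longrightarrow> \<omega> \<in> space M \<Longrightarrow> continuous_on {0..T} (\<lambda>t. Y j t \<omega>)"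
    and Y: "\<And>j. j \<in> {1..N} \<Longrightarrow> AE \<omega> in M. \<forall>t\<in>{0..T}. Y j t \<omega> = (\<xi> j \<omega> + \<sigma> * W j t \<omega>)
       - (LBINT s:{0..t}. f (Y j s \<omega>) + (\<Sum>l=1..N. h (Y l s \<omega>)) / real N * g (Y j s \<omega>))"
  shows "(\<integral>\<^sup>+\<omega>. (SUP t\<in>{0..T}. ennreal (\<bar>Y i t \<omega> - X t \<omega>\<bar>\<^sup>2)) \<partial>M) \<le> ennreal (chaos_constant P / real N)"
proof -
  interpret Di: driven_mean_field f g h T Ch b c M F "W i" "\<xi> i" \<sigma> by (rule D[OF i])
  have N: "0 < real N" using i by simp
  define Zp where "Zp j t \<omega> = \<xi> j \<omega> + \<sigma> * W j t \<omega>" for j t \<omega>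
  have Zp: "driven_mean_field.Z (W j) (\<xi> j) \<sigma> = Zp j" if "j \<in> {1..N}" for j
    using driven_mean_field.Z_def[OF D[OF that], of \<sigma>] by (simp add: fun_eq_iff Zp_def)
  define V where "V j = path_on T (Zp j)" for j
  have V: "V j \<in> measurable M (path_space T)" if "j \<in> {1..N}" for j
    using driven_mean_field.path_measurable[OF D[OF that], of \<sigma>] Zp[OF that] by (simp add: V_def)
  have lawV: "distr M (path_space T) (V j) = P" if "j \<in> {1..N}" for j
    using driven_mean_field.P_def[OF D[OF that], of \<sigma>] law[OF that] Zp[OF that] by (simp add: V_def)
  have P: "driving_law P" using Di.driving_law_P law[OF i] by simp
  have indV: "Di.indep_vars (\<lambda>_. path_space T) V {1..N}"
    unfolding V_def
  proof (rule Di.path_independence[OF _ _ _ T])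
    show "linear_increments M F T (\<sigma>\<^sup>2) {1..N} Zp"
      unfolding Zp_def[abs_def]
      by (rule Di.brownian_linear_increments[OF driven_mean_field.W[OF D] _ indW driven_mean_field.\<xi>[OF D]]) auto
    show "Di.indep_vars (\<lambda>_. borel) (\<lambda>j. Zp j 0) {1..N}"
    proof (rule Di.indep_vars_cong_AE[OF ind\<xi>])
      show "Zp j 0 \<in> borel_measurable M" if "j \<in> {1..N}" for j
        using Di.adapted_M[OF driven_mean_field.Z_adapted[OF D[OF that], of 0 \<sigma>]] T Zp[OF that] by simp
      show "AE \<omega> in M. \<xi> j \<omega> = Zp j 0 \<omega>" if "j \<in> {1..N}" for j
        using driven_mean_field.Z_start[OF D[OF that], of \<sigma>] Zp[OF that] by simp
    qed (use i in auto)
  qed (use i in auto)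
  have Yeq: "AE \<omega> in M. \<forall>j\<in>{1..N}. \<forall>t\<in>{0..T}. Y j t \<omega> = Zp j t \<omega>
       - (LBINT s:{0..t}. f (Y j s \<omega>) + (\<Sum>l=1..N. h (Y l s \<omega>)) / real N * g (Y j s \<omega>))"
    using Y by (simp add: AE_finite_all Zp_def)
  have reg: "AE \<omega> in M. \<forall>j\<in>{1..N}. continuous_on {0..T} (\<lambda>t. Zp j t \<omega>) \<and> (\<forall>t\<in>{0..T}. regularize moment_degree T (V j \<omega>) t = Zp j t \<omega>)"
  proof -
    have "AE \<omega> in M. continuous_on {0..T} (\<lambda>t. Zp j t \<omega>) \<and> (\<forall>t\<in>{0..T}. regularize moment_degree T (V j \<omega>) t = Zp j t \<omega>)" if j: "j \<in> {1..N}" for j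
      using driven_mean_field.path_regular[OF D[OF j], of \<sigma>] unfolding V_def Zp[OF j] .
    then show ?thesis by (simp add: AE_finite_all)
  qed
  have Yb: "AE \<omega> in M. \<forall>j\<in>{1..N}. continuous_on {0..T} (\<lambda>t. Y j t \<omega>) \<and> (\<forall>t\<in>{0..T}. \<bar>Y j t \<omega>\<bar> \<le> weight (V j \<omega>) - 1 \<and>
      Y j t \<omega> = regularize moment_degree T (V j \<omega>) t - (LBINT s:{0..t}. f (Y j s \<omega>) + (\<Sum>l=1..N. h (Y l s \<omega>)) / real N * g (Y j s \<omega>)))"
    using Yeq reg AE_space
  proof eventually_elim
    case (elim \<omega>)
    show ?case
    proof (intro ballI conjI)
      fix j assume j: "j \<in> {1..N}"
      show cY: "continuous_on {0..T} (\<lambda>t. Y j t \<omega>)" by (rule Yc[OF j elim(3)])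
      fix t assume t: "t \<in> {0..T}"
      have mean_c: "continuous_on {0..T} (\<lambda>s. (\<Sum>l=1..N. h (Y l s \<omega>)) / real N)"
        using N by (intro continuous_intros continuous_on_compose2[OF cont_h Yc[OF _ elim(3)]]) auto
      show "\<bar>Y j t \<omega>\<bar> \<le> weight (V j \<omega>) - 1"
        unfolding V_def Zp[OF j, symmetric]
      proof (rule driven_mean_field.forced_bound[OF D[OF j], where k="\<lambda>s. (\<Sum>l=1..N. h (Y l s \<omega>)) / real N" and x="\<lambda>t. Y j t \<omega>", OF _ _ cY _ _ _ t])
        show "0 \<le> (\<Sum>l=1..N. h (Y l s \<omega>)) / real N" for s by (intro divide_nonneg_nonneg sum_nonneg h_nonneg) auto
        show "set_integrable lborel {0..T} (\<lambda>s. f (Y j s \<omega>) + (\<Sum>l=1..N. h (Y l s \<omega>)) / real N * g (Y j s \<omega>))"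
          by (intro borel_integrable_atLeastAtMost' continuous_drift mean_c cY)
      qed (use elim j in \<open>auto simp: Zp V_def\<close>)
      show "Y j t \<omega> = regularize moment_degree T (V j \<omega>) t - (LBINT s:{0..t}. f (Y j s \<omega>) + (\<Sum>l=1..N. h (Y l s \<omega>)) / real N * g (Y j s \<omega>))"
        using elim j t by auto
    qed
  qed
  have Xsol: "AE \<omega> in M. \<forall>t\<in>{0..T}. X t \<omega> = solution (mean_rate P) (V i \<omega>) t"
    using Di.mean_field_solution_unique[OF Xm Xc] X unfolding law[OF i] V_def Zp[OF i] by (simp add: Zp_def)
  have "(\<integral>\<^sup>+\<omega>. (SUP t\<in>{0..T}. ennreal (\<bar>Y i t \<omega> - X t \<omega>\<bar>\<^sup>2)) \<partial>M) = (\<integral>\<^sup>+\<omega>. (SUP t\<in>{0..T}. ennreal (\<bar>Y i t \<omega> - solution (mean_rate P) (V i \<omega>) t\<bar>\<^sup>2)) \<partial>M)"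
    by (rule nn_integral_cong_AE) (use Xsol in \<open>eventually_elim, auto intro!: SUP_cong\<close>)
  also have "\<dots> \<le> ennreal (chaos_constant P / real N)"
    by (rule particle_mean_square[OF Di.prob_space_axioms indV lawV P mean_rate[OF P] i Yb])
  finally show ?thesis .
qed

end

text \<open>The solution is one and the same functional of the driving path.\<close>

lemma (in driven_mean_field) solution_law:
  assumes Y: "\<And>t. t \<in> {0..T} \<Longrightarrow> Y t \<in> borel_measurable M"
    and eq: "AE \<omega> in M. \<forall>t\<in>{0..T}. Y t \<omega> = solution (mean_rate P) (path_on T Z \<omega>) t"
  shows "distr M (path_space T) (path_on T Y) = distr P (path_space T) (path_on T (\<lambda>t w. solution (mean_rate P) w t))"
proof -
  let ?\<Phi> = "path_on T (\<lambda>t w. solution (mean_rate P) w t)"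
  have \<Phi>: "?\<Phi> \<in> measurable (path_space T) (path_space T)"
    by (rule measurable_path_on) (rule measurable_solution[OF mean_rate_rates])
  have "distr M (path_space T) (path_on T Y) = distr M (path_space T) (?\<Phi> \<circ> path_on T Z)"
  proof (rule distr_cong_AE[OF refl refl])
    show "AE \<omega> in M. path_on T Y \<omega> = (?\<Phi> \<circ> path_on T Z) \<omega>"
      using eq by eventually_elim (auto simp: path_on_def fun_eq_iff restrict_def)
    show "path_on T Y \<in> measurable M (path_space T)" by (rule measurable_path_on) (rule Y)
  qed (rule measurable_comp[OF path_measurable \<Phi>])
  also have "\<dots> = distr (distr M (path_space T) (path_on T Z)) (path_space T) ?\<Phi>"
    by (rule distr_distr[OF \<Phi> path_measurable, symmetric])
  finally show ?thesis by (simp only: P_def[symmetric])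
qed

section \<open>The polynomial interaction\<close>

lemma power_diff_bound:
  fixes x y r :: real
  assumes "\<bar>x\<bar> \<le> r" "\<bar>y\<bar> \<le> r"
  shows "\<bar>x ^ j - y ^ j\<bar> \<le> real j * (1 + r) ^ (j - 1) * \<bar>x - y\<bar>"
proof -
  have r: "0 \<le> r" using assms by linarith
  have "\<bar>\<Sum>i<j. y ^ (j - Suc i) * x ^ i\<bar> \<le> (\<Sum>i<j. (1 + r) ^ (j - 1))"
  proof (rule order_trans[OF sum_abs sum_mono])
    fix i assume "i \<in> {..<j}"
    then have e: "(1 + r) ^ (j - 1) = (1 + r) ^ (j - Suc i) * (1 + r) ^ i" by (simp add: power_add[symmetric])
    show "\<bar>y ^ (j - Suc i) * x ^ i\<bar> \<le> (1 + r) ^ (j - 1)"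
      unfolding e abs_mult power_abs using assms r by (intro mult_mono power_mono) auto
  qed
  then have "\<bar>x - y\<bar> * \<bar>\<Sum>i<j. y ^ (j - Suc i) * x ^ i\<bar> \<le> \<bar>x - y\<bar> * (real j * (1 + r) ^ (j - 1))"
    by (intro mult_left_mono) auto
  then show ?thesis unfolding power_diff_sumr2[of x j y] abs_mult by (simp only: mult.commute)
qed

lemma power_lipschitz_on_interval:
  "\<exists>L. \<forall>x\<in>{-r..r}. \<forall>y\<in>{-r..r}. \<bar>x ^ j - y ^ j\<bar> \<le> L * \<bar>x - y :: real\<bar>"
  using power_diff_bound[of _ r _ j] by (intro exI[of _ "real j * (1 + r) ^ (j - 1)"]) (auto simp: abs_le_iff)

lemma grad_potential_eq: "1 \<le> n \<Longrightarrow> grad_potential n y = y ^ (2 * n - 1)"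
  unfolding grad_potential_def potential_def[abs_def]
  by (rule DERIV_imp_deriv) (use DERIV_cmult[OF DERIV_pow[of "2 * n" y], of "1 / (2 * real n)"] in simp)

lemma grad2_kernel_eq: "1 \<le> m \<Longrightarrow> grad2_kernel k m x y = x ^ (2 * k - 1) * (real (2 * m - 1) * y ^ (2 * m - 2))"
  unfolding grad2_kernel_def kernel_def[abs_def]
  by (rule DERIV_imp_deriv) (use DERIV_cmult[OF DERIV_pow[of "2 * m - 1" y], of "x ^ (2 * k - 1)"] in \<open>simp add: diff_diff_eq numeral_2_eq_2\<close>)

locale polynomial_drift =
  fixes k m n :: nat and lam T :: real
  assumes k: "1 \<le> k" and m: "1 \<le> m" and n: "1 \<le> n" and lam: "0 < lam" and T0: "0 < T"
begin

definition confinement :: "real \<Rightarrow> real" where "confinement x = x ^ (2 * n - 1) / lam"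

definition attraction :: "real \<Rightarrow> real" where "attraction x = x ^ (2 * k - 1)"

text \<open>
  The factor of the interaction that depends on the second variable. Both exponents are even, so it is
  non-negative.
\<close>

definition intensity :: "real \<Rightarrow> real" where
  "intensity y = real (2 * m - 1) * y ^ (2 * m - 2) + y ^ (2 * (m + n - 1))"

definition intensity_bound :: real where
  "intensity_bound = (2 * real m)\<^sup>2 + 2 * (real m + real n)"

lemma interaction_eq: "interaction k m n x y = attraction x * intensity y"
proof -
  have "2 * (m + n - 1) = (2 * m - 1) + (2 * n - 1)" using m n by linarith
  then have "y ^ (2 * (m + n - 1)) = y ^ (2 * m - 1) * y ^ (2 * n - 1)" by (simp only: power_add)
  then show ?thesis
    by (simp add: interaction_def grad2_kernel_eq[OF m] grad_potential_eq[OF n] kernel_def attraction_def intensity_def distrib_left)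
qed

lemma confinement_eq: "1 / lam * grad_potential n x = confinement x"
  by (simp add: grad_potential_eq[OF n] confinement_def)

lemma intensity_growth:
  assumes "\<bar>x\<bar> \<le> r"
  shows "intensity x \<le> intensity_bound * (1 + r) ^ (2 * (m + n) - 3 + 1)"
proof -
  have r: "0 \<le> r" using assms by linarith
  have pw: "x ^ j \<le> (1 + r) ^ (2 * (m + n) - 3 + 1)" if "j \<le> 2 * (m + n) - 3 + 1" for j
  proof -
    have "x ^ j \<le> \<bar>x\<bar> ^ j" by (simp add: power_abs[symmetric])
    also have "\<dots> \<le> (1 + r) ^ j" using assms by (intro power_mono) auto
    also have "\<dots> \<le> (1 + r) ^ (2 * (m + n) - 3 + 1)" using that r by (intro power_increasing) auto
    finally show ?thesis .
  qed
  have "intensity x \<le> real (2 * m - 1) * (1 + r) ^ (2 * (m + n) - 3 + 1) + (1 + r) ^ (2 * (m + n) - 3 + 1)"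
    unfolding intensity_def using m n by (intro add_mono mult_left_mono pw) auto
  also have "\<dots> = (real (2 * m - 1) + 1) * (1 + r) ^ (2 * (m + n) - 3 + 1)" by (simp only: distrib_right mult_1)
  also have "\<dots> \<le> intensity_bound * (1 + r) ^ (2 * (m + n) - 3 + 1)"
    using r m by (intro mult_right_mono) (auto simp: intensity_bound_def)
  finally show ?thesis .
qed

lemma intensity_lipschitz:
  assumes "\<bar>x\<bar> \<le> r" "\<bar>y\<bar> \<le> r"
  shows "\<bar>intensity x - intensity y\<bar> \<le> intensity_bound * (1 + r) ^ (2 * (m + n) - 3) * \<bar>x - y\<bar>"
proof -
  let ?D = "(1 + r) ^ (2 * (m + n) - 3) * \<bar>x - y\<bar>"
  have r: "0 \<le> r" using assms by linarith
  have pw: "\<bar>x ^ j - y ^ j\<bar> \<le> real j * ?D" if "j - 1 \<le> 2 * (m + n) - 3" for j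
  proof -
    have "real j * (1 + r) ^ (j - 1) * \<bar>x - y\<bar> \<le> real j * (1 + r) ^ (2 * (m + n) - 3) * \<bar>x - y\<bar>"
      using that r by (intro mult_right_mono mult_left_mono power_increasing) auto
    with power_diff_bound[OF assms, of j] show ?thesis by (simp add: mult.assoc)
  qed
  have D0: "0 \<le> ?D" using r by simp
  have "\<bar>intensity x - intensity y\<bar> = \<bar>real (2 * m - 1) * (x ^ (2 * m - 2) - y ^ (2 * m - 2)) + (x ^ (2 * (m + n - 1)) - y ^ (2 * (m + n - 1)))\<bar>"
    by (rule arg_cong[where f=abs]) (simp add: intensity_def algebra_simps)
  also have "\<dots> \<le> real (2 * m - 1) * \<bar>x ^ (2 * m - 2) - y ^ (2 * m - 2)\<bar> + \<bar>x ^ (2 * (m + n - 1)) - y ^ (2 * (m + n - 1))\<bar>"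
    using abs_triangle_ineq[of "real (2 * m - 1) * (x ^ (2 * m - 2) - y ^ (2 * m - 2))"] by (simp add: abs_mult)
  also have "\<dots> \<le> real (2 * m - 1) * (real (2 * m - 2) * ?D) + real (2 * (m + n - 1)) * ?D"
    using m n by (intro add_mono mult_left_mono pw) auto
  also have "\<dots> = (real (2 * m - 1) * real (2 * m - 2) + real (2 * (m + n - 1))) * ?D" by (simp only: distrib_right mult.assoc)
  also have "\<dots> \<le> intensity_bound * ?D"
  proof (rule mult_right_mono[OF _ D0])
    have "real (2 * m - 1) * real (2 * m - 2) \<le> (2 * real m) * (2 * real m)" by (intro mult_mono) auto
    then show "real (2 * m - 1) * real (2 * m - 2) + real (2 * (m + n - 1)) \<le> intensity_bound"
      unfolding intensity_bound_def power2_eq_square by (intro add_mono) auto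
  qed
  finally show ?thesis by (simp only: mult.assoc)
qed

sublocale mean_field confinement attraction intensity T intensity_bound "2 * k - 1" "2 * (m + n) - 3"
proof
  show "mono confinement"
    using lam n by (auto intro!: monoI divide_right_mono power_mono_odd simp: confinement_def)
  show "mono attraction"
    using k by (auto intro!: monoI power_mono_odd simp: attraction_def)
  show "confinement 0 = 0" "attraction 0 = 0" using k n by (auto simp: confinement_def attraction_def)
  show "continuous_on UNIV confinement" "continuous_on UNIV attraction" "continuous_on UNIV intensity"
    unfolding confinement_def attraction_def intensity_def using lam by (intro continuous_intros; simp)+
  show "\<exists>L. \<forall>x\<in>{-r..r}. \<forall>y\<in>{-r..r}. \<bar>confinement x - confinement y\<bar> \<le> L * \<bar>x - y\<bar>" for r
  proof -
    obtain L where "\<forall>x\<in>{-r..r}. \<forall>y\<in>{-r..r}. \<bar>x ^ (2 * n - 1) - y ^ (2 * n - 1)\<bar> \<le> L * \<bar>x - y\<bar>"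
      using power_lipschitz_on_interval by blast
    then show ?thesis using lam
      by (intro exI[of _ "L / lam"]) (auto simp: confinement_def diff_divide_distrib[symmetric] abs_divide divide_right_mono)
  qed
  show "\<exists>L. \<forall>x\<in>{-r..r}. \<forall>y\<in>{-r..r}. \<bar>attraction x - attraction y\<bar> \<le> L * \<bar>x - y\<bar>" for r
    unfolding attraction_def by (rule power_lipschitz_on_interval)
  show "0 < T" by (rule T0)
  show "0 \<le> intensity_bound" by (simp add: intensity_bound_def)
  show "0 \<le> intensity x" for x
  proof -
    have "even (2 * m - 2)" by simp
    then show ?thesis unfolding intensity_def by (intro add_nonneg_nonneg mult_nonneg_nonneg zero_le_even_power) auto
  qed
  show "\<bar>attraction x\<bar> \<le> (1 + r) ^ (2 * k - 1)" if "\<bar>x\<bar> \<le> r" for x r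
    unfolding attraction_def power_abs using that by (intro power_mono) auto
qed (fact intensity_growth intensity_lipschitz)+

abbreviation noise_scale :: real where "noise_scale \<equiv> sqrt (2 / lam)"

lemma mean_field_drift_eq:
  assumes "X \<in> borel_measurable M"
  shows "mean_field_drift k m n lam (distr M borel X) x = - (confinement x + (\<integral>\<omega>. intensity (X \<omega>) \<partial>M) * attraction x)"
  unfolding mean_field_drift_def interaction_eq
  using integral_distr[OF assms h_measurable] confinement_eq[of x] by (simp add: mult.commute)

lemma particle_drift_eq:
  "particle_drift k m n lam N x i = - (confinement (x i) + (\<Sum>j=1..N. intensity (x j)) / real N * attraction (x i))"
proof -
  have "(\<Sum>j=1..N. grad2_kernel k m (x i) (x j)) + (\<Sum>j=1..N. kernel k m (x i) (x j) * grad_potential n (x j)) = attraction (x i) * (\<Sum>j=1..N. intensity (x j))"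
    unfolding sum.distrib[symmetric] interaction_def[symmetric] interaction_eq sum_distrib_left ..
  then have "1 / real N * (\<Sum>j=1..N. grad2_kernel k m (x i) (x j)) + 1 / real N * (\<Sum>j=1..N. kernel k m (x i) (x j) * grad_potential n (x j))
      = 1 / real N * (attraction (x i) * (\<Sum>j=1..N. intensity (x j)))"
    unfolding distrib_left[symmetric] by simp
  then show ?thesis unfolding particle_drift_def using confinement_eq[of "x i"] by (simp add: mult.commute)
qed

lemma set_integral_negated: "(LBINT s:A. - u s) = - (LBINT s:A. u s :: real)"
  by (simp add: set_lebesgue_integral_def)

lemma set_integrable_negated: "set_integrable lborel A (\<lambda>s. - u s) \<longleftrightarrow> set_integrable lborel A (u :: real \<Rightarrow> real)"
  unfolding set_integrable_def scaleR_minus_right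
  by (rule iffI; drule Bochner_Integration.integrable_minus; simp)

lemma solution_equation:
  assumes basis: "complete_stochastic_basis M F" and solution: "mean_field_solution k m n lam T M F W \<xi> X"
  shows "t \<in> {0..T} \<Longrightarrow> X t \<in> borel_measurable M"
    and "\<omega> \<in> space M \<Longrightarrow> continuous_on {0..T} (\<lambda>t. X t \<omega>)"
    and "AE \<omega> in M. set_integrable lborel {0..T} (\<lambda>s. confinement (X s \<omega>) + (\<integral>\<omega>'. intensity (X s \<omega>') \<partial>M) * attraction (X s \<omega>)) \<and>
      (\<forall>t\<in>{0..T}. X t \<omega> = (\<xi> \<omega> + noise_scale * W t \<omega>)
         - (LBINT s:{0..t}. confinement (X s \<omega>) + (\<integral>\<omega>'. intensity (X s \<omega>') \<partial>M) * attraction (X s \<omega>)))"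
proof -
  have Xm: "X t \<in> borel_measurable M" if "t \<in> {0..T}" for t
  proof (rule measurable_from_subalg)
    show "subalgebra M (F t)" using basis by (simp add: complete_stochastic_basis_def)
    show "X t \<in> borel_measurable (F t)" using solution that by (simp add: mean_field_solution_def continuous_adapted_def)
  qed
  then show "t \<in> {0..T} \<Longrightarrow> X t \<in> borel_measurable M" .
  show "\<omega> \<in> space M \<Longrightarrow> continuous_on {0..T} (\<lambda>t. X t \<omega>)"
    using solution by (auto simp: mean_field_solution_def continuous_adapted_def)
  let ?u = "\<lambda>\<omega> s. confinement (X s \<omega>) + (\<integral>\<omega>'. intensity (X s \<omega>') \<partial>M) * attraction (X s \<omega>)"
  have drift: "mean_field_drift k m n lam (distr M borel (X s)) (X s \<omega>) = - ?u \<omega> s" if "s \<in> {0..T}" for s \<omega>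
    by (rule mean_field_drift_eq[OF Xm[OF that]])
  have int: "set_integrable lborel {0..T} (\<lambda>s. mean_field_drift k m n lam (distr M borel (X s)) (X s \<omega>)) \<longleftrightarrow> set_integrable lborel {0..T} (?u \<omega>)" for \<omega>
  proof -
    have "set_integrable lborel {0..T} (\<lambda>s. mean_field_drift k m n lam (distr M borel (X s)) (X s \<omega>)) \<longleftrightarrow> set_integrable lborel {0..T} (\<lambda>s. - ?u \<omega> s)"
      by (rule set_integrable_cong) (auto simp: drift)
    also have "\<dots> \<longleftrightarrow> set_integrable lborel {0..T} (?u \<omega>)" by (rule set_integrable_negated)
    finally show ?thesis .
  qed
  have val: "(LBINT s:{0..t}. mean_field_drift k m n lam (distr M borel (X s)) (X s \<omega>)) = - (LBINT s:{0..t}. ?u \<omega> s)" if "t \<in> {0..T}" for t \<omega>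
    unfolding set_integral_negated[symmetric]
    by (intro set_lebesgue_integral_cong allI impI drift) (use that in auto)
  have "AE \<omega> in M. set_integrable lborel {0..T} (\<lambda>s. mean_field_drift k m n lam (distr M borel (X s)) (X s \<omega>)) \<and>
      (\<forall>t\<in>{0..T}. X t \<omega> = \<xi> \<omega> + (LBINT s:{0..t}. mean_field_drift k m n lam (distr M borel (X s)) (X s \<omega>)) + noise_scale * W t \<omega>)"
    using solution unfolding mean_field_solution_def by (elim conjE) (erule AE_mp, simp)
  then show "AE \<omega> in M. set_integrable lborel {0..T} (?u \<omega>) \<and> (\<forall>t\<in>{0..T}. X t \<omega> = (\<xi> \<omega> + noise_scale * W t \<omega>) - (LBINT s:{0..t}. ?u \<omega> s))"
    by eventually_elim (auto simp: int val)
qed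

lemma driven:
  assumes basis: "complete_stochastic_basis M F" and W: "brownian_motion M F T W"
    and \<xi>: "Lp_initial_value p M F \<xi>" and p: "real moment_degree \<le> p"
  shows "driven_mean_field confinement attraction intensity T intensity_bound (2 * k - 1) (2 * (m + n) - 3) M F W \<xi>"
proof -
  interpret stochastic_basis M F
    using basis by (auto simp: complete_stochastic_basis_def stochastic_basis_def stochastic_basis_axioms_def)
  have \<xi>m: "\<xi> \<in> borel_measurable (F 0)" using \<xi> by (simp add: Lp_initial_value_def)
  have "integrable M (\<lambda>\<omega>. \<bar>\<xi> \<omega>\<bar> ^ moment_degree)"
  proof (rule Bochner_Integration.integrable_bound)
    show "integrable M (\<lambda>\<omega>. 1 + \<bar>\<xi> \<omega>\<bar> powr p)" using \<xi> by (simp add: Lp_initial_value_def)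
    show "(\<lambda>\<omega>. \<bar>\<xi> \<omega>\<bar> ^ moment_degree) \<in> borel_measurable M" using adapted_M[OF \<xi>m] by measurable
    have "x ^ moment_degree \<le> 1 + x powr p" if x: "0 \<le> x" for x :: real
    proof (cases "x \<le> 1")
      case True
      then show ?thesis using x power_le_one[of x moment_degree] by (simp add: add_increasing2)
    next
      case False
      then have "x ^ moment_degree = x powr real moment_degree" by (simp add: powr_realpow)
      also have "\<dots> \<le> x powr p" using False p by (intro powr_mono) auto
      finally show ?thesis by simp
    qed
    from this[OF abs_ge_zero] show "AE \<omega> in M. norm (\<bar>\<xi> \<omega>\<bar> ^ moment_degree) \<le> norm (1 + \<bar>\<xi> \<omega>\<bar> powr p)"
      by (intro AE_I2) simp
  qed
  with W \<xi>m show ?thesis by unfold_locales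
qed

theorem strong_existence:
  assumes basis: "complete_stochastic_basis M F" and W: "brownian_motion M F T W"
    and \<xi>: "Lp_initial_value p M F \<xi>" and p: "real moment_degree \<le> p"
  shows "\<exists>X. mean_field_solution k m n lam T M F W \<xi> X"
proof -
  interpret D: driven_mean_field confinement attraction intensity T intensity_bound "2 * k - 1" "2 * (m + n) - 3" M F W \<xi> noise_scale
    by (rule driven[OF assms])
  have null: "null_sets M \<subseteq> sets (F 0)" using basis by (simp add: complete_stochastic_basis_def)
  let ?u = "\<lambda>\<omega> s. confinement (D.X s \<omega>) + mean_rate D.P s * attraction (D.X s \<omega>)"
  have drift: "mean_field_drift k m n lam (distr M borel (D.X s)) (D.X s \<omega>) = - ?u \<omega> s" if "s \<in> {0..T}" for s \<omega>
    unfolding mean_field_drift_eq[OF D.X_measurable[OF that]] D.X_mean[OF that] ..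
  have int: "set_integrable lborel {0..T} (\<lambda>s. mean_field_drift k m n lam (distr M borel (D.X s)) (D.X s \<omega>))" for \<omega>
  proof -
    have "set_integrable lborel {0..T} (\<lambda>s. - ?u \<omega> s)" using D.X_solves(1)[of \<omega>] unfolding set_integrable_negated .
    then show ?thesis by (subst set_integrable_cong[OF refl refl drift]) auto
  qed
  have val: "(LBINT s:{0..t}. mean_field_drift k m n lam (distr M borel (D.X s)) (D.X s \<omega>)) = - (LBINT s:{0..t}. ?u \<omega> s)" if "t \<in> {0..T}" for t \<omega>
    unfolding set_integral_negated[symmetric]
    by (intro set_lebesgue_integral_cong allI impI drift) (use that in auto)
  have inter: "integrable (distr M borel (D.X t)) (interaction k m n x)" if t: "t \<in> {0..T}" for t x
    unfolding interaction_eq[abs_def]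
    by (rule integrable_mult_right) (rule integrable_distr_eq[OF D.X_measurable[OF t] h_measurable, THEN iffD2, OF D.X_h_integrable[OF t]])
  have "mean_field_solution k m n lam T M F W \<xi> D.X"
    unfolding mean_field_solution_def continuous_adapted_def
  proof (intro conjI ballI)
    show "D.X t \<in> borel_measurable (F t)" if "t \<in> {0..T}" for t by (rule D.X_adapted[OF null that])
    show "continuous_on {0..T} (\<lambda>t. D.X t \<omega>)" for \<omega> by (rule D.X_continuous)
    show "AE \<omega> in M. (\<forall>t\<in>{0..T}. integrable (distr M borel (D.X t)) (interaction k m n (D.X t \<omega>))) \<and>
        set_integrable lborel {0..T} (\<lambda>s. mean_field_drift k m n lam (distr M borel (D.X s)) (D.X s \<omega>)) \<and>
        (\<forall>t\<in>{0..T}. D.X t \<omega> = \<xi> \<omega> + (LBINT s:{0..t}. mean_field_drift k m n lam (distr M borel (D.X s)) (D.X s \<omega>)) + noise_scale * W t \<omega>)"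
      using D.X_solves(2)
    proof eventually_elim
      case (elim \<omega>)
      show ?case
      proof (intro conjI ballI inter int)
        fix t assume t: "t \<in> {0..T}"
        show "D.X t \<omega> = \<xi> \<omega> + (LBINT s:{0..t}. mean_field_drift k m n lam (distr M borel (D.X s)) (D.X s \<omega>)) + noise_scale * W t \<omega>"
          using bspec[OF elim t] unfolding val[OF t] D.Z_def by linarith
      qed
    qed
  qed
  then show ?thesis by (rule exI[of _ D.X])
qed

theorem strong_uniqueness:
  assumes "complete_stochastic_basis M F" and "brownian_motion M F T W"
    and "Lp_initial_value p M F \<xi>" and "real moment_degree \<le> p"
    and X: "mean_field_solution k m n lam T M F W \<xi> X" "mean_field_solution k m n lam T M F W \<xi> X'"
  shows "AE \<omega> in M. \<forall>t\<in>{0..T}. X t \<omega> = X' t \<omega>"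
proof -
  interpret D: driven_mean_field confinement attraction intensity T intensity_bound "2 * k - 1" "2 * (m + n) - 3" M F W \<xi> noise_scale
    by (rule driven[OF assms(1-4)])
  have "AE \<omega> in M. \<forall>t\<in>{0..T}. Y t \<omega> = solution (mean_rate D.P) (path_on T D.Z \<omega>) t" if "mean_field_solution k m n lam T M F W \<xi> Y" for Y
    by (rule D.mean_field_solution_unique[OF solution_equation(1,2)[OF assms(1) that]])
      (use solution_equation(3)[OF assms(1) that] in \<open>simp_all add: D.Z_def\<close>)
  from this[OF X(1)] this[OF X(2)] show ?thesis by eventually_elim simp
qed

text \<open>
  Weak solutions carry their initial value as \<open>X 0\<close>, which agrees with \<open>\<xi>\<close>
  only almost surely.
\<close>

lemma solution_initial_value:
  assumes W: "brownian_motion M F T W" and X: "mean_field_solution k m n lam T M F W \<xi> X"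
  shows "AE \<omega> in M. X 0 \<omega> = \<xi> \<omega>" and "mean_field_solution k m n lam T M F W (X 0) X"
proof -
  have "AE \<omega> in M. W 0 \<omega> = 0" using W by (simp add: brownian_motion_def)
  moreover have "AE \<omega> in M. \<forall>t\<in>{0..T}. X t \<omega> = \<xi> \<omega> + (LBINT s:{0..t}. mean_field_drift k m n lam (distr M borel (X s)) (X s \<omega>)) + noise_scale * W t \<omega>"
    using X unfolding mean_field_solution_def by (elim conjE) (erule AE_mp, simp)
  ultimately show init: "AE \<omega> in M. X 0 \<omega> = \<xi> \<omega>"
  proof eventually_elim
    case (elim \<omega>)
    have "(LBINT s:{0..0::real}. u s) = 0" for u :: "real \<Rightarrow> real"
      unfolding set_lebesgue_integral_def
      by (rule integral_eq_zero_AE) (rule AE_mp[OF AE_lborel_singleton[of "0::real"]], auto simp: indicator_def)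
    then show ?case using elim T by auto
  qed
  show "mean_field_solution k m n lam T M F W (X 0) X"
    using X init unfolding mean_field_solution_def by auto
qed

lemma weak_solution_driven:
  assumes solution: "weak_mean_field_solution k m n lam T \<mu> M F W X" and \<mu>: "integrable \<mu> (\<lambda>x. \<bar>x\<bar> powr p)" and p: "real moment_degree \<le> p"
  shows "driven_mean_field confinement attraction intensity T intensity_bound (2 * k - 1) (2 * (m + n) - 3) M F W (X 0)"
proof -
  have b: "complete_stochastic_basis M F" and W: "brownian_motion M F T W" and X: "mean_field_solution k m n lam T M F W (X 0) X"
    and law: "distr M borel (X 0) = \<mu>" using solution by (auto simp: weak_mean_field_solution_def)
  have "X 0 \<in> borel_measurable M" using solution_equation(1)[OF b X, of 0] T by simp
  then have "integrable M (\<lambda>\<omega>. \<bar>X 0 \<omega>\<bar> powr p)"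
    using \<mu> integrable_distr_eq[of "X 0" M borel "\<lambda>x. \<bar>x\<bar> powr p"] by (simp add: law)
  moreover have "X 0 \<in> borel_measurable (F 0)"
    using X T by (simp add: mean_field_solution_def continuous_adapted_def)
  ultimately show ?thesis by (intro driven[OF b W _ p]) (simp add: Lp_initial_value_def)
qed

theorem weak_uniqueness:
  assumes solution: "weak_mean_field_solution k m n lam T \<mu> M F W X" "weak_mean_field_solution k m n lam T \<mu> M' F' W' X'"
    and \<mu>: "integrable \<mu> (\<lambda>x. \<bar>x\<bar> powr p)" and p: "real moment_degree \<le> p"
  shows "distr M (path_space T) (path_on T X) = distr M' (path_space T) (path_on T X')"
proof -
  note d = weak_solution_driven[OF solution(1) \<mu> p] and d' = weak_solution_driven[OF solution(2) \<mu> p]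
  have same: "driven_mean_field.P T M W (X 0) noise_scale = driven_mean_field.P T M' W' (X' 0) noise_scale"
    by (rule driving_law_unique[OF d d']) (use solution in \<open>simp add: weak_mean_field_solution_def\<close>)
  have image: "distr N (path_space T) (path_on T Y) = distr Q (path_space T) (path_on T (\<lambda>t w. solution (mean_rate Q) w t))"
    if d: "driven_mean_field confinement attraction intensity T intensity_bound (2 * k - 1) (2 * (m + n) - 3) N G V (Y 0)"
      and Q: "Q = driven_mean_field.P T N V (Y 0) noise_scale"
      and wsol: "weak_mean_field_solution k m n lam T \<mu> N G V Y" for N G V Y Q
  proof -
    interpret D: driven_mean_field confinement attraction intensity T intensity_bound "2 * k - 1" "2 * (m + n) - 3" N G V "Y 0" noise_scale
      by (rule d)
    have b: "complete_stochastic_basis N G" and Y: "mean_field_solution k m n lam T N G V (Y 0) Y"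
      using wsol by (auto simp: weak_mean_field_solution_def)
    have ae: "AE \<omega> in N. \<forall>t\<in>{0..T}. Y t \<omega> = solution (mean_rate D.P) (path_on T D.Z \<omega>) t"
      by (rule D.mean_field_solution_unique[OF solution_equation(1,2)[OF b Y]])
        (use solution_equation(3)[OF b Y] in \<open>simp_all add: D.Z_def\<close>)
    show ?thesis unfolding Q by (rule D.solution_law[OF _ ae]) (rule solution_equation(1)[OF b Y])
  qed
  show ?thesis unfolding image[OF d refl solution(1)] image[OF d' refl solution(2)] same ..
qed

context
  fixes \<mu> :: "real measure" and p :: real
  assumes \<mu>: "prob_space \<mu>" and \<mu>_sets: "sets \<mu> = sets borel" and \<mu>_moment: "integrable \<mu> (\<lambda>x. \<bar>x\<bar> powr p)"
    and p: "real moment_degree \<le> p"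
begin

lemma canonical_initial_value:
  "Lp_initial_value p (completion (canonical_base \<mu>)) (canonical_filtration \<mu> T) fst"
proof -
  have "subalgebra (completion (canonical_base \<mu>)) (canonical_filtration \<mu> T 0)"
    using canonical_basis[OF \<mu> \<mu>_sets T] by (simp add: complete_stochastic_basis_def)
  then have "fst \<in> borel_measurable (completion (canonical_base \<mu>))"
    by (rule measurable_from_subalg[OF _ initial_adapted[OF \<mu> \<mu>_sets T]])
  then have "integrable (completion (canonical_base \<mu>)) (\<lambda>z. \<bar>fst z\<bar> powr p)"
    using \<mu>_moment integrable_distr_eq[of fst "completion (canonical_base \<mu>)" borel "\<lambda>x. \<bar>x\<bar> powr p"]
    by (simp add: initial_law[OF \<mu> \<mu>_sets T])
  then show ?thesis by (simp add: Lp_initial_value_def initial_adapted[OF \<mu> \<mu>_sets T])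
qed

theorem weak_existence:
  "\<exists>(M :: (real \<times> (real \<Rightarrow> real)) measure) F W X. weak_mean_field_solution k m n lam T \<mu> M F W X"
proof -
  let ?M = "completion (canonical_base \<mu>)" and ?F = "canonical_filtration \<mu> T" and ?W = "\<lambda>t z. wiener T t (snd z)"
  note basis = canonical_basis[OF \<mu> \<mu>_sets T] and W = canonical_brownian[OF \<mu> \<mu>_sets T]
  obtain X where X: "mean_field_solution k m n lam T ?M ?F ?W fst X"
    using strong_existence[OF basis W canonical_initial_value p] by blast
  have "distr ?M borel (X 0) = distr ?M borel fst"
  proof (rule distr_cong_AE[OF refl refl solution_initial_value(1)[OF W X]])
    show "X 0 \<in> borel_measurable ?M" using solution_equation(1)[OF basis X, of 0] T by simp
    have "subalgebra ?M (?F 0)" using basis by (simp add: complete_stochastic_basis_def)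
    then show "fst \<in> borel_measurable ?M" by (rule measurable_from_subalg[OF _ initial_adapted[OF \<mu> \<mu>_sets T]])
  qed
  then have "weak_mean_field_solution k m n lam T \<mu> ?M ?F ?W X"
    using basis W solution_initial_value(2)[OF W X] initial_law[OF \<mu> \<mu>_sets T]
    by (simp add: weak_mean_field_solution_def)
  then show ?thesis by blast
qed

text \<open>
  The constant is computed on the canonical basis with initial law \<open>\<mu>\<close> and is shared by
  every other basis.
\<close>

lemma chaos_bound_admissible:
  "\<exists>C. \<forall>N\<ge>1. \<forall>(M :: 'a measure) F W \<xi> X Y.
     complete_stochastic_basis M F \<and> iid_data T p \<mu> N M F W \<xi> \<and>
     (\<forall>i\<in>{1..N}. mean_field_solution k m n lam T M F (W i) (\<xi> i) (X i)) \<and>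
     particle_solution k m n lam T N M F W \<xi> Y \<longrightarrow>
     (\<forall>i\<in>{1..N}. (\<integral>\<^sup>+\<omega>. (SUP t\<in>{0..T}. ennreal (\<bar>Y i t \<omega> - X i t \<omega>\<bar>\<^sup>2)) \<partial>M) \<le> ennreal (C / real N))"
proof -
  let ?M = "completion (canonical_base \<mu>)" and ?F = "canonical_filtration \<mu> T" and ?W = "\<lambda>t z. wiener T t (snd z)"
  let ?P = "driven_mean_field.P T ?M ?W fst noise_scale"
  note canon = driven[OF canonical_basis[OF \<mu> \<mu>_sets T] canonical_brownian[OF \<mu> \<mu>_sets T] canonical_initial_value p]
  have "(\<integral>\<^sup>+\<omega>. (SUP t\<in>{0..T}. ennreal (\<bar>Y i t \<omega> - X i t \<omega>\<bar>\<^sup>2)) \<partial>M) \<le> ennreal (chaos_constant ?P / real N)"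
    if N: "1 \<le> N" and basis: "complete_stochastic_basis M F" and data: "iid_data T p \<mu> N M F W \<xi>"
      and X: "\<forall>i\<in>{1..N}. mean_field_solution k m n lam T M F (W i) (\<xi> i) (X i)"
      and Y: "particle_solution k m n lam T N M F W \<xi> Y" and i: "i \<in> {1..N}"
    for N and M :: "'a measure" and F W \<xi> X Y i
  proof (rule propagation_of_chaos[where \<sigma>=noise_scale and W=W and \<xi>=\<xi> and X="X i" and Y=Y and F=F, OF _ _ _ _ i])
    fix j assume j: "j \<in> {1..N}"
    show D: "driven_mean_field confinement attraction intensity T intensity_bound (2 * k - 1) (2 * (m + n) - 3) M F (W j) (\<xi> j)"
      by (rule driven[OF basis _ _ p]) (use data j in \<open>auto simp: iid_data_def\<close>)
    show "driven_mean_field.P T M (W j) (\<xi> j) noise_scale = ?P"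
      by (rule driving_law_unique[OF D canon]) (use data j initial_law[OF \<mu> \<mu>_sets T] in \<open>simp add: iid_data_def\<close>)
    show "continuous_on {0..T} (\<lambda>t. Y j t \<omega>)" if "\<omega> \<in> space M" for \<omega>
      using Y j that by (simp add: particle_solution_def continuous_adapted_def)
    have "(LBINT s:{0..t}. particle_drift k m n lam N (\<lambda>j. Y j s \<omega>) j)
      = - (LBINT s:{0..t}. confinement (Y j s \<omega>) + (\<Sum>l=1..N. intensity (Y l s \<omega>)) / real N * attraction (Y j s \<omega>))" for t \<omega>
      unfolding particle_drift_eq set_integral_negated ..
    moreover have "AE \<omega> in M. \<forall>t\<in>{0..T}. Y j t \<omega> = \<xi> j \<omega> + (LBINT s:{0..t}. particle_drift k m n lam N (\<lambda>j. Y j s \<omega>) j) + noise_scale * W j t \<omega>"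
      using Y j by (simp add: particle_solution_def)
    ultimately show "AE \<omega> in M. \<forall>t\<in>{0..T}. Y j t \<omega> = (\<xi> j \<omega> + noise_scale * W j t \<omega>)
        - (LBINT s:{0..t}. confinement (Y j s \<omega>) + (\<Sum>l=1..N. intensity (Y l s \<omega>)) / real N * attraction (Y j s \<omega>))"
      by (simp add: algebra_simps)
  next
    note Xi = bspec[OF X i]
    show "X i t \<in> borel_measurable M" if "t \<in> {0..T}" for t by (rule solution_equation(1)[OF basis Xi that])
    show "continuous_on {0..T} (\<lambda>t. X i t \<omega>)" if "\<omega> \<in> space M" for \<omega> by (rule solution_equation(2)[OF basis Xi that])
    show "AE \<omega> in M. set_integrable lborel {0..T} (\<lambda>s. confinement (X i s \<omega>) + (\<integral>\<omega>'. intensity (X i s \<omega>') \<partial>M) * attraction (X i s \<omega>)) \<and>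
       (\<forall>t\<in>{0..T}. X i t \<omega> = (\<xi> i \<omega> + noise_scale * W i t \<omega>) - (LBINT s:{0..t}. confinement (X i s \<omega>) + (\<integral>\<omega>'. intensity (X i s \<omega>') \<partial>M) * attraction (X i s \<omega>)))"
      by (rule solution_equation(3)[OF basis Xi])
  qed (use data in \<open>auto simp: iid_data_def\<close>)
  then show ?thesis by blast
qed

end

text \<open>
  Independent data exist only if \<open>\<mu>\<close> is a probability law with \<open>p\<close> moments;
  for other \<open>\<mu>\<close> the statement is void.
\<close>

theorem chaos_bound:
  assumes p: "real moment_degree \<le> p"
  shows "\<exists>C\<ge>0. \<forall>N\<ge>1. \<forall>(M :: 'a measure) F W \<xi> X Y.
     complete_stochastic_basis M F \<and> iid_data T p \<mu> N M F W \<xi> \<and>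
     (\<forall>i\<in>{1..N}. mean_field_solution k m n lam T M F (W i) (\<xi> i) (X i)) \<and>
     particle_solution k m n lam T N M F W \<xi> Y \<longrightarrow>
     (\<forall>i\<in>{1..N}. (\<integral>\<^sup>+\<omega>. (SUP t\<in>{0..T}. ennreal (\<bar>Y i t \<omega> - X i t \<omega>\<bar>\<^sup>2)) \<partial>M) \<le> ennreal (C / real N))"
proof (cases "prob_space \<mu> \<and> sets \<mu> = sets borel \<and> integrable \<mu> (\<lambda>x. \<bar>x\<bar> powr p)")
  case True
  then obtain C where C: "\<forall>N\<ge>1. \<forall>(M :: 'a measure) F W \<xi> X Y.
     complete_stochastic_basis M F \<and> iid_data T p \<mu> N M F W \<xi> \<and>
     (\<forall>i\<in>{1..N}. mean_field_solution k m n lam T M F (W i) (\<xi> i) (X i)) \<and>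
     particle_solution k m n lam T N M F W \<xi> Y \<longrightarrow>
     (\<forall>i\<in>{1..N}. (\<integral>\<^sup>+\<omega>. (SUP t\<in>{0..T}. ennreal (\<bar>Y i t \<omega> - X i t \<omega>\<bar>\<^sup>2)) \<partial>M) \<le> ennreal (C / real N))"
    using chaos_bound_admissible[OF _ _ _ p] by blast
  have le: "ennreal (C / real N) \<le> ennreal (\<bar>C\<bar> / real N)" for N
    by (intro ennreal_leI divide_right_mono) auto
  show ?thesis
    by (intro exI[of _ "\<bar>C\<bar>"] conjI allI impI ballI abs_ge_zero) (rule order_trans[OF _ le], use C in blast)
next
  case False
  have "\<not> (complete_stochastic_basis M F \<and> iid_data T p \<mu> N M F W \<xi>)" if "1 \<le> N" for N and M :: "'a measure" and F W \<xi>
  proof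
    assume a: "complete_stochastic_basis M F \<and> iid_data T p \<mu> N M F W \<xi>"
    then have M: "prob_space M" and sub: "subalgebra M (F 0)" and \<xi>: "\<xi> 1 \<in> borel_measurable (F 0)" "integrable M (\<lambda>\<omega>. \<bar>\<xi> 1 \<omega>\<bar> powr p)"
      and law: "distr M borel (\<xi> 1) = \<mu>"
      using that by (auto simp: complete_stochastic_basis_def iid_data_def Lp_initial_value_def)
    have \<xi>m: "\<xi> 1 \<in> borel_measurable M" by (rule measurable_from_subalg[OF sub \<xi>(1)])
    have "prob_space \<mu>" "sets \<mu> = sets borel" using prob_space.prob_space_distr[OF M \<xi>m] law by auto
    moreover have "integrable \<mu> (\<lambda>x. \<bar>x\<bar> powr p)"
      unfolding law[symmetric] using \<xi>(2) integrable_distr_eq[OF \<xi>m, of "\<lambda>x. \<bar>x\<bar> powr p"] by simp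
    ultimately show False using False by blast
  qed
  then show ?thesis by (intro exI[of _ 0]) blast
qed

end

text \<open>Any exponent up to 1 is allowed, since \<open>1 \<le> N\<close>.\<close>

lemma rate_le_power:
  fixes C e :: real
  assumes "0 \<le> C" "e \<le> 1" "1 \<le> N"
  shows "ennreal (C / real N) \<le> ennreal (C * real N powr (- e))"
proof -
  have "1 / real N = real N powr (- 1)" using assms by (simp add: powr_minus_divide)
  also have "\<dots> \<le> real N powr (- e)" using assms by (intro powr_mono) auto
  finally show ?thesis using mult_left_mono[OF _ assms(1)] by (fastforce intro: ennreal_leI)
qed

theorem theorem3p1:
  fixes k m n :: nat and lam T p \<beta> :: real
  assumes "k \<ge> 1" and "m \<ge> 1" and "n \<ge> 1" and "lam > 0" and "T > 0"
    and beta: "\<beta> = max (8 * real k - 6) (8 * (real m + real n) - 10)"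
    and p: "p \<ge> max (32 * real k - 24) (32 * (real m + real n) - 40)"
  shows
   "(\<forall>(M :: 'a measure) F W \<xi>.
       complete_stochastic_basis M F \<and> brownian_motion M F T W \<and> Lp_initial_value p M F \<xi> \<longrightarrow>
       (\<exists>X. mean_field_solution k m n lam T M F W \<xi> X) \<and>
       (\<forall>X X'. mean_field_solution k m n lam T M F W \<xi> X \<and>
               mean_field_solution k m n lam T M F W \<xi> X' \<longrightarrow>
               (AE \<omega> in M. \<forall>t\<in>{0..T}. X t \<omega> = X' t \<omega>))) \<and>
    (\<forall>\<mu> :: real measure.
       prob_space \<mu> \<and> sets \<mu> = sets borel \<and> integrable \<mu> (\<lambda>x. \<bar>x\<bar> powr p) \<longrightarrow>
       (\<exists>(M :: (real \<times> (real \<Rightarrow> real)) measure) F W X.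
          weak_mean_field_solution k m n lam T \<mu> M F W X) \<and>
       (\<forall>(M :: 'b measure) F W X (M' :: 'c measure) F' W' X'.
          weak_mean_field_solution k m n lam T \<mu> M F W X \<and>
          weak_mean_field_solution k m n lam T \<mu> M' F' W' X' \<longrightarrow>
          distr M (path_space T) (path_on T X) = distr M' (path_space T) (path_on T X'))) \<and>
    (\<forall>(\<mu> :: real measure) p' q. 2 < p' \<and> p' < 2 * p / \<beta> \<and> \<beta> < q \<and> q < p \<longrightarrow>
       (\<exists>C::real. \<forall>N\<ge>1. \<forall>(M :: 'a measure) F W \<xi> X Y.
          complete_stochastic_basis M F \<and> iid_data T p \<mu> N M F W \<xi> \<and>
          (\<forall>i\<in>{1..N}. mean_field_solution k m n lam T M F (W i) (\<xi> i) (X i)) \<and>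
          particle_solution k m n lam T N M F W \<xi> Y \<longrightarrow>
          (SUP i\<in>{1..N}. \<integral>\<^sup>+\<omega>. (SUP t\<in>{0..T}. ennreal (\<bar>Y i t \<omega> - X i t \<omega>\<bar>\<^sup>2)) \<partial>M)
            \<le> ennreal (C * real N powr (- ((q - \<beta>) / (q - 2) * ((p' - 2) / p')))))) \<and>
    (\<forall>\<mu> :: real measure.
       \<exists>C::real. \<forall>N\<ge>1. \<forall>(M :: 'a measure) F W \<xi> X Y.
          complete_stochastic_basis M F \<and> iid_data T p \<mu> N M F W \<xi> \<and>
          (\<forall>i\<in>{1..N}. mean_field_solution k m n lam T M F (W i) (\<xi> i) (X i)) \<and>
          particle_solution k m n lam T N M F W \<xi> Y \<longrightarrow>
          (SUP i\<in>{1..N}. SUP t\<in>{0..T}. \<integral>\<^sup>+\<omega>. ennreal (\<bar>Y i t \<omega> - X i t \<omega>\<bar>\<^sup>2) \<partial>M)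
            \<le> ennreal (C * real N powr (- ((p - \<beta>) / p))))"
proof -
  interpret polynomial_drift k m n lam T by (standard) (use assms in auto)
  have k1: "1 \<le> real k" "1 \<le> real m" "1 \<le> real n" using assms by auto
  have "moment_degree = 4 * k + 4 * (m + n) - 6" unfolding moment_degree_def using k m n by simp
  then have "real moment_degree = 4 * real k + 4 * (real m + real n) - 6" using k m n by simp
  \<comment> \<open>the hypothesis on \<open>p\<close> bounds it below by the mean \<open>16 * k + 16 * (m + n) - 32\<close> of the two terms\<close>
  then have moment_degree: "real moment_degree \<le> p" using p k1 by simp
  have b6: "6 \<le> \<beta>" using beta k1 by simp
  have pb: "\<beta> \<le> p" using p beta k1 by simp
  have chaos: "\<exists>C::real. \<forall>N\<ge>1. \<forall>(M :: 'a measure) F W \<xi> X Y.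
          complete_stochastic_basis M F \<and> iid_data T p \<mu> N M F W \<xi> \<and>
          (\<forall>i\<in>{1..N}. mean_field_solution k m n lam T M F (W i) (\<xi> i) (X i)) \<and>
          particle_solution k m n lam T N M F W \<xi> Y \<longrightarrow>
          (\<forall>i\<in>{1..N}. (\<integral>\<^sup>+\<omega>. (SUP t\<in>{0..T}. ennreal (\<bar>Y i t \<omega> - X i t \<omega>\<bar>\<^sup>2)) \<partial>M) \<le> ennreal (C * real N powr (- e)))"
    if e: "e \<le> 1" for \<mu> e
  proof -
    obtain C where "0 \<le> C" and C: "\<forall>N\<ge>1. \<forall>(M :: 'a measure) F W \<xi> X Y.
          complete_stochastic_basis M F \<and> iid_data T p \<mu> N M F W \<xi> \<and>
          (\<forall>i\<in>{1..N}. mean_field_solution k m n lam T M F (W i) (\<xi> i) (X i)) \<and>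
          particle_solution k m n lam T N M F W \<xi> Y \<longrightarrow>
          (\<forall>i\<in>{1..N}. (\<integral>\<^sup>+\<omega>. (SUP t\<in>{0..T}. ennreal (\<bar>Y i t \<omega> - X i t \<omega>\<bar>\<^sup>2)) \<partial>M) \<le> ennreal (C / real N))"
      using chaos_bound[OF moment_degree, of \<mu>] by blast
    show ?thesis
      by (intro exI[of _ C] allI impI ballI) (rule order_trans[OF _ rate_le_power[OF \<open>0 \<le> C\<close> e]], use C in blast, simp)
  qed
  show ?thesis
  proof (intro conjI allI impI)
    fix M :: "'a measure" and F W \<xi>
    assume a: "complete_stochastic_basis M F \<and> brownian_motion M F T W \<and> Lp_initial_value p M F \<xi>"
    show "\<exists>X. mean_field_solution k m n lam T M F W \<xi> X" using a strong_existence[OF _ _ _ moment_degree] by blast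
    show "AE \<omega> in M. \<forall>t\<in>{0..T}. X t \<omega> = X' t \<omega>"
      if "mean_field_solution k m n lam T M F W \<xi> X \<and> mean_field_solution k m n lam T M F W \<xi> X'" for X X'
      using a that strong_uniqueness[OF _ _ _ moment_degree] by blast
  next
    fix \<mu> :: "real measure" assume \<mu>: "prob_space \<mu> \<and> sets \<mu> = sets borel \<and> integrable \<mu> (\<lambda>x. \<bar>x\<bar> powr p)"
    show "\<exists>(M :: (real \<times> (real \<Rightarrow> real)) measure) F W X. weak_mean_field_solution k m n lam T \<mu> M F W X"
      using \<mu> weak_existence[OF _ _ _ moment_degree] by blast
    show "distr M (path_space T) (path_on T X) = distr M' (path_space T) (path_on T X')"
      if "weak_mean_field_solution k m n lam T \<mu> M F W X \<and> weak_mean_field_solution k m n lam T \<mu> M' F' W' X'"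
      for M :: "'b measure" and F W X and M' :: "'c measure" and F' W' X'
      using \<mu> that weak_uniqueness[OF _ _ _ moment_degree] by blast
  next
    fix \<mu> :: "real measure" and p' q assume pq: "2 < p' \<and> p' < 2 * p / \<beta> \<and> \<beta> < q \<and> q < p"
    \<comment> \<open>the first factor is at most 1 because \<open>\<beta> \<ge> 2\<close>\<close>
    have "(q - \<beta>) / (q - 2) * ((p' - 2) / p') \<le> 1 * 1"
      using pq b6 by (intro mult_mono) (auto simp: divide_le_eq)
    then have "(q - \<beta>) / (q - 2) * ((p' - 2) / p') \<le> 1" by simp
    from chaos[OF this, of \<mu>] show "\<exists>C::real. \<forall>N\<ge>1. \<forall>(M :: 'a measure) F W \<xi> X Y.
          complete_stochastic_basis M F \<and> iid_data T p \<mu> N M F W \<xi> \<and>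
          (\<forall>i\<in>{1..N}. mean_field_solution k m n lam T M F (W i) (\<xi> i) (X i)) \<and>
          particle_solution k m n lam T N M F W \<xi> Y \<longrightarrow>
          (SUP i\<in>{1..N}. \<integral>\<^sup>+\<omega>. (SUP t\<in>{0..T}. ennreal (\<bar>Y i t \<omega> - X i t \<omega>\<bar>\<^sup>2)) \<partial>M)
            \<le> ennreal (C * real N powr (- ((q - \<beta>) / (q - 2) * ((p' - 2) / p'))))"
      unfolding SUP_le_iff .
  next
    fix \<mu> :: "real measure"
    have "(p - \<beta>) / p \<le> 1" using b6 pb by (simp add: divide_le_eq)
    from chaos[OF this, of \<mu>] obtain C where C: "\<forall>N\<ge>1. \<forall>(M :: 'a measure) F W \<xi> X Y.
          complete_stochastic_basis M F \<and> iid_data T p \<mu> N M F W \<xi> \<and>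
          (\<forall>i\<in>{1..N}. mean_field_solution k m n lam T M F (W i) (\<xi> i) (X i)) \<and>
          particle_solution k m n lam T N M F W \<xi> Y \<longrightarrow>
          (\<forall>i\<in>{1..N}. (\<integral>\<^sup>+\<omega>. (SUP t\<in>{0..T}. ennreal (\<bar>Y i t \<omega> - X i t \<omega>\<bar>\<^sup>2)) \<partial>M) \<le> ennreal (C * real N powr (- ((p - \<beta>) / p))))" ..
    have sup: "(\<integral>\<^sup>+\<omega>. ennreal (\<bar>Y i t \<omega> - X i t \<omega>\<bar>\<^sup>2) \<partial>M) \<le> (\<integral>\<^sup>+\<omega>. (SUP t\<in>{0..T}. ennreal (\<bar>Y i t \<omega> - X i t \<omega>\<bar>\<^sup>2)) \<partial>M)"
      if "t \<in> {0..T}" for i t and M :: "'a measure" and X Y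
      by (intro nn_integral_mono SUP_upper that)
    show "\<exists>C::real. \<forall>N\<ge>1. \<forall>(M :: 'a measure) F W \<xi> X Y.
          complete_stochastic_basis M F \<and> iid_data T p \<mu> N M F W \<xi> \<and>
          (\<forall>i\<in>{1..N}. mean_field_solution k m n lam T M F (W i) (\<xi> i) (X i)) \<and>
          particle_solution k m n lam T N M F W \<xi> Y \<longrightarrow>
          (SUP i\<in>{1..N}. SUP t\<in>{0..T}. \<integral>\<^sup>+\<omega>. ennreal (\<bar>Y i t \<omega> - X i t \<omega>\<bar>\<^sup>2) \<partial>M)
            \<le> ennreal (C * real N powr (- ((p - \<beta>) / p)))"
    proof (intro exI[of _ C] allI impI SUP_least)
      fix N i :: nat and M :: "'a measure" and F W \<xi> X Y t
      assume N: "1 \<le> N" and i: "i \<in> {1..N}" and t: "t \<in> {0..T}"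
        and a: "complete_stochastic_basis M F \<and> iid_data T p \<mu> N M F W \<xi> \<and>
          (\<forall>i\<in>{1..N}. mean_field_solution k m n lam T M F (W i) (\<xi> i) (X i)) \<and>
          particle_solution k m n lam T N M F W \<xi> Y"
      show "(\<integral>\<^sup>+\<omega>. ennreal (\<bar>Y i t \<omega> - X i t \<omega>\<bar>\<^sup>2) \<partial>M) \<le> ennreal (C * real N powr (- ((p - \<beta>) / p)))"
        using C N a i by (intro order_trans[OF sup[OF t]]) blast
    qed
  qed
qed

end
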